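(* Let $S$ be a closed coisotropic submanifold of a Jacobi manifold, equipped with a fat tubular neighborhood, so that the ambient Jacobi manifold is identified with $(NS,L,J\equiv\{-,-\})$, $L=L_{NS}=\pi^*\ell$. Two solutions $s_0,s_1\in\Gamma(NS)$ of $\mathfrak m_1(s)=0$ (i.e. two infinitesimal coisotropic deformations of $S$) are infinitesimally Hamiltonian equivalent if and only if they are cohomologous in the complex $(\Gamma(\wedge^\bullet N_\ell S\otimes\ell)[1],\mathfrak m_1)$. Hence, the infinitesimal moduli space (i.e. the set of infinitesimal Hamiltonian equivalence classes) of infinitesimal coisotropic deformations of $S$ is $H^0(\Gamma(\wedge^\bullet N_\ell S\otimes\ell)[1],\mathfrak m_1)=H^1(N_\ell{}^*S,\ell)$.
   Context: Everything is smooth. **Multi-differential operators.** For a line bundle $L\to M$, a derivation of $L$ is an $\mathbb R$-linear $\Delta:\Gamma(L)\to\Gamma(L)$ with $\Delta(f\lambda)=\sigma(\Delta)(f)\lambda+f\Delta\lambda$ for a vector field $\sigma(\Delta)$, its symbol. $J^1L$ is the first jet bundle, $J_1L:=(J^1L)^*$. $\mathcal D^kL:=\Gamma(\wedge^kJ_1L\otimes L)$ is the space of alternating maps $\Gamma(L)^k\to\Gamma(L)$ that are first order differential operators in each entry, equivalently of $L$-valued alternating $k$-forms on $J^1L$; $\mathcal D^0L=\Gamma(L)$, $\mathcal D^1L=\mathcal DL$ the derivations. Elements of $\mathcal D^kL$ have degree $k-1$ in $(\mathcal D^\bullet L)[1]$. The Schouten-Jacobi bracket is $[\square,\square']^{SJ}:=(-1)^{kk'}\square\circ\square'-\square'\circ\square$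 for $\square\in\mathcal D^{k+1}L$, $\square'\in\mathcal D^{k'+1}L$, where $(\square\circ\square')(\lambda_1,\dots,\lambda_{k+k'+1})=\sum_{\tau\in S_{k'+1,k}}(-1)^\tau\square(\square'(\lambda_{\tau(1)},\dots,\lambda_{\tau(k'+1)}),\lambda_{\tau(k'+2)},\dots,\lambda_{\tau(k+k'+1)})$ (sum over unshuffles). **Jacobi manifolds.** A Jacobi manifold $(M,L,J\equiv\{-,-\})$ is a manifold with a line bundle $L$ and a Lie bracket on $\Gamma(L)$ that is a first order differential operator in each entry; $J\in\mathcal D^2L$ denotes the bracket; $\Delta_\lambda:=\{\lambda,-\}$ and its symbol $X_\lambda$ is the Hamiltonian vector field of $\lambda\in\Gamma(L)$. A submanifold $S$ is coisotropic if $\Lambda_J^\#(T^0S\otimes L)\subset TS$, where $\Lambda_J^\#(df\otimes\lambda)=X_{f\lambda}-fX_\lambda$ and $T^0S$ is the annihilator of $TS$. **Normal data.** $\ell=L|_S$, $NS=TM|_S/TS$ with projection $\pi:NS\to S$, $N_\ell S=NS\otimes\ell^*$, $N_\ell{}^*S=N^*S\otimes\ell$, embedded in $J^1L|_S$ by $\gamma(df\otimes\lambda)=j^1(f\lambda)-fj^1\lambda$. $P:(\mathcal D^\bullet L)[1]\to\Gamma(\wedge^\bullet N_\ell S\otimes\ell)[1]$ sends $\square\in\mathcal D^kL$ to the restriction to $S$ of the $k$-form $\square$, pulled back along $\gamma:N_\ell{}^*S\to J^1L|_S$ (here $\Gamma(\wedge^kN_\ell S\otimes\ell)$ = $\ell$-valued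 alternating $k$-forms on $N_\ell{}^*S$, in degree $k-1$ after the shift; it is $\Gamma(\ell)$ for $k=0$ and $\Gamma(NS)$ for $k=1$). A fat tubular neighborhood is a line bundle embedding $\tau:L_{NS}:=\pi^*\ell\hookrightarrow L$ covering a tubular neighborhood $NS\hookrightarrow M$ and restricting to the inclusion $\ell\hookrightarrow L$ over the zero section; via $\tau$ one replaces $(M,L,J)$ by the induced Jacobi structure $(L=L_{NS},J)$ on $NS$, with $S$ the zero section. **The differential $\mathfrak m_1$.** For $\nu\in\Gamma(NS)$, $\pi^*\nu$ is the corresponding fiberwise constant vertical vector field; $\mathbb D$ is the flat connection in $L=\pi^*\ell$ along vertical vector fields with $\mathbb D_X\pi^*\lambda=0$, $\lambda\in\Gamma(\ell)$. Put $I(\nu)=\mathbb D_{\pi^*\nu}$, $I_0(\nu\otimes\varphi)=I(\nu)\otimes\pi^*\varphi$ ($\varphi\in\Gamma(\ell^* )$), $I(\lambda)=\pi^*\lambda$, $I(\xi_1\wedge\dots\wedge\xi_k\otimes\lambda)=I_0(\xi_1)\wedge\dots\wedge I_0(\xi_k)\otimes\pi^*\lambda$. Then $\mathfrak m_1(\xi):=P[J,I(\xi)]^{SJ}$. It coincides with the de Rham differential, with values in $\ell$, of the Lie algebroid $N_\ell{}^*S$ (a Lie subalgebroid of $J^1L$, the latter having anchor $j^1\lambda\mapsto X_\lambda$, bracket $[j^1\lambda,j^1\mu]=j^1\{\lambda,\mu\}$ and representation $\nabla_{j^1\lambda}\mu=\{\lambda,\mu\}$ on $L$, which restricts to a representation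 of $N_\ell{}^*S$ on $\ell$); $H^\bullet(N_\ell{}^*S,\ell)$ is the cohomology of $(\Gamma(\wedge^\bullet N_\ell S\otimes\ell),\mathfrak m_1)$ (unshifted degree). **Infinitesimal deformations.** A section $s$ of $NS$ is an infinitesimal coisotropic deformation of $S$ if $\epsilon s$ is a coisotropic section up to $O(\epsilon^2)$ (a section is coisotropic if its image is a coisotropic submanifold of $NS$); this holds iff $\mathfrak m_1(s)=0$. Two infinitesimal coisotropic deformations $s_0,s_1$ are infinitesimally Hamiltonian equivalent if $s_1-s_0$ is the vertical component along $S$ of a Hamiltonian vector field on $NS$ (with respect to $T(NS)|_S=TS\oplus NS$). *)

theory Defs
  imports
    "HOL-Analysis.Analysis"
    "HOL-Combinatorics.Permutations"
    "HOL-Library.Function_Algebras"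
    "HOL-Library.Landau_Symbols"
begin

section \<open>Smooth manifolds\<close>

primrec Ck_on :: "nat \<Rightarrow> 'a::real_normed_vector set \<Rightarrow> ('a \<Rightarrow> 'b::real_normed_vector) \<Rightarrow> bool" where
  "Ck_on 0 U f \<longleftrightarrow> continuous_on U f"
| "Ck_on (Suc k) U f \<longleftrightarrow>
     (\<forall>x\<in>U. f differentiable (at x)) \<and> (\<forall>v. Ck_on k U (\<lambda>x. frechet_derivative f (at x) v))"

text \<open>Only used for open \<open>U\<close>.\<close>
definition smooth_on :: "'a::real_normed_vector set \<Rightarrow> ('a \<Rightarrow> 'b::real_normed_vector) \<Rightarrow> bool" where
  "smooth_on U f \<longleftrightarrow> (\<forall>k. Ck_on k U f)"

text \<open>Charts take values in a finite-dimensional inner product space.  The class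
  \<open>euclidean_space\<close> is avoided because it excludes dimension 0.\<close>
definition finite_dim :: "'a::real_vector itself \<Rightarrow> bool" where
  "finite_dim _ \<longleftrightarrow> (\<exists>B::'a set. finite B \<and> span B = UNIV)"

type_synonym ('p, 'a) atlas = "('p set \<times> ('p \<Rightarrow> 'a)) set"

definition points :: "('p, 'a) atlas \<Rightarrow> 'p set" where
  "points A = (\<Union>(U, \<phi>)\<in>A. U)"

definition manifold_topology :: "('p, 'a::real_inner) atlas \<Rightarrow> 'p topology" where
  "manifold_topology A =
     topology (\<lambda>W. W \<subseteq> points A \<and> (\<forall>(U, \<phi>)\<in>A. open (\<phi> ` (U \<inter> W))))"

definition smooth_fun_on ::
    "('p, 'a::real_inner) atlas \<Rightarrow> 'p set \<Rightarrow> ('p \<Rightarrow> 'b::real_normed_vector) \<Rightarrow> bool" where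
  "smooth_fun_on A W f \<longleftrightarrow> (\<forall>(U, \<phi>)\<in>A. smooth_on (\<phi> ` (U \<inter> W)) (f \<circ> inv_into U \<phi>))"

text \<open>The openness condition, for all pairs of charts, says that \<open>F\<close> is continuous.\<close>
definition smooth_map ::
    "('p, 'a::real_inner) atlas \<Rightarrow> ('q, 'b::real_inner) atlas \<Rightarrow> ('p \<Rightarrow> 'q) \<Rightarrow> bool" where
  "smooth_map A B F \<longleftrightarrow>
     F ` points A \<subseteq> points B \<and>
     (\<forall>(U, \<phi>)\<in>A. \<forall>(V, \<psi>)\<in>B.
        open (\<phi> ` (U \<inter> F -` V)) \<and> smooth_on (\<phi> ` (U \<inter> F -` V)) (\<psi> \<circ> F \<circ> inv_into U \<phi>))"

definition smooth_manifold :: "('p, 'a::real_inner) atlas \<Rightarrow> bool" where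
  "smooth_manifold A \<longleftrightarrow>
     finite_dim TYPE('a) \<and>
     (\<forall>(U, \<phi>)\<in>A. inj_on \<phi> U \<and> open (\<phi> ` U)) \<and>
     (\<forall>(U, \<phi>)\<in>A. \<forall>(V, \<psi>)\<in>A.
        open (\<phi> ` (U \<inter> V)) \<and> smooth_on (\<phi> ` (U \<inter> V)) (\<psi> \<circ> inv_into U \<phi>)) \<and>
     Hausdorff_space (manifold_topology A) \<and> second_countable (manifold_topology A)"

definition open_submanifold :: "('p, 'a) atlas \<Rightarrow> 'p set \<Rightarrow> ('p, 'a) atlas" where
  "open_submanifold A W = (\<lambda>(U, \<phi>). (U \<inter> W, \<phi>)) ` A"

text \<open>Functions on a manifold are total functions that vanish off the set of points, so that
  two of them are equal as soon as they agree on the manifold.  The same convention is used for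
  sections and forms below.\<close>
definition Cinf :: "('p, 'a::real_inner) atlas \<Rightarrow> ('p \<Rightarrow> real) set" where
  "Cinf A = {f. smooth_fun_on A (points A) f \<and> (\<forall>p. p \<notin> points A \<longrightarrow> f p = 0)}"

text \<open>A tangent vector at \<open>p\<close> is a directional derivative in a chart, regarded as a functional
  on the smooth functions.\<close>
definition tangent_space :: "('p, 'a::real_inner) atlas \<Rightarrow> 'p \<Rightarrow> (('p \<Rightarrow> real) \<Rightarrow> real) set" where
  "tangent_space A p =
     {D. \<exists>(U, \<phi>)\<in>A. p \<in> U \<and>
        (\<exists>v. D = (\<lambda>f. if f \<in> Cinf A then frechet_derivative (f \<circ> inv_into U \<phi>) (at (\<phi> p)) v else 0))}"

definition vector_field :: "('p, 'a::real_inner) atlas \<Rightarrow> (('p \<Rightarrow> real) \<Rightarrow> 'p \<Rightarrow> real) \<Rightarrow> bool" where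
  "vector_field A X \<longleftrightarrow>
     (\<forall>f. X f \<in> Cinf A) \<and> (\<forall>p\<in>points A. (\<lambda>f. X f p) \<in> tangent_space A p)"

subsection \<open>Submanifolds\<close>

definition restrict_to :: "'p set \<Rightarrow> ('p \<Rightarrow> 'b::zero) \<Rightarrow> 'p \<Rightarrow> 'b" where
  "restrict_to S f = (\<lambda>x. if x \<in> S then f x else 0)"

text \<open>The differential of the inclusion of the submanifold with atlas \<open>AS\<close>.\<close>
definition pushforward_incl ::
    "('p, 'a::real_inner) atlas \<Rightarrow> ('p, 'c::real_inner) atlas \<Rightarrow>
     (('p \<Rightarrow> real) \<Rightarrow> real) \<Rightarrow> (('p \<Rightarrow> real) \<Rightarrow> real)" where
  "pushforward_incl A AS u = (\<lambda>g. if g \<in> Cinf A then u (restrict_to (points AS) g) else 0)"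

definition closed_submanifold ::
    "('p, 'a::real_inner) atlas \<Rightarrow> ('p, 'c::real_inner) atlas \<Rightarrow> bool" where
  "closed_submanifold A AS \<longleftrightarrow>
     smooth_manifold AS \<and>
     closedin (manifold_topology A) (points AS) \<and>
     manifold_topology AS = subtopology (manifold_topology A) (points AS) \<and>
     smooth_map AS A (\<lambda>x. x) \<and>
     (\<forall>x\<in>points AS. inj_on (pushforward_incl A AS) (tangent_space AS x))"

section \<open>Vector bundles\<close>

definition linear_map_on ::
    "'a::real_vector set \<Rightarrow> ('a \<Rightarrow> 'b::real_vector) \<Rightarrow> bool" where
  "linear_map_on V f \<longleftrightarrow>
     (\<forall>u\<in>V. \<forall>v\<in>V. f (u + v) = f u + f v) \<and> (\<forall>c. \<forall>v\<in>V. f (c *\<^sub>R v) = c *\<^sub>R f v)"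

text \<open>The fibres of a bundle are linear subspaces, possibly overlapping, of one real vector space
  type \<open>'e\<close>.  This is no restriction: every family of vector spaces embeds into its algebraic direct
  sum.  The ambient space has no other role; the total space is the disjoint union of the fibres.
  A local trivialization over \<open>U\<close> is a family of linear isomorphisms from the fibres over \<open>U\<close> to
  the model fibre \<open>'v\<close>.\<close>
record ('p, 'e, 'v) vbundle =
  fib :: "'p \<Rightarrow> 'e set"
  triv :: "('p set \<times> ('p \<Rightarrow> 'e \<Rightarrow> 'v)) set"

definition vector_bundle ::
    "('p, 'a::real_inner) atlas \<Rightarrow> ('p, 'e::real_vector, 'v::real_inner) vbundle \<Rightarrow> bool" where
  "vector_bundle A B \<longleftrightarrow>
     finite_dim TYPE('v) \<and>
     (\<forall>x\<in>points A. subspace (fib B x)) \<and>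
     (\<Union>(U, t)\<in>triv B. U) = points A \<and>
     (\<forall>(U, t)\<in>triv B. openin (manifold_topology A) U \<and>
        (\<forall>x\<in>U. linear_map_on (fib B x) (t x) \<and> bij_betw (t x) (fib B x) UNIV)) \<and>
     (\<forall>(U, t)\<in>triv B. \<forall>(V, t')\<in>triv B. \<forall>v.
        smooth_fun_on A (U \<inter> V) (\<lambda>x. t' x (inv_into (fib B x) (t x) v)))"

type_synonym ('p, 'l) line_bundle = "('p, 'l, real) vbundle"

definition sections ::
    "('p, 'a::real_inner) atlas \<Rightarrow> ('p, 'e::real_vector, 'v::real_inner) vbundle \<Rightarrow> ('p \<Rightarrow> 'e) set" where
  "sections A B =
     {\<sigma>. (\<forall>x\<in>points A. \<sigma> x \<in> fib B x) \<and> (\<forall>x. x \<notin> points A \<longrightarrow> \<sigma> x = 0) \<and>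
          (\<forall>(U, t)\<in>triv B. smooth_fun_on A U (\<lambda>x. t x (\<sigma> x)))}"

text \<open>Pullback along \<open>F\<close>, defined on the manifold with set of points \<open>C\<close>.\<close>
definition pullback_bundle ::
    "'q set \<Rightarrow> ('q \<Rightarrow> 'p) \<Rightarrow> ('p, 'e, 'v) vbundle \<Rightarrow> ('q, 'e, 'v) vbundle" where
  "pullback_bundle C F B =
     \<lparr>fib = (\<lambda>y. fib B (F y)), triv = (\<lambda>(U, t). (C \<inter> F -` U, \<lambda>y. t (F y))) ` triv B\<rparr>"

definition total_atlas ::
    "('p, 'a::real_inner) atlas \<Rightarrow> ('p, 'e::real_vector, 'v::real_inner) vbundle \<Rightarrow>
     ('p \<times> 'e, 'a \<times> 'v) atlas" where
  "total_atlas A B =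
     {((SIGMA x : U \<inter> V. fib B x), \<lambda>(x, w). (\<phi> x, t x w)) | U \<phi> V t. (U, \<phi>) \<in> A \<and> (V, t) \<in> triv B}"

definition smul :: "('p \<Rightarrow> real) \<Rightarrow> ('p \<Rightarrow> 'l::real_vector) \<Rightarrow> 'p \<Rightarrow> 'l" where
  "smul f \<eta> = (\<lambda>p. f p *\<^sub>R \<eta> p)"

section \<open>Multi-differential operators and Jacobi manifolds\<close>

definition derivation_with_symbol ::
    "('p, 'a::real_inner) atlas \<Rightarrow> ('p, 'l::real_vector) line_bundle \<Rightarrow>
     (('p \<Rightarrow> 'l) \<Rightarrow> ('p \<Rightarrow> 'l)) \<Rightarrow> (('p \<Rightarrow> real) \<Rightarrow> 'p \<Rightarrow> real) \<Rightarrow> bool" where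
  "derivation_with_symbol A L \<Delta> X \<longleftrightarrow>
     vector_field A X \<and>
     (\<forall>\<eta>\<in>sections A L. \<Delta> \<eta> \<in> sections A L) \<and>
     (\<forall>\<eta>\<in>sections A L. \<forall>\<mu>\<in>sections A L. \<Delta> (\<eta> + \<mu>) = \<Delta> \<eta> + \<Delta> \<mu>) \<and>
     (\<forall>c. \<forall>\<eta>\<in>sections A L. \<Delta> (\<lambda>p. c *\<^sub>R \<eta> p) = (\<lambda>p. c *\<^sub>R \<Delta> \<eta> p)) \<and>
     (\<forall>f\<in>Cinf A. \<forall>\<eta>\<in>sections A L. \<Delta> (smul f \<eta>) = smul (X f) \<eta> + smul f (\<Delta> \<eta>))"

definition derivation ::
    "('p, 'a::real_inner) atlas \<Rightarrow> ('p, 'l::real_vector) line_bundle \<Rightarrow>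
     (('p \<Rightarrow> 'l) \<Rightarrow> ('p \<Rightarrow> 'l)) \<Rightarrow> bool" where
  "derivation A L \<Delta> \<longleftrightarrow> (\<exists>X. derivation_with_symbol A L \<Delta> X)"

definition symbol ::
    "('p, 'a::real_inner) atlas \<Rightarrow> ('p, 'l::real_vector) line_bundle \<Rightarrow>
     (('p \<Rightarrow> 'l) \<Rightarrow> ('p \<Rightarrow> 'l)) \<Rightarrow> ('p \<Rightarrow> real) \<Rightarrow> 'p \<Rightarrow> real" where
  "symbol A L \<Delta> = (THE X. derivation_with_symbol A L \<Delta> X)"

text \<open>A \<open>k\<close>-ary operator on sections takes the list of its \<open>k\<close> arguments.\<close>
type_synonym ('p, 'l) multiop = "('p \<Rightarrow> 'l) list \<Rightarrow> 'p \<Rightarrow> 'l"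

definition unshuffles :: "nat \<Rightarrow> nat \<Rightarrow> (nat \<Rightarrow> nat) set" where
  "unshuffles p q =
     {\<tau>. \<tau> permutes {..<p + q} \<and> strict_mono_on {..<p} \<tau> \<and> strict_mono_on {p..<p + q} \<tau>}"

text \<open>\<open>a\<close> and \<open>b\<close> are the arities of \<open>D\<close> and \<open>D'\<close>.  There is nothing to insert into when
  \<open>a = 0\<close>: the sum over unshuffles is then empty.\<close>
definition insertion ::
    "nat \<Rightarrow> nat \<Rightarrow> ('p, 'l::real_vector) multiop \<Rightarrow> ('p, 'l) multiop \<Rightarrow> ('p, 'l) multiop" where
  "insertion a b D D' ls =
     (if a = 0 then 0
      else (\<lambda>p. \<Sum>\<tau>\<in>unshuffles b (a - 1). real_of_int (sign \<tau>) *\<^sub>R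
              D (D' (map (\<lambda>i. ls ! \<tau> i) [0..<b]) # map (\<lambda>i. ls ! \<tau> i) [b..<b + a - 1]) p))"

text \<open>In terms of the degrees \<open>k = a - 1\<close> and \<open>k' = b - 1\<close>, the sign is \<open>(-1)\<close> to the power
  \<open>k k'\<close>; it is written so as to cover \<open>a = 0\<close> and \<open>b = 0\<close>.\<close>
definition schouten_jacobi ::
    "nat \<Rightarrow> nat \<Rightarrow> ('p, 'l::real_vector) multiop \<Rightarrow> ('p, 'l) multiop \<Rightarrow> ('p, 'l) multiop" where
  "schouten_jacobi a b D D' ls =
     (\<lambda>p. (-1) ^ ((a + 1) * (b + 1)) *\<^sub>R insertion a b D D' ls p - insertion b a D' D ls p)"

text \<open>First order differential operators from a line bundle to itself are the same as
  derivations.\<close>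
definition jacobi_bracket ::
    "('p, 'a::real_inner) atlas \<Rightarrow> ('p, 'l::real_vector) line_bundle \<Rightarrow>
     (('p \<Rightarrow> 'l) \<Rightarrow> ('p \<Rightarrow> 'l) \<Rightarrow> 'p \<Rightarrow> 'l) \<Rightarrow> bool" where
  "jacobi_bracket A L J \<longleftrightarrow>
     (\<forall>\<eta>\<in>sections A L. derivation A L (J \<eta>) \<and> derivation A L (\<lambda>\<mu>. J \<mu> \<eta>)) \<and>
     (\<forall>\<eta>\<in>sections A L. J \<eta> \<eta> = 0) \<and>
     (\<forall>\<eta>\<in>sections A L. \<forall>\<mu>\<in>sections A L. \<forall>\<nu>\<in>sections A L.
        J \<eta> (J \<mu> \<nu>) + J \<mu> (J \<nu> \<eta>) + J \<nu> (J \<eta> \<mu>) = 0)"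

definition jacobi_manifold ::
    "('p, 'a::real_inner) atlas \<Rightarrow> ('p, 'l::real_vector) line_bundle \<Rightarrow>
     (('p \<Rightarrow> 'l) \<Rightarrow> ('p \<Rightarrow> 'l) \<Rightarrow> 'p \<Rightarrow> 'l) \<Rightarrow> bool" where
  "jacobi_manifold A L J \<longleftrightarrow> smooth_manifold A \<and> vector_bundle A L \<and> jacobi_bracket A L J"

definition hamiltonian ::
    "('p, 'a::real_inner) atlas \<Rightarrow> ('p, 'l::real_vector) line_bundle \<Rightarrow>
     (('p \<Rightarrow> 'l) \<Rightarrow> ('p \<Rightarrow> 'l) \<Rightarrow> 'p \<Rightarrow> 'l) \<Rightarrow>
     ('p \<Rightarrow> 'l) \<Rightarrow> ('p \<Rightarrow> real) \<Rightarrow> 'p \<Rightarrow> real" where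
  "hamiltonian A L J \<eta> = symbol A L (J \<eta>)"

text \<open>The tangent vector at \<open>p\<close> that is the image of \<open>df \<otimes> \<eta>\<close> under the sharp map of \<open>J\<close>.\<close>
definition Lambda_sharp ::
    "('p, 'a::real_inner) atlas \<Rightarrow> ('p, 'l::real_vector) line_bundle \<Rightarrow>
     (('p \<Rightarrow> 'l) \<Rightarrow> ('p \<Rightarrow> 'l) \<Rightarrow> 'p \<Rightarrow> 'l) \<Rightarrow>
     ('p \<Rightarrow> real) \<Rightarrow> ('p \<Rightarrow> 'l) \<Rightarrow> 'p \<Rightarrow> ('p \<Rightarrow> real) \<Rightarrow> real" where
  "Lambda_sharp A L J f \<eta> p =
     (\<lambda>g. hamiltonian A L J (smul f \<eta>) g p - f p * hamiltonian A L J \<eta> g p)"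

definition coisotropic ::
    "('p, 'a::real_inner) atlas \<Rightarrow> ('p, 'l::real_vector) line_bundle \<Rightarrow>
     (('p \<Rightarrow> 'l) \<Rightarrow> ('p \<Rightarrow> 'l) \<Rightarrow> 'p \<Rightarrow> 'l) \<Rightarrow> ('p, 'c::real_inner) atlas \<Rightarrow> bool" where
  "coisotropic A L J AS \<longleftrightarrow>
     (\<forall>x\<in>points AS. \<forall>f\<in>Cinf A. \<forall>\<eta>\<in>sections A L.
        (\<forall>u\<in>tangent_space AS x. pushforward_incl A AS u f = 0) \<longrightarrow>
        Lambda_sharp A L J f \<eta> x \<in> pushforward_incl A AS ` tangent_space AS x)"

section \<open>Normal bundle and fat tubular neighbourhoods\<close>

text \<open>\<open>E\<close>, with the projection \<open>q\<close>, is the quotient of \<open>TM\<close> restricted to \<open>S\<close> by \<open>TS\<close>.\<close>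
definition normal_bundle ::
    "('p, 'a::real_inner) atlas \<Rightarrow> ('p, 'c::real_inner) atlas \<Rightarrow>
     ('p, 'e::real_vector, 'v::real_inner) vbundle \<Rightarrow> ('p \<Rightarrow> (('p \<Rightarrow> real) \<Rightarrow> real) \<Rightarrow> 'e) \<Rightarrow> bool" where
  "normal_bundle A AS E q \<longleftrightarrow>
     vector_bundle AS E \<and>
     (\<forall>x\<in>points AS.
        (\<forall>u\<in>tangent_space A x. \<forall>v\<in>tangent_space A x. q x (u + v) = q x u + q x v) \<and>
        (\<forall>c. \<forall>u\<in>tangent_space A x. q x (\<lambda>g. c * u g) = c *\<^sub>R q x u) \<and>
        q x ` tangent_space A x = fib E x \<and>
        {u \<in> tangent_space A x. q x u = 0} = pushforward_incl A AS ` tangent_space AS x) \<and>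
     (\<forall>X. vector_field A X \<longrightarrow>
        restrict_to (points AS) (\<lambda>x. q x (\<lambda>g. X g x)) \<in> sections AS E)"

text \<open>The line bundle \<open>\<ell>\<close>, that is \<open>L\<close> restricted to \<open>S\<close>, and its pullback to the total space of \<open>E\<close>.\<close>
abbreviation restricted_line ::
    "('p, 'c) atlas \<Rightarrow> ('p, 'l) line_bundle \<Rightarrow> ('p, 'l) line_bundle" where
  "restricted_line AS L \<equiv> pullback_bundle (points AS) (\<lambda>x. x) L"

abbreviation normal_line ::
    "('p, 'c::real_inner) atlas \<Rightarrow> ('p, 'e::real_vector, 'v::real_inner) vbundle \<Rightarrow>
     ('p, 'l) line_bundle \<Rightarrow> ('p \<times> 'e, 'l) line_bundle" where
  "normal_line AS E L \<equiv> pullback_bundle (points (total_atlas AS E)) fst (restricted_line AS L)"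

text \<open>\<open>\<tau>0\<close> is the tubular neighbourhood and \<open>\<tau>1 v\<close> the map from the fibre over \<open>v\<close> to the fibre
  over \<open>\<tau>0 v\<close>.  The condition on \<open>q\<close> says that \<open>\<tau>0\<close> induces the identity of the normal bundle.\<close>
definition fat_tubular_neighborhood ::
    "('p, 'a::real_inner) atlas \<Rightarrow> ('p, 'l::real_vector) line_bundle \<Rightarrow>
     ('p, 'c::real_inner) atlas \<Rightarrow> ('p, 'e::real_vector, 'v::real_inner) vbundle \<Rightarrow>
     ('p \<Rightarrow> (('p \<Rightarrow> real) \<Rightarrow> real) \<Rightarrow> 'e) \<Rightarrow> ('p \<times> 'e \<Rightarrow> 'p) \<Rightarrow> ('p \<times> 'e \<Rightarrow> 'l \<Rightarrow> 'l) \<Rightarrow> bool" where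
  "fat_tubular_neighborhood A L AS E q \<tau>0 \<tau>1 \<longleftrightarrow>
     (let AN = total_atlas AS E; N = points AN; LN = normal_line AS E L in
        inj_on \<tau>0 N \<and> openin (manifold_topology A) (\<tau>0 ` N) \<and>
        smooth_map AN A \<tau>0 \<and> smooth_map (open_submanifold A (\<tau>0 ` N)) AN (inv_into N \<tau>0) \<and>
        (\<forall>x\<in>points AS. \<tau>0 (x, 0) = x) \<and>
        (\<forall>(x, w)\<in>N.
           q x (\<lambda>g. if g \<in> Cinf A then deriv (\<lambda>t. g (\<tau>0 (x, t *\<^sub>R w))) 0 else 0) = w) \<and>
        (\<forall>v\<in>N. linear_map_on (fib LN v) (\<tau>1 v) \<and> bij_betw (\<tau>1 v) (fib LN v) (fib L (\<tau>0 v))) \<and>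
        (\<forall>(U, t)\<in>triv LN. \<forall>(V, t')\<in>triv L. \<forall>c.
           smooth_fun_on AN (U \<inter> \<tau>0 -` V) (\<lambda>v. t' (\<tau>0 v) (\<tau>1 v (inv_into (fib LN v) (t v) c)))) \<and>
        (\<forall>x\<in>points AS. \<forall>l\<in>fib L x. \<tau>1 (x, 0) l = l))"

definition pullback_section ::
    "('p, 'l::real_vector) line_bundle \<Rightarrow> ('p, 'c::real_inner) atlas \<Rightarrow>
     ('p, 'e::real_vector, 'v::real_inner) vbundle \<Rightarrow> ('p \<times> 'e \<Rightarrow> 'p) \<Rightarrow> ('p \<times> 'e \<Rightarrow> 'l \<Rightarrow> 'l) \<Rightarrow>
     ('p \<Rightarrow> 'l) \<Rightarrow> 'p \<times> 'e \<Rightarrow> 'l" where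
  "pullback_section L AS E \<tau>0 \<tau>1 \<eta> =
     restrict_to (points (total_atlas AS E))
       (\<lambda>v. inv_into (fib (normal_line AS E L) v) (\<tau>1 v) (\<eta> (\<tau>0 v)))"

text \<open>Jacobi brackets are local and the embedding is open, so there is exactly one such \<open>JN\<close>.\<close>
definition induced_jacobi_bracket ::
    "('p, 'a::real_inner) atlas \<Rightarrow> ('p, 'l::real_vector) line_bundle \<Rightarrow>
     (('p \<Rightarrow> 'l) \<Rightarrow> ('p \<Rightarrow> 'l) \<Rightarrow> 'p \<Rightarrow> 'l) \<Rightarrow> ('p, 'c::real_inner) atlas \<Rightarrow>
     ('p, 'e::real_vector, 'v::real_inner) vbundle \<Rightarrow> ('p \<times> 'e \<Rightarrow> 'p) \<Rightarrow> ('p \<times> 'e \<Rightarrow> 'l \<Rightarrow> 'l) \<Rightarrow>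
     (('p \<times> 'e \<Rightarrow> 'l) \<Rightarrow> ('p \<times> 'e \<Rightarrow> 'l) \<Rightarrow> 'p \<times> 'e \<Rightarrow> 'l) \<Rightarrow> bool" where
  "induced_jacobi_bracket A L J AS E \<tau>0 \<tau>1 JN \<longleftrightarrow>
     jacobi_bracket (total_atlas AS E) (normal_line AS E L) JN \<and>
     (\<forall>\<eta>\<in>sections A L. \<forall>\<mu>\<in>sections A L.
        JN (pullback_section L AS E \<tau>0 \<tau>1 \<eta>) (pullback_section L AS E \<tau>0 \<tau>1 \<mu>) =
        pullback_section L AS E \<tau>0 \<tau>1 (J \<eta> \<mu>))"

section \<open>The complex of forms on the twisted conormal bundle\<close>

text \<open>The fibre of \<open>N\<^sup>*S \<otimes> \<ell>\<close> at \<open>x\<close>, as the space of linear maps from \<open>E\<^sub>x\<close> to \<open>\<ell>\<^sub>x\<close>: an element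
  \<open>\<alpha> \<otimes> l\<close> is the map sending \<open>w\<close> to \<open>\<alpha>(w) l\<close>.\<close>
definition conormal ::
    "('p, 'e::real_vector, 'v) vbundle \<Rightarrow> ('p, 'l::real_vector) line_bundle \<Rightarrow> 'p \<Rightarrow> ('e \<Rightarrow> 'l) set" where
  "conormal E L x =
     {\<alpha>. linear_map_on (fib E x) \<alpha> \<and> \<alpha> ` fib E x \<subseteq> fib L x \<and> (\<forall>w. w \<notin> fib E x \<longrightarrow> \<alpha> w = 0)}"

definition conormal_sections ::
    "('p, 'c::real_inner) atlas \<Rightarrow> ('p, 'e::real_vector, 'v::real_inner) vbundle \<Rightarrow>
     ('p, 'l::real_vector) line_bundle \<Rightarrow> ('p \<Rightarrow> 'e \<Rightarrow> 'l) set" where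
  "conormal_sections AS E L =
     {\<alpha>. (\<forall>x\<in>points AS. \<alpha> x \<in> conormal E L x) \<and> (\<forall>x. x \<notin> points AS \<longrightarrow> \<alpha> x = 0) \<and>
         (\<forall>s\<in>sections AS E. (\<lambda>x. \<alpha> x (s x)) \<in> sections AS (restricted_line AS L))}"

type_synonym ('p, 'e, 'l) form = "'p \<Rightarrow> ('e \<Rightarrow> 'l) list \<Rightarrow> 'l"

definition valid_args ::
    "('p, 'c) atlas \<Rightarrow> ('p, 'e::real_vector, 'v) vbundle \<Rightarrow>
     ('p, 'l::real_vector) line_bundle \<Rightarrow> nat \<Rightarrow> 'p \<Rightarrow> ('e \<Rightarrow> 'l) list \<Rightarrow> bool" where
  "valid_args AS E L k x as \<longleftrightarrow> x \<in> points AS \<and> length as = k \<and> set as \<subseteq> conormal E L x"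

text \<open>The \<open>\<ell>\<close>-valued alternating \<open>k\<close>-forms on the bundle \<open>conormal E L\<close> over \<open>S\<close>.\<close>
definition forms ::
    "('p, 'c::real_inner) atlas \<Rightarrow> ('p, 'e::real_vector, 'v::real_inner) vbundle \<Rightarrow>
     ('p, 'l::real_vector) line_bundle \<Rightarrow> nat \<Rightarrow> ('p, 'e, 'l) form set" where
  "forms AS E L k =
     {\<xi>. (\<forall>x as. \<not> valid_args AS E L k x as \<longrightarrow> \<xi> x as = 0) \<and>
         (\<forall>x as. valid_args AS E L k x as \<longrightarrow>
            \<xi> x as \<in> fib L x \<and>
            (\<forall>j<k. \<forall>\<alpha>\<in>conormal E L x. \<forall>\<beta>\<in>conormal E L x.
               \<xi> x (as[j := \<alpha> + \<beta>]) = \<xi> x (as[j := \<alpha>]) + \<xi> x (as[j := \<beta>])) \<and>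
            (\<forall>j<k. \<forall>c. \<forall>\<alpha>\<in>conormal E L x.
               \<xi> x (as[j := (\<lambda>w. c *\<^sub>R \<alpha> w)]) = c *\<^sub>R \<xi> x (as[j := \<alpha>])) \<and>
            (\<forall>i<k. \<forall>j<k. i \<noteq> j \<and> as ! i = as ! j \<longrightarrow> \<xi> x as = 0)) \<and>
         (\<forall>\<alpha>s. length \<alpha>s = k \<and> set \<alpha>s \<subseteq> conormal_sections AS E L \<longrightarrow>
            (\<lambda>x. \<xi> x (map (\<lambda>\<alpha>. \<alpha> x) \<alpha>s)) \<in> sections AS (restricted_line AS L))}"

text \<open>The identification of sections of the normal bundle with 1-forms.\<close>
definition as_form ::
    "('p, 'c) atlas \<Rightarrow> ('p, 'e::real_vector, 'v) vbundle \<Rightarrow>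
     ('p, 'l::real_vector) line_bundle \<Rightarrow> ('p \<Rightarrow> 'e) \<Rightarrow> ('p, 'e, 'l) form" where
  "as_form AS E L s = (\<lambda>x as. if valid_args AS E L 1 x as then hd as (s x) else 0)"

text \<open>The covariant derivative \<open>\<D>\<close>, at the point \<open>(x, w)\<close>, along the vertical vector \<open>w'\<close>: since
  \<open>\<D>\<close> annihilates the sections pulled back from \<open>S\<close>, it is the ordinary derivative along the line
  \<open>w + r w'\<close>, on which a section takes values in the fixed one-dimensional space \<open>\<ell>\<^sub>x\<close>.  This
  derivative is the reason why the fibres of \<open>L\<close> lie in a normed space; it does not depend on the
  norm, and every real vector space carries one.  As a function of \<open>w'\<close> this is an element of
  \<open>conormal E L x\<close>.\<close>
definition vertical_derivative ::
    "('p, 'e::real_vector, 'v) vbundle \<Rightarrow> ('p \<times> 'e \<Rightarrow> 'l::real_normed_vector) \<Rightarrow>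
     'p \<times> 'e \<Rightarrow> 'e \<Rightarrow> 'l" where
  "vertical_derivative E \<eta> = (\<lambda>(x, w).
     restrict_to (fib E x) (\<lambda>w'. vector_derivative (\<lambda>r. \<eta> (x, w + r *\<^sub>R w')) (at 0)))"

text \<open>The lift \<open>I\<close> of a form to a multi-differential operator on the total space.  For
  \<open>\<xi> = \<nu> \<otimes> \<phi>\<close> the operator \<open>\<eta> \<mapsto> \<phi>(\<D> \<eta>)\<close> along \<open>\<nu>\<close> is the contraction of \<open>\<xi>\<close> with the vertical derivative
  of \<open>\<eta>\<close>; hence for wedge products one evaluates \<open>\<xi>\<close> on the vertical derivatives of all
  arguments.  For \<open>k = 0\<close> this is the pullback of a section of \<open>\<ell>\<close>, and for \<open>k = 1\<close> it is \<open>\<D>\<close>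
  along the vertical lift of a section of \<open>E\<close>.\<close>
definition lift_form ::
    "('p, 'c::real_inner) atlas \<Rightarrow> ('p, 'e::real_vector, 'v::real_inner) vbundle \<Rightarrow>
     ('p, 'e, 'l::real_normed_vector) form \<Rightarrow> ('p \<times> 'e, 'l) multiop" where
  "lift_form AS E \<xi> ls =
     restrict_to (points (total_atlas AS E))
       (\<lambda>v. \<xi> (fst v) (map (\<lambda>\<eta>. vertical_derivative E \<eta> v) ls))"

text \<open>\<open>\<mu>\<close> represents the jet \<open>\<gamma>(\<alpha>)\<close> at \<open>x\<close>: one has \<open>\<alpha> = df \<otimes> \<eta>\<close> with \<open>df\<close> annihilating \<open>TS\<close> at \<open>x\<close>,
  and \<open>\<gamma>(df \<otimes> \<eta>) = j\<^sup>1(f \<eta>) - f j\<^sup>1\<eta>\<close> is at \<open>(x, 0)\<close> the jet of \<open>f \<eta> - f(x, 0) \<eta>\<close>.\<close>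
definition represents_gamma ::
    "('p, 'c::real_inner) atlas \<Rightarrow> ('p, 'e::real_vector, 'v::real_inner) vbundle \<Rightarrow>
     ('p, 'l::real_normed_vector) line_bundle \<Rightarrow> 'p \<Rightarrow> ('e \<Rightarrow> 'l) \<Rightarrow> ('p \<times> 'e \<Rightarrow> 'l) \<Rightarrow> bool" where
  "represents_gamma AS E L x \<alpha> \<mu> \<longleftrightarrow>
     (\<exists>f\<in>Cinf (total_atlas AS E). \<exists>\<eta>\<in>sections (total_atlas AS E) (normal_line AS E L).
        (\<forall>u\<in>tangent_space AS x. u (\<lambda>y. f (y, 0)) = 0) \<and>
        (\<forall>w\<in>fib E x. \<alpha> w = deriv (\<lambda>r. f (x, r *\<^sub>R w)) 0 *\<^sub>R \<eta> (x, 0)) \<and>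
        \<mu> = (\<lambda>v. f v *\<^sub>R \<eta> v - f (x, 0) *\<^sub>R \<eta> v))"

text \<open>The map \<open>P\<close>.  A multi-differential operator, evaluated at a point, depends only on the 1-jets
  of its arguments there, so any representatives will do.\<close>
definition normal_part ::
    "('p, 'c::real_inner) atlas \<Rightarrow> ('p, 'e::real_vector, 'v::real_inner) vbundle \<Rightarrow>
     ('p, 'l::real_normed_vector) line_bundle \<Rightarrow> nat \<Rightarrow> ('p \<times> 'e, 'l) multiop \<Rightarrow> ('p, 'e, 'l) form" where
  "normal_part AS E L k D = (\<lambda>x as.
     if valid_args AS E L k x as
     then D (map (\<lambda>\<alpha>. SOME \<mu>. represents_gamma AS E L x \<alpha> \<mu>) as) (x, 0)
     else 0)"

definition cochains ::
    "('p, 'c::real_inner) atlas \<Rightarrow> ('p, 'e::real_vector, 'v::real_inner) vbundle \<Rightarrow>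
     ('p, 'l::real_vector) line_bundle \<Rightarrow> int \<Rightarrow> ('p, 'e, 'l) form set" where
  "cochains AS E L n = (if n < 0 then {0} else forms AS E L (nat n))"

text \<open>The differential from degree \<open>n\<close> to \<open>n + 1\<close>, in the unshifted grading.\<close>
definition m1 ::
    "('p, 'c::real_inner) atlas \<Rightarrow> ('p, 'e::real_vector, 'v::real_inner) vbundle \<Rightarrow>
     ('p, 'l::real_normed_vector) line_bundle \<Rightarrow>
     (('p \<times> 'e \<Rightarrow> 'l) \<Rightarrow> ('p \<times> 'e \<Rightarrow> 'l) \<Rightarrow> 'p \<times> 'e \<Rightarrow> 'l) \<Rightarrow>
     int \<Rightarrow> ('p, 'e, 'l) form \<Rightarrow> ('p, 'e, 'l) form" where
  "m1 AS E L JN n \<xi> =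
     (if n < 0 then 0
      else normal_part AS E L (nat n + 1)
             (schouten_jacobi 2 (nat n) (\<lambda>ls. JN (ls ! 0) (ls ! 1)) (lift_form AS E \<xi>)))"

subsection \<open>Cohomology\<close>

text \<open>For a complex with \<open>d n\<close> mapping \<open>C n\<close> to \<open>C (n + 1)\<close>.\<close>
definition cocycles :: "(int \<Rightarrow> 'a::ab_group_add set) \<Rightarrow> (int \<Rightarrow> 'a \<Rightarrow> 'a) \<Rightarrow> int \<Rightarrow> 'a set" where
  "cocycles C d n = {a \<in> C n. d n a = 0}"

definition cohomologous ::
    "(int \<Rightarrow> 'a::ab_group_add set) \<Rightarrow> (int \<Rightarrow> 'a \<Rightarrow> 'a) \<Rightarrow> int \<Rightarrow> 'a rel" where
  "cohomologous C d n =
     {(a, b). a \<in> cocycles C d n \<and> b \<in> cocycles C d n \<and> b - a \<in> d (n - 1) ` C (n - 1)}"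

definition cohomology ::
    "(int \<Rightarrow> 'a::ab_group_add set) \<Rightarrow> (int \<Rightarrow> 'a \<Rightarrow> 'a) \<Rightarrow> int \<Rightarrow> 'a set set" where
  "cohomology C d n = cocycles C d n // cohomologous C d n"

text \<open>The degree shift \<open>[1]\<close>.\<close>
definition shift1 :: "(int \<Rightarrow> 'a) \<Rightarrow> int \<Rightarrow> 'a" where
  "shift1 C n = C (n + 1)"

section \<open>Infinitesimal coisotropic deformations\<close>

text \<open>Translation by \<open>\<sigma>\<close> in the fibres: \<open>translate \<sigma> f\<close> vanishes on the image of \<open>\<sigma>\<close> if and only if
  \<open>f\<close> vanishes on the zero section.\<close>
definition translate :: "('p \<Rightarrow> 'e::real_vector) \<Rightarrow> ('p \<times> 'e \<Rightarrow> real) \<Rightarrow> 'p \<times> 'e \<Rightarrow> real" where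
  "translate \<sigma> f = (\<lambda>(x, w). f (x, w - \<sigma> x))"

text \<open>The conormal spaces of the image of a section \<open>\<sigma>\<close> are spanned by the differentials of the
  functions \<open>translate \<sigma> f\<close>, \<open>f\<close> vanishing on the zero section, and the tangent vectors are those
  annihilated by them.  So the image is coisotropic if and only if the number \<open>\<Lambda>\<^sub>J\<^sup>#(df' \<otimes> \<eta>)(g')\<close>
  vanishes along it for all such \<open>f' = translate \<sigma> f\<close> and \<open>g' = translate \<sigma> g\<close>.  For \<open>\<sigma> = \<epsilon> s\<close>
  this is required here up to \<open>O(\<epsilon>\<^sup>2)\<close>.\<close>
definition inf_coisotropic_deformation ::
    "('p, 'c::real_inner) atlas \<Rightarrow> ('p, 'e::real_vector, 'v::real_inner) vbundle \<Rightarrow>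
     ('p, 'l::real_vector) line_bundle \<Rightarrow>
     (('p \<times> 'e \<Rightarrow> 'l) \<Rightarrow> ('p \<times> 'e \<Rightarrow> 'l) \<Rightarrow> 'p \<times> 'e \<Rightarrow> 'l) \<Rightarrow> ('p \<Rightarrow> 'e) \<Rightarrow> bool" where
  "inf_coisotropic_deformation AS E L JN s \<longleftrightarrow>
     (let AN = total_atlas AS E; LN = normal_line AS E L in
        s \<in> sections AS E \<and>
        (\<forall>f\<in>Cinf AN. \<forall>g\<in>Cinf AN. \<forall>\<eta>\<in>sections AN LN. \<forall>x\<in>points AS.
           (\<forall>y\<in>points AS. f (y, 0) = 0 \<and> g (y, 0) = 0) \<longrightarrow>
           (\<lambda>\<epsilon>::real. Lambda_sharp AN LN JN (translate (\<lambda>y. \<epsilon> *\<^sub>R s y) f) \<eta> (x, \<epsilon> *\<^sub>R s x)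
                        (translate (\<lambda>y. \<epsilon> *\<^sub>R s y) g)) \<in> O[at 0](\<lambda>\<epsilon>. \<epsilon>\<^sup>2)))"

text \<open>\<open>s\<close> is the vertical component of \<open>X\<close> along the zero section: at each \<open>(x, 0)\<close>, the vector \<open>X\<close>
  is the sum of a vector tangent to the zero section and the vertical vector defined by \<open>s x\<close>.\<close>
definition is_vertical_component ::
    "('p, 'c::real_inner) atlas \<Rightarrow> ('p, 'e::real_vector, 'v::real_inner) vbundle \<Rightarrow>
     (('p \<times> 'e \<Rightarrow> real) \<Rightarrow> 'p \<times> 'e \<Rightarrow> real) \<Rightarrow> ('p \<Rightarrow> 'e) \<Rightarrow> bool" where
  "is_vertical_component AS E X s \<longleftrightarrow>
     (\<forall>x\<in>points AS. s x \<in> fib E x \<and>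
        (\<exists>u\<in>tangent_space AS x. \<forall>g\<in>Cinf (total_atlas AS E).
           X g (x, 0) = u (\<lambda>y. g (y, 0)) + deriv (\<lambda>r. g (x, r *\<^sub>R s x)) 0))"

definition inf_hamiltonian_equivalent ::
    "('p, 'c::real_inner) atlas \<Rightarrow> ('p, 'e::real_vector, 'v::real_inner) vbundle \<Rightarrow>
     ('p, 'l::real_vector) line_bundle \<Rightarrow>
     (('p \<times> 'e \<Rightarrow> 'l) \<Rightarrow> ('p \<times> 'e \<Rightarrow> 'l) \<Rightarrow> 'p \<times> 'e \<Rightarrow> 'l) \<Rightarrow> ('p \<Rightarrow> 'e) rel" where
  "inf_hamiltonian_equivalent AS E L JN =
     {(s0, s1). inf_coisotropic_deformation AS E L JN s0 \<and> inf_coisotropic_deformation AS E L JN s1 \<and>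
        (\<exists>\<eta>\<in>sections (total_atlas AS E) (normal_line AS E L).
           is_vertical_component AS E
             (hamiltonian (total_atlas AS E) (normal_line AS E L) JN \<eta>) (s1 - s0))}"

definition inf_moduli_space ::
    "('p, 'c::real_inner) atlas \<Rightarrow> ('p, 'e::real_vector, 'v::real_inner) vbundle \<Rightarrow>
     ('p, 'l::real_vector) line_bundle \<Rightarrow>
     (('p \<times> 'e \<Rightarrow> 'l) \<Rightarrow> ('p \<times> 'e \<Rightarrow> 'l) \<Rightarrow> 'p \<times> 'e \<Rightarrow> 'l) \<Rightarrow> ('p \<Rightarrow> 'e) set set" where
  "inf_moduli_space AS E L JN =
     {s. inf_coisotropic_deformation AS E L JN s} // inf_hamiltonian_equivalent AS E L JN"

end

(*
  Translating the image of the section \<epsilon> s back to the zero section, the defect of coisotropy of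
  \<epsilon> s at (x, \<epsilon> s(x)) depends only on the differentials of the two test functions there.  They may
  thus be taken linear on the fibres, and such an f turns into f - \<epsilon> s(f).  The defect becomes the
  polynomial \<Lambda>(f, g) - \<epsilon> (\<Lambda>(s f, g) + \<Lambda>(f, s g)) + \<epsilon>^2 \<Lambda>(s f, s g) along the line \<epsilon> s(x).  Its value
  at \<epsilon> = 0 vanishes by coisotropy, and its derivative there is minus the bracket of J with the lift
  of s, that is minus m1 s.  The bracket depends only on the 1-jets of its arguments because [X, Y] h
  vanishes at the critical points of h.  In degree 0, m1 maps \<lambda> to minus the vertical component of the
  Hamiltonian vector field of the pullback of \<lambda>.  Coisotropy makes the vertical component of the
  Hamiltonian vector field of any section depend only on its restriction to S.
*)
theory Submission
  imports Defs
begin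

section \<open>Calculus on open sets\<close>

text \<open>Operators act on global sections and functions only, so local frames and coordinates can
  enter only after multiplication by a cutoff. On NS the cutoffs are pulled back from S; they are
  then constant on the fibres and cost no more than a separation axiom on S. Since \<open>m1\<close>
  evaluates operators on representatives picked by \<open>SOME\<close>, nothing can be computed
  before the value is known not to depend on that choice. L has no global frame: antisymmetry of the
  bivector therefore takes the form \<open>lam_exchange\<close>, which trades the two sections along
  with the two functions, and facts about the first function are obtained from the second one in
  this way. Finally, coisotropy is given for functions on M, while the test functions live on NS; a
  cutoff supported in the tubular neighborhood carries them over. The locale \<open>jacobi\<close>
  is instantiated for both manifolds, so that one bracket calculus serves M and NS.\<close>

lemma frechet_derivative_cong_open:
  assumes "open U" "x \<in> U" "\<And>y. y \<in> U \<Longrightarrow> f y = g y"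
  shows "frechet_derivative f (at x) = frechet_derivative g (at x)"
    and "f differentiable (at x) \<longleftrightarrow> g differentiable (at x)"
proof -
  have *: "(f has_derivative D) (at x) \<longleftrightarrow> (g has_derivative D) (at x)" for D
    using assms has_derivative_transform_within_open[of f D x UNIV U g]
      has_derivative_transform_within_open[of g D x UNIV U f] by auto
  show "frechet_derivative f (at x) = frechet_derivative g (at x)"
    unfolding frechet_derivative_def by (simp add: *)
  show "f differentiable (at x) \<longleftrightarrow> g differentiable (at x)"
    unfolding differentiable_def by (simp add: *)
qed

lemma Ck_on_cong:
  assumes "open U" "\<And>x. x \<in> U \<Longrightarrow> f x = g x"
  shows "Ck_on k U f \<longleftrightarrow> Ck_on k U g"
  using assms(2)
proof (induction k arbitrary: f g)
  case 0
  then show ?case by (simp cong: continuous_on_cong)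
next
  case (Suc k)
  have "Ck_on k U (\<lambda>x. frechet_derivative f (at x) v) \<longleftrightarrow>
        Ck_on k U (\<lambda>x. frechet_derivative g (at x) v)" for v
    by (rule Suc.IH) (use frechet_derivative_cong_open(1)[OF assms(1)] Suc.prems in metis)
  moreover have "f differentiable (at x) \<longleftrightarrow> g differentiable (at x)" if "x \<in> U" for x
    using frechet_derivative_cong_open(2)[OF assms(1) that] Suc.prems by blast
  ultimately show ?case by simp
qed

text \<open>\<open>Ck_on\<close> recurses on the chosen \<open>frechet_derivative\<close>;
  uniqueness of derivatives at points of an open set lets any explicit formula \<open>D\<close> take
  its place. Most closure properties below are proved by exhibiting \<open>D\<close>.\<close>

lemma Ck_on_Suc_I:
  assumes "open U"
    and "\<And>x. x \<in> U \<Longrightarrow> (f has_derivative D x) (at x)"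
    and "\<And>v. Ck_on k U (\<lambda>x. D x v)"
  shows "Ck_on (Suc k) U f"
proof -
  have "frechet_derivative f (at x) = D x" if "x \<in> U" for x
    using frechet_derivative_at[OF assms(2)[OF that]] by simp
  then have "Ck_on k U (\<lambda>x. frechet_derivative f (at x) v)" for v
    using Ck_on_cong[OF assms(1), of "\<lambda>x. frechet_derivative f (at x) v" "\<lambda>x. D x v"] assms(3)
    by simp
  then show ?thesis using assms(2) by (auto simp: differentiable_def)
qed

lemma Ck_on_has_derivative:
  assumes "Ck_on (Suc k) U f" "x \<in> U"
  shows "(f has_derivative frechet_derivative f (at x)) (at x)"
  using assms frechet_derivative_works by auto

lemma Ck_on_Suc_imp: "Ck_on (Suc k) U f \<Longrightarrow> Ck_on k U f"
proof (induction k arbitrary: f)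
  case 0
  then show ?case
    by (auto intro!: continuous_at_imp_continuous_on differentiable_imp_continuous_within)
qed auto

lemma Ck_on_subset: "Ck_on k U f \<Longrightarrow> V \<subseteq> U \<Longrightarrow> Ck_on k V f"
  by (induction k arbitrary: f) (auto intro: continuous_on_subset)

lemma Ck_on_local:
  assumes "\<And>x. x \<in> U \<Longrightarrow> \<exists>V. open V \<and> x \<in> V \<and> Ck_on k V f"
  shows "Ck_on k U f"
  using assms
proof (induction k arbitrary: f)
  case 0
  show ?case
    unfolding Ck_on.simps
  proof (rule continuous_at_imp_continuous_on, rule ballI)
    fix x assume "x \<in> U"
    with 0 obtain V where "open V" "x \<in> V" "continuous_on V f" by auto
    then show "isCont f x" using continuous_on_eq_continuous_at by blast
  qed
next
  case (Suc k)
  have "Ck_on k U (\<lambda>x. frechet_derivative f (at x) v)" for v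
    by (rule Suc.IH) (use Suc.prems in fastforce)
  with Suc.prems show ?case by fastforce
qed

lemma Ck_on_const: "Ck_on k U (\<lambda>x. c)"
  by (induction k arbitrary: c) auto

lemma Ck_on_linear:
  assumes "bounded_linear g"
  shows "Ck_on k U g"
proof (cases k)
  case 0
  then show ?thesis using assms by (simp add: linear_continuous_on)
next
  case (Suc j)
  have "frechet_derivative g (at x) = g" for x
    using frechet_derivative_at[OF bounded_linear_imp_has_derivative[OF assms]] by metis
  with Suc show ?thesis
    using assms by (auto simp: Ck_on_const bounded_linear_imp_differentiable)
qed

lemma Ck_on_linear_compose:
  assumes "bounded_linear g" "open U" "Ck_on k U f"
  shows "Ck_on k U (\<lambda>x. g (f x))"
  using assms(3)
proof (induction k arbitrary: f)
  case 0
  then show ?case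
    by (auto intro: continuous_on_compose2[OF linear_continuous_on[OF assms(1), of UNIV]])
next
  case (Suc k)
  show ?case
    by (rule Ck_on_Suc_I[OF assms(2), where D = "\<lambda>x v. g (frechet_derivative f (at x) v)"])
      (use Suc in \<open>auto intro!: bounded_linear.has_derivative[OF assms(1)]
         simp: frechet_derivative_works[symmetric]\<close>)
qed

lemma Ck_on_add:
  assumes "open U" "Ck_on k U f" "Ck_on k U g"
  shows "Ck_on k U (\<lambda>x. f x + g x)"
  using assms(2,3)
proof (induction k arbitrary: f g)
  case 0
  then show ?case by (auto intro: continuous_intros)
next
  case (Suc k)
  show ?case
    by (rule Ck_on_Suc_I[OF assms(1), where D = "\<lambda>x v. frechet_derivative f (at x) v + frechet_derivative g (at x) v"])
      (use Suc in \<open>auto intro!: has_derivative_add simp: frechet_derivative_works[symmetric]\<close>)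
qed

lemma Ck_on_sum:
  assumes "open U" "\<And>b. b \<in> B \<Longrightarrow> Ck_on k U (f b)"
  shows "Ck_on k U (\<lambda>x. \<Sum>b\<in>B. f b x)"
  using assms(2)
  by (induction B rule: infinite_finite_induct) (auto intro: Ck_on_const Ck_on_add[OF assms(1)])

lemma Ck_on_bilinear:
  assumes "bounded_bilinear p" "open U" "Ck_on k U f" "Ck_on k U g"
  shows "Ck_on k U (\<lambda>x. p (f x) (g x))"
  using assms(3,4)
proof (induction k arbitrary: f g)
  case 0
  then show ?case using bounded_bilinear.continuous_on[OF assms(1)] by auto
next
  case (Suc k)
  \<comment> \<open>Each term of the product rule contains one undifferentiated factor, so the
    induction hypothesis needs \<open>f\<close> and \<open>g\<close> themselves in class
    \<open>k\<close>.\<close>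
  have fg: "Ck_on k U f" "Ck_on k U g" using Suc.prems Ck_on_Suc_imp by blast+
  show ?case
    by (rule Ck_on_Suc_I[OF assms(2), where
          D = "\<lambda>x v. p (f x) (frechet_derivative g (at x) v) + p (frechet_derivative f (at x) v) (g x)"])
      (use Suc fg in \<open>auto intro!: bounded_bilinear.FDERIV[OF assms(1)] Ck_on_add[OF assms(2)]
         simp: frechet_derivative_works[symmetric]\<close>)
qed

lemma Ck_on_Pair:
  assumes "open U" "Ck_on k U f" "Ck_on k U g"
  shows "Ck_on k U (\<lambda>x. (f x, g x))"
  using assms(2,3)
proof (induction k arbitrary: f g)
  case 0
  then show ?case by (auto intro: continuous_intros)
next
  case (Suc k)
  show ?case
    by (rule Ck_on_Suc_I[OF assms(1), where D = "\<lambda>x v. (frechet_derivative f (at x) v, frechet_derivative g (at x) v)"])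
      (use Suc in \<open>auto intro!: has_derivative_Pair simp: frechet_derivative_works[symmetric]\<close>)
qed

text \<open>Gram-Schmidt may leave 0 in the orthogonal spanning set; its coordinate is then a
  quotient by 0, hence 0, and the expansion still holds. The residual \<open>y\<close> is orthogonal
  to the whole span, thus to itself. Coordinates given by inner products are bounded, which makes
  them usable in the calculus.\<close>

lemma finite_dim_coordinates:
  assumes "finite_dim TYPE('a::real_inner)"
  obtains B :: "'a::real_inner set" and c where "finite B" "\<And>b. bounded_linear (c b :: 'a::real_inner \<Rightarrow> real)"
    "\<And>x. x = (\<Sum>b\<in>B. c b x *\<^sub>R b)"
proof -
  from assms obtain B0 :: "'a set" where "finite B0" "span B0 = UNIV" by (auto simp: finite_dim_def)
  with basis_orthogonal[of B0] obtain C :: "'a set" where C: "finite C" "span C = UNIV" "pairwise orthogonal C"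
    by auto
  define c where "c b x = (x \<bullet> b) / (b \<bullet> b)" for b x :: 'a
  have lin: "bounded_linear (c b)" for b
    unfolding c_def divide_inverse by (intro bounded_linear_mult_const bounded_linear_inner_left)
  have "x = (\<Sum>b\<in>C. c b x *\<^sub>R b)" for x
  proof -
    define y where "y = x - (\<Sum>b\<in>C. c b x *\<^sub>R b)"
    have "y \<bullet> b = 0" if "b \<in> C" for b
    proof -
      have "(\<Sum>d\<in>C. c d x *\<^sub>R d) \<bullet> b = (\<Sum>d\<in>C. c d x * (d \<bullet> b))"
        by (simp add: inner_sum_left)
      also have "\<dots> = (\<Sum>d\<in>C. if d = b then c b x * (b \<bullet> b) else 0)"
        by (rule sum.cong) (use C(3) that in \<open>auto simp: pairwise_def orthogonal_def\<close>)
      also have "\<dots> = x \<bullet> b" using C(1) that by (simp add: c_def)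
      finally show ?thesis by (simp add: y_def inner_diff_left)
    qed
    then have "C \<subseteq> {z. orthogonal y z}" by (auto simp: orthogonal_def)
    then have "span C \<subseteq> {z. orthogonal y z}"
      by (rule span_minimal) (rule subspace_orthogonal_to_vector)
    then have "orthogonal y y" using C(2) by blast
    then show ?thesis by (simp add: orthogonal_def y_def)
  qed
  with that lin C(1) show ?thesis by blast
qed

lemma finite_dim_real: "finite_dim TYPE(real)"
  unfolding finite_dim_def
  by (rule exI[of _ "{1::real}"]) (use span_Basis[where ?'a = real] in simp)

lemma finite_dim_prod:
  assumes "finite_dim TYPE('a::real_inner)" "finite_dim TYPE('b::real_inner)"
  shows "finite_dim TYPE('a::real_inner \<times> 'b::real_inner)"
proof -
  obtain B :: "'a set" and c where B: "finite B" "\<And>b. bounded_linear (c b :: 'a \<Rightarrow> real)"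
    "\<And>x. x = (\<Sum>b\<in>B. c b x *\<^sub>R b)" by (rule finite_dim_coordinates[OF assms(1)]) blast
  obtain B' :: "'b set" and c' where B': "finite B'" "\<And>b. bounded_linear (c' b :: 'b \<Rightarrow> real)"
    "\<And>x. x = (\<Sum>b\<in>B'. c' b x *\<^sub>R b)" by (rule finite_dim_coordinates[OF assms(2)]) blast
  let ?S = "(\<lambda>b. (b, 0::'b)) ` B \<union> (\<lambda>b. (0::'a, b)) ` B'"
  have "(x, y) \<in> span ?S" for x y
  proof -
    have "(x, y) = (\<Sum>b\<in>B. c b x *\<^sub>R (b, 0)) + (\<Sum>b\<in>B'. c' b y *\<^sub>R (0, b))"
      by (rule prod_eqI; simp add: fst_sum snd_sum flip: B(3) B'(3))
    also have "\<dots> \<in> span ?S"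
      by (intro span_add span_sum span_scale span_base) auto
    finally show ?thesis .
  qed
  then show ?thesis unfolding finite_dim_def using B(1) B'(1) by (intro exI[of _ ?S]) auto
qed

text \<open>In the chain rule the derivative of \<open>g\<close> is taken in a direction that moves
  with \<open>x\<close>. Expanding that direction in coordinates leaves derivatives of
  \<open>g\<close> in fixed directions \<open>b\<close>, composed with \<open>f\<close>, to which
  the induction hypothesis applies.\<close>

lemma Ck_on_compose:
  fixes f :: "'a::real_normed_vector \<Rightarrow> 'b::real_inner"
  assumes fd: "finite_dim TYPE('b)" and "open U" "open V" "f ` U \<subseteq> V"
    and "Ck_on k U f" "Ck_on k V g"
  shows "Ck_on k U (\<lambda>x. g (f x))"
  using assms(5,6)
proof (induction k arbitrary: g)
  case 0
  then show ?case using continuous_on_compose2 assms(4) by auto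
next
  case (Suc k)
  obtain B :: "'b set" and c where B: "finite B" "\<And>b. bounded_linear (c b :: 'b \<Rightarrow> real)"
    "\<And>x. x = (\<Sum>b\<in>B. c b x *\<^sub>R b)" by (rule finite_dim_coordinates[OF fd]) blast
  define D where "D x v = (\<Sum>b\<in>B. c b (frechet_derivative f (at x) v) *\<^sub>R frechet_derivative g (at (f x)) b)" for x v
  show ?case
  proof (rule Ck_on_Suc_I[OF assms(2), where D = D])
    fix x assume x: "x \<in> U"
    then have "f x \<in> V" using assms(4) by auto
    let ?g = "frechet_derivative g (at (f x))" and ?f = "frechet_derivative f (at x)"
    have g: "(g has_derivative ?g) (at (f x))"
      using Ck_on_has_derivative[OF Suc.prems(2) \<open>f x \<in> V\<close>] .
    have f: "(f has_derivative ?f) (at x)"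
      using Ck_on_has_derivative[OF Suc.prems(1) x] .
    have lin: "linear ?g" using g has_derivative_linear by blast
    have "?g w = (\<Sum>b\<in>B. c b w *\<^sub>R ?g b)" for w
    proof -
      have "?g w = ?g (\<Sum>b\<in>B. c b w *\<^sub>R b)" by (rule arg_cong[OF B(3)])
      also have "\<dots> = (\<Sum>b\<in>B. c b w *\<^sub>R ?g b)"
        by (simp add: linear_sum[OF lin] linear_scale[OF lin])
      finally show ?thesis .
    qed
    then have "D x = (\<lambda>v. ?g (?f v))" unfolding D_def by (intro ext) (rule sym)
    then show "((\<lambda>x. g (f x)) has_derivative D x) (at x)"
      using has_derivative_compose[OF f g] by simp
  next
    fix v
    have f: "Ck_on k U f" using Suc.prems Ck_on_Suc_imp by blast
    show "Ck_on k U (\<lambda>x. D x v)"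
      unfolding D_def
      by (intro Ck_on_sum assms(2) Ck_on_bilinear[OF bounded_bilinear_scaleR]
          Ck_on_linear_compose[OF B(2)] Suc.IH f) (use Suc.prems in auto)
  qed
qed

lemma smooth_on_cong:
  "open U \<Longrightarrow> (\<And>x. x \<in> U \<Longrightarrow> f x = g x) \<Longrightarrow> smooth_on U f \<longleftrightarrow> smooth_on U g"
  unfolding smooth_on_def using Ck_on_cong by blast

lemma smooth_on_subset: "smooth_on U f \<Longrightarrow> V \<subseteq> U \<Longrightarrow> smooth_on V f"
  unfolding smooth_on_def using Ck_on_subset by blast

lemma smooth_on_local:
  "(\<And>x. x \<in> U \<Longrightarrow> \<exists>V. open V \<and> x \<in> V \<and> smooth_on V f) \<Longrightarrow> smooth_on U f"
  unfolding smooth_on_def using Ck_on_local by metis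

lemma smooth_on_const: "smooth_on U (\<lambda>x. c)"
  unfolding smooth_on_def using Ck_on_const by blast

lemma smooth_on_linear: "bounded_linear g \<Longrightarrow> smooth_on U g"
  unfolding smooth_on_def using Ck_on_linear by blast

lemma smooth_on_linear_compose:
  "bounded_linear g \<Longrightarrow> open U \<Longrightarrow> smooth_on U f \<Longrightarrow> smooth_on U (\<lambda>x. g (f x))"
  unfolding smooth_on_def using Ck_on_linear_compose by blast

lemma smooth_on_add: "open U \<Longrightarrow> smooth_on U f \<Longrightarrow> smooth_on U g \<Longrightarrow> smooth_on U (\<lambda>x. f x + g x)"
  unfolding smooth_on_def using Ck_on_add by blast

lemma smooth_on_sum:
  "open U \<Longrightarrow> (\<And>b. b \<in> B \<Longrightarrow> smooth_on U (f b)) \<Longrightarrow> smooth_on U (\<lambda>x. \<Sum>b\<in>B. f b x)"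
  unfolding smooth_on_def by (auto intro: Ck_on_sum)

lemma smooth_on_bilinear:
  "bounded_bilinear p \<Longrightarrow> open U \<Longrightarrow> smooth_on U f \<Longrightarrow> smooth_on U g \<Longrightarrow>
   smooth_on U (\<lambda>x. p (f x) (g x))"
  unfolding smooth_on_def using Ck_on_bilinear by blast

lemmas smooth_on_mult = smooth_on_bilinear[OF bounded_bilinear_mult]
lemmas smooth_on_scaleR = smooth_on_bilinear[OF bounded_bilinear_scaleR]
lemmas smooth_on_inner = smooth_on_bilinear[OF bounded_bilinear_inner]

lemma smooth_on_minus: "open U \<Longrightarrow> smooth_on U f \<Longrightarrow> smooth_on U (\<lambda>x. - f x)"
  by (rule smooth_on_linear_compose[OF bounded_linear_minus[OF bounded_linear_ident]])

lemma smooth_on_diff: "open U \<Longrightarrow> smooth_on U f \<Longrightarrow> smooth_on U g \<Longrightarrow> smooth_on U (\<lambda>x. f x - g x)"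
  using smooth_on_add[of U f "\<lambda>x. - g x"] smooth_on_minus by auto

lemma smooth_on_Pair: "open U \<Longrightarrow> smooth_on U f \<Longrightarrow> smooth_on U g \<Longrightarrow> smooth_on U (\<lambda>x. (f x, g x))"
  unfolding smooth_on_def using Ck_on_Pair by blast

lemma smooth_on_compose:
  fixes f :: "'a::real_normed_vector \<Rightarrow> 'b::real_inner"
  assumes "finite_dim TYPE('b)" "open U" "open V" "f ` U \<subseteq> V" "smooth_on U f" "smooth_on V g"
  shows "smooth_on U (\<lambda>x. g (f x))"
  using assms(5,6) Ck_on_compose[OF assms(1-4)] by (auto simp: smooth_on_def)

lemma smooth_on_imp_has_derivative:
  "smooth_on U f \<Longrightarrow> x \<in> U \<Longrightarrow> (f has_derivative frechet_derivative f (at x)) (at x)"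
  unfolding smooth_on_def using Ck_on_has_derivative by blast

lemma smooth_on_imp_continuous_on: "smooth_on U f \<Longrightarrow> continuous_on U f"
  unfolding smooth_on_def using Ck_on.simps(1) by blast

lemma smooth_on_frechet_derivative:
  "smooth_on U f \<Longrightarrow> smooth_on U (\<lambda>x. frechet_derivative f (at x) v)"
  unfolding smooth_on_def using Ck_on.simps(2) by blast

text \<open>\<open>smooth_on_frechet_derivative\<close> treats a fixed direction; a moving one is
  again expanded in coordinates. This is the form needed for derivatives along a vector field such
  as \<open>vert s\<close>.\<close>

lemma smooth_on_frechet_derivative_field:
  fixes f :: "'a::real_inner \<Rightarrow> 'b::real_normed_vector"
  assumes fd: "finite_dim TYPE('a)" and "open U" "smooth_on U f" "smooth_on U X"
  shows "smooth_on U (\<lambda>x. frechet_derivative f (at x) (X x))"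
proof -
  obtain B :: "'a set" and c where B: "finite B" "\<And>b. bounded_linear (c b :: 'a \<Rightarrow> real)"
    "\<And>x. x = (\<Sum>b\<in>B. c b x *\<^sub>R b)" by (rule finite_dim_coordinates[OF fd]) blast
  have eq: "frechet_derivative f (at x) (X x) = (\<Sum>b\<in>B. c b (X x) *\<^sub>R frechet_derivative f (at x) b)"
    if "x \<in> U" for x
  proof -
    have lin: "linear (frechet_derivative f (at x))"
      using has_derivative_linear smooth_on_imp_has_derivative[OF assms(3) that] by blast
    have "frechet_derivative f (at x) (X x) = frechet_derivative f (at x) (\<Sum>b\<in>B. c b (X x) *\<^sub>R b)"
      by (rule arg_cong[OF B(3)])
    also have "\<dots> = (\<Sum>b\<in>B. c b (X x) *\<^sub>R frechet_derivative f (at x) b)"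
      by (simp add: linear_sum[OF lin] linear_scale[OF lin])
    finally show ?thesis .
  qed
  have "smooth_on U (\<lambda>x. \<Sum>b\<in>B. c b (X x) *\<^sub>R frechet_derivative f (at x) b)"
    by (intro smooth_on_sum assms(2) smooth_on_scaleR smooth_on_linear_compose[OF B(2)] assms(4)
        smooth_on_frechet_derivative assms(3))
  then show ?thesis using smooth_on_cong[OF assms(2) eq] by simp
qed

text \<open>The derivative of the inverse is minus a product of two inverses, so the induction on
  the order closes on itself.\<close>

lemma smooth_on_inverse_real: "smooth_on (- {0::real}) inverse"
proof -
  have "Ck_on k (- {0::real}) inverse" for k
  proof (induction k)
    case 0
    show ?case by (auto intro!: continuous_intros)
  next
    case (Suc k)
    have o: "open (- {0::real})" by auto
    show ?case
      by (rule Ck_on_Suc_I[OF o, where D = "\<lambda>x v. - (inverse x * v * inverse x)"])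
        (auto intro!: has_derivative_inverse' Ck_on_linear_compose[OF bounded_linear_minus[OF bounded_linear_ident] o]
            Ck_on_bilinear[OF bounded_bilinear_mult o] Ck_on_const Suc)
  qed
  then show ?thesis by (simp add: smooth_on_def)
qed

lemma smooth_on_divide:
  fixes f g :: "'a::real_normed_vector \<Rightarrow> real"
  assumes "open U" "smooth_on U f" "smooth_on U g" "\<And>x. x \<in> U \<Longrightarrow> g x \<noteq> 0"
  shows "smooth_on U (\<lambda>x. f x / g x)"
  unfolding divide_inverse
  by (intro smooth_on_mult assms smooth_on_compose[OF finite_dim_real _ _ _ _ smooth_on_inverse_real])
    (use assms(4) in auto)

section \<open>Bump functions built from exp(-1/t)\<close>

definition flat :: "nat \<Rightarrow> real \<Rightarrow> real" where
  "flat n t = (if t > 0 then inverse t ^ n * exp (- inverse t) else 0)"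

text \<open>With \<open>u = 1/t\<close> the limit from the right is the limit of
  \<open>u^n / exp u\<close> at infinity; from the left the function is constantly zero.\<close>

lemma flat_tendsto_0: "(flat n \<longlongrightarrow> 0) (at 0)"
proof -
  have "((\<lambda>t. inverse t ^ n / exp (inverse t)) \<longlongrightarrow> 0) (at_right (0::real))"
    by (rule filterlim_compose[OF tendsto_power_div_exp_0 filterlim_inverse_at_top_right])
  then have "(flat n \<longlongrightarrow> 0) (at_right 0)"
    by (rule Lim_transform_eventually)
      (auto simp: flat_def exp_minus field_simps eventually_at_filter)
  moreover have "(flat n \<longlongrightarrow> 0) (at_left 0)"
    by (rule tendsto_eventually) (auto simp: flat_def eventually_at_filter)
  ultimately show ?thesis by (simp add: filterlim_at_split)
qed

text \<open>The exponent \<open>n\<close> is carried along to make the family closed under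
  differentiation, up to linear combinations; smoothness then follows by one induction for all
  \<open>n\<close> at once.\<close>

lemma flat_has_derivative:
  "(flat n has_real_derivative flat (n + 2) t - n * flat (n + 1) t) (at t)"
proof -
  consider "t > 0" | "t < 0" | "t = 0" by linarith
  then show ?thesis
  proof cases
    case 1
    have inv: "(inverse has_real_derivative - (inverse t ^ 2)) (at t)"
      using DERIV_inverse[of t UNIV] 1 by (simp add: power2_eq_square)
    have e: "((\<lambda>t. exp (- inverse t)) has_real_derivative exp (- inverse t) * - (- (inverse t ^ 2))) (at t)"
      by (rule DERIV_chain2[OF DERIV_exp DERIV_minus[OF inv]])
    have "((\<lambda>t. inverse t ^ n * exp (- inverse t)) has_real_derivative
        flat (n + 2) t - n * flat (n + 1) t) (at t)"
      using DERIV_mult[OF DERIV_power[OF inv, of n] e] 1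
      by (cases n) (simp_all add: flat_def power2_eq_square algebra_simps)
    then show ?thesis
      by (rule has_field_derivative_transform_within_open[of _ _ _ "{0<..}"])
        (use 1 in \<open>auto simp: flat_def\<close>)
  next
    case 2
    have "((\<lambda>t. 0) has_real_derivative flat (n + 2) t - n * flat (n + 1) t) (at t)"
      using 2 by (simp add: flat_def)
    then show ?thesis
      by (rule has_field_derivative_transform_within_open[of _ _ _ "{..<0}"])
        (use 2 in \<open>auto simp: flat_def\<close>)
  next
    case 3
    \<comment> \<open>The difference quotient of \<open>flat n\<close> at 0 is
      \<open>flat (n + 1)\<close>, whose limit is known.\<close>
    have "((\<lambda>h. (flat n (0 + h) - flat n 0) / h) \<longlongrightarrow> 0) (at 0)"
      by (rule Lim_transform_eventually[OF flat_tendsto_0[of "n + 1"]])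
        (auto simp: flat_def eventually_at_filter divide_inverse)
    then show ?thesis unfolding DERIV_def using 3 by (simp add: flat_def)
  qed
qed

lemma smooth_on_flat: "smooth_on U (flat n)"
proof -
  have "Ck_on k UNIV (flat n)" for k
  proof (induction k arbitrary: n)
    case 0
    show ?case
      by (auto intro!: continuous_at_imp_continuous_on DERIV_isCont[OF flat_has_derivative])
  next
    case (Suc k)
    show ?case
    proof (rule Ck_on_Suc_I[where D = "\<lambda>t v. v * (flat (n + 2) t + (- real n) * flat (n + 1) t)"])
      have "(\<lambda>v. v * (flat (n + 2) t + (- real n) * flat (n + 1) t)) =
          (*) (flat (n + 2) t - n * flat (n + 1) t)" for t
        by (rule ext) (simp add: algebra_simps)
      then show "(flat n has_derivative (\<lambda>v. v * (flat (n + 2) t + (- real n) * flat (n + 1) t))) (at t)" for t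
        using flat_has_derivative[of n t] unfolding has_field_derivative_def by simp
      show "Ck_on k UNIV (\<lambda>t. v * (flat (n + 2) t + (- real n) * flat (n + 1) t))" for v
        by (intro Ck_on_bilinear[OF bounded_bilinear_mult] Ck_on_add Ck_on_const Suc) auto
    qed auto
  qed
  then show ?thesis using smooth_on_subset[of UNIV "flat n" U] by (simp add: smooth_on_def)
qed

text \<open>The squared distance \<open>n\<close> is smooth everywhere, while the norm is not.
  \<open>p\<close> is positive exactly inside radius \<open>R\<close> and \<open>q\<close> exactly
  outside radius \<open>r\<close>; as \<open>r < R\<close>, their sum is positive everywhere, and
  the quotient \<open>p / (p + q)\<close> is 1 where \<open>q\<close> vanishes and 0 where
  \<open>p\<close> does.\<close>

lemma smooth_bump:
  fixes z :: "'a::real_inner"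
  assumes "finite_dim TYPE('a)" "0 < r" "r < R"
  obtains \<rho> :: "'a \<Rightarrow> real" where "smooth_on UNIV \<rho>"
    "\<And>x. dist x z < r \<Longrightarrow> \<rho> x = 1" "\<And>x. dist x z \<ge> R \<Longrightarrow> \<rho> x = 0"
proof -
  define n where "n x = (x - z) \<bullet> (x - z)" for x
  have n: "n x = (dist x z)\<^sup>2" for x by (simp add: n_def dist_norm power2_norm_eq_inner)
  have sn: "smooth_on UNIV n" unfolding n_def
    by (intro smooth_on_inner smooth_on_diff smooth_on_const smooth_on_linear bounded_linear_ident open_UNIV)
  define p where "p x = flat 0 (R\<^sup>2 - n x)" for x
  define q where "q x = flat 0 (n x - r\<^sup>2)" for x
  have sp: "smooth_on UNIV p" "smooth_on UNIV q" unfolding p_def q_def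
    by (rule smooth_on_compose[OF finite_dim_real, where V = UNIV];
        (intro smooth_on_flat smooth_on_diff smooth_on_const sn open_UNIV)?; simp)+
  have rR: "r\<^sup>2 < R\<^sup>2" using assms by (simp add: power_strict_mono)
  have pos: "p x + q x > 0" for x
    using rR by (cases "n x < R\<^sup>2") (auto simp: p_def q_def flat_def intro!: add_pos_pos)
  show ?thesis
  proof (rule that[of "\<lambda>x. p x / (p x + q x)"])
    show "smooth_on UNIV (\<lambda>x. p x / (p x + q x))"
      by (intro smooth_on_divide smooth_on_add sp open_UNIV) (use pos in \<open>auto simp: less_imp_neq[symmetric]\<close>)
    show "p x / (p x + q x) = 1" if "dist x z < r" for x
    proof -
      have "n x < r\<^sup>2" unfolding n using that by (simp add: power_strict_mono)
      then have "q x = 0" by (simp add: q_def flat_def)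
      with pos[of x] show ?thesis by simp
    qed
    show "p x / (p x + q x) = 0" if "dist x z \<ge> R" for x
    proof -
      have "n x \<ge> R\<^sup>2" unfolding n using that assms by (simp add: power_mono)
      then show ?thesis by (simp add: p_def flat_def)
    qed
  qed
qed

text \<open>The ball is a closed subset of \<open>C B\<close>, a Minkowski sum of finitely many
  compact segments. Compactness of balls is what makes the support of a bump function closed in a
  Hausdorff manifold.\<close>

lemma finite_dim_compact_cball:
  fixes z :: "'a::real_inner"
  assumes "finite_dim TYPE('a)"
  shows "compact (cball z r)"
proof -
  obtain B :: "'a set" and c where B: "finite B" "\<And>b. bounded_linear (c b :: 'a \<Rightarrow> real)"
    "\<And>x. x = (\<Sum>b\<in>B. c b x *\<^sub>R b)" by (rule finite_dim_coordinates[OF assms]) blast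
  have "\<exists>K. \<forall>x. norm (c b x) \<le> norm x * K" for b
    using bounded_linear.bounded[OF B(2)] .
  then obtain K where K: "norm (c b x) \<le> norm x * K b" for b x by metis
  \<comment> \<open>A bound for the coordinate \<open>c b\<close> on the ball, where
    \<open>norm x\<close> is at most \<open>norm z + |r|\<close>.\<close>
  define m where "m b = (norm z + \<bar>r\<bar>) * \<bar>K b\<bar>" for b
  define C where "C D = {\<Sum>b\<in>D. u b *\<^sub>R b | u. \<forall>b\<in>D. u b \<in> {- m b .. m b}}" for D
  have "compact (C D)" if "finite D" for D
    using that
  proof induction
    case empty
    have "C {} = {0}" by (auto simp: C_def)
    then show ?case by simp
  next
    case (insert d D)
    have "C (insert d D) = {x + y | x y. x \<in> (\<lambda>u. u *\<^sub>R d) ` {- m d .. m d} \<and> y \<in> C D}"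
    proof (intro set_eqI iffI)
      fix x assume "x \<in> C (insert d D)"
      then obtain u where "x = (\<Sum>b\<in>insert d D. u b *\<^sub>R b)" "\<forall>b\<in>insert d D. u b \<in> {- m b .. m b}"
        unfolding C_def by blast
      then show "x \<in> {x + y | x y. x \<in> (\<lambda>u. u *\<^sub>R d) ` {- m d .. m d} \<and> y \<in> C D}"
        using insert unfolding C_def
        by (intro CollectI exI[of _ "u d *\<^sub>R d"] exI[of _ "\<Sum>b\<in>D. u b *\<^sub>R b"]) auto
    next
      fix x assume "x \<in> {x + y | x y. x \<in> (\<lambda>u. u *\<^sub>R d) ` {- m d .. m d} \<and> y \<in> C D}"
      then obtain v u where x: "x = v *\<^sub>R d + (\<Sum>b\<in>D. u b *\<^sub>R b)" "v \<in> {- m d .. m d}"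
        "\<forall>b\<in>D. u b \<in> {- m b .. m b}" by (auto simp: C_def)
      have "(\<Sum>b\<in>D. u b *\<^sub>R b) = (\<Sum>b\<in>D. (u(d := v)) b *\<^sub>R b)"
        by (rule sum.cong) (use insert in auto)
      then have "x = (\<Sum>b\<in>insert d D. (u(d := v)) b *\<^sub>R b)" using x insert by simp
      then show "x \<in> C (insert d D)" using x unfolding C_def
        by (intro CollectI exI[of _ "u(d := v)"]) auto
    qed
    moreover have "compact ((\<lambda>u. u *\<^sub>R d) ` {- m d .. m d})"
      by (intro compact_continuous_image continuous_intros) auto
    ultimately show ?case using compact_sums insert by auto
  qed
  then have "compact (C B)" using B(1) .
  moreover have "cball z r \<subseteq> C B"
  proof
    fix x assume "x \<in> cball z r"
    then have "norm (x - z) \<le> r" by (simp add: dist_norm norm_minus_commute)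
    then have "norm x \<le> norm z + \<bar>r\<bar>" using norm_triangle_sub[of x z] by linarith
    then have "\<bar>c b x\<bar> \<le> m b" for b
    proof -
      have "\<bar>c b x\<bar> \<le> norm x * K b" using K[of b x] by simp
      also have "\<dots> \<le> norm x * \<bar>K b\<bar>" by (simp add: mult_left_mono)
      also have "\<dots> \<le> m b" unfolding m_def
        using \<open>norm x \<le> norm z + \<bar>r\<bar>\<close> by (intro mult_right_mono) auto
      finally show ?thesis .
    qed
    then have "\<forall>b\<in>B. c b x \<in> {- m b .. m b}" by (simp add: abs_le_iff minus_le_iff)
    then show "x \<in> C B" unfolding C_def by (intro CollectI exI[of _ "\<lambda>b. c b x"] conjI B(3))
  qed
  ultimately show ?thesis
    using compact_Int_closed[of "C B" "cball z r"] by (simp add: Int_absorb1)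
qed

section \<open>Symmetry of second derivatives\<close>

lemma mixed_difference_quotient:
  fixes f :: "'a::real_normed_vector \<Rightarrow> real"
  assumes "smooth_on (ball z d) f" "0 < h" "h * (norm v + norm w) < d"
  shows "\<exists>y. dist y z \<le> h * (norm v + norm w) \<and>
    f (z + h *\<^sub>R v + h *\<^sub>R w) - f (z + h *\<^sub>R v) - f (z + h *\<^sub>R w) + f z =
    h * h * frechet_derivative (\<lambda>x. frechet_derivative f (at x) v) (at y) w"
proof -
  let ?fv = "\<lambda>x. frechet_derivative f (at x) v"
  have dst: "dist (z + r *\<^sub>R v + q *\<^sub>R w) z \<le> h * (norm v + norm w)"
    if "0 \<le> r" "r \<le> h" "0 \<le> q" "q \<le> h" for r q
  proof -
    have "dist (z + r *\<^sub>R v + q *\<^sub>R w) z \<le> r * norm v + q * norm w"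
      using that norm_triangle_ineq[of "r *\<^sub>R v" "q *\<^sub>R w"] by (simp add: dist_norm)
    also have "\<dots> \<le> h * norm v + h * norm w" using that by (intro add_mono mult_right_mono) auto
    finally show ?thesis by (simp add: distrib_left)
  qed
  then have inb: "z + r *\<^sub>R v + q *\<^sub>R w \<in> ball z d" if "0 \<le> r" "r \<le> h" "0 \<le> q" "q \<le> h" for r q
    using assms(3) that by (smt (verit) dist_commute mem_ball)
  have D: "((\<lambda>r. g (y + r *\<^sub>R u)) has_real_derivative frechet_derivative g (at (y + r *\<^sub>R u)) u) (at r)"
    if "smooth_on (ball z d) g" "y + r *\<^sub>R u \<in> ball z d" for g :: "'a \<Rightarrow> real" and y u r
  proof -
    have g: "(g has_derivative frechet_derivative g (at (y + r *\<^sub>R u))) (at (y + r *\<^sub>R u))"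
      using smooth_on_imp_has_derivative[OF that] .
    have "((\<lambda>r. y + r *\<^sub>R u) has_derivative (\<lambda>h. h *\<^sub>R u)) (at r)"
      by (auto intro!: derivative_eq_intros)
    from has_derivative_compose[OF this g]
    have "((\<lambda>r. g (y + r *\<^sub>R u)) has_derivative
        (\<lambda>h. frechet_derivative g (at (y + r *\<^sub>R u)) (h *\<^sub>R u))) (at r)" .
    moreover have "(\<lambda>h. frechet_derivative g (at (y + r *\<^sub>R u)) (h *\<^sub>R u)) =
        (*) (frechet_derivative g (at (y + r *\<^sub>R u)) u)"
      by (rule ext) (simp add: linear_scale[OF has_derivative_linear[OF g]])
    ultimately show ?thesis unfolding has_field_derivative_def by simp
  qed
  \<comment> \<open>The mixed difference is the increment of \<open>?g\<close> over
    \<open>[0, h]\<close>, where \<open>?g\<close> is itself the difference across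
    \<open>h w\<close>. The mean value theorem in direction \<open>v\<close>, and then in direction
    \<open>w\<close> for the derivative \<open>?k\<close>, yields the factor
    \<open>h * h\<close>.\<close>
  let ?g = "\<lambda>r. f ((z + h *\<^sub>R w) + r *\<^sub>R v) - f (z + r *\<^sub>R v)"
  have "\<exists>r. 0 < r \<and> r < h \<and> ?g h - ?g 0 = (h - 0) * (?fv ((z + h *\<^sub>R w) + r *\<^sub>R v) - ?fv (z + r *\<^sub>R v))"
  proof (rule MVT2[OF assms(2)])
    fix r assume r: "0 \<le> r" "r \<le> h"
    show "(?g has_real_derivative (?fv ((z + h *\<^sub>R w) + r *\<^sub>R v) - ?fv (z + r *\<^sub>R v))) (at r)"
      by (intro DERIV_diff D assms(1))
        (use inb[of r h] inb[of r 0] r assms(2) in \<open>auto simp: algebra_simps\<close>)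
  qed
  then obtain r where r: "0 < r" "r < h"
    "?g h - ?g 0 = h * (?fv ((z + h *\<^sub>R w) + r *\<^sub>R v) - ?fv (z + r *\<^sub>R v))" by auto
  let ?k = "\<lambda>q. ?fv ((z + r *\<^sub>R v) + q *\<^sub>R w)"
  have "\<exists>q. 0 < q \<and> q < h \<and> ?k h - ?k 0 = (h - 0) * frechet_derivative ?fv (at ((z + r *\<^sub>R v) + q *\<^sub>R w)) w"
    by (rule MVT2[OF assms(2)])
      (intro D smooth_on_frechet_derivative assms(1) inb, use r in auto)
  then obtain q where q: "0 < q" "q < h"
    "?k h - ?k 0 = h * frechet_derivative ?fv (at ((z + r *\<^sub>R v) + q *\<^sub>R w)) w" by auto
  have "?g h - ?g 0 = h * (?k h - ?k 0)" using r(3) by (simp add: algebra_simps)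
  also have "\<dots> = h * h * frechet_derivative ?fv (at ((z + r *\<^sub>R v) + q *\<^sub>R w)) w"
    by (simp only: q(3) mult.assoc)
  finally show ?thesis
    by (intro exI[of _ "z + r *\<^sub>R v + q *\<^sub>R w"] conjI dst) (use r q in \<open>auto simp: algebra_simps\<close>)
qed

text \<open>The mixed difference does not see the order of \<open>v\<close> and \<open>w\<close>, so
  the two second derivatives agree at two points \<open>y\<close> and \<open>y'\<close> close to
  \<open>z\<close>, and continuity brings both to \<open>z\<close>.\<close>

lemma second_derivative_symmetric:
  fixes f :: "'a::real_normed_vector \<Rightarrow> real"
  assumes "open U" "smooth_on U f" "z \<in> U"
  shows "frechet_derivative (\<lambda>x. frechet_derivative f (at x) v) (at z) w =
         frechet_derivative (\<lambda>x. frechet_derivative f (at x) w) (at z) v"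
proof -
  define a where "a y = frechet_derivative (\<lambda>x. frechet_derivative f (at x) v) (at y) w" for y
  define b where "b y = frechet_derivative (\<lambda>x. frechet_derivative f (at x) w) (at y) v" for y
  obtain d where d: "d > 0" "ball z d \<subseteq> U" using assms openE by blast
  have sf: "smooth_on (ball z d) f" using smooth_on_subset assms d by blast
  have "continuous_on (ball z d) a" "continuous_on (ball z d) b"
    unfolding a_def b_def by (intro smooth_on_imp_continuous_on smooth_on_frechet_derivative sf)+
  then have ab: "isCont a z" "isCont b z"
    using d(1) by (auto simp: continuous_on_eq_continuous_at[OF open_ball])
  have close: "\<bar>a z - b z\<bar> < e" if "e > 0" for e
  proof -
    have "e/2 > 0" using \<open>e > 0\<close> by simp
    with ab(1) obtain d1 where d1: "d1 > 0" "\<And>y. dist y z < d1 \<Longrightarrow> dist (a y) (a z) < e/2"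
      unfolding continuous_at_eps_delta dist_real_def by blast
    from ab(2) \<open>e/2 > 0\<close> obtain d2 where d2: "d2 > 0" "\<And>y. dist y z < d2 \<Longrightarrow> dist (b y) (b z) < e/2"
      unfolding continuous_at_eps_delta dist_real_def by blast
    note d12 = d1 d2
    define m where "m = Min {d, d1, d2}"
    have m: "0 < m" "m \<le> d" "m \<le> d1" "m \<le> d2" using d d12 by (auto simp: m_def)
    \<comment> \<open>The summand 1 keeps the denominator positive when \<open>v = w = 0\<close> and
      makes \<open>h * (norm v + norm w)\<close> strictly smaller than \<open>m\<close>.\<close>
    define h where "h = m / (norm v + norm w + 1)"
    have h: "0 < h" "h * (norm v + norm w) < m"
    proof -
      have p: "norm v + norm w + 1 > 0" by (simp add: add_nonneg_pos)
      then show "0 < h" using m by (simp add: h_def)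
      have "h * (norm v + norm w) < h * (norm v + norm w + 1)" using \<open>0 < h\<close> by (simp add: mult_strict_left_mono)
      also have "\<dots> = m" using p by (simp add: h_def)
      finally show "h * (norm v + norm w) < m" .
    qed
    obtain y where y: "dist y z \<le> h * (norm v + norm w)"
      "f (z + h *\<^sub>R v + h *\<^sub>R w) - f (z + h *\<^sub>R v) - f (z + h *\<^sub>R w) + f z = h * h * a y"
      using mixed_difference_quotient[OF sf h(1), of v w] h m unfolding a_def by auto
    obtain y' where y': "dist y' z \<le> h * (norm w + norm v)"
      "f (z + h *\<^sub>R w + h *\<^sub>R v) - f (z + h *\<^sub>R w) - f (z + h *\<^sub>R v) + f z = h * h * b y'"
      using mixed_difference_quotient[OF sf h(1), of w v] h m unfolding b_def by (auto simp: add.commute)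
    have "h * h * a y = h * h * b y'" using y(2) y'(2) by (simp add: algebra_simps)
    then have "a y = b y'" using h by simp
    moreover have "dist (a y) (a z) < e/2" "dist (b y') (b z) < e/2"
      using d12 y(1) y'(1) h m by (auto simp: add.commute)
    ultimately show ?thesis unfolding dist_real_def by arith
  qed
  have "a z = b z" using close[of "\<bar>a z - b z\<bar>"] by (cases "a z = b z") auto
  then show ?thesis by (simp add: a_def b_def)
qed

text \<open>The mean value theorem gives \<open>u x - u 0 = x * v t\<close> with \<open>t\<close> no
  farther from 0 than \<open>x\<close>, and near 0 the difference \<open>v t - v 0\<close> is at
  most \<open>K * |t|\<close>. The constant \<open>K\<close> is the size of the derivative of
  \<open>v\<close> at 0, increased by 1.\<close>

lemma smooth_first_order_expansion:
  fixes u :: "real \<Rightarrow> real"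
  assumes "smooth_on UNIV u"
  shows "(\<lambda>x. u x - u 0 - x * deriv u 0) \<in> O[at 0](\<lambda>x. x\<^sup>2)"
proof -
  define v where "v x = frechet_derivative u (at x) 1" for x
  have uv: "(u has_real_derivative v x) (at x)" for x
  proof -
    have u: "(u has_derivative frechet_derivative u (at x)) (at x)"
      using smooth_on_imp_has_derivative[OF assms] by simp
    have "frechet_derivative u (at x) h = v x * h" for h
      using linear_scale[OF has_derivative_linear[OF u], of h 1] by (simp add: v_def)
    then have "frechet_derivative u (at x) = (*) (v x)" by auto
    then show ?thesis using u unfolding has_field_derivative_def by simp
  qed
  have d0: "deriv u 0 = v 0" using uv DERIV_imp_deriv by blast
  have "smooth_on UNIV v" unfolding v_def by (rule smooth_on_frechet_derivative[OF assms])
  then have "(v has_derivative frechet_derivative v (at 0)) (at 0)"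
    using smooth_on_imp_has_derivative by blast
  then obtain K where K: "eventually (\<lambda>x. norm (v x - v 0) \<le> K * norm (x - 0)) (at 0)"
  proof -
    have "(v has_real_derivative frechet_derivative v (at 0) 1) (at 0)"
      using \<open>(v has_derivative frechet_derivative v (at 0)) (at 0)\<close>
      by (rule has_derivative_imp_has_field_derivative)
        (metis linear_scale[OF has_derivative_linear[OF \<open>(v has_derivative _) _\<close>]] mult.right_neutral mult.commute real_scaleR_def)
    then have "((\<lambda>x. (v x - v 0) / (x - 0)) \<longlongrightarrow> frechet_derivative v (at 0) 1) (at 0)"
      by (simp add: has_field_derivative_iff)
    then have "eventually (\<lambda>x. dist ((v x - v 0) / (x - 0)) (frechet_derivative v (at 0) 1) < 1) (at 0)"
      by (rule tendstoD) simp
    moreover have "eventually (\<lambda>x. x \<noteq> 0) (at (0::real))" by (simp add: eventually_at_filter)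
    ultimately have "eventually (\<lambda>x. norm (v x - v 0) \<le> (\<bar>frechet_derivative v (at 0) 1\<bar> + 1) * norm (x - 0)) (at 0)"
    proof (eventually_elim)
      case (elim x)
      then have "\<bar>(v x - v 0) / x\<bar> \<le> \<bar>frechet_derivative v (at 0) 1\<bar> + 1" by (simp add: dist_real_def)
      moreover have "x \<noteq> 0" using elim by auto
      ultimately show ?case by (simp add: abs_divide divide_le_eq)
    qed
    then show ?thesis using that by blast
  qed
  then obtain d where d: "d > 0" "\<And>x. x \<noteq> 0 \<Longrightarrow> dist x 0 < d \<Longrightarrow> \<bar>v x - v 0\<bar> \<le> K * \<bar>x\<bar>"
    unfolding eventually_at by auto
  have main: "\<bar>u x - u 0 - x * v 0\<bar> \<le> \<bar>K\<bar> * x\<^sup>2" if x: "x \<noteq> 0" "\<bar>x\<bar> < d" for x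
  proof -
    have "\<exists>t. \<bar>t\<bar> \<le> \<bar>x\<bar> \<and> u x - u 0 = x * v t"
    proof (cases "x > 0")
      case True
      with MVT2[of 0 x u v] uv show ?thesis by (metis abs_of_pos diff_zero less_eq_real_def)
    next
      case False
      then have "x < 0" using x by simp
      with MVT2[of x 0 u v] uv obtain t where "x < t" "t < 0" "u 0 - u x = (0 - x) * v t" by auto
      then show ?thesis by (intro exI[of _ t]) (auto simp: algebra_simps)
    qed
    then obtain t where t: "\<bar>t\<bar> \<le> \<bar>x\<bar>" "u x - u 0 = x * v t" by blast
    have "\<bar>v t - v 0\<bar> \<le> \<bar>K\<bar> * \<bar>t\<bar>"
    proof (cases "t = 0")
      case False
      then have "\<bar>v t - v 0\<bar> \<le> K * \<bar>t\<bar>" using d(2)[of t] t x by (simp add: dist_real_def)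
      also have "\<dots> \<le> \<bar>K\<bar> * \<bar>t\<bar>" by (intro mult_right_mono) auto
      finally show ?thesis .
    qed simp
    also have "\<dots> \<le> \<bar>K\<bar> * \<bar>x\<bar>" using t by (intro mult_left_mono) auto
    finally have "\<bar>x\<bar> * \<bar>v t - v 0\<bar> \<le> \<bar>x\<bar> * (\<bar>K\<bar> * \<bar>x\<bar>)" by (intro mult_left_mono) auto
    moreover have "u x - u 0 - x * v 0 = x * (v t - v 0)" using t(2) by (simp add: algebra_simps)
    then have "\<bar>u x - u 0 - x * v 0\<bar> = \<bar>x\<bar> * \<bar>v t - v 0\<bar>" by (simp only: abs_mult)
    ultimately show ?thesis by (simp add: power2_eq_square mult.left_commute)
  qed
  show ?thesis
    unfolding d0
    by (rule bigoI[of _ "\<bar>K\<bar>"]) (use main d(1) in \<open>auto simp: eventually_at dist_real_def intro!: exI[of _ d]\<close>)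
qed

section \<open>Local geometry of smooth manifolds\<close>

text \<open>The part of \<open>smooth_manifold\<close> that concerns charts. Leaving out the
  topological axioms lets a total space qualify through its charts alone; where separation is
  needed, it is assumed separately.\<close>

definition smooth_atlas :: "('p, 'a::real_inner) atlas \<Rightarrow> bool" where
  "smooth_atlas A \<longleftrightarrow>
     finite_dim TYPE('a) \<and>
     (\<forall>(U, \<phi>)\<in>A. inj_on \<phi> U \<and> open (\<phi> ` U)) \<and>
     (\<forall>(U, \<phi>)\<in>A. \<forall>(V, \<psi>)\<in>A.
        open (\<phi> ` (U \<inter> V)) \<and> smooth_on (\<phi> ` (U \<inter> V)) (\<psi> \<circ> inv_into U \<phi>))"

definition mopen :: "('p, 'a::real_inner) atlas \<Rightarrow> 'p set \<Rightarrow> bool" where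
  "mopen A W \<longleftrightarrow> W \<subseteq> points A \<and> (\<forall>(U, \<phi>)\<in>A. open (\<phi> ` (U \<inter> W)))"

text \<open>Smoothness around a point, tested in one chart; compatibility of charts makes the choice
  immaterial (\<open>smooth_near_chart\<close>). Gluing by cutoffs is done with this local notion,
  and \<open>smooth_fun_on_iff\<close> returns to the global one.\<close>

definition smooth_near ::
    "('p, 'a::real_inner) atlas \<Rightarrow> ('p \<Rightarrow> 'b::real_normed_vector) \<Rightarrow> 'p \<Rightarrow> bool" where
  "smooth_near A f p \<longleftrightarrow>
     (\<exists>(U, \<phi>)\<in>A. p \<in> U \<and>
        (\<exists>Q. open Q \<and> Q \<subseteq> \<phi> ` U \<and> \<phi> p \<in> Q \<and> smooth_on Q (f \<circ> inv_into U \<phi>)))"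

definition chart_derivative ::
    "'p set \<Rightarrow> ('p \<Rightarrow> 'a::real_normed_vector) \<Rightarrow> ('p \<Rightarrow> 'b::real_normed_vector) \<Rightarrow> 'p \<Rightarrow> 'a \<Rightarrow> 'b" where
  "chart_derivative U \<phi> f p = frechet_derivative (f \<circ> inv_into U \<phi>) (at (\<phi> p))"

text \<open>The support condition is phrased as an open cover: each point of the manifold off
  \<open>W\<close> has a neighborhood, \<open>W0\<close>, on which \<open>\<theta>\<close> is
  identically zero. Hence \<open>\<theta>\<close> times a function smooth on \<open>W\<close> is
  smooth everywhere, whatever its values off \<open>W\<close>.\<close>

definition cutoff :: "('p, 'a::real_inner) atlas \<Rightarrow> 'p set \<Rightarrow> ('p \<Rightarrow> real) \<Rightarrow> bool" where
  "cutoff A W \<theta> \<longleftrightarrow> \<theta> \<in> Cinf A \<and>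
     (\<exists>W0. mopen A W0 \<and> points A \<subseteq> W \<union> W0 \<and> (\<forall>q\<in>W0. \<theta> q = 0))"

locale atlas =
  fixes A :: "('p, 'a::real_inner) atlas"
  assumes smooth_atlas: "smooth_atlas A"
begin

lemma fin_dim: "finite_dim TYPE('a)"
  using smooth_atlas by (simp add: smooth_atlas_def)

lemma chart_inj: "(U, \<phi>) \<in> A \<Longrightarrow> inj_on \<phi> U"
  and chart_open: "(U, \<phi>) \<in> A \<Longrightarrow> open (\<phi> ` U)"
  and chart_Int_open: "(U, \<phi>) \<in> A \<Longrightarrow> (V, \<psi>) \<in> A \<Longrightarrow> open (\<phi> ` (U \<inter> V))"
  and transition_smooth:
    "(U, \<phi>) \<in> A \<Longrightarrow> (V, \<psi>) \<in> A \<Longrightarrow> smooth_on (\<phi> ` (U \<inter> V)) (\<psi> \<circ> inv_into U \<phi>)"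
  using smooth_atlas unfolding smooth_atlas_def by blast+

lemma chart_inverse [simp]: "(U, \<phi>) \<in> A \<Longrightarrow> p \<in> U \<Longrightarrow> inv_into U \<phi> (\<phi> p) = p"
  using chart_inj by (simp add: inv_into_f_f)

lemma chart_subset_points: "(U, \<phi>) \<in> A \<Longrightarrow> U \<subseteq> points A"
  by (auto simp: points_def)

lemma chart_at:
  assumes "p \<in> points A"
  obtains U \<phi> where "(U, \<phi>) \<in> A" "p \<in> U"
  using assms by (auto simp: points_def)

lemma mopenD: "mopen A W \<Longrightarrow> (U, \<phi>) \<in> A \<Longrightarrow> open (\<phi> ` (U \<inter> W))"
  and mopen_subset: "mopen A W \<Longrightarrow> W \<subseteq> points A"
  by (auto simp: mopen_def)

lemma chart_at_mopen:
  assumes "mopen A W" "p \<in> W"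
  obtains U \<phi> where "(U, \<phi>) \<in> A" "p \<in> U"
  using chart_at assms mopen_subset by blast

lemma mopen_chart: "(U, \<phi>) \<in> A \<Longrightarrow> mopen A U"
  unfolding mopen_def using chart_Int_open chart_subset_points by blast

lemma mopen_Int: "mopen A V \<Longrightarrow> mopen A W \<Longrightarrow> mopen A (V \<inter> W)"
proof -
  assume *: "mopen A V" "mopen A W"
  have "open (\<phi> ` (U \<inter> (V \<inter> W)))" if "(U, \<phi>) \<in> A" for U \<phi>
  proof -
    have "\<phi> ` (U \<inter> (V \<inter> W)) = \<phi> ` ((U \<inter> V) \<inter> (U \<inter> W))" by (rule arg_cong[of _ _ "image \<phi>"]) auto
    also have "\<dots> = \<phi> ` (U \<inter> V) \<inter> \<phi> ` (U \<inter> W)"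
      by (rule inj_on_image_Int[OF chart_inj[OF that]]) auto
    finally show ?thesis using * that by (auto simp: mopen_def)
  qed
  then show ?thesis using * by (auto simp: mopen_def)
qed

lemma mopen_Union:
  assumes "\<And>W. W \<in> K \<Longrightarrow> mopen A W"
  shows "mopen A (\<Union>K)"
proof -
  have "open (\<phi> ` (U \<inter> \<Union>K))" if "(U, \<phi>) \<in> A" for U \<phi>
  proof -
    have "\<phi> ` (U \<inter> \<Union>K) = (\<Union>W\<in>K. \<phi> ` (U \<inter> W))" by auto
    then show ?thesis using mopenD[OF assms that] by (auto intro!: open_UN)
  qed
  then show ?thesis using assms by (fastforce simp: mopen_def)
qed

lemma mopen_points: "mopen A (points A)"
  using mopen_Union[of "fst ` A"] mopen_chart by (fastforce simp: points_def case_prod_beta)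

lemma openin_manifold_topology: "openin (manifold_topology A) W \<longleftrightarrow> mopen A W"
proof -
  have "istopology (mopen A)"
    unfolding istopology_def using mopen_Int mopen_Union by blast
  then show ?thesis
    unfolding manifold_topology_def by (simp add: topology_inverse' mopen_def[abs_def])
qed

lemma topspace_manifold_topology: "topspace (manifold_topology A) = points A"
  unfolding topspace_def openin_manifold_topology
  using mopen_points by (auto simp: mopen_def)

lemma smooth_near_chart:
  assumes "smooth_near A f p" "(V, \<psi>) \<in> A" "p \<in> V"
  obtains Q where "open Q" "Q \<subseteq> \<psi> ` V" "\<psi> p \<in> Q" "smooth_on Q (f \<circ> inv_into V \<psi>)"
proof -
  from assms(1) obtain U \<phi> Q where U: "(U, \<phi>) \<in> A" "p \<in> U" and
    Q: "open Q" "Q \<subseteq> \<phi> ` U" "\<phi> p \<in> Q" "smooth_on Q (f \<circ> inv_into U \<phi>)"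
    unfolding smooth_near_def by blast
  let ?T = "\<phi> \<circ> inv_into V \<psi>"
  have T: "smooth_on (\<psi> ` (V \<inter> U)) ?T" using transition_smooth assms(2) U(1) by blast
  define R where "R = \<psi> ` (V \<inter> U) \<inter> ?T -` Q"
  have oR: "open R" unfolding R_def
    using continuous_open_preimage[OF smooth_on_imp_continuous_on[OF T] chart_Int_open Q(1)]
      assms(2) U(1) by blast
  have "smooth_on R (\<lambda>z. (f \<circ> inv_into U \<phi>) (?T z))"
    by (rule smooth_on_compose[OF fin_dim oR Q(1) _ smooth_on_subset[OF T] Q(4)]) (auto simp: R_def)
  moreover have "(f \<circ> inv_into U \<phi>) (?T z) = (f \<circ> inv_into V \<psi>) z" if "z \<in> R" for z
    using that assms(2) U(1) by (auto simp: R_def)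
  ultimately have "smooth_on R (f \<circ> inv_into V \<psi>)" using smooth_on_cong[OF oR] by metis
  with that[OF oR] show ?thesis using assms U Q(3) by (auto simp: R_def)
qed

lemma smooth_nearI:
  "(U, \<phi>) \<in> A \<Longrightarrow> p \<in> U \<Longrightarrow> open Q \<Longrightarrow> \<phi> p \<in> Q \<Longrightarrow> smooth_on Q (f \<circ> inv_into U \<phi>) \<Longrightarrow> smooth_near A f p"
  unfolding smooth_near_def
  using chart_open by (fastforce intro!: bexI[of _ "(U, \<phi>)"] exI[of _ "Q \<inter> \<phi> ` U"] elim: smooth_on_subset)

lemma smooth_near_imp_points: "smooth_near A f p \<Longrightarrow> p \<in> points A"
  by (auto simp: smooth_near_def points_def)

lemma smooth_fun_on_iff:
  assumes "mopen A W"
  shows "smooth_fun_on A W f \<longleftrightarrow> (\<forall>p\<in>W. smooth_near A f p)"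
proof
  assume f: "smooth_fun_on A W f"
  show "\<forall>p\<in>W. smooth_near A f p"
  proof
    fix p assume p: "p \<in> W"
    then obtain U \<phi> where U: "(U, \<phi>) \<in> A" "p \<in> U" by (rule chart_at_mopen[OF assms])
    show "smooth_near A f p"
      by (rule smooth_nearI[OF U, of "\<phi> ` (U \<inter> W)"])
        (use f U p assms in \<open>auto simp: smooth_fun_on_def mopen_def\<close>)
  qed
next
  assume f: "\<forall>p\<in>W. smooth_near A f p"
  have "smooth_on (\<phi> ` (U \<inter> W)) (f \<circ> inv_into U \<phi>)" if U: "(U, \<phi>) \<in> A" for U \<phi>
  proof (rule smooth_on_local)
    fix z assume "z \<in> \<phi> ` (U \<inter> W)"
    then obtain p where p: "z = \<phi> p" "p \<in> U" "p \<in> W" by blast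
    then show "\<exists>V. open V \<and> z \<in> V \<and> smooth_on V (f \<circ> inv_into U \<phi>)"
      using smooth_near_chart[OF _ U, of f p] f by metis
  qed
  then show "smooth_fun_on A W f" by (auto simp: smooth_fun_on_def)
qed

lemma smooth_near_cong:
  assumes "smooth_near A f p" "mopen A W" "p \<in> W" "\<And>q. q \<in> W \<Longrightarrow> f q = g q"
  shows "smooth_near A g p"
proof -
  obtain U \<phi> where U: "(U, \<phi>) \<in> A" "p \<in> U" by (rule chart_at_mopen[OF assms(2,3)])
  obtain Q where Q: "open Q" "Q \<subseteq> \<phi> ` U" "\<phi> p \<in> Q" "smooth_on Q (f \<circ> inv_into U \<phi>)"
    by (rule smooth_near_chart[OF assms(1) U])
  define R where "R = Q \<inter> \<phi> ` (U \<inter> W)"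
  have oR: "open R" using Q(1) assms(2) U(1) by (auto simp: R_def mopen_def)
  have "(f \<circ> inv_into U \<phi>) z = (g \<circ> inv_into U \<phi>) z" if "z \<in> R" for z
    using that U assms(4) by (auto simp: R_def)
  moreover have "smooth_on R (f \<circ> inv_into U \<phi>)"
    using smooth_on_subset[OF Q(4)] by (auto simp: R_def)
  ultimately have "smooth_on R (g \<circ> inv_into U \<phi>)" using smooth_on_cong[OF oR] by metis
  then show ?thesis using smooth_nearI[OF U oR] Q(3) U(2) assms(3) by (auto simp: R_def)
qed

lemma smooth_near_const: "p \<in> points A \<Longrightarrow> smooth_near A (\<lambda>_. c) p"
  using smooth_nearI[OF _ _ open_UNIV] by (metis UNIV_I chart_at comp_def smooth_on_const smooth_on_cong open_UNIV)

lemma smooth_near_local_chart: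
  assumes "(U, \<phi>) \<in> A" "p \<in> U"
  shows "smooth_near A \<phi> p"
proof (rule smooth_nearI[OF assms chart_open])
  have "smooth_on (\<phi> ` U) (\<lambda>z. z)" by (rule smooth_on_linear[OF bounded_linear_ident])
  moreover have "(\<phi> \<circ> inv_into U \<phi>) z = z" if "z \<in> \<phi> ` U" for z
    using that by (simp add: f_inv_into_f)
  ultimately show "smooth_on (\<phi> ` U) (\<phi> \<circ> inv_into U \<phi>)"
    using smooth_on_cong[OF chart_open[OF assms(1)]] by metis
qed (use assms in auto)

lemma smooth_near_binary:
  assumes "smooth_near A f p" "smooth_near A g p"
    and op: "\<And>Q (f' :: 'a \<Rightarrow> 'b::real_normed_vector) (g' :: 'a \<Rightarrow> 'c::real_normed_vector).
      open Q \<Longrightarrow> smooth_on Q f' \<Longrightarrow> smooth_on Q g' \<Longrightarrow> smooth_on Q (\<lambda>z. h (f' z) (g' z))"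
  shows "smooth_near A (\<lambda>q. h (f q) (g q) :: 'd::real_normed_vector) p"
proof -
  obtain U \<phi> where U: "(U, \<phi>) \<in> A" "p \<in> U" using assms(1) smooth_near_imp_points chart_at by blast
  obtain Q where Q: "open Q" "Q \<subseteq> \<phi> ` U" "\<phi> p \<in> Q" "smooth_on Q (f \<circ> inv_into U \<phi>)"
    by (rule smooth_near_chart[OF assms(1) U])
  obtain R where R: "open R" "R \<subseteq> \<phi> ` U" "\<phi> p \<in> R" "smooth_on R (g \<circ> inv_into U \<phi>)"
    by (rule smooth_near_chart[OF assms(2) U])
  have "smooth_on (Q \<inter> R) (\<lambda>z. h ((f \<circ> inv_into U \<phi>) z) ((g \<circ> inv_into U \<phi>) z))"
    by (intro op open_Int Q(1) R(1) smooth_on_subset[OF Q(4)] smooth_on_subset[OF R(4)]) auto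
  then show ?thesis
    by (intro smooth_nearI[OF U open_Int[OF Q(1) R(1)]]) (use Q R in \<open>auto simp: comp_def\<close>)
qed

lemma smooth_near_add: "smooth_near A f p \<Longrightarrow> smooth_near A g p \<Longrightarrow> smooth_near A (\<lambda>q. f q + g q) p"
  by (rule smooth_near_binary) (auto intro: smooth_on_add)

lemma smooth_near_diff: "smooth_near A f p \<Longrightarrow> smooth_near A g p \<Longrightarrow> smooth_near A (\<lambda>q. f q - g q) p"
  by (rule smooth_near_binary) (auto intro: smooth_on_diff)

lemma smooth_near_mult:
  fixes f g :: "'p \<Rightarrow> real"
  shows "smooth_near A f p \<Longrightarrow> smooth_near A g p \<Longrightarrow> smooth_near A (\<lambda>q. f q * g q) p"
  by (rule smooth_near_binary) (auto intro: smooth_on_mult)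

lemma smooth_near_scaleR:
  "smooth_near A f p \<Longrightarrow> smooth_near A g p \<Longrightarrow> smooth_near A (\<lambda>q. f q *\<^sub>R g q) p"
  by (rule smooth_near_binary) (auto intro: smooth_on_scaleR)

lemma smooth_near_Pair:
  "smooth_near A f p \<Longrightarrow> smooth_near A g p \<Longrightarrow> smooth_near A (\<lambda>q. (f q, g q)) p"
  by (rule smooth_near_binary) (auto intro: smooth_on_Pair)

lemma smooth_near_sum:
  "p \<in> points A \<Longrightarrow> (\<And>b. b \<in> B \<Longrightarrow> smooth_near A (f b) p) \<Longrightarrow> smooth_near A (\<lambda>q. \<Sum>b\<in>B. f b q) p"
  by (induction B rule: infinite_finite_induct) (auto intro: smooth_near_const smooth_near_add)

lemma smooth_near_linear:
  assumes "bounded_linear g" "smooth_near A f p"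
  shows "smooth_near A (\<lambda>q. g (f q)) p"
  by (rule smooth_near_binary[OF assms(2,2), where h = "\<lambda>a b. g a"])
    (auto intro: smooth_on_linear_compose[OF assms(1)])

lemma smooth_near_compose:
  fixes f :: "'p \<Rightarrow> 'b::real_inner"
  assumes "finite_dim TYPE('b)" "smooth_near A f p" "open V" "f p \<in> V" "smooth_on V g"
  shows "smooth_near A (\<lambda>q. g (f q)) p"
proof -
  obtain U \<phi> where U: "(U, \<phi>) \<in> A" "p \<in> U" using assms(2) smooth_near_imp_points chart_at by blast
  obtain Q where Q: "open Q" "Q \<subseteq> \<phi> ` U" "\<phi> p \<in> Q" "smooth_on Q (f \<circ> inv_into U \<phi>)"
    by (rule smooth_near_chart[OF assms(2) U])
  define R where "R = Q \<inter> (f \<circ> inv_into U \<phi>) -` V"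
  have oR: "open R" unfolding R_def
    using continuous_open_preimage[OF smooth_on_imp_continuous_on[OF Q(4)] Q(1) assms(3)] .
  have "smooth_on R (\<lambda>z. g ((f \<circ> inv_into U \<phi>) z))"
    by (rule smooth_on_compose[OF assms(1) oR assms(3) _ smooth_on_subset[OF Q(4)] assms(5)])
      (auto simp: R_def)
  then show ?thesis
    by (intro smooth_nearI[OF U oR]) (use Q U assms(4) in \<open>auto simp: comp_def R_def\<close>)
qed

lemma smooth_near_divide:
  fixes f g :: "'p \<Rightarrow> real"
  assumes "smooth_near A f p" "smooth_near A g p" "g p \<noteq> 0"
  shows "smooth_near A (\<lambda>q. f q / g q) p"
  unfolding divide_inverse
  by (intro smooth_near_mult assms(1) smooth_near_compose[OF finite_dim_real assms(2) _ _ smooth_on_inverse_real])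
    (use assms(3) in auto)

lemma mopen_preimage:
  assumes "mopen A W" "\<And>p. p \<in> W \<Longrightarrow> smooth_near A f p" "open V"
  shows "mopen A {p \<in> W. f p \<in> V}"
proof -
  have "open (\<phi> ` (U \<inter> {p \<in> W. f p \<in> V}))" if U: "(U, \<phi>) \<in> A" for U \<phi>
  proof -
    have "smooth_on (\<phi> ` (U \<inter> W)) (f \<circ> inv_into U \<phi>)"
      using assms(2) smooth_fun_on_iff[OF assms(1), of f] U by (auto simp: smooth_fun_on_def)
    then have "open (\<phi> ` (U \<inter> W) \<inter> (f \<circ> inv_into U \<phi>) -` V)"
      by (intro continuous_open_preimage smooth_on_imp_continuous_on mopenD assms(1,3) U)
    moreover have "\<phi> ` (U \<inter> W) \<inter> (f \<circ> inv_into U \<phi>) -` V = \<phi> ` (U \<inter> {p \<in> W. f p \<in> V})"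
      using U by auto
    ultimately show ?thesis by simp
  qed
  then show ?thesis using assms(1) by (auto simp: mopen_def)
qed

lemma Cinf_iff:
  "f \<in> Cinf A \<longleftrightarrow> (\<forall>p\<in>points A. smooth_near A f p) \<and> (\<forall>p. p \<notin> points A \<longrightarrow> f p = 0)"
  by (simp add: Cinf_def smooth_fun_on_iff[OF mopen_points])

lemma Cinf_smooth_near: "f \<in> Cinf A \<Longrightarrow> p \<in> points A \<Longrightarrow> smooth_near A f p"
  by (simp add: Cinf_iff)

lemma Cinf_add: "f \<in> Cinf A \<Longrightarrow> g \<in> Cinf A \<Longrightarrow> (\<lambda>q. f q + g q) \<in> Cinf A"
  by (simp add: Cinf_iff smooth_near_add)

lemma Cinf_diff: "f \<in> Cinf A \<Longrightarrow> g \<in> Cinf A \<Longrightarrow> (\<lambda>q. f q - g q) \<in> Cinf A"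
  by (simp add: Cinf_iff smooth_near_diff)

lemma Cinf_mult: "f \<in> Cinf A \<Longrightarrow> g \<in> Cinf A \<Longrightarrow> (\<lambda>q. f q * g q) \<in> Cinf A"
  by (simp add: Cinf_iff smooth_near_mult)

lemma Cinf_scale: "f \<in> Cinf A \<Longrightarrow> (\<lambda>q. c * f q) \<in> Cinf A"
  by (auto simp: Cinf_iff intro!: smooth_near_mult smooth_near_const)

lemma Cinf_const: "restrict_to (points A) (\<lambda>_. c) \<in> Cinf A"
  unfolding Cinf_iff
proof (intro conjI ballI allI impI)
  fix p assume "p \<in> points A"
  then show "smooth_near A (restrict_to (points A) (\<lambda>_. c)) p"
    by (intro smooth_near_cong[OF smooth_near_const mopen_points]) (auto simp: restrict_to_def)
qed (auto simp: restrict_to_def)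

lemma Cinf_zero: "(\<lambda>_. 0) \<in> Cinf A"
  by (auto simp: Cinf_iff intro: smooth_near_const)

lemma Cinf_chart:
  assumes "f \<in> Cinf A" "(U, \<phi>) \<in> A"
  shows "smooth_on (\<phi> ` U) (f \<circ> inv_into U \<phi>)"
proof -
  have "U \<inter> points A = U" using chart_subset_points assms(2) by blast
  with assms show ?thesis by (fastforce simp: Cinf_def smooth_fun_on_def)
qed

section \<open>Cutoff functions\<close>

lemma cutoff_smooth_near:
  assumes "cutoff A W \<theta>" "p \<in> points A" "p \<in> W \<Longrightarrow> smooth_near A f p"
  shows "smooth_near A (\<lambda>q. \<theta> q *\<^sub>R f q) p"
proof (cases "p \<in> W")
  case True
  then show ?thesis
    using assms Cinf_smooth_near smooth_near_scaleR unfolding cutoff_def by blast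
next
  case False
  with assms(1,2) obtain W0 where W0: "mopen A W0" "p \<in> W0" "\<forall>q\<in>W0. \<theta> q = 0"
    unfolding cutoff_def by blast
  then show ?thesis
    by (intro smooth_near_cong[OF smooth_near_const[OF assms(2), of 0] W0(1,2)]) auto
qed

lemma cutoff_zero: "cutoff A W \<theta> \<Longrightarrow> p \<notin> W \<Longrightarrow> \<theta> p = 0"
  unfolding cutoff_def Cinf_def by blast

lemma cutoff_Cinf:
  assumes "cutoff A W \<theta>" "\<And>p. p \<in> W \<Longrightarrow> smooth_near A f p"
  shows "(\<lambda>q. \<theta> q * f q) \<in> Cinf A"
proof -
  have "\<theta> p = 0" if "p \<notin> points A" for p
    using assms(1) that by (auto simp: cutoff_def Cinf_def)
  then show ?thesis
    using cutoff_smooth_near[OF assms(1) _ assms(2)] by (auto simp: Cinf_iff)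
qed

text \<open>A compact subset of a Hausdorff space is closed. On a non-Hausdorff manifold a bump
  function extended by zero from a chart need not even be continuous.\<close>

lemma closedin_chart_cball:
  assumes "Hausdorff_space (manifold_topology A)" "(U, \<phi>) \<in> A" "cball z r \<subseteq> \<phi> ` U"
  shows "mopen A (points A - inv_into U \<phi> ` cball z r)"
proof -
  let ?T = "top_of_set (\<phi> ` U)"
  have "continuous_map ?T (manifold_topology A) (inv_into U \<phi>)"
    unfolding continuous_map_def
  proof (intro conjI allI impI)
    show "inv_into U \<phi> \<in> topspace ?T \<rightarrow> topspace (manifold_topology A)"
      using chart_subset_points[OF assms(2)] assms(2) topspace_manifold_topology by auto
    fix W assume "openin (manifold_topology A) W"
    then have "mopen A W" by (simp add: openin_manifold_topology)
    then have "open (\<phi> ` (U \<inter> W))" using assms(2) by (auto simp: mopen_def)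
    moreover have "{x \<in> topspace ?T. inv_into U \<phi> x \<in> W} = \<phi> ` (U \<inter> W)"
      using assms(2) by auto
    ultimately show "openin ?T {x \<in> topspace ?T. inv_into U \<phi> x \<in> W}"
      by (auto simp: openin_open_eq[OF chart_open[OF assms(2)]])
  qed
  moreover have "compactin ?T (cball z r)"
    using assms(3) finite_dim_compact_cball[OF fin_dim] by (simp add: compactin_subtopology)
  ultimately have "compactin (manifold_topology A) (inv_into U \<phi> ` cball z r)"
    by (rule image_compactin[rotated])
  then have "closedin (manifold_topology A) (inv_into U \<phi> ` cball z r)"
    using assms(1) compactin_imp_closedin by blast
  then show ?thesis
    by (simp add: closedin_def openin_manifold_topology topspace_manifold_topology)
qed

lemma cutoff_exists:
  assumes "Hausdorff_space (manifold_topology A)" "mopen A W" "p \<in> W"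
  obtains \<theta> W' where "cutoff A W \<theta>" "mopen A W'" "p \<in> W'" "W' \<subseteq> W" "\<forall>q\<in>W'. \<theta> q = 1"
proof -
  obtain U \<phi> where U: "(U, \<phi>) \<in> A" "p \<in> U" by (rule chart_at_mopen[OF assms(2,3)])
  have "open (\<phi> ` (U \<inter> W))" "\<phi> p \<in> \<phi> ` (U \<inter> W)" using assms U by (auto simp: mopen_def)
  then obtain d where d: "d > 0" "cball (\<phi> p) d \<subseteq> \<phi> ` (U \<inter> W)"
    using open_contains_cball by blast
  have "0 < d / 2" "d / 2 < d" using d by auto
  then obtain \<rho> :: "'a \<Rightarrow> real" where \<rho>: "smooth_on UNIV \<rho>" "\<And>x. dist x (\<phi> p) < d / 2 \<Longrightarrow> \<rho> x = 1"
    "\<And>x. dist x (\<phi> p) \<ge> d \<Longrightarrow> \<rho> x = 0"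
    by (rule smooth_bump[OF fin_dim, where z = "\<phi> p"]) (rule that)
  define \<theta> where "\<theta> q = (if q \<in> U then \<rho> (\<phi> q) else 0)" for q
  \<comment> \<open>The complement of the closed ball in the whole manifold. It is open, the bump
    function vanishes on it, and what it leaves out lies in \<open>U \<inter> W\<close>; so it
    serves both for smoothness of the extension by zero and for the cover in
    \<open>cutoff\<close>.\<close>
  define W0 where "W0 = points A - inv_into U \<phi> ` cball (\<phi> p) d"
  have W0: "mopen A W0" unfolding W0_def
    by (rule closedin_chart_cball[OF assms(1) U(1)]) (use d in auto)
  have inv: "inv_into U \<phi> ` cball (\<phi> p) d \<subseteq> U \<inter> W"
  proof
    fix q assume "q \<in> inv_into U \<phi> ` cball (\<phi> p) d"
    then show "q \<in> U \<inter> W" using d(2) U(1) by auto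
  qed
  have zero: "\<theta> q = 0" if "q \<in> W0" for q
  proof (cases "q \<in> U")
    case True
    have "\<phi> q \<notin> cball (\<phi> p) d"
    proof
      assume "\<phi> q \<in> cball (\<phi> p) d"
      then have "inv_into U \<phi> (\<phi> q) \<in> inv_into U \<phi> ` cball (\<phi> p) d" by blast
      then show False using that U True by (simp add: W0_def)
    qed
    then show ?thesis using \<rho>(3) by (simp add: \<theta>_def dist_commute)
  qed (simp add: \<theta>_def)
  have near: "smooth_near A \<theta> q" if "q \<in> points A" for q
  proof (cases "q \<in> W0")
    case True
    then show ?thesis
      by (intro smooth_near_cong[OF smooth_near_const[OF that, of 0] W0]) (auto simp: zero)
  next
    case False
    then have q: "q \<in> U" using inv that by (auto simp: W0_def)
    have "smooth_near A (\<lambda>q. \<rho> (\<phi> q)) q"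
      by (rule smooth_near_compose[OF fin_dim smooth_near_local_chart[OF U(1) q] open_UNIV _ \<rho>(1)]) simp
    then show ?thesis
      by (rule smooth_near_cong[OF _ mopen_chart[OF U(1)] q]) (simp add: \<theta>_def)
  qed
  have "\<theta> \<in> Cinf A" unfolding Cinf_iff
    using near chart_subset_points[OF U(1)] by (auto simp: \<theta>_def)
  moreover have "points A \<subseteq> W \<union> W0" using inv by (auto simp: W0_def)
  ultimately have "cutoff A W \<theta>" unfolding cutoff_def using W0 zero by blast
  moreover define W' where "W' = {q \<in> U \<inter> W. \<phi> q \<in> ball (\<phi> p) (d / 2)}"
  moreover have "mopen A W'" unfolding W'_def
    by (rule mopen_preimage) (use U assms mopen_chart mopen_Int smooth_near_local_chart in auto)
  moreover have "p \<in> W'" using U assms d by (auto simp: W'_def)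
  moreover have "\<theta> q = 1" if "q \<in> W'" for q
    using that \<rho>(2)[of "\<phi> q"] by (auto simp: W'_def \<theta>_def dist_commute)
  ultimately show ?thesis using that[of \<theta> W'] by (auto simp: W'_def)
qed

section \<open>Tangent vectors\<close>

lemma tangent_spaceI:
  assumes "(U, \<phi>) \<in> A" "p \<in> U"
  shows "(\<lambda>f. if f \<in> Cinf A then chart_derivative U \<phi> f p v else 0) \<in> tangent_space A p"
  unfolding tangent_space_def chart_derivative_def using assms by blast

lemma Cinf_chart_has_derivative:
  assumes "f \<in> Cinf A" "(U, \<phi>) \<in> A" "p \<in> U"
  shows "(f \<circ> inv_into U \<phi> has_derivative chart_derivative U \<phi> f p) (at (\<phi> p))"
  unfolding chart_derivative_def
  by (rule smooth_on_imp_has_derivative[OF Cinf_chart[OF assms(1,2)]]) (use assms in auto)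

text \<open>A tangent vector is given through some chart; the differential of the transition map
  carries its direction to any other chart at the point, by the chain rule.\<close>

lemma tangent_space_chart:
  assumes "D \<in> tangent_space A p" "(V, \<psi>) \<in> A" "p \<in> V"
  obtains v where "\<And>f. f \<in> Cinf A \<Longrightarrow> D f = chart_derivative V \<psi> f p v"
proof -
  from assms(1) obtain U \<phi> u where U: "(U, \<phi>) \<in> A" "p \<in> U"
    and D: "D = (\<lambda>f. if f \<in> Cinf A then frechet_derivative (f \<circ> inv_into U \<phi>) (at (\<phi> p)) u else 0)"
    unfolding tangent_space_def by blast
  let ?T = "\<psi> \<circ> inv_into U \<phi>"
  have p: "\<phi> p \<in> \<phi> ` (U \<inter> V)" using U assms by auto
  have T: "(?T has_derivative frechet_derivative ?T (at (\<phi> p))) (at (\<phi> p))"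
    by (rule smooth_on_imp_has_derivative[OF transition_smooth[OF U(1) assms(2)] p])
  have "D f = chart_derivative V \<psi> f p (frechet_derivative ?T (at (\<phi> p)) u)" if f: "f \<in> Cinf A" for f
  proof -
    have "(f \<circ> inv_into V \<psi> has_derivative chart_derivative V \<psi> f p) (at (?T (\<phi> p)))"
      using Cinf_chart_has_derivative[OF f assms(2,3)] U by simp
    from has_derivative_compose[OF T this]
    have "((\<lambda>z. (f \<circ> inv_into V \<psi>) (?T z)) has_derivative
        (\<lambda>v. chart_derivative V \<psi> f p (frechet_derivative ?T (at (\<phi> p)) v))) (at (\<phi> p))" .
    then have "(f \<circ> inv_into U \<phi> has_derivative
        (\<lambda>v. chart_derivative V \<psi> f p (frechet_derivative ?T (at (\<phi> p)) v))) (at (\<phi> p))"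
      by (rule has_derivative_transform_within_open[OF _ chart_Int_open[OF U(1) assms(2)] p])
        (use U assms(2) in auto)
    note fd = frechet_derivative_at[OF this]
    show ?thesis unfolding D using f by (simp add: fd[symmetric])
  qed
  with that show ?thesis by blast
qed

lemma chart_derivative_cong:
  assumes "(U, \<phi>) \<in> A" "mopen A W" "p \<in> U" "p \<in> W" "\<And>q. q \<in> W \<Longrightarrow> f q = g q"
  shows "chart_derivative U \<phi> f p = chart_derivative U \<phi> g p"
  unfolding chart_derivative_def
  by (rule frechet_derivative_cong_open(1)[of "\<phi> ` (U \<inter> W)"])
    (use assms in \<open>auto simp: mopen_def\<close>)

lemma tangent_at: "D \<in> tangent_space A p \<Longrightarrow> p \<in> points A"
  by (auto simp: tangent_space_def points_def)

lemma tangent_add: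
  assumes "D \<in> tangent_space A p" "f \<in> Cinf A" "g \<in> Cinf A"
  shows "D (\<lambda>q. f q + g q) = D f + D g"
proof -
  obtain U \<phi> where U: "(U, \<phi>) \<in> A" "p \<in> U" using tangent_at[OF assms(1)] chart_at by blast
  obtain v where v: "\<And>f. f \<in> Cinf A \<Longrightarrow> D f = chart_derivative U \<phi> f p v"
    by (rule tangent_space_chart[OF assms(1) U]) blast
  have "((\<lambda>q. f q + g q) \<circ> inv_into U \<phi> has_derivative
      (\<lambda>v. chart_derivative U \<phi> f p v + chart_derivative U \<phi> g p v)) (at (\<phi> p))"
    using has_derivative_add[OF Cinf_chart_has_derivative[OF assms(2) U] Cinf_chart_has_derivative[OF assms(3) U]]
    by (simp add: comp_def)
  note fd = frechet_derivative_at[OF this]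
  show ?thesis
    unfolding v[OF Cinf_add[OF assms(2,3)]] v[OF assms(2)] v[OF assms(3)]
    by (subst chart_derivative_def, subst fd[symmetric]) simp
qed

lemma tangent_mult:
  assumes "D \<in> tangent_space A p" "f \<in> Cinf A" "g \<in> Cinf A"
  shows "D (\<lambda>q. f q * g q) = f p * D g + D f * g p"
proof -
  obtain U \<phi> where U: "(U, \<phi>) \<in> A" "p \<in> U" using tangent_at[OF assms(1)] chart_at by blast
  obtain v where v: "\<And>f. f \<in> Cinf A \<Longrightarrow> D f = chart_derivative U \<phi> f p v"
    by (rule tangent_space_chart[OF assms(1) U]) blast
  have "((\<lambda>q. f q * g q) \<circ> inv_into U \<phi> has_derivative
      (\<lambda>v. f p * chart_derivative U \<phi> g p v + chart_derivative U \<phi> f p v * g p)) (at (\<phi> p))"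
    using has_derivative_mult[OF Cinf_chart_has_derivative[OF assms(2) U] Cinf_chart_has_derivative[OF assms(3) U]] U
    by (simp add: comp_def)
  note fd = frechet_derivative_at[OF this]
  show ?thesis
    unfolding v[OF Cinf_mult[OF assms(2,3)]] v[OF assms(2)] v[OF assms(3)]
    by (subst chart_derivative_def, subst fd[symmetric]) simp
qed

lemma tangent_const:
  assumes "D \<in> tangent_space A p"
  shows "D (restrict_to (points A) (\<lambda>_. c)) = 0"
proof -
  obtain U \<phi> where U: "(U, \<phi>) \<in> A" "p \<in> U" using tangent_at[OF assms(1)] chart_at by blast
  obtain v where v: "\<And>f. f \<in> Cinf A \<Longrightarrow> D f = chart_derivative U \<phi> f p v"
    by (rule tangent_space_chart[OF assms(1) U]) blast
  have "chart_derivative U \<phi> (restrict_to (points A) (\<lambda>_. c)) p = chart_derivative U \<phi> (\<lambda>_. c) p"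
    by (rule chart_derivative_cong[OF U(1) mopen_points U(2) tangent_at[OF assms]])
      (auto simp: restrict_to_def)
  then show ?thesis using v[OF Cinf_const] by (simp add: chart_derivative_def comp_def)
qed

lemma tangent_scale:
  assumes "D \<in> tangent_space A p" "f \<in> Cinf A"
  shows "D (\<lambda>q. c * f q) = c * D f"
proof -
  \<comment> \<open>Scaling becomes multiplication by a function. The constant has to be cut to zero
    off the manifold to lie in \<open>Cinf\<close>, which is harmless since \<open>f\<close>
    vanishes there.\<close>
  have "(\<lambda>q. c * f q) = (\<lambda>q. restrict_to (points A) (\<lambda>_. c) q * f q)"
    using assms(2) by (auto simp: Cinf_def restrict_to_def)
  then show ?thesis
    using tangent_mult[OF assms(1) Cinf_const[of c] assms(2)] tangent_const[OF assms(1)] tangent_at[OF assms(1)]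
    by (simp add: restrict_to_def)
qed

lemma tangent_diff:
  assumes "D \<in> tangent_space A p" "f \<in> Cinf A" "g \<in> Cinf A"
  shows "D (\<lambda>q. f q - g q) = D f - D g"
  using tangent_add[OF assms(1,2) Cinf_scale[OF assms(3), of "-1"]]
    tangent_scale[OF assms(1,3), of "-1"] by simp

text \<open>A vector field acts on \<open>Cinf\<close> only, so chart coordinates must be extended
  from a neighborhood of \<open>p\<close> to global functions before the components of the field can
  be formed.\<close>

definition has_coordinates :: "'p \<Rightarrow> bool" where
  "has_coordinates p \<longleftrightarrow> (\<exists>U \<phi>. (U, \<phi>) \<in> A \<and> p \<in> U \<and>
     (\<forall>c. bounded_linear c \<longrightarrow> (\<exists>y\<in>Cinf A. \<exists>W. mopen A W \<and> p \<in> W \<and> W \<subseteq> U \<and> (\<forall>q\<in>W. y q = c (\<phi> q)))))"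

lemma vector_field_tangent:
  "vector_field A X \<Longrightarrow> p \<in> points A \<Longrightarrow> (\<lambda>f. X f p) \<in> tangent_space A p"
  and vector_field_Cinf: "vector_field A X \<Longrightarrow> X f \<in> Cinf A"
  by (auto simp: vector_field_def)

text \<open>Near \<open>p\<close>, \<open>X h\<close> is the sum of the components
  \<open>X (y b)\<close> times the partial derivatives of \<open>h\<close>. These partial
  derivatives vanish at \<open>p\<close>, so differentiating there kills every term with a
  derivative of a component; what remains is the Hessian of \<open>h\<close> on \<open>v\<close> and
  \<open>w\<close>.\<close>

lemma second_order_chart:
  assumes X: "vector_field A X" and h: "h \<in> Cinf A"
    and U: "(U, \<phi>) \<in> A" "p \<in> U"
    and co: "\<And>c. bounded_linear c \<Longrightarrow> \<exists>y\<in>Cinf A. \<exists>W. mopen A W \<and> p \<in> W \<and> W \<subseteq> U \<and> (\<forall>q\<in>W. y q = c (\<phi> q))"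
    and v: "\<And>f. f \<in> Cinf A \<Longrightarrow> X f p = chart_derivative U \<phi> f p v"
    and crit: "\<And>w. chart_derivative U \<phi> h p w = 0"
  shows "chart_derivative U \<phi> (X h) p w =
    frechet_derivative (\<lambda>z. frechet_derivative (h \<circ> inv_into U \<phi>) (at z) w) (at (\<phi> p)) v"
proof -
  obtain B :: "'a set" and c where B: "finite B" "\<And>b. bounded_linear (c b :: 'a \<Rightarrow> real)"
    "\<And>x. x = (\<Sum>b\<in>B. c b x *\<^sub>R b)" by (rule finite_dim_coordinates[OF fin_dim]) blast
  have "\<forall>b. \<exists>y W. y \<in> Cinf A \<and> mopen A W \<and> p \<in> W \<and> W \<subseteq> U \<and> (\<forall>q\<in>W. y q = c b (\<phi> q))"
    using co[OF B(2)] by blast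
  then obtain y W where yW: "\<And>b. y b \<in> Cinf A" "\<And>b. mopen A (W b)" "\<And>b. p \<in> W b"
    "\<And>b. W b \<subseteq> U" "\<And>b q. q \<in> W b \<Longrightarrow> y b q = c b (\<phi> q)" by metis
  \<comment> \<open>A common neighborhood on which all the global functions \<open>y b\<close> agree
    with the chart coordinates; finiteness of the coordinate system keeps it open.\<close>
  define V where "V = U \<inter> (\<Inter>b\<in>B. W b)"
  have V: "mopen A V" unfolding V_def using B(1)
  proof (induction B)
    case empty
    then show ?case using mopen_chart U by simp
  next
    case (insert b B)
    have "U \<inter> (\<Inter>b\<in>insert b B. W b) = (U \<inter> (\<Inter>b\<in>B. W b)) \<inter> W b" by auto
    then show ?case using insert mopen_Int yW(2) by metis
  qed
  have pV: "p \<in> V" "V \<subseteq> U" using U yW by (auto simp: V_def)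
  let ?h = "h \<circ> inv_into U \<phi>" and ?inv = "inv_into U \<phi>"
  have sh: "smooth_on (\<phi> ` U) ?h" using Cinf_chart h U by blast
  have cdy: "chart_derivative U \<phi> (y b) q = c b" if "q \<in> W b" "q \<in> U" for b q
  proof -
    have "chart_derivative U \<phi> (y b) q = chart_derivative U \<phi> (\<lambda>q. c b (\<phi> q)) q"
      by (rule chart_derivative_cong[OF U(1) yW(2)[of b] that(2,1)]) (rule yW(5))
    also have "\<dots> = frechet_derivative (c b) (at (\<phi> q))"
      unfolding chart_derivative_def
      by (rule frechet_derivative_cong_open(1)[OF chart_open[OF U(1)]])
        (use that U in \<open>auto simp: f_inv_into_f\<close>)
    also have "\<dots> = c b"
      using frechet_derivative_at[OF bounded_linear_imp_has_derivative[OF B(2)]] by metis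
    finally show ?thesis .
  qed
  have lin: "linear (frechet_derivative ?h (at z))" if "z \<in> \<phi> ` U" for z
    using has_derivative_linear smooth_on_imp_has_derivative[OF sh that] by blast
  have expand: "X h q = (\<Sum>b\<in>B. X (y b) q * frechet_derivative ?h (at (\<phi> q)) b)" if "q \<in> V" for q
  proof -
    have q: "q \<in> U" "q \<in> points A" using that pV chart_subset_points U by auto
    obtain u where u: "\<And>f. f \<in> Cinf A \<Longrightarrow> X f q = chart_derivative U \<phi> f q u"
      by (rule tangent_space_chart[OF vector_field_tangent[OF X q(2)] U(1) q(1)]) blast
    have "X h q = frechet_derivative ?h (at (\<phi> q)) (\<Sum>b\<in>B. c b u *\<^sub>R b)"
      using u[OF h] unfolding chart_derivative_def by (subst B(3)[symmetric])
    also have "\<dots> = (\<Sum>b\<in>B. c b u * frechet_derivative ?h (at (\<phi> q)) b)"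
      using q by (simp add: linear_sum[OF lin] linear_scale[OF lin])
    also have "\<dots> = (\<Sum>b\<in>B. X (y b) q * frechet_derivative ?h (at (\<phi> q)) b)"
      by (rule sum.cong) (use u[OF yW(1)] cdy that q in \<open>auto simp: V_def\<close>)
    finally show ?thesis .
  qed
  define H where "H b z = frechet_derivative ?h (at z) b" for b z
  have sH: "smooth_on (\<phi> ` U) (H b)" for b unfolding H_def by (rule smooth_on_frechet_derivative[OF sh])
  have DH: "(H b has_derivative frechet_derivative (H b) (at (\<phi> p))) (at (\<phi> p))" for b
    by (rule smooth_on_imp_has_derivative[OF sH]) (use U in auto)
  have H0: "H b (\<phi> p) = 0" for b using crit by (simp add: H_def chart_derivative_def)
  have oV: "open (\<phi> ` V)" using V U pV unfolding mopen_def by (fastforce simp: Int_absorb1)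
  have "((\<lambda>z. \<Sum>b\<in>B. (X (y b) \<circ> ?inv) z * H b z) has_derivative
      (\<lambda>w. \<Sum>b\<in>B. X (y b) p * frechet_derivative (H b) (at (\<phi> p)) w)) (at (\<phi> p))"
  proof (rule has_derivative_sum)
    fix b
    have "(X (y b) \<circ> ?inv has_derivative chart_derivative U \<phi> (X (y b)) p) (at (\<phi> p))"
      by (rule Cinf_chart_has_derivative[OF vector_field_Cinf[OF X] U])
    from has_derivative_mult[OF this DH[of b]]
    show "((\<lambda>z. (X (y b) \<circ> ?inv) z * H b z) has_derivative
        (\<lambda>w. X (y b) p * frechet_derivative (H b) (at (\<phi> p)) w)) (at (\<phi> p))"
      using U by (simp add: H0)
  qed
  then have "(X h \<circ> ?inv has_derivative
      (\<lambda>w. \<Sum>b\<in>B. X (y b) p * frechet_derivative (H b) (at (\<phi> p)) w)) (at (\<phi> p))"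
    by (rule has_derivative_transform_within_open[OF _ oV])
      (use pV U expand in \<open>auto simp: H_def subset_iff\<close>)
  note fd = frechet_derivative_at[OF this]
  have "chart_derivative U \<phi> (X h) p w = (\<Sum>b\<in>B. X (y b) p * frechet_derivative (H b) (at (\<phi> p)) w)"
    unfolding chart_derivative_def fd[symmetric] ..
  also have "\<dots> = (\<Sum>b\<in>B. c b v * frechet_derivative (H w) (at (\<phi> p)) b)"
  proof (rule sum.cong[OF refl])
    fix b assume "b \<in> B"
    have "X (y b) p = c b v" using v[OF yW(1)] cdy[of p b] yW(3) U(2) by metis
    moreover have "frechet_derivative (H b) (at (\<phi> p)) w = frechet_derivative (H w) (at (\<phi> p)) b"
      unfolding H_def using second_derivative_symmetric[OF chart_open[OF U(1)] sh] U(2) by blast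
    ultimately show "X (y b) p * frechet_derivative (H b) (at (\<phi> p)) w =
        c b v * frechet_derivative (H w) (at (\<phi> p)) b" by simp
  qed
  also have "\<dots> = frechet_derivative (H w) (at (\<phi> p)) (\<Sum>b\<in>B. c b v *\<^sub>R b)"
    using has_derivative_linear[OF DH[of w]] by (simp add: linear_sum linear_scale)
  also have "(\<Sum>b\<in>B. c b v *\<^sub>R b) = v" by (rule B(3)[symmetric])
  finally show ?thesis unfolding H_def .
qed

text \<open>At a critical point both sides are the Hessian of \<open>h\<close> on the values of
  \<open>X\<close> and \<open>Y\<close> at \<open>p\<close>, and the Hessian is symmetric.\<close>

lemma commutator_critical:
  assumes X: "vector_field A X" and Y: "vector_field A Y" and h: "h \<in> Cinf A"
    and p: "p \<in> points A" "has_coordinates p"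
    and crit: "\<And>D. D \<in> tangent_space A p \<Longrightarrow> D h = 0"
  shows "X (Y h) p = Y (X h) p"
proof -
  from p(2) obtain U \<phi> where U: "(U, \<phi>) \<in> A" "p \<in> U"
    and co: "\<And>c. bounded_linear c \<Longrightarrow> \<exists>y\<in>Cinf A. \<exists>W. mopen A W \<and> p \<in> W \<and> W \<subseteq> U \<and> (\<forall>q\<in>W. y q = c (\<phi> q))"
    unfolding has_coordinates_def by blast
  have crit': "chart_derivative U \<phi> h p w = 0" for w
    using crit[OF tangent_spaceI[OF U, of w]] h by simp
  obtain v where v: "\<And>f. f \<in> Cinf A \<Longrightarrow> X f p = chart_derivative U \<phi> f p v"
    by (rule tangent_space_chart[OF vector_field_tangent[OF X p(1)] U]) blast
  obtain w where w: "\<And>f. f \<in> Cinf A \<Longrightarrow> Y f p = chart_derivative U \<phi> f p w"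
    by (rule tangent_space_chart[OF vector_field_tangent[OF Y p(1)] U]) blast
  have "chart_derivative U \<phi> (X h) p w =
      frechet_derivative (\<lambda>z. frechet_derivative (h \<circ> inv_into U \<phi>) (at z) w) (at (\<phi> p)) v"
    by (rule second_order_chart[OF X h U]) (erule co, erule v, rule crit')
  moreover have "chart_derivative U \<phi> (Y h) p v =
      frechet_derivative (\<lambda>z. frechet_derivative (h \<circ> inv_into U \<phi>) (at z) v) (at (\<phi> p)) w"
    by (rule second_order_chart[OF Y h U]) (erule co, erule w, rule crit')
  moreover have "frechet_derivative (\<lambda>z. frechet_derivative (h \<circ> inv_into U \<phi>) (at z) w) (at (\<phi> p)) v =
      frechet_derivative (\<lambda>z. frechet_derivative (h \<circ> inv_into U \<phi>) (at z) v) (at (\<phi> p)) w"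
    by (rule second_derivative_symmetric[OF chart_open[OF U(1)] Cinf_chart[OF h U(1)]]) (use U in auto)
  ultimately show ?thesis
    unfolding v[OF vector_field_Cinf[OF Y]] w[OF vector_field_Cinf[OF X]] by simp
qed

end

section \<open>Composition with smooth maps\<close>

lemma smooth_near_map:
  assumes "smooth_atlas A" "smooth_atlas B" "smooth_map A B F" "p \<in> points A" "smooth_near B g (F p)"
  shows "smooth_near A (\<lambda>q. g (F q)) p"
proof -
  interpret A: atlas A by standard fact
  interpret B: atlas B by standard fact
  obtain U \<phi> where U: "(U, \<phi>) \<in> A" "p \<in> U" using assms(4) A.chart_at by blast
  obtain V \<psi> where V: "(V, \<psi>) \<in> B" "F p \<in> V" using assms(5) B.smooth_near_imp_points B.chart_at by blast
  obtain Q where Q: "open Q" "Q \<subseteq> \<psi> ` V" "\<psi> (F p) \<in> Q" "smooth_on Q (g \<circ> inv_into V \<psi>)"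
    by (rule B.smooth_near_chart[OF assms(5) V])
  let ?W = "\<phi> ` (U \<inter> F -` V)" and ?T = "\<psi> \<circ> F \<circ> inv_into U \<phi>"
  have W: "open ?W" "smooth_on ?W ?T" using assms(3) U V unfolding smooth_map_def by blast+
  define R where "R = ?W \<inter> ?T -` Q"
  have oR: "open R" unfolding R_def
    using continuous_open_preimage[OF smooth_on_imp_continuous_on[OF W(2)] W(1) Q(1)] .
  have "smooth_on R (\<lambda>z. (g \<circ> inv_into V \<psi>) (?T z))"
    by (rule smooth_on_compose[OF B.fin_dim oR Q(1) _ smooth_on_subset[OF W(2)] Q(4)]) (auto simp: R_def)
  moreover have "(g \<circ> inv_into V \<psi>) (?T z) = ((\<lambda>q. g (F q)) \<circ> inv_into U \<phi>) z" if "z \<in> R" for z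
    using that U V by (auto simp: R_def)
  ultimately have "smooth_on R ((\<lambda>q. g (F q)) \<circ> inv_into U \<phi>)" using smooth_on_cong[OF oR] by metis
  then show ?thesis by (rule A.smooth_nearI[OF U oR, rotated]) (use U V Q in \<open>auto simp: R_def\<close>)
qed

text \<open>\<open>smooth_map\<close> gives openness of preimages for chart domains. Within a pair
  of charts the preimage of \<open>W\<close> is the preimage of an open set of coordinates under a
  continuous map, and the whole preimage is a union of such pieces.\<close>

lemma mopen_smooth_map_preimage:
  assumes "smooth_atlas A" "smooth_atlas B" "smooth_map A B F" "mopen B W"
  shows "mopen A (points A \<inter> F -` W)"
proof -
  interpret A: atlas A by standard fact
  interpret B: atlas B by standard fact
  have "\<exists>V. mopen A V \<and> p \<in> V \<and> V \<subseteq> points A \<inter> F -` W" if p: "p \<in> points A" "F p \<in> W" for p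
  proof -
    obtain U \<phi> where U: "(U, \<phi>) \<in> A" "p \<in> U" using p A.chart_at by blast
    obtain V \<psi> where V: "(V, \<psi>) \<in> B" "F p \<in> V" by (rule B.chart_at_mopen[OF assms(4) p(2)])
    have W: "open (\<phi> ` (U \<inter> F -` V))" "smooth_on (\<phi> ` (U \<inter> F -` V)) (\<psi> \<circ> F \<circ> inv_into U \<phi>)"
      using assms(3) U V unfolding smooth_map_def by blast+
    have oV: "open (\<psi> ` (V \<inter> W))" using assms(4) V by (auto simp: mopen_def)
    define R where "R = \<phi> ` (U \<inter> F -` V) \<inter> (\<psi> \<circ> F \<circ> inv_into U \<phi>) -` (\<psi> ` (V \<inter> W))"
    have oR: "open R" unfolding R_def
      using continuous_open_preimage[OF smooth_on_imp_continuous_on[OF W(2)] W(1) oV] .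
    have "mopen A {q \<in> U. \<phi> q \<in> R}"
      by (rule A.mopen_preimage[OF A.mopen_chart[OF U(1)] A.smooth_near_local_chart[OF U(1)] oR])
    moreover have "p \<in> {q \<in> U. \<phi> q \<in> R}" using p U V by (auto simp: R_def)
    moreover have "F q \<in> W" if "q \<in> U" "\<phi> q \<in> R" for q
    proof -
      from that(2) obtain q' where q': "q' \<in> U" "F q' \<in> V" "\<phi> q = \<phi> q'" by (auto simp: R_def)
      then have "q' = q" using A.chart_inj[OF U(1)] that(1) by (auto dest: inj_onD)
      have "\<psi> (F q) \<in> \<psi> ` (V \<inter> W)" using that U by (auto simp: R_def)
      then obtain r where "\<psi> (F q) = \<psi> r" "r \<in> V" "r \<in> W" by blast
      moreover have "F q \<in> V" using q' \<open>q' = q\<close> by simp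
      ultimately show ?thesis using B.chart_inj[OF V(1)] by (metis inj_onD)
    qed
    ultimately show ?thesis using A.chart_subset_points[OF U(1)]
      by (intro exI[of _ "{q \<in> U. \<phi> q \<in> R}"]) auto
  qed
  then have "points A \<inter> F -` W = \<Union>{V. mopen A V \<and> V \<subseteq> points A \<inter> F -` W}" by blast
  also have "mopen A \<dots>" by (rule A.mopen_Union) blast
  finally show ?thesis .
qed

section \<open>Vector bundles\<close>

locale vec_bundle = atlas A for A :: "('p, 'a::real_inner) atlas" +
  fixes B :: "('p, 'e::real_vector, 'v::real_inner) vbundle"
  assumes vector_bundle: "vector_bundle A B"
begin

abbreviation tinv :: "('p \<Rightarrow> 'e \<Rightarrow> 'v) \<Rightarrow> 'p \<Rightarrow> 'v \<Rightarrow> 'e" where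
  "tinv t x \<equiv> inv_into (fib B x) (t x)"

lemma model_fin_dim: "finite_dim TYPE('v)"
  using vector_bundle by (simp add: vector_bundle_def)

lemma fib_subspace: "x \<in> points A \<Longrightarrow> subspace (fib B x)"
  using vector_bundle by (simp add: vector_bundle_def)

lemma triv_mopen: "(V, t) \<in> triv B \<Longrightarrow> mopen A V"
  unfolding openin_manifold_topology[symmetric] using vector_bundle unfolding vector_bundle_def by blast

lemma triv_linear: "(V, t) \<in> triv B \<Longrightarrow> x \<in> V \<Longrightarrow> linear_map_on (fib B x) (t x)"
  and triv_bij: "(V, t) \<in> triv B \<Longrightarrow> x \<in> V \<Longrightarrow> bij_betw (t x) (fib B x) UNIV"
  and triv_transition: "(V, t) \<in> triv B \<Longrightarrow> (V', t') \<in> triv B \<Longrightarrow>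
    smooth_fun_on A (V \<inter> V') (\<lambda>x. t' x (tinv t x v))"
  using vector_bundle unfolding vector_bundle_def by blast+

lemma triv_at:
  assumes "x \<in> points A"
  obtains V t where "(V, t) \<in> triv B" "x \<in> V"
proof -
  have "(\<Union>(V, t)\<in>triv B. V) = points A" using vector_bundle by (simp add: vector_bundle_def)
  with assms that show ?thesis by blast
qed

lemma triv_points: "(V, t) \<in> triv B \<Longrightarrow> x \<in> V \<Longrightarrow> x \<in> points A"
  using triv_mopen mopen_subset by blast

lemma fib_zero: "x \<in> points A \<Longrightarrow> 0 \<in> fib B x"
  and fib_add: "x \<in> points A \<Longrightarrow> u \<in> fib B x \<Longrightarrow> w \<in> fib B x \<Longrightarrow> u + w \<in> fib B x"
  and fib_diff: "x \<in> points A \<Longrightarrow> u \<in> fib B x \<Longrightarrow> w \<in> fib B x \<Longrightarrow> u - w \<in> fib B x"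
  and fib_scale: "x \<in> points A \<Longrightarrow> w \<in> fib B x \<Longrightarrow> c *\<^sub>R w \<in> fib B x"
  using fib_subspace subspace_0 subspace_add subspace_diff subspace_scale by blast+

lemma triv_add: "(V, t) \<in> triv B \<Longrightarrow> x \<in> V \<Longrightarrow> u \<in> fib B x \<Longrightarrow> w \<in> fib B x \<Longrightarrow> t x (u + w) = t x u + t x w"
  and triv_scale: "(V, t) \<in> triv B \<Longrightarrow> x \<in> V \<Longrightarrow> w \<in> fib B x \<Longrightarrow> t x (c *\<^sub>R w) = c *\<^sub>R t x w"
  using triv_linear unfolding linear_map_on_def by blast+

lemma triv_zero: "(V, t) \<in> triv B \<Longrightarrow> x \<in> V \<Longrightarrow> t x 0 = 0"
  using triv_scale[of V t x 0 0] fib_zero triv_points by simp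

lemma triv_diff: "(V, t) \<in> triv B \<Longrightarrow> x \<in> V \<Longrightarrow> u \<in> fib B x \<Longrightarrow> w \<in> fib B x \<Longrightarrow> t x (u - w) = t x u - t x w"
  using triv_add[of V t x u "(-1) *\<^sub>R w"] triv_scale[of V t x w "-1"] fib_scale[of x w "-1"] triv_points
  by auto

lemma triv_inj: "(V, t) \<in> triv B \<Longrightarrow> x \<in> V \<Longrightarrow> u \<in> fib B x \<Longrightarrow> w \<in> fib B x \<Longrightarrow> t x u = t x w \<Longrightarrow> u = w"
  using triv_bij by (meson bij_betw_imp_inj_on inj_onD)

lemma tinv_fib: "(V, t) \<in> triv B \<Longrightarrow> x \<in> V \<Longrightarrow> tinv t x v \<in> fib B x"
  using triv_bij[of V t x] by (metis UNIV_I bij_betw_def inv_into_into)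

lemma triv_tinv: "(V, t) \<in> triv B \<Longrightarrow> x \<in> V \<Longrightarrow> t x (tinv t x v) = v"
  using triv_bij[of V t x] by (simp add: bij_betw_inv_into_right)

lemma tinv_triv: "(V, t) \<in> triv B \<Longrightarrow> x \<in> V \<Longrightarrow> w \<in> fib B x \<Longrightarrow> tinv t x (t x w) = w"
  using triv_bij[of V t x] by (simp add: bij_betw_inv_into_left)

lemma tinv_add: "(V, t) \<in> triv B \<Longrightarrow> x \<in> V \<Longrightarrow> tinv t x (u + v) = tinv t x u + tinv t x v"
  by (rule triv_inj[of V t x]) (auto simp: triv_tinv triv_add tinv_fib intro!: fib_add triv_points)

lemma tinv_scale: "(V, t) \<in> triv B \<Longrightarrow> x \<in> V \<Longrightarrow> tinv t x (c *\<^sub>R v) = c *\<^sub>R tinv t x v"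
  by (rule triv_inj[of V t x]) (auto simp: triv_tinv triv_scale tinv_fib intro!: fib_scale triv_points)

lemma transition_sum:
  assumes "(V, t) \<in> triv B" "(V', t') \<in> triv B" "x \<in> V" "x \<in> V'" "finite I"
  shows "t' x (tinv t x (\<Sum>b\<in>I. c b *\<^sub>R v b)) = (\<Sum>b\<in>I. c b *\<^sub>R t' x (tinv t x (v b)))"
  using assms(5)
proof (induction I)
  case empty
  show ?case using tinv_scale[OF assms(1,3), of 0 0] triv_zero[OF assms(2,4)] by simp
next
  case (insert b I)
  then show ?case
    using assms by (simp add: tinv_add tinv_scale triv_add triv_scale tinv_fib fib_scale triv_points)
qed

text \<open>The bundle axioms make the transitions smooth on constant vectors only; linearity of
  trivializations extends this to a varying vector \<open>g\<close>, expanded in coordinates of the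
  model fibre.\<close>

lemma transition_near:
  assumes "(V, t) \<in> triv B" "(V', t') \<in> triv B" "x \<in> V" "x \<in> V'" "smooth_near A g x"
  shows "smooth_near A (\<lambda>y. t' y (tinv t y (g y))) x"
proof -
  obtain I :: "'v set" and c where I: "finite I" "\<And>b. bounded_linear (c b :: 'v \<Rightarrow> real)"
    "\<And>v. v = (\<Sum>b\<in>I. c b v *\<^sub>R b)" by (rule finite_dim_coordinates[OF model_fin_dim]) blast
  have VV: "mopen A (V \<inter> V')" using triv_mopen mopen_Int assms by blast
  have "smooth_near A (\<lambda>y. t' y (tinv t y b)) x" for b
    using triv_transition[OF assms(1,2)] smooth_fun_on_iff[OF VV] assms(3,4) by blast
  then have "smooth_near A (\<lambda>y. \<Sum>b\<in>I. c b (g y) *\<^sub>R t' y (tinv t y b)) x"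
    by (intro smooth_near_sum smooth_near_scaleR smooth_near_linear[OF I(2)] assms(5) triv_points[OF assms(1,3)])
  then show ?thesis
  proof (rule smooth_near_cong[OF _ VV])
    fix y assume "y \<in> V \<inter> V'"
    then have "(\<Sum>b\<in>I. c b (g y) *\<^sub>R t' y (tinv t y b)) = t' y (tinv t y (\<Sum>b\<in>I. c b (g y) *\<^sub>R b))"
      using transition_sum[OF assms(1,2) _ _ I(1)] by simp
    also have "\<dots> = t' y (tinv t y (g y))" by (subst I(3)[symmetric]) simp
    finally show "(\<Sum>b\<in>I. c b (g y) *\<^sub>R t' y (tinv t y b)) = t' y (tinv t y (g y))" .
  qed (use assms in auto)
qed

text \<open>The first conjunct is there because a trivialization has a meaning on the fibre only:
  smoothness of \<open>t y (\<sigma> y)\<close> says nothing about values outside it.\<close>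

definition section_near :: "('p \<Rightarrow> 'e) \<Rightarrow> 'p \<Rightarrow> bool" where
  "section_near \<sigma> x \<longleftrightarrow> (\<exists>W. mopen A W \<and> x \<in> W \<and> (\<forall>y\<in>W. \<sigma> y \<in> fib B y)) \<and>
     (\<exists>V t. (V, t) \<in> triv B \<and> x \<in> V \<and> smooth_near A (\<lambda>y. t y (\<sigma> y)) x)"

lemma section_near_smooth_near:
  assumes "section_near \<sigma> x" "(V', t') \<in> triv B" "x \<in> V'"
  shows "smooth_near A (\<lambda>y. t' y (\<sigma> y)) x"
proof -
  obtain W V t where W: "mopen A W" "x \<in> W" "\<forall>y\<in>W. \<sigma> y \<in> fib B y"
    and V: "(V, t) \<in> triv B" "x \<in> V" "smooth_near A (\<lambda>y. t y (\<sigma> y)) x"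
    using assms(1) unfolding section_near_def by blast
  have o: "mopen A (W \<inter> V)" using W(1) triv_mopen[OF V(1)] mopen_Int by blast
  show ?thesis
    by (rule smooth_near_cong[OF transition_near[OF V(1) assms(2) V(2) assms(3) V(3)] o])
      (use W V tinv_triv in auto)
qed

lemma section_nearI:
  assumes "mopen A W" "x \<in> W" "\<And>y. y \<in> W \<Longrightarrow> \<sigma> y \<in> fib B y"
    "(V, t) \<in> triv B" "x \<in> V" "smooth_near A (\<lambda>y. t y (\<sigma> y)) x"
  shows "section_near \<sigma> x"
  using assms unfolding section_near_def by blast

lemma section_near_cong:
  assumes "section_near \<sigma> x" "mopen A W" "x \<in> W" "\<And>y. y \<in> W \<Longrightarrow> \<sigma> y = \<sigma>' y"
  shows "section_near \<sigma>' x"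
proof -
  obtain W' V t where W: "mopen A W'" "x \<in> W'" "\<forall>y\<in>W'. \<sigma> y \<in> fib B y"
    and V: "(V, t) \<in> triv B" "x \<in> V" "smooth_near A (\<lambda>y. t y (\<sigma> y)) x"
    using assms(1) unfolding section_near_def by blast
  show ?thesis
    by (rule section_nearI[OF mopen_Int[OF W(1) assms(2)] _ _ V(1,2) smooth_near_cong[OF V(3) assms(2,3)]])
      (use W assms in auto)
qed

lemma sections_iff:
  "\<sigma> \<in> sections A B \<longleftrightarrow> (\<forall>x\<in>points A. section_near \<sigma> x) \<and> (\<forall>x. x \<notin> points A \<longrightarrow> \<sigma> x = 0)"
proof
  assume \<sigma>: "\<sigma> \<in> sections A B"
  have "section_near \<sigma> x" if x: "x \<in> points A" for x
  proof -
    obtain V t where V: "(V, t) \<in> triv B" "x \<in> V" by (rule triv_at[OF x])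
    have near: "smooth_near A (\<lambda>y. t y (\<sigma> y)) x"
      using \<sigma> V smooth_fun_on_iff[OF triv_mopen[OF V(1)]] unfolding sections_def by blast
    show ?thesis
      by (rule section_nearI[OF mopen_points x _ V near]) (use \<sigma> in \<open>auto simp: sections_def\<close>)
  qed
  then show "(\<forall>x\<in>points A. section_near \<sigma> x) \<and> (\<forall>x. x \<notin> points A \<longrightarrow> \<sigma> x = 0)"
    using \<sigma> by (auto simp: sections_def)
next
  assume \<sigma>: "(\<forall>x\<in>points A. section_near \<sigma> x) \<and> (\<forall>x. x \<notin> points A \<longrightarrow> \<sigma> x = 0)"
  have "smooth_fun_on A V (\<lambda>x. t x (\<sigma> x))" if "(V, t) \<in> triv B" for V t
    using smooth_fun_on_iff[OF triv_mopen[OF that]] section_near_smooth_near[OF _ that] \<sigma>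
      triv_points[OF that] by blast
  moreover have "\<sigma> x \<in> fib B x" if "x \<in> points A" for x
    using \<sigma> that unfolding section_near_def by blast
  ultimately show "\<sigma> \<in> sections A B" using \<sigma> unfolding sections_def by blast
qed

lemma sections_fib: "\<sigma> \<in> sections A B \<Longrightarrow> x \<in> points A \<Longrightarrow> \<sigma> x \<in> fib B x"
  and sections_off: "\<sigma> \<in> sections A B \<Longrightarrow> x \<notin> points A \<Longrightarrow> \<sigma> x = 0"
  by (auto simp: sections_def)

lemma sections_smooth_near:
  "\<sigma> \<in> sections A B \<Longrightarrow> (V, t) \<in> triv B \<Longrightarrow> x \<in> V \<Longrightarrow> smooth_near A (\<lambda>y. t y (\<sigma> y)) x"
  using sections_iff section_near_smooth_near triv_points by blast

lemma section_near_add: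
  assumes "section_near \<sigma> x" "section_near \<sigma>' x"
  shows "section_near (\<lambda>y. \<sigma> y + \<sigma>' y) x"
proof -
  obtain W where W: "mopen A W" "x \<in> W" "\<forall>y\<in>W. \<sigma> y \<in> fib B y"
    using assms(1) unfolding section_near_def by blast
  obtain W' where W': "mopen A W'" "x \<in> W'" "\<forall>y\<in>W'. \<sigma>' y \<in> fib B y"
    using assms(2) unfolding section_near_def by blast
  obtain V t where V: "(V, t) \<in> triv B" "x \<in> V" using triv_at W mopen_subset by blast
  have o: "mopen A (W \<inter> W')" "mopen A (W \<inter> W' \<inter> V)" using W W' V triv_mopen mopen_Int by blast+
  have "smooth_near A (\<lambda>y. t y (\<sigma> y) + t y (\<sigma>' y)) x"
    by (intro smooth_near_add section_near_smooth_near[OF assms(1) V] section_near_smooth_near[OF assms(2) V])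
  then have near: "smooth_near A (\<lambda>y. t y (\<sigma> y + \<sigma>' y)) x"
    by (rule smooth_near_cong[OF _ o(2)]) (use W W' V triv_add in auto)
  show ?thesis
    by (rule section_nearI[OF o(1) _ _ V near])
      (use W W' mopen_subset[OF W(1)] in \<open>auto intro!: fib_add\<close>)
qed

lemma section_near_scaleR:
  assumes "smooth_near A f x" "section_near \<sigma> x"
  shows "section_near (\<lambda>y. f y *\<^sub>R \<sigma> y) x"
proof -
  obtain W where W: "mopen A W" "x \<in> W" "\<forall>y\<in>W. \<sigma> y \<in> fib B y"
    using assms(2) unfolding section_near_def by blast
  obtain V t where V: "(V, t) \<in> triv B" "x \<in> V" using triv_at W mopen_subset by blast
  have o: "mopen A (W \<inter> V)" using W V triv_mopen mopen_Int by blast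
  have "smooth_near A (\<lambda>y. f y *\<^sub>R t y (\<sigma> y)) x"
    by (intro smooth_near_scaleR assms(1) section_near_smooth_near[OF assms(2) V])
  then have near: "smooth_near A (\<lambda>y. t y (f y *\<^sub>R \<sigma> y)) x"
    by (rule smooth_near_cong[OF _ o]) (use W V triv_scale in auto)
  show ?thesis
    by (rule section_nearI[OF W(1,2) _ V near]) (use W mopen_subset[OF W(1)] in \<open>auto intro!: fib_scale\<close>)
qed

lemma section_near_zero:
  assumes "x \<in> points A"
  shows "section_near (\<lambda>_. 0) x"
proof -
  obtain V t where V: "(V, t) \<in> triv B" "x \<in> V" using triv_at assms by blast
  have near: "smooth_near A (\<lambda>y. t y 0) x"
    by (rule smooth_near_cong[OF smooth_near_const[OF assms, of 0] triv_mopen[OF V(1)] V(2)])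
      (simp add: triv_zero[OF V(1)])
  show ?thesis by (rule section_nearI[OF mopen_points assms fib_zero V near])
qed

lemma section_near_frame:
  assumes "(V, t) \<in> triv B" "x \<in> V"
  shows "section_near (\<lambda>y. tinv t y v) x"
  by (rule section_nearI[OF triv_mopen[OF assms(1)] assms(2) _ assms])
    (use tinv_fib[OF assms(1)] in \<open>auto intro!: smooth_near_cong[OF smooth_near_const[of x v] triv_mopen[OF assms(1)]]
      simp: triv_tinv[OF assms(1)] assms triv_points[OF assms]\<close>)

lemma sections_add: "\<sigma> \<in> sections A B \<Longrightarrow> \<sigma>' \<in> sections A B \<Longrightarrow> (\<lambda>x. \<sigma> x + \<sigma>' x) \<in> sections A B"
  by (simp add: sections_iff section_near_add)

lemma sections_smul: "f \<in> Cinf A \<Longrightarrow> \<sigma> \<in> sections A B \<Longrightarrow> smul f \<sigma> \<in> sections A B"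
  by (simp add: sections_iff smul_def section_near_scaleR Cinf_smooth_near)

lemma sections_scale: "\<sigma> \<in> sections A B \<Longrightarrow> (\<lambda>x. c *\<^sub>R \<sigma> x) \<in> sections A B"
  by (auto simp: sections_iff intro!: section_near_scaleR smooth_near_const)

lemma sections_minus: "\<sigma> \<in> sections A B \<Longrightarrow> (\<lambda>x. - \<sigma> x) \<in> sections A B"
  using sections_scale[of \<sigma> "-1"] by simp

lemma sections_diff: "\<sigma> \<in> sections A B \<Longrightarrow> \<sigma>' \<in> sections A B \<Longrightarrow> (\<lambda>x. \<sigma> x - \<sigma>' x) \<in> sections A B"
  using sections_add[OF _ sections_minus] by fastforce

lemma sections_cutoff:
  assumes "cutoff A W \<theta>" "\<And>x. x \<in> W \<Longrightarrow> section_near \<sigma> x"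
  shows "(\<lambda>x. \<theta> x *\<^sub>R \<sigma> x) \<in> sections A B"
  unfolding sections_iff
proof (intro conjI ballI allI impI)
  fix x assume x: "x \<in> points A"
  show "section_near (\<lambda>x. \<theta> x *\<^sub>R \<sigma> x) x"
  proof (cases "x \<in> W")
    case True
    then show ?thesis
      using section_near_scaleR[OF Cinf_smooth_near[OF _ x] assms(2)] assms(1)
      unfolding cutoff_def by blast
  next
    case False
    with assms(1) x obtain W0 where W0: "mopen A W0" "x \<in> W0" "\<forall>q\<in>W0. \<theta> q = 0"
      unfolding cutoff_def by blast
    then show ?thesis by (intro section_near_cong[OF section_near_zero[OF x] W0(1,2)]) auto
  qed
next
  fix x assume "x \<notin> points A"
  then show "\<theta> x *\<^sub>R \<sigma> x = 0" using assms(1) by (auto simp: cutoff_def Cinf_def)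
qed

text \<open>A constant vector in a local trivialization, cut off: \<open>\<theta>\<close> is 1 at
  \<open>x\<close>, so the value there survives.\<close>

lemma section_through:
  assumes "Hausdorff_space (manifold_topology A)" "x \<in> points A" "w \<in> fib B x"
  obtains \<sigma> where "\<sigma> \<in> sections A B" "\<sigma> x = w"
proof -
  obtain V t where V: "(V, t) \<in> triv B" "x \<in> V" using triv_at assms by blast
  obtain \<theta> W' where \<theta>: "cutoff A V \<theta>" "mopen A W'" "x \<in> W'" "W' \<subseteq> V" "\<forall>q\<in>W'. \<theta> q = 1"
    by (rule cutoff_exists[OF assms(1) triv_mopen[OF V(1)] V(2)])
  show ?thesis
    by (rule that[OF sections_cutoff[OF \<theta>(1) section_near_frame[OF V(1), of _ "t x w"]]])
      (use \<theta> V assms in \<open>auto simp: tinv_triv\<close>)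
qed

end

section \<open>Pullback bundles\<close>

lemma vector_bundle_pullback:
  fixes A :: "('p, 'a::real_inner) atlas" and C :: "('q, 'c::real_inner) atlas"
    and B :: "('p, 'e::real_vector, 'v::real_inner) vbundle"
  assumes "smooth_atlas A" "smooth_atlas C" "vector_bundle A B" "smooth_map C A F"
  shows "vector_bundle C (pullback_bundle (points C) F B)"
proof -
  interpret vec_bundle A B by standard fact+
  interpret C: atlas C by standard fact
  have F: "F x \<in> points A" if "x \<in> points C" for x using assms(4) that by (auto simp: smooth_map_def)
  have pre: "mopen C (points C \<inter> F -` V)" if "(V, t) \<in> triv B" for V t
    using mopen_smooth_map_preimage[OF assms(2,1,4) triv_mopen[OF that]] .
  have trans: "smooth_fun_on C ((points C \<inter> F -` V) \<inter> (points C \<inter> F -` V'))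
      (\<lambda>y. t' (F y) (tinv t (F y) v))" if V: "(V, t) \<in> triv B" "(V', t') \<in> triv B" for V t V' t' v
  proof -
    have "smooth_near C (\<lambda>y. t' (F y) (tinv t (F y) v)) y"
      if "y \<in> points C" "F y \<in> V" "F y \<in> V'" for y
      by (rule smooth_near_map[OF assms(2,1,4) that(1), where g = "\<lambda>x. t' x (tinv t x v)"])
        (rule transition_near[OF V that(2,3) smooth_near_const[OF F[OF that(1)]]])
    then show ?thesis
      unfolding C.smooth_fun_on_iff[OF C.mopen_Int[OF pre[OF V(1)] pre[OF V(2)]]] by blast
  qed
  show ?thesis
    unfolding vector_bundle_def pullback_bundle_def
  proof (simp only: vbundle.simps, intro conjI)
    show "finite_dim TYPE('v)" by (rule model_fin_dim)
    show "\<forall>x\<in>points C. subspace (fib B (F x))" using F fib_subspace by blast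
    have "x \<in> (\<Union>(U, t)\<in>(\<lambda>(U, t). (points C \<inter> F -` U, \<lambda>y. t (F y))) ` triv B. U)"
      if x: "x \<in> points C" for x
    proof -
      obtain V t where V: "(V, t) \<in> triv B" "F x \<in> V" by (rule triv_at[OF F[OF x]])
      then show ?thesis using x
        by (intro UN_I[OF imageI[OF V(1)]]) simp
    qed
    then show "(\<Union>(U, t)\<in>(\<lambda>(U, t). (points C \<inter> F -` U, \<lambda>y. t (F y))) ` triv B. U) = points C"
      by (intro equalityI subsetI) (auto simp del: SUP_image UN_simps)
    show "\<forall>(U, t)\<in>(\<lambda>(U, t). (points C \<inter> F -` U, \<lambda>y. t (F y))) ` triv B.
        openin (manifold_topology C) U \<and>
        (\<forall>x\<in>U. linear_map_on (fib B (F x)) (t x) \<and> bij_betw (t x) (fib B (F x)) UNIV)"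
      unfolding C.openin_manifold_topology using pre triv_linear triv_bij by auto
    show "\<forall>(U, t)\<in>(\<lambda>(U, t). (points C \<inter> F -` U, \<lambda>y. t (F y))) ` triv B.
       \<forall>(V, t')\<in>(\<lambda>(U, t). (points C \<inter> F -` U, \<lambda>y. t (F y))) ` triv B. \<forall>v.
         smooth_fun_on C (U \<inter> V) (\<lambda>x. t' x (inv_into (fib B (F x)) (t x) v))"
      using trans by auto
  qed
qed

section \<open>The total space as a manifold\<close>

context vec_bundle
begin

abbreviation tot :: "('p \<times> 'e, 'a \<times> 'v) atlas" where
  "tot \<equiv> total_atlas A B"

definition tdom :: "'p set \<Rightarrow> 'p set \<Rightarrow> ('p \<times> 'e) set" where
  "tdom U V = (SIGMA x : U \<inter> V. fib B x)"

definition tmap :: "('p \<Rightarrow> 'a) \<Rightarrow> ('p \<Rightarrow> 'e \<Rightarrow> 'v) \<Rightarrow> 'p \<times> 'e \<Rightarrow> 'a \<times> 'v" where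
  "tmap \<phi> t = (\<lambda>(x, w). (\<phi> x, t x w))"

lemma tmap_apply [simp]: "tmap \<phi> t (x, w) = (\<phi> x, t x w)"
  by (simp add: tmap_def)

lemma mem_tdom [simp]: "(x, w) \<in> tdom U V \<longleftrightarrow> x \<in> U \<and> x \<in> V \<and> w \<in> fib B x"
  by (auto simp: tdom_def)

lemma total_chart: "(U, \<phi>) \<in> A \<Longrightarrow> (V, t) \<in> triv B \<Longrightarrow> (tdom U V, tmap \<phi> t) \<in> tot"
  unfolding total_atlas_def tdom_def tmap_def by blast

lemma total_chart_cases:
  assumes "(C, \<psi>) \<in> tot"
  obtains U \<phi> V t where "(U, \<phi>) \<in> A" "(V, t) \<in> triv B" "C = tdom U V" "\<psi> = tmap \<phi> t"
  using assms unfolding total_atlas_def tdom_def tmap_def by blast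

lemma points_total: "points tot = (SIGMA x : points A. fib B x)"
proof (intro set_eqI iffI)
  fix p assume "p \<in> points tot"
  then obtain C \<psi> where "(C, \<psi>) \<in> tot" "p \<in> C" unfolding points_def by blast
  then show "p \<in> (SIGMA x : points A. fib B x)"
    using chart_subset_points by (elim total_chart_cases) (auto simp: tdom_def)
next
  fix p assume p: "p \<in> (SIGMA x : points A. fib B x)"
  then obtain x w where xw: "p = (x, w)" "x \<in> points A" "w \<in> fib B x" by auto
  obtain U \<phi> where U: "(U, \<phi>) \<in> A" "x \<in> U" by (rule chart_at[OF xw(2)])
  obtain V t where V: "(V, t) \<in> triv B" "x \<in> V" by (rule triv_at[OF xw(2)])
  show "p \<in> points tot" using total_chart[OF U(1) V(1)] U V xw
    by (auto simp: points_def intro!: bexI[of _ "(tdom U V, tmap \<phi> t)"])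
qed

lemma mem_points_total [simp]: "(x, w) \<in> points tot \<longleftrightarrow> x \<in> points A \<and> w \<in> fib B x"
  by (simp add: points_total)

lemma tmap_inj:
  assumes "(U, \<phi>) \<in> A" "(V, t) \<in> triv B"
  shows "inj_on (tmap \<phi> t) (tdom U V)"
proof (rule inj_onI, safe)
  fix x w y u
  assume *: "(x, w) \<in> tdom U V" "(y, u) \<in> tdom U V" "tmap \<phi> t (x, w) = tmap \<phi> t (y, u)"
  then have "x = y" using inj_onD[OF chart_inj[OF assms(1)], of x y] by simp
  moreover have "w = u" using * \<open>x = y\<close> triv_inj[OF assms(2), of y w u] by simp
  ultimately show "x = y" "w = u" by auto
qed

lemma tmap_image:
  assumes "(U, \<phi>) \<in> A" "(V, t) \<in> triv B" "W \<subseteq> U \<inter> V"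
  shows "tmap \<phi> t ` (SIGMA x : W. fib B x) = \<phi> ` W \<times> UNIV"
proof (intro set_eqI iffI)
  fix z :: "'a \<times> 'v" assume "z \<in> \<phi> ` W \<times> UNIV"
  then obtain x b where z: "z = (\<phi> x, b)" "x \<in> W" by auto
  then have "z = tmap \<phi> t (x, tinv t x b)" "tinv t x b \<in> fib B x"
    using assms triv_tinv[OF assms(2)] tinv_fib[OF assms(2)] by auto
  then show "z \<in> tmap \<phi> t ` (SIGMA x : W. fib B x)" using z(2) by blast
qed auto

lemma tmap_inverse:
  assumes "(U, \<phi>) \<in> A" "(V, t) \<in> triv B" "a \<in> \<phi> ` (U \<inter> V)"
  shows "inv_into (tdom U V) (tmap \<phi> t) (a, b) = (inv_into U \<phi> a, tinv t (inv_into U \<phi> a) b)"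
proof -
  obtain x where x: "a = \<phi> x" "x \<in> U" "x \<in> V" using assms(3) by auto
  have "inv_into (tdom U V) (tmap \<phi> t) (tmap \<phi> t (x, tinv t x b)) = (x, tinv t x b)"
    by (rule inv_into_f_f[OF tmap_inj[OF assms(1,2)]]) (use x tinv_fib[OF assms(2)] in auto)
  then show ?thesis using x assms(1) triv_tinv[OF assms(2) x(3)] by simp
qed

lemma smooth_on_fst_product:
  assumes "open W" "smooth_on W (g :: 'a \<Rightarrow> 'b::real_normed_vector)"
  shows "smooth_on (W \<times> (UNIV :: 'v set)) (\<lambda>z. g (fst z))"
  by (rule smooth_on_compose[OF fin_dim open_Times[OF assms(1) open_UNIV] assms(1) _ _ assms(2)])
    (auto intro: smooth_on_linear bounded_linear_fst)

text \<open>A change of charts is the transition of the base paired with a map that is linear in the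
  fibre coordinate; the coefficients of the latter are transitions of constant vectors, hence smooth
  functions of the base point alone.\<close>

lemma total_transition:
  assumes "(U, \<phi>) \<in> A" "(V, t) \<in> triv B" "(U', \<phi>') \<in> A" "(V', t') \<in> triv B"
  defines "W \<equiv> U \<inter> V \<inter> (U' \<inter> V')"
  shows "tmap \<phi> t ` (tdom U V \<inter> tdom U' V') = \<phi> ` W \<times> UNIV" "open (\<phi> ` W)"
    "smooth_on (\<phi> ` W \<times> UNIV) (tmap \<phi>' t' \<circ> inv_into (tdom U V) (tmap \<phi> t))"
proof -
  have "tdom U V \<inter> tdom U' V' = (SIGMA x : W. fib B x)" by (auto simp: W_def)
  then show "tmap \<phi> t ` (tdom U V \<inter> tdom U' V') = \<phi> ` W \<times> UNIV"
    using tmap_image[OF assms(1,2), of W] unfolding W_def by auto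
  have oW: "mopen A W" unfolding W_def
    using assms mopen_Int mopen_chart triv_mopen by blast
  then show o: "open (\<phi> ` W)" using mopenD[OF oW assms(1)] by (simp add: W_def Int_absorb1 inf.assoc)
  obtain I :: "'v set" and c where I: "finite I" "\<And>b. bounded_linear (c b :: 'v \<Rightarrow> real)"
    "\<And>v. v = (\<Sum>b\<in>I. c b v *\<^sub>R b)" by (rule finite_dim_coordinates[OF model_fin_dim]) blast
  let ?i = "inv_into U \<phi>"
  have ow: "open (\<phi> ` W \<times> (UNIV :: 'v set))" using o open_Times open_UNIV by blast
  have s1: "smooth_on (\<phi> ` W) (\<phi>' \<circ> ?i)"
    by (rule smooth_on_subset[OF transition_smooth[OF assms(1,3)]]) (auto simp: W_def)
  have s2: "smooth_on (\<phi> ` W) ((\<lambda>x. t' x (tinv t x b)) \<circ> ?i)" for b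
  proof -
    have "smooth_fun_on A W (\<lambda>x. t' x (tinv t x b))"
      unfolding smooth_fun_on_iff[OF oW]
      using mopen_subset[OF oW]
      by (auto simp: W_def subset_iff intro!: transition_near[OF assms(2,4)] smooth_near_const)
    moreover have "U \<inter> W = W" by (auto simp: W_def)
    ultimately show ?thesis using assms(1) by (fastforce simp: smooth_fun_on_def)
  qed
  have "smooth_on (\<phi> ` W \<times> (UNIV :: 'v set))
      (\<lambda>z. ((\<phi>' \<circ> ?i) (fst z), \<Sum>b\<in>I. c b (snd z) *\<^sub>R ((\<lambda>x. t' x (tinv t x b)) \<circ> ?i) (fst z)))"
    by (intro smooth_on_Pair ow smooth_on_sum smooth_on_scaleR
        smooth_on_fst_product[OF o s1] smooth_on_fst_product[OF o s2]
        smooth_on_linear_compose[OF I(2)] smooth_on_linear bounded_linear_snd)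
  moreover have "((\<phi>' \<circ> ?i) (fst z), \<Sum>b\<in>I. c b (snd z) *\<^sub>R ((\<lambda>x. t' x (tinv t x b)) \<circ> ?i) (fst z)) =
      (tmap \<phi>' t' \<circ> inv_into (tdom U V) (tmap \<phi> t)) z" (is "?L z = ?R z") if z0: "z \<in> \<phi> ` W \<times> UNIV" for z
  proof -
    from z0 obtain x b where z: "z = (\<phi> x, b)" "x \<in> W" by auto
    have x: "x \<in> U" "x \<in> V" "x \<in> V'" using z by (auto simp: W_def)
    have "(\<Sum>d\<in>I. c d b *\<^sub>R t' x (tinv t x d)) = t' x (tinv t x (\<Sum>d\<in>I. c d b *\<^sub>R d))"
      using transition_sum[OF assms(2,4) x(2,3) I(1)] by simp
    also have "\<dots> = t' x (tinv t x b)" by (subst I(3)[symmetric]) simp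
    finally show ?thesis using z x assms(1) tmap_inverse[OF assms(1,2), of "\<phi> x" b] by simp
  qed
  ultimately show "smooth_on (\<phi> ` W \<times> UNIV) (tmap \<phi>' t' \<circ> inv_into (tdom U V) (tmap \<phi> t))"
    by (rule iffD1[OF smooth_on_cong[OF ow], rotated])
qed

lemma smooth_atlas_total: "smooth_atlas tot"
  unfolding smooth_atlas_def
proof (intro conjI)
  show "finite_dim TYPE('a \<times> 'v)" by (rule finite_dim_prod[OF fin_dim model_fin_dim])
  have "inj_on \<psi> C \<and> open (\<psi> ` C)" if "(C, \<psi>) \<in> tot" for C \<psi>
    using that
  proof (rule total_chart_cases)
    fix U \<phi> V t assume *: "(U, \<phi>) \<in> A" "(V, t) \<in> triv B" "C = tdom U V" "\<psi> = tmap \<phi> t"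
    then show ?thesis
      using tmap_inj[OF *(1,2)] total_transition(1,2)[OF *(1,2) *(1,2)] by (simp add: open_Times)
  qed
  then show "\<forall>(C, \<psi>)\<in>tot. inj_on \<psi> C \<and> open (\<psi> ` C)" by blast
  have "open (\<psi> ` (C \<inter> C')) \<and> smooth_on (\<psi> ` (C \<inter> C')) (\<psi>' \<circ> inv_into C \<psi>)"
    if C: "(C, \<psi>) \<in> tot" "(C', \<psi>') \<in> tot" for C \<psi> C' \<psi>'
  proof -
    obtain U \<phi> V t where *: "(U, \<phi>) \<in> A" "(V, t) \<in> triv B" "C = tdom U V" "\<psi> = tmap \<phi> t"
      by (rule total_chart_cases[OF C(1)])
    obtain U' \<phi>' V' t' where **: "(U', \<phi>') \<in> A" "(V', t') \<in> triv B" "C' = tdom U' V'" "\<psi>' = tmap \<phi>' t'"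
      by (rule total_chart_cases[OF C(2)])
    show ?thesis
      unfolding *(3,4) **(3,4) total_transition(1)[OF *(1,2) **(1,2)]
      using total_transition(2,3)[OF *(1,2) **(1,2)] open_Times open_UNIV by blast
  qed
  then show "\<forall>(C, \<psi>)\<in>tot. \<forall>(C', \<psi>')\<in>tot.
      open (\<psi> ` (C \<inter> C')) \<and> smooth_on (\<psi> ` (C \<inter> C')) (\<psi>' \<circ> inv_into C \<psi>)" by blast
qed

sublocale T: atlas tot
  by standard (rule smooth_atlas_total)

lemma smooth_near_base:
  assumes "smooth_near A g x" "w \<in> fib B x"
  shows "smooth_near tot (\<lambda>p. g (fst p)) (x, w)"
proof -
  have x: "x \<in> points A" using assms smooth_near_imp_points by blast
  obtain U \<phi> where U: "(U, \<phi>) \<in> A" "x \<in> U" by (rule chart_at[OF x])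
  obtain V t where V: "(V, t) \<in> triv B" "x \<in> V" by (rule triv_at[OF x])
  note C = total_chart[OF U(1) V(1)]
  have xC: "(x, w) \<in> tdom U V" using U V assms by simp
  obtain Q where Q: "open Q" "Q \<subseteq> \<phi> ` U" "\<phi> x \<in> Q" "smooth_on Q (g \<circ> inv_into U \<phi>)"
    by (rule smooth_near_chart[OF assms(1) U])
  have "smooth_near tot (\<lambda>p. fst (tmap \<phi> t p)) (x, w)"
    by (rule T.smooth_near_linear[OF bounded_linear_fst T.smooth_near_local_chart[OF C xC]])
  then have "smooth_near tot (\<lambda>p. (g \<circ> inv_into U \<phi>) (fst (tmap \<phi> t p))) (x, w)"
    by (rule T.smooth_near_compose[OF fin_dim _ Q(1) _ Q(4)]) (use Q in auto)
  then show ?thesis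
    by (rule T.smooth_near_cong[OF _ T.mopen_chart[OF C] xC]) (use U in \<open>auto simp: tdom_def\<close>)
qed

lemma smooth_near_fibre_coordinate:
  assumes "(V, t) \<in> triv B" "x \<in> V" "w \<in> fib B x"
  shows "smooth_near tot (\<lambda>p. t (fst p) (snd p)) (x, w)"
proof -
  obtain U \<phi> where U: "(U, \<phi>) \<in> A" "x \<in> U" by (rule chart_at[OF triv_points[OF assms(1,2)]])
  note C = total_chart[OF U(1) assms(1)]
  have xC: "(x, w) \<in> tdom U V" using U assms by simp
  have "smooth_near tot (\<lambda>p. snd (tmap \<phi> t p)) (x, w)"
    by (rule T.smooth_near_linear[OF bounded_linear_snd T.smooth_near_local_chart[OF C xC]])
  then show ?thesis
    by (rule T.smooth_near_cong[OF _ T.mopen_chart[OF C] xC]) (use U in \<open>auto simp: tdom_def\<close>)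
qed

lemma mopen_over: "mopen A W \<Longrightarrow> mopen tot (points tot \<inter> fst -` W)"
proof -
  assume W: "mopen A W"
  have "open (\<psi> ` (C \<inter> (points tot \<inter> fst -` W)))" if "(C, \<psi>) \<in> tot" for C \<psi>
    using that
  proof (rule total_chart_cases)
    fix U \<phi> V t assume *: "(U, \<phi>) \<in> A" "(V, t) \<in> triv B" "C = tdom U V" "\<psi> = tmap \<phi> t"
    have "C \<inter> (points tot \<inter> fst -` W) = (SIGMA x : U \<inter> (V \<inter> W). fib B x)"
      using * chart_subset_points[OF *(1)] by (auto simp: tdom_def points_total)
    then have "\<psi> ` (C \<inter> (points tot \<inter> fst -` W)) = \<phi> ` (U \<inter> (V \<inter> W)) \<times> UNIV"
      using tmap_image[OF *(1,2), of "U \<inter> (V \<inter> W)"] * by auto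
    moreover have "open (\<phi> ` (U \<inter> (V \<inter> W)))"
      using mopenD[OF mopen_Int[OF triv_mopen[OF *(2)] W] *(1)] .
    ultimately show ?thesis using open_Times open_UNIV by metis
  qed
  then show ?thesis unfolding mopen_def by blast
qed

lemma smooth_map_projection: "smooth_map tot A fst"
proof -
  have "open (\<psi> ` (C \<inter> fst -` U')) \<and> smooth_on (\<psi> ` (C \<inter> fst -` U')) (\<phi>' \<circ> fst \<circ> inv_into C \<psi>)"
    if C: "(C, \<psi>) \<in> tot" and U': "(U', \<phi>') \<in> A" for C \<psi> U' \<phi>'
  proof -
    let ?W = "points tot \<inter> fst -` U'"
    have W: "mopen tot ?W" by (rule mopen_over[OF mopen_chart[OF U']])
    have eq: "C \<inter> fst -` U' = C \<inter> ?W" using T.chart_subset_points[OF C] by blast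
    have "smooth_near tot (\<lambda>p. \<phi>' (fst p)) p" if "p \<in> ?W" for p
      using smooth_near_base[OF smooth_near_local_chart[OF U'], of "fst p" "snd p"] that
      by (auto simp: points_total)
    then have "smooth_fun_on tot ?W (\<phi>' \<circ> fst)"
      by (simp add: T.smooth_fun_on_iff[OF W] comp_def)
    then show ?thesis unfolding eq using C T.mopenD[OF W C] by (auto simp: smooth_fun_on_def)
  qed
  then show ?thesis unfolding smooth_map_def by (fastforce simp: points_total)
qed

lemma smooth_near_along_section:
  assumes "\<sigma> \<in> sections A B" "smooth_near tot h (x, \<sigma> x)"
  shows "smooth_near A (\<lambda>y. h (y, \<sigma> y)) x"
proof -
  have x: "x \<in> points A" using T.smooth_near_imp_points[OF assms(2)] by simp
  obtain U \<phi> where U: "(U, \<phi>) \<in> A" "x \<in> U" by (rule chart_at[OF x])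
  obtain V t where V: "(V, t) \<in> triv B" "x \<in> V" by (rule triv_at[OF x])
  note C = total_chart[OF U(1) V(1)]
  have xC: "(x, \<sigma> x) \<in> tdom U V" using U V sections_fib[OF assms(1) x] by simp
  obtain Q where Q: "open Q" "Q \<subseteq> tmap \<phi> t ` tdom U V" "tmap \<phi> t (x, \<sigma> x) \<in> Q"
    "smooth_on Q (h \<circ> inv_into (tdom U V) (tmap \<phi> t))"
    by (rule T.smooth_near_chart[OF assms(2) C xC])
  have "smooth_near A (\<lambda>y. (\<phi> y, t y (\<sigma> y))) x"
    by (intro smooth_near_Pair smooth_near_local_chart[OF U] sections_smooth_near[OF assms(1) V])
  then have "smooth_near A (\<lambda>y. (h \<circ> inv_into (tdom U V) (tmap \<phi> t)) (\<phi> y, t y (\<sigma> y))) x"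
    by (rule smooth_near_compose[OF T.fin_dim _ Q(1) _ Q(4)]) (use Q in auto)
  then show ?thesis
  proof (rule smooth_near_cong[OF _ mopen_Int[OF mopen_chart[OF U(1)] triv_mopen[OF V(1)]]])
    fix y assume y: "y \<in> U \<inter> V"
    have "\<sigma> y \<in> fib B y" using y triv_points[OF V(1)] sections_fib[OF assms(1)] by blast
    then show "(h \<circ> inv_into (tdom U V) (tmap \<phi> t)) (\<phi> y, t y (\<sigma> y)) = h (y, \<sigma> y)"
      using y T.chart_inverse[OF C, of "(y, \<sigma> y)"] by simp
  qed (use U V in auto)
qed

lemma zero_section: "(\<lambda>_. 0) \<in> sections A B"
  by (simp add: sections_iff section_near_zero)

definition over :: "('p \<Rightarrow> real) \<Rightarrow> 'p \<times> 'e \<Rightarrow> real" where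
  "over \<theta> = restrict_to (points tot) (\<lambda>p. \<theta> (fst p))"

lemma over_apply: "over \<theta> (x, w) = (if x \<in> points A \<and> w \<in> fib B x then \<theta> x else 0)"
  by (simp add: over_def restrict_to_def)

lemma over_Cinf: "f \<in> Cinf A \<Longrightarrow> over f \<in> Cinf tot"
  unfolding T.Cinf_iff
proof (intro conjI ballI allI impI)
  fix p assume f: "f \<in> Cinf A" and p: "p \<in> points tot"
  then obtain x w where xw: "p = (x, w)" "x \<in> points A" "w \<in> fib B x" by (auto simp: points_total)
  show "smooth_near tot (over f) p"
    unfolding xw(1)
    by (rule T.smooth_near_cong[OF smooth_near_base[OF Cinf_smooth_near[OF f xw(2)] xw(3)] T.mopen_points])
      (use xw in \<open>auto simp: over_def restrict_to_def\<close>)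
qed (simp add: over_def restrict_to_def)

lemma over_cutoff:
  assumes "cutoff A W \<theta>"
  shows "cutoff tot (points tot \<inter> fst -` W) (over \<theta>)"
proof -
  obtain W0 where W0: "mopen A W0" "points A \<subseteq> W \<union> W0" "\<forall>q\<in>W0. \<theta> q = 0"
    using assms unfolding cutoff_def by blast
  show ?thesis unfolding cutoff_def
  proof (intro conjI exI[of _ "points tot \<inter> fst -` W0"])
    show "over \<theta> \<in> Cinf tot" using assms over_Cinf by (simp add: cutoff_def)
    show "mopen tot (points tot \<inter> fst -` W0)" by (rule mopen_over[OF W0(1)])
    show "points tot \<subseteq> points tot \<inter> fst -` W \<union> points tot \<inter> fst -` W0"
      using W0(2) by (auto simp: points_total)
    show "\<forall>q\<in>points tot \<inter> fst -` W0. over \<theta> q = 0"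
      using W0(3) by (auto simp: over_def restrict_to_def)
  qed
qed

text \<open>Fibre coordinates are defined on entire fibres, so a cutoff pulled back from the base
  already makes them global. Separation is therefore asked of the base, not of the total
  space.\<close>

lemma total_has_coordinates:
  assumes "Hausdorff_space (manifold_topology A)" "(x, w) \<in> points tot"
  shows "T.has_coordinates (x, w)"
proof -
  have x: "x \<in> points A" "w \<in> fib B x" using assms by auto
  obtain U \<phi> where U: "(U, \<phi>) \<in> A" "x \<in> U" by (rule chart_at[OF x(1)])
  obtain V t where V: "(V, t) \<in> triv B" "x \<in> V" by (rule triv_at[OF x(1)])
  note C = total_chart[OF U(1) V(1)]
  have oUV: "mopen A (U \<inter> V)" "x \<in> U \<inter> V" using U V mopen_Int mopen_chart triv_mopen by auto
  obtain \<theta> W' where \<theta>: "cutoff A (U \<inter> V) \<theta>" "mopen A W'" "x \<in> W'" "W' \<subseteq> U \<inter> V"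
    "\<forall>q\<in>W'. \<theta> q = 1"
    by (rule cutoff_exists[OF assms(1) oUV])
  have "\<exists>y\<in>Cinf tot. \<exists>W. mopen tot W \<and> (x, w) \<in> W \<and> W \<subseteq> tdom U V \<and> (\<forall>q\<in>W. y q = c (tmap \<phi> t q))"
    if c: "bounded_linear c" for c
  proof (intro bexI exI conjI)
    let ?W = "points tot \<inter> fst -` W'"
    show "(\<lambda>q. over \<theta> q * c (tmap \<phi> t q)) \<in> Cinf tot"
    proof (rule T.cutoff_Cinf[OF over_cutoff[OF \<theta>(1)]])
      fix q assume "q \<in> points tot \<inter> fst -` (U \<inter> V)"
      then have "q \<in> tdom U V" by (auto simp: points_total)
      then show "smooth_near tot (\<lambda>q. c (tmap \<phi> t q)) q"
        by (intro T.smooth_near_linear[OF c] T.smooth_near_local_chart[OF C])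
    qed
    show "mopen tot ?W" by (rule mopen_over[OF \<theta>(2)])
    show "(x, w) \<in> ?W" using x \<theta> by simp
    show "?W \<subseteq> tdom U V" using \<theta>(4) by (auto simp: points_total)
    show "\<forall>q\<in>?W. over \<theta> q * c (tmap \<phi> t q) = c (tmap \<phi> t q)"
      using \<theta>(5) by (auto simp: over_def restrict_to_def)
  qed
  then show ?thesis unfolding T.has_coordinates_def
    using C U V x by (intro exI[of _ "tdom U V"] exI[of _ "tmap \<phi> t"]) auto
qed

end

section \<open>Jacobi brackets\<close>

text \<open>\<open>nonvanishing\<close> is an assumption because its two instances obtain it
  differently: on the ambient manifold from a cutoff frame, on the total space by pulling back
  sections from the base.\<close>

locale jacobi = vec_bundle A L for A :: "('p, 'a::real_inner) atlas" and L :: "('p, 'l::real_vector) line_bundle" +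
  fixes J :: "('p \<Rightarrow> 'l) \<Rightarrow> ('p \<Rightarrow> 'l) \<Rightarrow> 'p \<Rightarrow> 'l"
  assumes jacobi_bracket: "jacobi_bracket A L J"
    and nonvanishing: "p \<in> points A \<Longrightarrow> \<exists>\<eta>\<in>sections A L. \<eta> p \<noteq> 0"
begin

lemma line_multiple:
  assumes "p \<in> points A" "u \<in> fib L p" "e \<in> fib L p" "e \<noteq> 0"
  obtains c where "u = c *\<^sub>R e"
proof -
  obtain V t where V: "(V, t) \<in> triv L" "p \<in> V" by (rule triv_at[OF assms(1)])
  have "t p e \<noteq> 0"
    using triv_inj[OF V assms(3) fib_zero[OF assms(1)]] triv_zero[OF V] assms(4) by auto
  then have "t p u = t p ((t p u / t p e) *\<^sub>R e)" using triv_scale[OF V assms(3)] by simp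
  then have "u = (t p u / t p e) *\<^sub>R e"
    by (rule triv_inj[OF V assms(2) fib_scale[OF assms(1,3)]])
  with that show ?thesis .
qed

abbreviation ham :: "('p \<Rightarrow> 'l) \<Rightarrow> ('p \<Rightarrow> real) \<Rightarrow> 'p \<Rightarrow> real" where
  "ham \<equiv> hamiltonian A L J"

lemma derivation_symbol_apply:
  assumes "derivation_with_symbol A L \<Delta> X" "f \<in> Cinf A" "\<eta> \<in> sections A L"
  shows "\<Delta> (smul f \<eta>) p = X f p *\<^sub>R \<eta> p + f p *\<^sub>R \<Delta> \<eta> p"
  using assms unfolding derivation_with_symbol_def by (simp add: smul_def fun_eq_iff)

lemma derivation_vector_field: "derivation_with_symbol A L \<Delta> X \<Longrightarrow> vector_field A X"
  and derivation_sections: "derivation_with_symbol A L \<Delta> X \<Longrightarrow> \<eta> \<in> sections A L \<Longrightarrow> \<Delta> \<eta> \<in> sections A L"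
  by (simp_all add: derivation_with_symbol_def)

lemma derivation_add: "derivation_with_symbol A L \<Delta> X \<Longrightarrow> \<eta> \<in> sections A L \<Longrightarrow> \<mu> \<in> sections A L \<Longrightarrow>
    \<Delta> (\<lambda>q. \<eta> q + \<mu> q) p = \<Delta> \<eta> p + \<Delta> \<mu> p"
  and derivation_scale: "derivation_with_symbol A L \<Delta> X \<Longrightarrow> \<eta> \<in> sections A L \<Longrightarrow>
    \<Delta> (\<lambda>q. c *\<^sub>R \<eta> q) p = c *\<^sub>R \<Delta> \<eta> p"
  by (simp_all add: derivation_with_symbol_def plus_fun_def fun_eq_iff)

lemma derivation_diff: "derivation_with_symbol A L \<Delta> X \<Longrightarrow> \<eta> \<in> sections A L \<Longrightarrow> \<mu> \<in> sections A L \<Longrightarrow>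
    \<Delta> (\<lambda>q. \<eta> q - \<mu> q) p = \<Delta> \<eta> p - \<Delta> \<mu> p"
  using derivation_add[of \<Delta> X \<eta> "\<lambda>q. (-1) *\<^sub>R \<mu> q"] derivation_scale[of \<Delta> X \<mu> "-1"]
    sections_scale[of \<mu> "-1"] by simp

text \<open>The Leibniz rule on a section that is nonzero at \<open>p\<close> isolates
  \<open>X f p\<close>; for \<open>f\<close> outside \<open>Cinf\<close>, or \<open>p\<close> off
  the manifold, the conventions force the value 0. \<open>symbol\<close> is a definite description,
  and gets its meaning from this uniqueness.\<close>

lemma symbol_unique:
  assumes "derivation_with_symbol A L \<Delta> X" "derivation_with_symbol A L \<Delta> Y"
  shows "X = Y"
proof (intro ext)
  fix f p
  note XY = derivation_vector_field[OF assms(1)] derivation_vector_field[OF assms(2)]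
  show "X f p = Y f p"
  proof (cases "p \<in> points A")
    case p: True
    show ?thesis
    proof (cases "f \<in> Cinf A")
      case True
      obtain \<eta> where \<eta>: "\<eta> \<in> sections A L" "\<eta> p \<noteq> 0" using nonvanishing[OF p] by blast
      have "X f p *\<^sub>R \<eta> p = Y f p *\<^sub>R \<eta> p"
        using derivation_symbol_apply[OF assms(1) True \<eta>(1), of p]
          derivation_symbol_apply[OF assms(2) True \<eta>(1), of p] by (metis add_right_cancel)
      then show ?thesis using \<eta>(2) by auto
    next
      case False
      have zero: "D f = 0" if "D \<in> tangent_space A p" for D
        using that False unfolding tangent_space_def by auto
      show ?thesis
        using zero[OF vector_field_tangent[OF XY(1) p]] zero[OF vector_field_tangent[OF XY(2) p]] by simp
    qed
  next
    case False
    then show ?thesis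
      using vector_field_Cinf[OF XY(1), of f] vector_field_Cinf[OF XY(2), of f] by (simp add: Cinf_def)
  qed
qed

lemma bracket_derivation:
  assumes "\<eta> \<in> sections A L"
  shows "derivation_with_symbol A L (J \<eta>) (ham \<eta>)"
proof -
  obtain X where X: "derivation_with_symbol A L (J \<eta>) X"
    using jacobi_bracket assms unfolding jacobi_bracket_def derivation_def by blast
  show ?thesis unfolding hamiltonian_def symbol_def
    by (rule theI[of "derivation_with_symbol A L (J \<eta>)", OF X]) (rule symbol_unique[OF _ X])
qed

lemmas ham_vector_field = derivation_vector_field[OF bracket_derivation]
  and J_sections = derivation_sections[OF bracket_derivation]
  and J_smul_right = derivation_symbol_apply[OF bracket_derivation]
  and J_add_right = derivation_add[OF bracket_derivation]
  and J_scale_right = derivation_scale[OF bracket_derivation]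

lemmas ham_Cinf = vector_field_Cinf[OF ham_vector_field]
  and ham_tangent = vector_field_tangent[OF ham_vector_field]

text \<open>Polarization of \<open>J \<eta> \<eta> = 0\<close>; additivity in the first entry is
  part of the derivation property there.\<close>

lemma J_antisym:
  assumes "\<eta> \<in> sections A L" "\<mu> \<in> sections A L"
  shows "J \<eta> \<mu> p = - J \<mu> \<eta> p"
proof -
  have s: "(\<lambda>q. \<eta> q + \<mu> q) \<in> sections A L" by (rule sections_add[OF assms])
  have zero: "J \<nu> \<nu> p = 0" if "\<nu> \<in> sections A L" for \<nu>
    using jacobi_bracket that by (simp add: jacobi_bracket_def)
  obtain X where X: "derivation_with_symbol A L (\<lambda>\<nu>. J \<nu> (\<lambda>q. \<eta> q + \<mu> q)) X"
    using jacobi_bracket s unfolding jacobi_bracket_def derivation_def by blast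
  have "0 = J (\<lambda>q. \<eta> q + \<mu> q) (\<lambda>q. \<eta> q + \<mu> q) p" using zero[OF s] by simp
  also have "\<dots> = J \<eta> (\<lambda>q. \<eta> q + \<mu> q) p + J \<mu> (\<lambda>q. \<eta> q + \<mu> q) p"
    by (rule derivation_add[OF X assms])
  also have "\<dots> = J \<eta> \<mu> p + J \<mu> \<eta> p"
    using J_add_right[OF assms(1) assms] J_add_right[OF assms(2) assms] zero assms by simp
  finally show ?thesis by (simp add: eq_neg_iff_add_eq_0)
qed

lemma J_smul_left:
  assumes "f \<in> Cinf A" "\<eta> \<in> sections A L" "\<mu> \<in> sections A L"
  shows "J (smul f \<eta>) \<mu> p = f p *\<^sub>R J \<eta> \<mu> p - ham \<mu> f p *\<^sub>R \<eta> p"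
  using J_antisym[OF sections_smul[OF assms(1,2)] assms(3), of p] J_smul_right[OF assms(3,1,2), of p]
    J_antisym[OF assms(2,3), of p] by simp

lemma J_add_left:
  assumes "\<eta> \<in> sections A L" "\<mu> \<in> sections A L" "\<nu> \<in> sections A L"
  shows "J (\<lambda>q. \<eta> q + \<mu> q) \<nu> p = J \<eta> \<nu> p + J \<mu> \<nu> p"
  using J_antisym[OF sections_add[OF assms(1,2)] assms(3), of p] J_add_right[OF assms(3,1,2), of p]
    J_antisym[OF assms(1,3), of p] J_antisym[OF assms(2,3), of p] by simp

text \<open>The bivector of the Jacobi structure, contracted with \<open>df \<otimes> \<eta>\<close>
  and \<open>dg\<close>. It is kept as a function of \<open>p\<close>, since it will itself be
  differentiated along a vector field.\<close>

definition lam :: "('p \<Rightarrow> 'l) \<Rightarrow> ('p \<Rightarrow> real) \<Rightarrow> ('p \<Rightarrow> real) \<Rightarrow> 'p \<Rightarrow> real" where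
  "lam \<eta> f g p = ham (smul f \<eta>) g p - f p * ham \<eta> g p"

lemma Lambda_sharp_eq: "Lambda_sharp A L J f \<eta> p g = lam \<eta> f g p"
  by (simp add: Lambda_sharp_def lam_def)

lemma lam_Cinf:
  assumes "f \<in> Cinf A" "\<eta> \<in> sections A L"
  shows "lam \<eta> f g \<in> Cinf A"
proof -
  have "(\<lambda>p. ham (smul f \<eta>) g p - f p * ham \<eta> g p) \<in> Cinf A"
    by (intro Cinf_diff Cinf_mult ham_Cinf sections_smul assms)
  then show ?thesis unfolding lam_def[abs_def] by simp
qed

text \<open>At a common zero of \<open>f\<close> and \<open>g\<close> only the term
  \<open>lam \<eta> f g p *\<^sub>R \<mu> p\<close> remains; this is how \<open>lam\<close> is read
  off from brackets.\<close>

lemma J_smul_smul: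
  assumes "f \<in> Cinf A" "g \<in> Cinf A" "\<eta> \<in> sections A L" "\<mu> \<in> sections A L"
  shows "J (smul f \<eta>) (smul g \<mu>) p =
    (lam \<eta> f g p + f p * ham \<eta> g p) *\<^sub>R \<mu> p - (g p * ham \<mu> f p) *\<^sub>R \<eta> p + (f p * g p) *\<^sub>R J \<eta> \<mu> p"
  using J_smul_right[OF sections_smul[OF assms(1,3)] assms(2,4), of p] J_smul_left[OF assms(1,3,4), of p]
  by (simp add: lam_def algebra_simps)

text \<open>Antisymmetry of the bivector: both sides are its value, in the fibre of L, on
  \<open>df \<otimes> \<eta>\<close> and \<open>dg \<otimes> \<mu>\<close>. In the absence of a
  frame the sections must change places together with the functions.\<close>

lemma lam_exchange:
  assumes "f \<in> Cinf A" "g \<in> Cinf A" "\<eta> \<in> sections A L" "\<mu> \<in> sections A L"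
  shows "lam \<eta> f g p *\<^sub>R \<mu> p = - (lam \<mu> g f p *\<^sub>R \<eta> p)"
proof -
  have "J (smul f \<eta>) (smul g \<mu>) p = - J (smul g \<mu>) (smul f \<eta>) p"
    by (intro J_antisym sections_smul assms)
  then show ?thesis
    unfolding J_smul_smul[OF assms] J_smul_smul[OF assms(2,1,4,3)]
    using J_antisym[OF assms(3,4), of p] by (simp add: algebra_simps eq_neg_iff_add_eq_0)
qed

lemma lam_cong_right:
  assumes "p \<in> points A" "f \<in> Cinf A" "\<eta> \<in> sections A L"
    "\<And>D. D \<in> tangent_space A p \<Longrightarrow> D g = D g'"
  shows "lam \<eta> f g p = lam \<eta> f g' p"
  using assms(4)[OF ham_tangent[OF sections_smul[OF assms(2,3)] assms(1)]]
    assms(4)[OF ham_tangent[OF assms(3,1)]] by (simp add: lam_def)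

lemma lam_eqI:
  assumes "p \<in> points A" "f \<in> Cinf A" "f' \<in> Cinf A" "g \<in> Cinf A" "\<eta> \<in> sections A L"
    and eq: "\<And>\<mu>. \<mu> \<in> sections A L \<Longrightarrow> lam \<mu> g f p = lam \<mu> g f' p"
  shows "lam \<eta> f g p = lam \<eta> f' g p"
proof -
  obtain \<mu> where \<mu>: "\<mu> \<in> sections A L" "\<mu> p \<noteq> 0" using nonvanishing[OF assms(1)] by blast
  have "lam \<eta> f g p *\<^sub>R \<mu> p = lam \<eta> f' g p *\<^sub>R \<mu> p"
    using lam_exchange[OF assms(2,4,5) \<mu>(1), of p] lam_exchange[OF assms(3,4,5) \<mu>(1), of p] eq[OF \<mu>(1)]
    by simp
  then show ?thesis using \<mu>(2) by simp
qed

text \<open>In the right entry \<open>lam\<close> is a combination of two tangent vectors at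
  \<open>p\<close> applied to \<open>g\<close>. The left entry is moved to the right by
  \<open>lam_exchange\<close>, with division by a section that is nonzero at
  \<open>p\<close>.\<close>

lemma lam_cong:
  assumes "p \<in> points A" "f \<in> Cinf A" "f' \<in> Cinf A" "g \<in> Cinf A" "g' \<in> Cinf A" "\<eta> \<in> sections A L"
    "\<And>D. D \<in> tangent_space A p \<Longrightarrow> D f = D f'" "\<And>D. D \<in> tangent_space A p \<Longrightarrow> D g = D g'"
  shows "lam \<eta> f g p = lam \<eta> f' g' p"
proof -
  have "lam \<eta> f g p = lam \<eta> f' g p"
    by (rule lam_eqI[OF assms(1-4,6)]) (rule lam_cong_right[OF assms(1,4) _ assms(7)])
  also have "\<dots> = lam \<eta> f' g' p" by (rule lam_cong_right[OF assms(1,3,6,8)])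
  finally show ?thesis .
qed

lemma lam_comb_right:
  assumes "p \<in> points A" "f \<in> Cinf A" "\<eta> \<in> sections A L" "g \<in> Cinf A" "g' \<in> Cinf A"
  shows "lam \<eta> f (\<lambda>q. g q - c * g' q) p = lam \<eta> f g p - c * lam \<eta> f g' p"
proof -
  have "D (\<lambda>q. g q - c * g' q) = D g - c * D g'" if "D \<in> tangent_space A p" for D
    using tangent_diff[OF that assms(4) Cinf_scale[OF assms(5)]] tangent_scale[OF that assms(5)] by simp
  note D = this[OF ham_tangent[OF sections_smul[OF assms(2,3)] assms(1)]] this[OF ham_tangent[OF assms(3,1)]]
  show ?thesis unfolding lam_def D by (simp add: algebra_simps)
qed

lemma lam_comb_left:
  assumes "p \<in> points A" "f \<in> Cinf A" "f' \<in> Cinf A" "\<eta> \<in> sections A L" "g \<in> Cinf A"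
  shows "lam \<eta> (\<lambda>q. f q - c * f' q) g p = lam \<eta> f g p - c * lam \<eta> f' g p"
proof -
  obtain \<mu> where \<mu>: "\<mu> \<in> sections A L" "\<mu> p \<noteq> 0" using nonvanishing[OF assms(1)] by blast
  have C: "(\<lambda>q. f q - c * f' q) \<in> Cinf A" by (intro Cinf_diff Cinf_scale assms)
  have "lam \<eta> (\<lambda>q. f q - c * f' q) g p *\<^sub>R \<mu> p = - (lam \<mu> g (\<lambda>q. f q - c * f' q) p *\<^sub>R \<eta> p)"
    by (rule lam_exchange[OF C assms(5,4) \<mu>(1)])
  also have "\<dots> = - (lam \<mu> g f p *\<^sub>R \<eta> p) + c *\<^sub>R (lam \<mu> g f' p *\<^sub>R \<eta> p)"
    by (simp add: lam_comb_right[OF assms(1,5) \<mu>(1) assms(2,3)] algebra_simps)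
  also have "\<dots> = (lam \<eta> f g p - c * lam \<eta> f' g p) *\<^sub>R \<mu> p"
    by (simp add: scaleR_left_diff_distrib lam_exchange[OF assms(2,5,4) \<mu>(1)]
        lam_exchange[OF assms(3,5,4) \<mu>(1)] flip: scaleR_scaleR)
  finally show ?thesis using \<mu>(2) by simp
qed

text \<open>By \<open>lam_exchange\<close> the conclusion times \<open>\<eta>0 p\<close> is a
  multiple of \<open>lam \<eta>0 g f p\<close>; so it suffices to know the vanishing for one section
  that is nonzero at \<open>p\<close>.\<close>

lemma lam_zero_transfer:
  assumes "p \<in> points A" "f \<in> Cinf A" "g \<in> Cinf A" "\<eta> \<in> sections A L" "\<eta>0 \<in> sections A L" "\<eta>0 p \<noteq> 0"
    "lam \<eta>0 g f p = 0"
  shows "lam \<eta> f g p = 0"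
  using lam_exchange[OF assms(2-5), of p] assms(6,7) by simp

end

text \<open>The Schouten--Jacobi bracket \<open>bd\<close> of \<open>J\<close> with a derivation \<open>\<Delta>\<close>, and the symbol of \<open>bd\<close> in its
  first argument.\<close>
locale jacobi_derivation = jacobi +
  fixes \<Delta> X
  assumes der: "derivation_with_symbol A L \<Delta> X"
begin

definition bd :: "('a \<Rightarrow> 'c) \<Rightarrow> ('a \<Rightarrow> 'c) \<Rightarrow> 'a \<Rightarrow> 'c" where
  "bd \<eta> \<mu> p = J (\<Delta> \<eta>) \<mu> p + J \<eta> (\<Delta> \<mu>) p - \<Delta> (J \<eta> \<mu>) p"

definition bd_symbol :: "('a \<Rightarrow> 'c) \<Rightarrow> ('a \<Rightarrow> real) \<Rightarrow> 'a \<Rightarrow> real" where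
  "bd_symbol \<nu> f p = X (ham \<nu> f) p - ham \<nu> (X f) p - ham (\<Delta> \<nu>) f p"

lemmas \<Delta>_sections = derivation_sections[OF der]
  and \<Delta>_smul = derivation_symbol_apply[OF der]
  and X_field = derivation_vector_field[OF der]
  and X_Cinf = vector_field_Cinf[OF derivation_vector_field[OF der]]
  and X_tangent = vector_field_tangent[OF derivation_vector_field[OF der]]

lemma \<Delta>_smul_fun:
  "f \<in> Cinf A \<Longrightarrow> \<eta> \<in> sections A L \<Longrightarrow> \<Delta> (smul f \<eta>) = (\<lambda>q. smul (X f) \<eta> q + smul f (\<Delta> \<eta>) q)"
  using \<Delta>_smul by (auto simp: smul_def)

lemma bd_antisym:
  assumes "\<eta> \<in> sections A L" "\<mu> \<in> sections A L"
  shows "bd \<eta> \<mu> p = - bd \<mu> \<eta> p"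
proof -
  have "J \<eta> \<mu> = (\<lambda>q. (-1) *\<^sub>R J \<mu> \<eta> q)" using J_antisym[OF assms] by auto
  then have "\<Delta> (J \<eta> \<mu>) p = - \<Delta> (J \<mu> \<eta>) p"
    using derivation_scale[OF der J_sections[OF assms(2,1)], of "-1" p] by simp
  then show ?thesis
    unfolding bd_def
    using J_antisym[OF \<Delta>_sections[OF assms(1)] assms(2), of p] J_antisym[OF assms(1) \<Delta>_sections[OF assms(2)], of p]
    by simp
qed

text \<open>The terms \<open>X f p *\<^sub>R J \<eta> \<nu> p\<close> and
  \<open>ham \<nu> f p *\<^sub>R \<Delta> \<eta> p\<close> each occur twice and cancel. What is left
  as symbol is the commutator of \<open>X\<close> with the Hamiltonian vector field of
  \<open>\<nu>\<close>, minus the Hamiltonian vector field of \<open>\<Delta> \<nu>\<close>.\<close>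

lemma bd_smul_left:
  assumes f: "f \<in> Cinf A" and \<eta>: "\<eta> \<in> sections A L" and \<nu>: "\<nu> \<in> sections A L"
  shows "bd (smul f \<eta>) \<nu> p = bd_symbol \<nu> f p *\<^sub>R \<eta> p + f p *\<^sub>R bd \<eta> \<nu> p"
proof -
  note [simp] = X_Cinf \<Delta>_sections sections_smul J_sections ham_Cinf f \<eta> \<nu>
  have 1: "J (\<Delta> (smul f \<eta>)) \<nu> p = X f p *\<^sub>R J \<eta> \<nu> p - ham \<nu> (X f) p *\<^sub>R \<eta> p
      + (f p *\<^sub>R J (\<Delta> \<eta>) \<nu> p - ham \<nu> f p *\<^sub>R \<Delta> \<eta> p)"
    using J_add_left[of "smul (X f) \<eta>" "smul f (\<Delta> \<eta>)" \<nu> p] by (simp add: \<Delta>_smul_fun J_smul_left)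
  have 2: "J (smul f \<eta>) (\<Delta> \<nu>) p = f p *\<^sub>R J \<eta> (\<Delta> \<nu>) p - ham (\<Delta> \<nu>) f p *\<^sub>R \<eta> p"
    by (simp add: J_smul_left)
  have "J (smul f \<eta>) \<nu> = (\<lambda>q. smul f (J \<eta> \<nu>) q - smul (ham \<nu> f) \<eta> q)"
    using J_smul_left[OF f \<eta> \<nu>] by (auto simp: smul_def)
  then have 3: "\<Delta> (J (smul f \<eta>) \<nu>) p = X f p *\<^sub>R J \<eta> \<nu> p + f p *\<^sub>R \<Delta> (J \<eta> \<nu>) p
      - (X (ham \<nu> f) p *\<^sub>R \<eta> p + ham \<nu> f p *\<^sub>R \<Delta> \<eta> p)"
    using derivation_diff[OF der, of "smul f (J \<eta> \<nu>)" "smul (ham \<nu> f) \<eta>" p] by (simp add: \<Delta>_smul)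
  show ?thesis unfolding bd_def bd_symbol_def 1 2 3 by (simp add: algebra_simps)
qed

lemma vector_field_comb:
  assumes "vector_field A Y" "f \<in> Cinf A" "g \<in> Cinf A"
  shows "Y (\<lambda>q. a * f q - b * g q) = (\<lambda>q. a * Y f q - b * Y g q)"
proof (rule ext)
  fix p
  show "Y (\<lambda>q. a * f q - b * g q) p = a * Y f p - b * Y g p"
  proof (cases "p \<in> points A")
    case True
    note D = vector_field_tangent[OF assms(1) True]
    show ?thesis
      using tangent_diff[OF D Cinf_scale[OF assms(2)] Cinf_scale[OF assms(3)]]
        tangent_scale[OF D assms(2)] tangent_scale[OF D assms(3)] by simp
  next
    case False
    then show ?thesis using vector_field_Cinf[OF assms(1)] by (simp add: Cinf_def)
  qed
qed

lemma bd_symbol_comb: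
  assumes "\<nu> \<in> sections A L" "f \<in> Cinf A" "g \<in> Cinf A"
  shows "bd_symbol \<nu> (\<lambda>q. a * f q - b * g q) p = a * bd_symbol \<nu> f p - b * bd_symbol \<nu> g p"
  unfolding bd_symbol_def
  by (simp add: vector_field_comb[OF ham_vector_field[OF assms(1)]] vector_field_comb[OF X_field]
      vector_field_comb[OF ham_vector_field[OF \<Delta>_sections[OF assms(1)]]] assms X_Cinf ham_Cinf algebra_simps)

lemma bd_symbol_critical:
  assumes "\<nu> \<in> sections A L" "h \<in> Cinf A" "p \<in> points A" "has_coordinates p"
    "\<And>D. D \<in> tangent_space A p \<Longrightarrow> D h = 0"
  shows "bd_symbol \<nu> h p = 0"
proof -
  have "X (ham \<nu> h) p = ham \<nu> (X h) p"
    by (rule commutator_critical[OF X_field ham_vector_field[OF assms(1)] assms(2-4)]) (rule assms(5))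
  then show ?thesis
    using assms(5)[OF ham_tangent[OF \<Delta>_sections[OF assms(1)] assms(3)]] by (simp add: bd_symbol_def)
qed

text \<open>The 1-jet at \<open>p\<close> of \<open>smul f \<eta>\<close> with
  \<open>f p = 0\<close> is \<open>df \<otimes> \<eta> p\<close>. Measured against the common vector
  \<open>e\<close>, the last hypothesis says that the two products have the same jet; then
  \<open>a f - b f'\<close> is critical at \<open>p\<close> and the symbol annihilates it.\<close>

lemma bd_jet_left:
  assumes p: "p \<in> points A" "has_coordinates p"
    and f: "f \<in> Cinf A" "f p = 0" and f': "f' \<in> Cinf A" "f' p = 0"
    and \<eta>: "\<eta> \<in> sections A L" "\<eta> p = a *\<^sub>R e" and \<eta>': "\<eta>' \<in> sections A L" "\<eta>' p = b *\<^sub>R e"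
    and \<nu>: "\<nu> \<in> sections A L"
    and eq: "\<And>D. D \<in> tangent_space A p \<Longrightarrow> a * D f = b * D f'"
  shows "bd (smul f \<eta>) \<nu> p = bd (smul f' \<eta>') \<nu> p"
proof -
  have "bd_symbol \<nu> (\<lambda>q. a * f q - b * f' q) p = 0"
  proof (rule bd_symbol_critical[OF \<nu> _ p])
    show "(\<lambda>q. a * f q - b * f' q) \<in> Cinf A" by (intro Cinf_diff Cinf_scale f f')
    fix D assume D: "D \<in> tangent_space A p"
    show "D (\<lambda>q. a * f q - b * f' q) = 0"
      using tangent_diff[OF D Cinf_scale[OF f(1)] Cinf_scale[OF f'(1)]]
        tangent_scale[OF D f(1)] tangent_scale[OF D f'(1)] eq[OF D] by simp
  qed
  then have "a * bd_symbol \<nu> f p = b * bd_symbol \<nu> f' p" by (simp add: bd_symbol_comb[OF \<nu> f(1) f'(1)])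
  then show ?thesis
    using f f' \<eta> \<eta>' by (simp add: bd_smul_left \<nu> mult.commute)
qed

lemma bd_jet:
  assumes p: "p \<in> points A" "has_coordinates p"
    and f: "f \<in> Cinf A" "f p = 0" and f': "f' \<in> Cinf A" "f' p = 0"
    and \<eta>: "\<eta> \<in> sections A L" "\<eta> p = a *\<^sub>R e" and \<eta>': "\<eta>' \<in> sections A L" "\<eta>' p = a' *\<^sub>R e"
    and g: "g \<in> Cinf A" "g p = 0" and g': "g' \<in> Cinf A" "g' p = 0"
    and \<mu>: "\<mu> \<in> sections A L" "\<mu> p = b *\<^sub>R e" and \<mu>': "\<mu>' \<in> sections A L" "\<mu>' p = b' *\<^sub>R e"
    and eq: "\<And>D. D \<in> tangent_space A p \<Longrightarrow> a * D f = a' * D f'"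
      "\<And>D. D \<in> tangent_space A p \<Longrightarrow> b * D g = b' * D g'"
  shows "bd (smul f \<eta>) (smul g \<mu>) p = bd (smul f' \<eta>') (smul g' \<mu>') p"
proof -
  note s = sections_smul[OF f(1) \<eta>(1)] sections_smul[OF f'(1) \<eta>'(1)]
    sections_smul[OF g(1) \<mu>(1)] sections_smul[OF g'(1) \<mu>'(1)]
  have "bd (smul f \<eta>) (smul g \<mu>) p = bd (smul f' \<eta>') (smul g \<mu>) p"
    by (rule bd_jet_left[OF p f f' \<eta> \<eta>' s(3) eq(1)])
  also have "\<dots> = - bd (smul g \<mu>) (smul f' \<eta>') p" by (rule bd_antisym[OF s(2,3)])
  also have "bd (smul g \<mu>) (smul f' \<eta>') p = bd (smul g' \<mu>') (smul f' \<eta>') p"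
    by (rule bd_jet_left[OF p g g' \<mu> \<mu>' s(2) eq(2)])
  also have "- bd (smul g' \<mu>') (smul f' \<eta>') p = bd (smul f' \<eta>') (smul g' \<mu>') p"
    using bd_antisym[OF s(2,4)] by simp
  finally show ?thesis .
qed

text \<open>Up to sign, the Lie derivative of the bivector along \<open>\<Delta>\<close>. The first
  three terms will reappear, negated, as the derivative of the coisotropy defect; the last one
  vanishes there because the zero section is coisotropic.\<close>

lemma bd_smul_smul:
  assumes f: "f \<in> Cinf A" "f p = 0" and g: "g \<in> Cinf A" "g p = 0"
    and \<eta>: "\<eta> \<in> sections A L" and \<mu>: "\<mu> \<in> sections A L"
  shows "bd (smul f \<eta>) (smul g \<mu>) p =
    (lam \<eta> (X f) g p + lam \<eta> f (X g) p - X (lam \<eta> f g) p + lam (\<Delta> \<eta>) f g p) *\<^sub>R \<mu> p"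
proof -
  note [simp] = X_Cinf \<Delta>_sections sections_smul J_sections ham_Cinf lam_Cinf Cinf_mult Cinf_add
    f g \<eta> \<mu> sections_add
  have 1: "J (\<Delta> (smul f \<eta>)) (smul g \<mu>) p =
      (lam \<eta> (X f) g p + X f p * ham \<eta> g p) *\<^sub>R \<mu> p + lam (\<Delta> \<eta>) f g p *\<^sub>R \<mu> p"
    using J_add_left[of "smul (X f) \<eta>" "smul f (\<Delta> \<eta>)" "smul g \<mu>" p]
    by (simp add: \<Delta>_smul_fun J_smul_smul)
  have 2: "J (smul f \<eta>) (\<Delta> (smul g \<mu>)) p =
      lam \<eta> f (X g) p *\<^sub>R \<mu> p - (X g p * ham \<mu> f p) *\<^sub>R \<eta> p + lam \<eta> f g p *\<^sub>R \<Delta> \<mu> p"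
    using J_add_right[of "smul f \<eta>" "smul (X g) \<mu>" "smul g (\<Delta> \<mu>)" p]
    by (simp add: \<Delta>_smul_fun J_smul_smul)
  \<comment> \<open>The coefficients in \<open>J_smul_smul\<close> as functions:
    \<open>\<Delta>\<close> differentiates the bracket, so its value at \<open>p\<close> would not
    be enough. At \<open>p\<close> the functions \<open>?b\<close> and \<open>?c\<close> vanish, the
    latter to second order.\<close>
  let ?a = "\<lambda>q. lam \<eta> f g q + f q * ham \<eta> g q" and ?b = "\<lambda>q. g q * ham \<mu> f q" and ?c = "\<lambda>q. f q * g q"
  have Xa: "X ?a p = X (lam \<eta> f g) p + X f p * ham \<eta> g p" if p: "p \<in> points A"
    using tangent_add[OF X_tangent[OF p], of "lam \<eta> f g" "\<lambda>q. f q * ham \<eta> g q"]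
      tangent_mult[OF X_tangent[OF p], of f "ham \<eta> g"] by simp
  have Xb: "X ?b p = X g p * ham \<mu> f p" if p: "p \<in> points A"
    using tangent_mult[OF X_tangent[OF p], of g "ham \<mu> f"] by simp
  have Xc: "X ?c p = 0" if p: "p \<in> points A"
    using tangent_mult[OF X_tangent[OF p], of f g] by simp
  show ?thesis
  proof (cases "p \<in> points A")
    case True
    have "J (smul f \<eta>) (smul g \<mu>) = (\<lambda>q. (smul ?a \<mu> q - smul ?b \<eta> q) + smul ?c (J \<eta> \<mu>) q)"
      using J_smul_smul[OF f(1) g(1) \<eta> \<mu>] by (auto simp: smul_def)
    then have "\<Delta> (J (smul f \<eta>) (smul g \<mu>)) p = \<Delta> (smul ?a \<mu>) p - \<Delta> (smul ?b \<eta>) p + \<Delta> (smul ?c (J \<eta> \<mu>)) p"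
      using derivation_add[OF der, of "\<lambda>q. smul ?a \<mu> q - smul ?b \<eta> q" "smul ?c (J \<eta> \<mu>)" p]
        derivation_diff[OF der, of "smul ?a \<mu>" "smul ?b \<eta>" p] sections_diff by simp
    then have 3: "\<Delta> (J (smul f \<eta>) (smul g \<mu>)) p =
        (X (lam \<eta> f g) p + X f p * ham \<eta> g p) *\<^sub>R \<mu> p + lam \<eta> f g p *\<^sub>R \<Delta> \<mu> p - (X g p * ham \<mu> f p) *\<^sub>R \<eta> p"
      by (simp add: \<Delta>_smul Xa[OF True] Xb[OF True] Xc[OF True])
    show ?thesis unfolding bd_def 1 2 3 by (simp add: algebra_simps)
  next
    case False
    have off: "\<nu> p = 0" if "\<nu> \<in> sections A L" for \<nu> using sections_off[OF that False] .
    have "\<mu> p = 0" "J (\<Delta> (smul f \<eta>)) (smul g \<mu>) p = 0" "J (smul f \<eta>) (\<Delta> (smul g \<mu>)) p = 0"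
      "\<Delta> (J (smul f \<eta>) (smul g \<mu>)) p = 0"
      by (intro off; simp)+
    then show ?thesis by (simp add: bd_def)
  qed
qed

end

section \<open>Vertical vector fields and fibre-linear functions\<close>

context vec_bundle
begin

text \<open>The fibrewise constant vertical vector field of \<open>s\<close>. The guards are forced
  by \<open>vector_field\<close>: functions outside \<open>Cinf\<close> must go to 0, and results
  must vanish off the total space.\<close>

definition vert :: "('p \<Rightarrow> 'e) \<Rightarrow> ('p \<times> 'e \<Rightarrow> real) \<Rightarrow> 'p \<times> 'e \<Rightarrow> real" where
  "vert s f = (\<lambda>(x, w). if f \<in> Cinf tot \<and> (x, w) \<in> points tot
     then deriv (\<lambda>r. f (x, w + r *\<^sub>R s x)) 0 else 0)"

lemma chart_formula:
  assumes "(U, \<phi>) \<in> A" "(V, t) \<in> triv B" "(x, w) \<in> tdom U V" 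
  shows "f (x, w) = (f \<circ> inv_into (tdom U V) (tmap \<phi> t)) (\<phi> x, t x w)"
  using T.chart_inverse[OF total_chart[OF assms(1,2)] assms(3)] by simp

lemma line_chart:
  assumes "(U, \<phi>) \<in> A" "(V, t) \<in> triv B" "x \<in> U" "x \<in> V" "w \<in> fib B x" "w' \<in> fib B x"
  shows "f (x, w + r *\<^sub>R w') = (f \<circ> inv_into (tdom U V) (tmap \<phi> t)) (\<phi> x, t x w + r *\<^sub>R t x w')"
proof -
  have x: "x \<in> points A" using chart_subset_points assms by blast
  have rw: "r *\<^sub>R w' \<in> fib B x" by (rule fib_scale[OF x assms(6)])
  have "t x (w + r *\<^sub>R w') = t x w + r *\<^sub>R t x w'"
    using triv_add[OF assms(2,4,5) rw] triv_scale[OF assms(2,4,6)] by simp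
  then show ?thesis
    using chart_formula[OF assms(1,2), of x "w + r *\<^sub>R w'" f] assms fib_add[OF x assms(5) rw] by simp
qed

text \<open>A chart of the total space is linear on fibres, so it turns the line in the fibre into a
  straight line with direction \<open>(0, t x w')\<close>.\<close>

lemma line_derivative:
  assumes "(U, \<phi>) \<in> A" "(V, t) \<in> triv B" "x \<in> U" "x \<in> V" "w \<in> fib B x" "w' \<in> fib B x" "f \<in> Cinf tot"
  shows "((\<lambda>r. f (x, w + r *\<^sub>R w')) has_real_derivative
    chart_derivative (tdom U V) (tmap \<phi> t) f (x, w) (0, t x w')) (at 0)"
proof -
  let ?D = "chart_derivative (tdom U V) (tmap \<phi> t) f (x, w)"
  let ?f = "f \<circ> inv_into (tdom U V) (tmap \<phi> t)"
  have f: "(?f has_derivative ?D) (at (\<phi> x, t x w + 0 *\<^sub>R t x w'))"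
    using T.Cinf_chart_has_derivative[OF assms(7) total_chart[OF assms(1,2)], of "(x, w)"] assms by simp
  have "((\<lambda>r. (\<phi> x, t x w + r *\<^sub>R t x w')) has_derivative (\<lambda>h. (0, h *\<^sub>R t x w'))) (at 0)"
    by (auto intro!: derivative_eq_intros has_derivative_Pair)
  from has_derivative_compose[OF this f]
  have "((\<lambda>r. f (x, w + r *\<^sub>R w')) has_derivative (\<lambda>h. ?D (0, h *\<^sub>R t x w'))) (at 0)"
    by (simp only: line_chart[OF assms(1-6)])
  moreover have "(\<lambda>h. ?D (0, h *\<^sub>R t x w')) = (*) (?D (0, t x w'))"
  proof
    fix h
    show "?D (0, h *\<^sub>R t x w') = ?D (0, t x w') * h"
      using linear_scale[OF has_derivative_linear[OF f], of h "(0, t x w')"] by (simp add: mult.commute)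
  qed
  ultimately show ?thesis by (simp add: has_field_derivative_def)
qed

text \<open>Charts of the total space contain whole fibres. The entire line therefore lies in one
  chart, and the function is smooth for all real parameters without any patching.\<close>

lemma line_smooth:
  assumes "f \<in> Cinf tot" "x \<in> points A" "w \<in> fib B x"
  shows "smooth_on UNIV (\<lambda>r. f (x, r *\<^sub>R w))"
proof -
  obtain U \<phi> where U: "(U, \<phi>) \<in> A" "x \<in> U" by (rule chart_at[OF assms(2)])
  obtain V t where V: "(V, t) \<in> triv B" "x \<in> V" by (rule triv_at[OF assms(2)])
  note C = total_chart[OF U(1) V(1)]
  have "smooth_on UNIV (\<lambda>r. (f \<circ> inv_into (tdom U V) (tmap \<phi> t)) (\<phi> x, r *\<^sub>R t x w))"
  proof (rule smooth_on_compose[OF T.fin_dim open_UNIV T.chart_open[OF C] _ _ T.Cinf_chart[OF assms(1) C]])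
    show "(\<lambda>r. (\<phi> x, r *\<^sub>R t x w)) ` UNIV \<subseteq> tmap \<phi> t ` tdom U V"
    proof (rule image_subsetI)
      fix r :: real
      have "(\<phi> x, r *\<^sub>R t x w) = tmap \<phi> t (x, r *\<^sub>R w)"
        using triv_scale[OF V assms(3)] by simp
      moreover have "(x, r *\<^sub>R w) \<in> tdom U V" using U V fib_scale[OF assms(2,3)] by simp
      ultimately show "(\<phi> x, r *\<^sub>R t x w) \<in> tmap \<phi> t ` tdom U V" by blast
    qed
    show "smooth_on UNIV (\<lambda>r. (\<phi> x, r *\<^sub>R t x w))"
      by (intro smooth_on_Pair smooth_on_const smooth_on_scaleR open_UNIV smooth_on_linear[OF bounded_linear_ident])
  qed
  then show ?thesis
    using line_chart[OF U(1) V(1) U(2) V(2) fib_zero[OF assms(2)] assms(3), of f] triv_zero[OF V] by simp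
qed

lemma vert_chart:
  assumes "(U, \<phi>) \<in> A" "(V, t) \<in> triv B" "(x, w) \<in> tdom U V" "s x \<in> fib B x" "f \<in> Cinf tot"
  shows "vert s f (x, w) = chart_derivative (tdom U V) (tmap \<phi> t) f (x, w) (0, t x (s x))"
  using DERIV_imp_deriv[OF line_derivative[OF assms(1,2) _ _ _ assms(4,5), of w]]
    chart_subset_points[OF assms(1)] assms(3,5)
  by (auto simp: vert_def)

lemma vert_off: "p \<notin> points tot \<Longrightarrow> vert s f p = 0"
  by (cases p) (auto simp: vert_def)

lemma vertical_tangent:
  assumes "(x, w) \<in> points tot" "w' \<in> fib B x"
  shows "(\<lambda>f. if f \<in> Cinf tot then deriv (\<lambda>r. f (x, w + r *\<^sub>R w')) 0 else 0) \<in> tangent_space tot (x, w)"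
proof -
  have x: "x \<in> points A" "w \<in> fib B x" using assms by auto
  obtain U \<phi> where U: "(U, \<phi>) \<in> A" "x \<in> U" by (rule chart_at[OF x(1)])
  obtain V t where V: "(V, t) \<in> triv B" "x \<in> V" by (rule triv_at[OF x(1)])
  have "(\<lambda>f. if f \<in> Cinf tot then deriv (\<lambda>r. f (x, w + r *\<^sub>R w')) 0 else 0) =
      (\<lambda>f. if f \<in> Cinf tot then chart_derivative (tdom U V) (tmap \<phi> t) f (x, w) (0, t x w') else 0)"
    using DERIV_imp_deriv[OF line_derivative[OF U(1) V(1) U(2) V(2) x(2) assms(2)]] by auto
  then show ?thesis using T.tangent_spaceI[OF total_chart[OF U(1) V(1)]] U V x by simp
qed

lemma section_chart_smooth:
  assumes "s \<in> sections A B" "(U, \<phi>) \<in> A" "(V, t) \<in> triv B"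
  shows "smooth_on (\<phi> ` (U \<inter> V)) ((\<lambda>y. t y (s y)) \<circ> inv_into U \<phi>)"
proof -
  have "smooth_fun_on A V (\<lambda>y. t y (s y))"
    using sections_smooth_near[OF assms(1,3)] by (simp add: smooth_fun_on_iff[OF triv_mopen[OF assms(3)]])
  then show ?thesis using assms(2) by (auto simp: smooth_fun_on_def)
qed

lemma tchart_image:
  "(U, \<phi>) \<in> A \<Longrightarrow> (V, t) \<in> triv B \<Longrightarrow> tmap \<phi> t ` tdom U V = \<phi> ` (U \<inter> V) \<times> UNIV"
  using tmap_image[of U \<phi> V t "U \<inter> V"] by (simp add: tdom_def)

text \<open>In a chart the direction is \<open>(0, t y (s y))\<close>, which varies with the base
  point; its smoothness and \<open>smooth_on_frechet_derivative_field\<close> give smoothness of the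
  derivative.\<close>

lemma vert_vector_field:
  assumes "s \<in> sections A B"
  shows "vector_field tot (vert s)"
  unfolding vector_field_def
proof (intro conjI allI ballI)
  fix p assume "p \<in> points tot"
  then obtain x w where p: "p = (x, w)" "(x, w) \<in> points tot" by (cases p) auto
  have "(\<lambda>f. vert s f p) = (\<lambda>f. if f \<in> Cinf tot then deriv (\<lambda>r. f (x, w + r *\<^sub>R s x)) 0 else 0)"
    using p by (auto simp: vert_def simp del: mem_points_total)
  then show "(\<lambda>f. vert s f p) \<in> tangent_space tot p"
    using vertical_tangent[OF p(2)] sections_fib[OF assms, of x] p by auto
next
  fix f
  show "vert s f \<in> Cinf tot"
  proof (cases "f \<in> Cinf tot")
    case False
    then have "vert s f = (\<lambda>_. 0)" by (auto simp: vert_def)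
    then show ?thesis using T.Cinf_zero by simp
  next
    case f: True
    show ?thesis unfolding T.Cinf_iff
    proof (intro conjI ballI allI impI)
      fix p assume "p \<in> points tot"
      then obtain x w where p: "p = (x, w)" "x \<in> points A" "w \<in> fib B x" by (cases p) auto
      obtain U \<phi> where U: "(U, \<phi>) \<in> A" "x \<in> U" by (rule chart_at[OF p(2)])
      obtain V t where V: "(V, t) \<in> triv B" "x \<in> V" by (rule triv_at[OF p(2)])
      note C = total_chart[OF U(1) V(1)]
      have pC: "p \<in> tdom U V" using p U V by simp
      let ?f = "f \<circ> inv_into (tdom U V) (tmap \<phi> t)" and ?Q = "tmap \<phi> t ` tdom U V"
      let ?s = "(\<lambda>y. t y (s y)) \<circ> inv_into U \<phi>"
      have o: "open (\<phi> ` (U \<inter> V))" using mopenD[OF triv_mopen[OF V(1)] U(1)] .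
      have "smooth_on ?Q (\<lambda>z. frechet_derivative ?f (at z) (0, ?s (fst z)))"
        by (intro smooth_on_frechet_derivative_field[OF T.fin_dim T.chart_open[OF C] T.Cinf_chart[OF f C]]
            smooth_on_Pair T.chart_open[OF C] smooth_on_const)
          (simp only: tchart_image[OF U(1) V(1)] smooth_on_fst_product[OF o section_chart_smooth[OF assms U(1) V(1)]])
      then have "smooth_near tot (\<lambda>q. frechet_derivative ?f (at (tmap \<phi> t q)) (0, ?s (fst (tmap \<phi> t q)))) p"
        by (rule T.smooth_near_compose[OF T.fin_dim T.smooth_near_local_chart[OF C pC] T.chart_open[OF C], rotated])
          (use pC in auto)
      then show "smooth_near tot (vert s f) p"
      proof (rule T.smooth_near_cong[OF _ T.mopen_chart[OF C] pC])
        fix q assume q: "q \<in> tdom U V"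
        obtain y u where yu: "q = (y, u)" by (cases q)
        have "s y \<in> fib B y" using sections_fib[OF assms] chart_subset_points[OF U(1)] q yu by auto
        then show "frechet_derivative ?f (at (tmap \<phi> t q)) (0, ?s (fst (tmap \<phi> t q))) = vert s f q"
          using vert_chart[OF U(1) V(1) _ _ f, of y u s] q yu U(1) by (simp add: chart_derivative_def)
      qed
    qed (rule vert_off)
  qed
qed


section \<open>Translation by a section and tangent vectors along the zero section\<close>

lemma translate_chart:
  assumes "\<sigma> \<in> sections A B" "(U, \<phi>) \<in> A" "(V, t) \<in> triv B" "(y, u) \<in> tdom U V"
  shows "translate \<sigma> f (y, u) = (f \<circ> inv_into (tdom U V) (tmap \<phi> t)) (\<phi> y, t y u - t y (\<sigma> y))"
    "(y, u - \<sigma> y) \<in> tdom U V"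
proof -
  have y: "y \<in> points A" "y \<in> V" "u \<in> fib B y" using chart_subset_points[OF assms(2)] assms(4) by auto
  have \<sigma>: "\<sigma> y \<in> fib B y" by (rule sections_fib[OF assms(1) y(1)])
  show "(y, u - \<sigma> y) \<in> tdom U V" using assms(4) fib_diff[OF y(1,3) \<sigma>] by simp
  then show "translate \<sigma> f (y, u) = (f \<circ> inv_into (tdom U V) (tmap \<phi> t)) (\<phi> y, t y u - t y (\<sigma> y))"
    using chart_formula[OF assms(2,3), of y "u - \<sigma> y" f] triv_diff[OF assms(3) y(2,3) \<sigma>]
    by (simp add: translate_def)
qed

lemma translate_Cinf:
  assumes "\<sigma> \<in> sections A B" "f \<in> Cinf tot"
  shows "translate \<sigma> f \<in> Cinf tot"
  unfolding T.Cinf_iff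
proof (intro conjI ballI allI impI)
  fix p assume "p \<in> points tot"
  then obtain x w where p: "p = (x, w)" "x \<in> points A" "w \<in> fib B x" by (cases p) auto
  obtain U \<phi> where U: "(U, \<phi>) \<in> A" "x \<in> U" by (rule chart_at[OF p(2)])
  obtain V t where V: "(V, t) \<in> triv B" "x \<in> V" by (rule triv_at[OF p(2)])
  note C = total_chart[OF U(1) V(1)]
  have pC: "p \<in> tdom U V" using p U V by simp
  let ?f = "f \<circ> inv_into (tdom U V) (tmap \<phi> t)" and ?Q = "tmap \<phi> t ` tdom U V"
  have "smooth_near tot (\<lambda>q. (\<phi> (fst q), t (fst q) (snd q) - t (fst q) (\<sigma> (fst q)))) p"
    unfolding p(1)
    by (intro T.smooth_near_Pair T.smooth_near_diff smooth_near_base[OF _ p(3)]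
        smooth_near_local_chart[OF U] smooth_near_fibre_coordinate[OF V p(3)] sections_smooth_near[OF assms(1) V]
        smooth_near_base[OF sections_smooth_near[OF assms(1) V] p(3)])
  then have "smooth_near tot (\<lambda>q. ?f (\<phi> (fst q), t (fst q) (snd q) - t (fst q) (\<sigma> (fst q)))) p"
  proof (rule T.smooth_near_compose[OF T.fin_dim _ T.chart_open[OF C] _ T.Cinf_chart[OF assms(2) C]])
    show "(\<phi> (fst p), t (fst p) (snd p) - t (fst p) (\<sigma> (fst p))) \<in> ?Q"
      unfolding tchart_image[OF U(1) V(1)] using p U V by auto
  qed
  then show "smooth_near tot (translate \<sigma> f) p"
    by (rule T.smooth_near_cong[OF _ T.mopen_chart[OF C] pC])
      (use translate_chart(1)[OF assms(1) U(1) V(1), of _ _ f] in auto)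
next
  fix p assume p: "p \<notin> points tot"
  obtain x w where xw: "p = (x, w)" by (cases p)
  \<comment> \<open>Fibres are closed under adding \<open>\<sigma> x\<close>, so translation never
    brings an outside point into the total space and the convention of vanishing outside is
    preserved.\<close>
  have "(x, w - \<sigma> x) \<notin> points tot"
    using p xw fib_add[of x "w - \<sigma> x" "\<sigma> x"] sections_fib[OF assms(1), of x] by auto
  then show "translate \<sigma> f p = 0" using assms(2) xw by (simp add: translate_def T.Cinf_iff)
qed

text \<open>The push-forward of \<open>D\<close> along the diffeomorphism sending
  \<open>(y, u)\<close> to \<open>(y, u - \<sigma> y)\<close>. For \<open>w = \<sigma> x\<close> it
  brings a tangent vector on the image of \<open>\<sigma>\<close> back to the zero section, where
  differentials of test functions are compared.\<close>

lemma tangent_translate: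
  assumes "\<sigma> \<in> sections A B" "D \<in> tangent_space tot (x, w)"
  shows "(\<lambda>f. if f \<in> Cinf tot then D (translate \<sigma> f) else 0) \<in> tangent_space tot (x, w - \<sigma> x)"
proof -
  have x: "x \<in> points A" "w \<in> fib B x" using T.tangent_at[OF assms(2)] by auto
  obtain U \<phi> where U: "(U, \<phi>) \<in> A" "x \<in> U" by (rule chart_at[OF x(1)])
  obtain V t where V: "(V, t) \<in> triv B" "x \<in> V" by (rule triv_at[OF x(1)])
  note C = total_chart[OF U(1) V(1)]
  have pC: "(x, w) \<in> tdom U V" using x U V by simp
  obtain v where v: "\<And>f. f \<in> Cinf tot \<Longrightarrow> D f = chart_derivative (tdom U V) (tmap \<phi> t) f (x, w) v"
    by (rule T.tangent_space_chart[OF assms(2) C pC]) blast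
  let ?s = "(\<lambda>y. t y (\<sigma> y)) \<circ> inv_into U \<phi>"
  let ?T = "\<lambda>z. (fst z, snd z - ?s (fst z))"
  have o: "open (\<phi> ` (U \<inter> V))" using mopenD[OF triv_mopen[OF V(1)] U(1)] .
  have oo: "open (\<phi> ` (U \<inter> V) \<times> (UNIV :: 'v set))" by (rule open_Times[OF o open_UNIV])
  have "smooth_on (\<phi> ` (U \<inter> V) \<times> (UNIV :: 'v set)) ?T"
    by (intro smooth_on_Pair smooth_on_diff oo smooth_on_linear bounded_linear_fst bounded_linear_snd
        smooth_on_fst_product[OF o section_chart_smooth[OF assms(1) U(1) V(1)]])
  then have T: "(?T has_derivative frechet_derivative ?T (at (\<phi> x, t x w))) (at (\<phi> x, t x w))"
    by (rule smooth_on_imp_has_derivative) (use U V in auto)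
  let ?v = "frechet_derivative ?T (at (\<phi> x, t x w)) v"
  have "D (translate \<sigma> f) = chart_derivative (tdom U V) (tmap \<phi> t) f (x, w - \<sigma> x) ?v" if f: "f \<in> Cinf tot" for f
  proof -
    let ?f = "f \<circ> inv_into (tdom U V) (tmap \<phi> t)"
    note tr = translate_chart(1)[OF assms(1) U(1) V(1), where f = f]
      translate_chart(2)[OF assms(1) U(1) V(1)]
    have "?T (\<phi> x, t x w) = tmap \<phi> t (x, w - \<sigma> x)"
      using U V x triv_diff[OF V x(2) sections_fib[OF assms(1) x(1)]] by simp
    then have "(?f has_derivative chart_derivative (tdom U V) (tmap \<phi> t) f (x, w - \<sigma> x)) (at (?T (\<phi> x, t x w)))"
      using T.Cinf_chart_has_derivative[OF f C tr(2)[OF pC]] by simp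
    from has_derivative_compose[OF T this]
    have "((\<lambda>z. ?f (?T z)) has_derivative
        (\<lambda>v. chart_derivative (tdom U V) (tmap \<phi> t) f (x, w - \<sigma> x) (frechet_derivative ?T (at (\<phi> x, t x w)) v)))
        (at (\<phi> x, t x w))" .
    then have "(translate \<sigma> f \<circ> inv_into (tdom U V) (tmap \<phi> t) has_derivative
        (\<lambda>v. chart_derivative (tdom U V) (tmap \<phi> t) f (x, w - \<sigma> x) (frechet_derivative ?T (at (\<phi> x, t x w)) v)))
        (at (\<phi> x, t x w))"
    proof (rule has_derivative_transform_within_open[OF _ T.chart_open[OF C]])
      show "(\<phi> x, t x w) \<in> tmap \<phi> t ` tdom U V" using U V tchart_image[OF U(1) V(1)] by auto
      fix z assume "z \<in> tmap \<phi> t ` tdom U V"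
      then obtain y u where z: "z = tmap \<phi> t (y, u)" "(y, u) \<in> tdom U V" by auto
      then show "?f (?T z) = (translate \<sigma> f \<circ> inv_into (tdom U V) (tmap \<phi> t)) z"
        using tr(1)[OF z(2)] T.chart_inverse[OF C z(2)] U(1) by simp
    qed
    note fd = frechet_derivative_at[OF this]
    show ?thesis
      unfolding v[OF translate_Cinf[OF assms(1) f]]
      by (subst chart_derivative_def) (simp add: fd[symmetric])
  qed
  then have "(\<lambda>f. if f \<in> Cinf tot then D (translate \<sigma> f) else 0) =
      (\<lambda>f. if f \<in> Cinf tot then chart_derivative (tdom U V) (tmap \<phi> t) f (x, w - \<sigma> x) ?v else 0)" by auto
  then show ?thesis
    using T.tangent_spaceI[OF C translate_chart(2)[OF assms(1) U(1) V(1) pC]] by simp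
qed

lemma restrict_zero_Cinf:
  assumes "f \<in> Cinf tot"
  shows "(\<lambda>y. f (y, 0)) \<in> Cinf A"
  unfolding Cinf_iff
  using assms fib_zero
  by (auto simp: T.Cinf_iff intro!: smooth_near_along_section[OF zero_section])

text \<open>The splitting of \<open>T(NS)\<close> along the zero section into \<open>TS\<close> and
  \<open>NS\<close>. In a chart the zero section is the set with fibre coordinate 0, so the two
  summands are the base and fibre components of the direction.\<close>

lemma tangent_zero_split:
  assumes "D \<in> tangent_space tot (x, 0)"
  obtains u w where "u \<in> tangent_space A x" "w \<in> fib B x"
    "\<And>f. f \<in> Cinf tot \<Longrightarrow> D f = u (\<lambda>y. f (y, 0)) + deriv (\<lambda>r. f (x, r *\<^sub>R w)) 0"
proof -
  have x: "x \<in> points A" "0 \<in> fib B x" using T.tangent_at[OF assms] by auto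
  obtain U \<phi> where U: "(U, \<phi>) \<in> A" "x \<in> U" by (rule chart_at[OF x(1)])
  obtain V t where V: "(V, t) \<in> triv B" "x \<in> V" by (rule triv_at[OF x(1)])
  note C = total_chart[OF U(1) V(1)]
  have pC: "(x, 0) \<in> tdom U V" using x U V by simp
  have t0: "t x 0 = 0" by (rule triv_zero[OF V])
  obtain v where v: "\<And>f. f \<in> Cinf tot \<Longrightarrow> D f = chart_derivative (tdom U V) (tmap \<phi> t) f (x, 0) v"
    by (rule T.tangent_space_chart[OF assms C pC]) blast
  define u where "u = (\<lambda>f. if f \<in> Cinf A then chart_derivative U \<phi> f x (fst v) else 0)"
  define w where "w = tinv t x (snd v)"
  have "D f = u (\<lambda>y. f (y, 0)) + deriv (\<lambda>r. f (x, r *\<^sub>R w)) 0" if f: "f \<in> Cinf tot" for f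
  proof -
    let ?f = "f \<circ> inv_into (tdom U V) (tmap \<phi> t)" and ?D = "chart_derivative (tdom U V) (tmap \<phi> t) f (x, 0)"
    have D: "(?f has_derivative ?D) (at (\<phi> x, 0))"
      using T.Cinf_chart_has_derivative[OF f C pC] t0 by simp
    have i: "((\<lambda>a. (a, 0 :: 'v)) has_derivative (\<lambda>a. (a, 0))) (at (\<phi> x))"
      by (intro has_derivative_Pair has_derivative_ident has_derivative_const)
    from has_derivative_compose[OF i D]
    have "((\<lambda>a. ?f (a, 0)) has_derivative (\<lambda>a. ?D (a, 0))) (at (\<phi> x))" .
    then have "((\<lambda>y. f (y, 0)) \<circ> inv_into U \<phi> has_derivative (\<lambda>a. ?D (a, 0))) (at (\<phi> x))"
    proof (rule has_derivative_transform_within_open[OF _ mopenD[OF triv_mopen[OF V(1)] U(1)]])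
      fix a assume "a \<in> \<phi> ` (U \<inter> V)"
      then obtain y where y: "a = \<phi> y" "y \<in> U" "y \<in> V" by auto
      then show "?f (a, 0) = ((\<lambda>y. f (y, 0)) \<circ> inv_into U \<phi>) a"
        using chart_formula[OF U(1) V(1), of y 0 f] fib_zero triv_points[OF V(1)] triv_zero[OF V(1)] U(1) by simp
    qed (use U V in auto)
    note fd = frechet_derivative_at[OF this]
    have "u (\<lambda>y. f (y, 0)) = ?D (fst v, 0)"
      using restrict_zero_Cinf[OF f] unfolding u_def
      by (simp add: chart_derivative_def[of U \<phi>] fd[symmetric])
    moreover have "deriv (\<lambda>r. f (x, r *\<^sub>R w)) 0 = ?D (0, snd v)"
      using DERIV_imp_deriv[OF line_derivative[OF U(1) V(1) U(2) V(2) x(2) tinv_fib[OF V] f, of "snd v"]]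
      by (simp add: w_def triv_tinv[OF V])
    moreover have "?D v = ?D (fst v, 0) + ?D (0, snd v)"
      using linear_add[OF has_derivative_linear[OF D], of "(fst v, 0)" "(0, snd v)"] by simp
    ultimately show ?thesis using v[OF f] by simp
  qed
  moreover have "u \<in> tangent_space A x" unfolding u_def by (rule tangent_spaceI[OF U])
  moreover have "w \<in> fib B x" unfolding w_def by (rule tinv_fib[OF V])
  ultimately show ?thesis using that by blast
qed

text \<open>The cutoff acts on the base point alone, so the function is linear on every entire fibre
  and not just near the zero section; the formulas for its translates then have no
  remainder.\<close>

definition flin :: "('p \<Rightarrow> real) \<Rightarrow> ('p \<Rightarrow> 'e \<Rightarrow> 'v) \<Rightarrow> ('v \<Rightarrow> real) \<Rightarrow> 'p \<times> 'e \<Rightarrow> real" where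
  "flin \<theta> t \<kappa> = (\<lambda>(x, w). over \<theta> (x, w) * \<kappa> (t x w))"

lemma flin_Cinf:
  assumes "cutoff A V \<theta>" "(V, t) \<in> triv B" "bounded_linear \<kappa>"
  shows "flin \<theta> t \<kappa> \<in> Cinf tot"
proof -
  have "(\<lambda>p. over \<theta> p * \<kappa> (t (fst p) (snd p))) \<in> Cinf tot"
  proof (rule T.cutoff_Cinf[OF over_cutoff[OF assms(1)]])
    fix p assume "p \<in> points tot \<inter> fst -` V"
    then obtain x w where p: "p = (x, w)" "x \<in> V" "w \<in> fib B x" by (cases p) auto
    show "smooth_near tot (\<lambda>p. \<kappa> (t (fst p) (snd p))) p"
      unfolding p(1) by (rule T.smooth_near_linear[OF assms(3) smooth_near_fibre_coordinate[OF assms(2) p(2,3)]])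
  qed
  then show ?thesis by (simp add: flin_def case_prod_beta')
qed

lemma flin_line:
  assumes "cutoff A V \<theta>" "(V, t) \<in> triv B" "bounded_linear \<kappa>" "x \<in> points A" "w \<in> fib B x" "w' \<in> fib B x"
  shows "flin \<theta> t \<kappa> (x, w + r *\<^sub>R w') = flin \<theta> t \<kappa> (x, w) + r * (\<theta> x * \<kappa> (t x w'))"
proof (cases "x \<in> V")
  case True
  interpret bounded_linear \<kappa> by fact
  have rw: "r *\<^sub>R w' \<in> fib B x" by (rule fib_scale[OF assms(4,6)])
  show ?thesis
    using triv_add[OF assms(2) True assms(5) rw] triv_scale[OF assms(2) True assms(6)] fib_add[OF assms(4,5) rw] assms(4,5)
    by (simp add: flin_def over_apply add scaleR algebra_simps)
next
  case False
  then show ?thesis using cutoff_zero[OF assms(1) False] by (simp add: flin_def over_apply)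
qed

lemma flin_vert:
  assumes "cutoff A V \<theta>" "(V, t) \<in> triv B" "bounded_linear \<kappa>" "s \<in> sections A B" "(x, w) \<in> points tot"
  shows "vert s (flin \<theta> t \<kappa>) (x, w) = \<theta> x * \<kappa> (t x (s x))"
proof -
  have x: "x \<in> points A" "w \<in> fib B x" "s x \<in> fib B x" using assms(5) sections_fib[OF assms(4)] by auto
  have "((\<lambda>r. flin \<theta> t \<kappa> (x, w + r *\<^sub>R s x)) has_real_derivative \<theta> x * \<kappa> (t x (s x))) (at 0)"
    unfolding flin_line[OF assms(1-3) x] by (auto intro!: derivative_eq_intros)
  then show ?thesis
    using flin_Cinf[OF assms(1-3)] assms(5) by (simp add: vert_def DERIV_imp_deriv del: mem_points_total)
qed

text \<open>On a fibre the function has constant slope along \<open>s\<close>, and that slope is the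
  value of \<open>vert s\<close>; hence the shift is exactly affine in
  \<open>\<epsilon>\<close>.\<close>

lemma flin_translate:
  assumes "cutoff A V \<theta>" "(V, t) \<in> triv B" "bounded_linear \<kappa>" "s \<in> sections A B"
  shows "translate (\<lambda>y. \<epsilon> *\<^sub>R s y) (flin \<theta> t \<kappa>) = (\<lambda>p. flin \<theta> t \<kappa> p - \<epsilon> * vert s (flin \<theta> t \<kappa>) p)"
proof
  fix p :: "'p \<times> 'e"
  obtain x w where p: "p = (x, w)" by (cases p)
  show "translate (\<lambda>y. \<epsilon> *\<^sub>R s y) (flin \<theta> t \<kappa>) p = flin \<theta> t \<kappa> p - \<epsilon> * vert s (flin \<theta> t \<kappa>) p"
  proof (cases "p \<in> points tot")
    case True
    then have x: "x \<in> points A" "w \<in> fib B x" "s x \<in> fib B x" using sections_fib[OF assms(4)] p by auto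
    show ?thesis
      using flin_line[OF assms(1-3) x, where r = "- \<epsilon>"] flin_vert[OF assms] True
      by (simp add: p translate_def)
  next
    case False
    have "translate (\<lambda>y. \<epsilon> *\<^sub>R s y) (flin \<theta> t \<kappa>) p = 0" "flin \<theta> t \<kappa> p = 0"
      using T.Cinf_iff translate_Cinf[OF sections_scale[OF assms(4)] flin_Cinf[OF assms(1-3)]]
        flin_Cinf[OF assms(1-3)] False by blast+
    then show ?thesis using vert_off[OF False] by simp
  qed
qed

lemma flin_zero:
  assumes "cutoff A V \<theta>" "(V, t) \<in> triv B" "bounded_linear \<kappa>"
  shows "flin \<theta> t \<kappa> (x, 0) = 0"
proof (cases "x \<in> V")
  case True
  interpret bounded_linear \<kappa> by fact
  show ?thesis using triv_zero[OF assms(2) True] by (simp add: flin_def zero)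
next
  case False
  then show ?thesis using cutoff_zero[OF assms(1) False] by (simp add: flin_def over_apply)
qed

lemma flin_deriv:
  assumes "cutoff A V \<theta>" "(V, t) \<in> triv B" "bounded_linear \<kappa>" "x \<in> points A" "w \<in> fib B x"
  shows "deriv (\<lambda>r. flin \<theta> t \<kappa> (x, r *\<^sub>R w)) 0 = \<theta> x * \<kappa> (t x w)"
proof (rule DERIV_imp_deriv)
  show "((\<lambda>r. flin \<theta> t \<kappa> (x, r *\<^sub>R w)) has_real_derivative \<theta> x * \<kappa> (t x w)) (at 0)"
    using flin_line[OF assms(1-4) fib_zero[OF assms(4)] assms(5)] flin_zero[OF assms(1-3)]
    by (auto intro!: derivative_eq_intros)
qed

text \<open>\<open>\<kappa>\<close> is the functional \<open>l\<close> transported to the model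
  fibre by the trivialization, written as a finite sum of coordinates so that it is bounded. The
  cutoff is 1 at \<open>x\<close> and does not rescale the derivative.\<close>

lemma fibre_linearization:
  assumes "Hausdorff_space (manifold_topology A)" "x \<in> points A"
    and \<kappa>: "\<And>w w'. w \<in> fib B x \<Longrightarrow> w' \<in> fib B x \<Longrightarrow> l (w + w') = l w + l w'"
      "\<And>c w. w \<in> fib B x \<Longrightarrow> l (c *\<^sub>R w) = c * l w"
  obtains V t \<theta> \<kappa> where "cutoff A V \<theta>" "(V, t) \<in> triv B" "bounded_linear \<kappa>"
    "\<And>w. w \<in> fib B x \<Longrightarrow> deriv (\<lambda>r. flin \<theta> t \<kappa> (x, r *\<^sub>R w)) 0 = l w"
proof -
  obtain V t where V: "(V, t) \<in> triv B" "x \<in> V" by (rule triv_at[OF assms(2)])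
  obtain \<theta> W' where \<theta>: "cutoff A V \<theta>" "mopen A W'" "x \<in> W'" "W' \<subseteq> V" "\<forall>q\<in>W'. \<theta> q = 1"
    by (rule cutoff_exists[OF assms(1) triv_mopen[OF V(1)] V(2)])
  obtain I :: "'v set" and c where I: "finite I" "\<And>b. bounded_linear (c b :: 'v \<Rightarrow> real)"
    "\<And>v. v = (\<Sum>b\<in>I. c b v *\<^sub>R b)" by (rule finite_dim_coordinates[OF model_fin_dim]) blast
  define \<kappa> where "\<kappa> v = (\<Sum>b\<in>I. c b v * l (tinv t x b))" for v
  have bl: "bounded_linear \<kappa>"
    unfolding \<kappa>_def[abs_def] by (intro bounded_linear_sum bounded_linear_mult_const I(2))
  have "\<kappa> v = l (tinv t x v)" for v
  proof -
    have "l (tinv t x (\<Sum>b\<in>J. c b v *\<^sub>R b)) = (\<Sum>b\<in>J. c b v * l (tinv t x b))" if "finite J" for J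
      using that
    proof induction
      case empty
      show ?case using tinv_scale[OF V, of 0 0] \<kappa>(2)[OF fib_zero[OF assms(2)], of 0] by simp
    next
      case (insert b J)
      then show ?case
        using tinv_fib[OF V] by (simp add: tinv_add[OF V] tinv_scale[OF V] \<kappa> fib_scale[OF assms(2)])
    qed
    from this[OF I(1)] show ?thesis unfolding \<kappa>_def by (subst (2) I(3)) simp
  qed
  then show ?thesis
    using that[OF \<theta>(1) V(1) bl] flin_deriv[OF \<theta>(1) V(1) bl assms(2)] \<theta>(3,5) by (simp add: tinv_triv[OF V])
qed

end

section \<open>The complex of the twisted conormal bundle\<close>

lemma permutes_two: "\<tau> permutes {..<2::nat} \<longleftrightarrow> \<tau> = id \<or> \<tau> = Transposition.transpose 0 1"
proof -
  have "{..<2::nat} = {0, 1}" by auto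
  then show ?thesis by (simp only: permutes_doubleton_iff)
qed

lemma unshuffles_1_1: "unshuffles 1 1 = {id, Transposition.transpose 0 1}"
proof -
  have "strict_mono_on {..<1::nat} \<tau>" "strict_mono_on {1..<1+1::nat} \<tau>" for \<tau> :: "nat \<Rightarrow> nat"
    by (auto intro!: strict_mono_onI)
  then show ?thesis unfolding unshuffles_def
    by (auto simp: permutes_two[unfolded numeral_2_eq_2 One_nat_def])
qed

lemma unshuffles_2_0: "unshuffles 2 0 = {id}"
proof -
  have "\<not> strict_mono_on {..<2::nat} (Transposition.transpose 0 (1::nat))"
    using strict_mono_onD[of "{..<2::nat}" "Transposition.transpose 0 (1::nat)" 0 1] by auto
  then show ?thesis unfolding unshuffles_def
    by (auto simp: permutes_two strict_mono_on_def)
qed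

lemma unshuffles_0_1: "unshuffles 0 1 = {id}"
proof -
  have "{..<1::nat} = {0}" by auto
  then show ?thesis unfolding unshuffles_def by (auto simp: strict_mono_on_def permutes_sing)
qed

text \<open>Arities 2 and 1 are degrees 1 and 0, so the global sign is plus. The minus of the second
  term is the sign of the transposition, one of the two unshuffles.\<close>

lemma schouten_jacobi_2_1:
  "schouten_jacobi 2 1 (\<lambda>ls. J (ls ! 0) (ls ! 1)) D [\<eta>, \<mu>] =
    (\<lambda>p. J (D [\<eta>]) \<mu> p - J (D [\<mu>]) \<eta> p - D [J \<eta> \<mu>] p)"
proof -
  have "id \<noteq> Transposition.transpose 0 (1::nat)" by (metis id_apply transpose_apply_first zero_neq_one)
  then show ?thesis
    unfolding schouten_jacobi_def insertion_def
    by (simp add: unshuffles_1_1[unfolded One_nat_def] unshuffles_2_0[unfolded numeral_2_eq_2] sign_swap_id upt_rec numeral_2_eq_2)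
qed

text \<open>The exponent \<open>(2 + 1) * (0 + 1)\<close> is odd, whence the minus sign; the other
  composition is 0, as nothing can be inserted into a section.\<close>

lemma schouten_jacobi_2_0:
  "schouten_jacobi 2 0 (\<lambda>ls. J (ls ! 0) (ls ! 1)) D [\<eta>] = (\<lambda>p. - J (D []) \<eta> p)"
  unfolding schouten_jacobi_def insertion_def
  by (simp add: unshuffles_0_1[unfolded One_nat_def] upt_rec)

text \<open>Data on the total space alone: the ambient manifold enters with \<open>tubular\<close>,
  coisotropy with \<open>coisotropic_setup\<close>. The computation of \<open>m1\<close> is thus
  valid for every Jacobi bracket on the total space.\<close>

locale normal_setup =
  fixes S :: "('p, 'c::real_inner) atlas"
    and E :: "('p, 'e::real_vector, 'v::real_inner) vbundle"
    and L :: "('p, 'l::real_normed_vector) line_bundle"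
    and JN :: "('p \<times> 'e \<Rightarrow> 'l) \<Rightarrow> ('p \<times> 'e \<Rightarrow> 'l) \<Rightarrow> 'p \<times> 'e \<Rightarrow> 'l"
  assumes atlas_S: "smooth_atlas S"
    and Hausdorff_S: "Hausdorff_space (manifold_topology S)"
    and bundle_E: "vector_bundle S E"
    and bundle_l: "vector_bundle S (restricted_line S L)"
    and bracket_N: "jacobi_bracket (total_atlas S E) (normal_line S E L) JN"
begin

sublocale E: vec_bundle S E
  by unfold_locales (rule atlas_S, rule bundle_E)

sublocale l: vec_bundle S "restricted_line S L"
  by unfold_locales (rule bundle_l)

abbreviation "N \<equiv> total_atlas S E"
abbreviation "LN \<equiv> normal_line S E L"
abbreviation "ell \<equiv> restricted_line S L"

sublocale LN: vec_bundle N LN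
  by unfold_locales
    (rule vector_bundle_pullback[OF atlas_S E.smooth_atlas_total bundle_l E.smooth_map_projection])

lemma fib_ell [simp]: "fib ell x = fib L x"
  and fib_LN [simp]: "fib LN p = fib L (fst p)"
  by (simp_all add: pullback_bundle_def)

lemma triv_LN: "(V, t) \<in> triv ell \<Longrightarrow> (points N \<inter> fst -` V, \<lambda>p. t (fst p)) \<in> triv LN"
  unfolding pullback_bundle_def[of "points N"] by force

definition pull :: "('p \<Rightarrow> 'l) \<Rightarrow> 'p \<times> 'e \<Rightarrow> 'l" where
  "pull a = restrict_to (points N) (\<lambda>p. a (fst p))"

lemma pull_sections:
  assumes "a \<in> sections S ell"
  shows "pull a \<in> sections N LN"
  unfolding LN.sections_iff
proof (intro conjI ballI allI impI)
  fix p assume "p \<in> points N"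
  then obtain x w where p: "p = (x, w)" "x \<in> points S" "w \<in> fib E x" by (cases p) auto
  obtain V t where V: "(V, t) \<in> triv ell" "x \<in> V" by (rule l.triv_at[OF p(2)])
  have near: "smooth_near N (\<lambda>q. t (fst q) (pull a q)) p"
    unfolding p(1)
    by (rule E.T.smooth_near_cong[OF E.smooth_near_base[OF l.sections_smooth_near[OF assms V] p(3)] E.T.mopen_points])
      (use p in \<open>auto simp: pull_def restrict_to_def\<close>)
  show "LN.section_near (pull a) p"
    by (rule LN.section_nearI[OF E.T.mopen_points _ _ triv_LN[OF V(1)] _ near])
      (use p V l.sections_fib[OF assms] in \<open>auto simp: pull_def restrict_to_def\<close>)
qed (simp add: pull_def restrict_to_def)

lemma restrict_zero_sections:
  assumes "\<eta> \<in> sections N LN"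
  shows "(\<lambda>x. \<eta> (x, 0)) \<in> sections S ell"
  unfolding l.sections_iff
proof (intro conjI ballI allI impI)
  fix x assume x: "x \<in> points S"
  obtain V t where V: "(V, t) \<in> triv ell" "x \<in> V" by (rule l.triv_at[OF x])
  have x0: "(x, 0) \<in> points N \<inter> fst -` V" using x V E.fib_zero by simp
  have near: "smooth_near S (\<lambda>y. t y (\<eta> (y, 0))) x"
    using E.smooth_near_along_section[OF E.zero_section LN.sections_smooth_near[OF assms triv_LN[OF V(1)] x0]] by simp
  have "\<eta> (y, 0) \<in> fib ell y" if "y \<in> points S" for y
    using LN.sections_fib[OF assms, of "(y, 0)"] that E.fib_zero by simp
  then show "l.section_near (\<lambda>x. \<eta> (x, 0)) x"
    by (rule l.section_nearI[OF E.mopen_points x _ V near])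
next
  fix x assume "x \<notin> points S"
  then show "\<eta> (x, 0) = 0" using LN.sections_off[OF assms, of "(x, 0)"] by simp
qed

lemma section_N_through:
  assumes "p \<in> points N" "u \<in> fib L (fst p)"
  obtains a where "a \<in> sections S ell" "pull a p = u"
proof -
  obtain x w where p: "p = (x, w)" "x \<in> points S" "w \<in> fib E x" using assms by (cases p) auto
  obtain a where "a \<in> sections S ell" "a x = u"
    using l.section_through[OF Hausdorff_S p(2), of u] assms(2) p(1) by auto
  then show ?thesis using that p by (auto simp: pull_def restrict_to_def)
qed

lemma frame_nonzero:
  assumes "(V, t) \<in> triv ell" "x \<in> V"
  shows "l.tinv t x 1 \<in> fib L x" "l.tinv t x 1 \<noteq> 0"
  using l.tinv_fib[OF assms, of 1] l.triv_tinv[OF assms, of 1] l.triv_zero[OF assms] by auto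

sublocale J: jacobi N LN JN
proof unfold_locales
  show "jacobi_bracket N LN JN" by (rule bracket_N)
  fix p assume p: "p \<in> points N"
  then have "fst p \<in> points S" by (cases p) auto
  then obtain V t where V: "(V, t) \<in> triv ell" "fst p \<in> V" by (rule l.triv_at)
  obtain a where "a \<in> sections S ell" "pull a p = l.tinv t (fst p) 1"
    by (rule section_N_through[OF p frame_nonzero(1)[OF V]])
  then show "\<exists>\<eta>\<in>sections N LN. \<eta> p \<noteq> 0"
    using pull_sections frame_nonzero(2)[OF V] by metis
qed

text \<open>The component of a section in the local frame \<open>l.tinv t y 1\<close>, cut off to a
  global function. It reduces vertical derivatives of sections to derivatives of real
  functions.\<close>

definition coord :: "('p \<Rightarrow> real) \<Rightarrow> ('p \<Rightarrow> 'l \<Rightarrow> real) \<Rightarrow> ('p \<times> 'e \<Rightarrow> 'l) \<Rightarrow> 'p \<times> 'e \<Rightarrow> real" where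
  "coord \<theta> t \<eta> = (\<lambda>p. E.over \<theta> p * t (fst p) (\<eta> p))"

lemma coord_Cinf:
  assumes "cutoff S V \<theta>" "(V, t) \<in> triv ell" "\<eta> \<in> sections N LN"
  shows "coord \<theta> t \<eta> \<in> Cinf N"
  unfolding coord_def
  by (rule E.T.cutoff_Cinf[OF E.over_cutoff[OF assms(1)]])
    (rule LN.sections_smooth_near[OF assms(3) triv_LN[OF assms(2)]])

lemma over_outside: "cutoff S V \<theta> \<Longrightarrow> p \<notin> points N \<inter> fst -` V \<Longrightarrow> E.over \<theta> p = 0"
  using E.cutoff_zero[of V \<theta> "fst p"] by (cases p) (auto simp: E.over_apply)

lemma coord_add:
  assumes "cutoff S V \<theta>" "(V, t) \<in> triv ell" "\<eta> \<in> sections N LN" "\<mu> \<in> sections N LN"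
  shows "coord \<theta> t (\<lambda>q. \<eta> q + \<mu> q) = (\<lambda>q. coord \<theta> t \<eta> q + coord \<theta> t \<mu> q)"
proof
  fix q
  show "coord \<theta> t (\<lambda>q. \<eta> q + \<mu> q) q = coord \<theta> t \<eta> q + coord \<theta> t \<mu> q"
    using over_outside[OF assms(1), of q] l.triv_add[OF assms(2), of "fst q" "\<eta> q" "\<mu> q"]
      LN.sections_fib[OF assms(3), of q] LN.sections_fib[OF assms(4), of q]
    by (cases "q \<in> points N \<inter> fst -` V") (simp_all add: coord_def distrib_left)
qed

lemma coord_smul:
  assumes "cutoff S V \<theta>" "(V, t) \<in> triv ell" "\<eta> \<in> sections N LN"
  shows "coord \<theta> t (smul f \<eta>) = (\<lambda>q. f q * coord \<theta> t \<eta> q)"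
proof
  fix q
  show "coord \<theta> t (smul f \<eta>) q = f q * coord \<theta> t \<eta> q"
    using over_outside[OF assms(1), of q] l.triv_scale[OF assms(2), of "fst q" "\<eta> q" "f q"]
      LN.sections_fib[OF assms(3), of q]
    by (cases "q \<in> points N \<inter> fst -` V") (simp_all add: coord_def smul_def)
qed

lemma coord_expand:
  assumes "(V, t) \<in> triv ell" "\<eta> \<in> sections N LN" "(x, w) \<in> points N" "x \<in> V"
  shows "coord \<theta> t \<eta> (x, w) *\<^sub>R l.tinv t x 1 = \<theta> x *\<^sub>R \<eta> (x, w)"
proof -
  have "\<eta> (x, w) \<in> fib ell x" using LN.sections_fib[OF assms(2,3)] by simp
  then have "t x (\<eta> (x, w)) *\<^sub>R l.tinv t x 1 = \<eta> (x, w)"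
    using l.tinv_scale[OF assms(1,4), of "t x (\<eta> (x, w))" 1] l.tinv_triv[OF assms(1,4)] by simp
  then show ?thesis
    using assms(3) by (simp add: coord_def E.over_apply flip: scaleR_scaleR)
qed

lemma local_frame:
  assumes "x \<in> points S"
  obtains V t \<theta> W where "(V, t) \<in> triv ell" "x \<in> V" "cutoff S V \<theta>" "mopen S W" "x \<in> W" "W \<subseteq> V"
    "\<forall>y\<in>W. \<theta> y = 1"
proof -
  obtain V t where V: "(V, t) \<in> triv ell" "x \<in> V" by (rule l.triv_at[OF assms])
  obtain \<theta> W where "cutoff S V \<theta>" "mopen S W" "x \<in> W" "W \<subseteq> V" "\<forall>q\<in>W. \<theta> q = 1"
    by (rule E.cutoff_exists[OF Hausdorff_S l.triv_mopen[OF V(1)] V(2)])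
  with V that show ?thesis by blast
qed

lemma line_vector_derivative:
  assumes "(V, t) \<in> triv ell" "x \<in> V" "cutoff S V \<theta>" "\<theta> x = 1" "\<eta> \<in> sections N LN"
    "(x, w) \<in> points N" "w' \<in> fib E x"
  shows "vector_derivative (\<lambda>r. \<eta> (x, w + r *\<^sub>R w')) (at 0) =
    deriv (\<lambda>r. coord \<theta> t \<eta> (x, w + r *\<^sub>R w')) 0 *\<^sub>R l.tinv t x 1"
proof -
  have x: "x \<in> points S" "w \<in> fib E x" using assms(6) by auto
  obtain U \<phi> where U: "(U, \<phi>) \<in> S" "x \<in> U" by (rule E.chart_at[OF x(1)])
  obtain V' t' where V': "(V', t') \<in> triv E" "x \<in> V'" by (rule E.triv_at[OF x(1)])
  let ?c = "\<lambda>r. coord \<theta> t \<eta> (x, w + r *\<^sub>R w')"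
  have "\<eta> (x, w + r *\<^sub>R w') = ?c r *\<^sub>R l.tinv t x 1" for r
    using coord_expand[OF assms(1,5) _ assms(2), of "w + r *\<^sub>R w'" \<theta>] assms(4,7) x
      E.fib_add[OF x E.fib_scale[OF x(1) assms(7)]] by simp
  moreover have "(?c has_real_derivative deriv ?c 0) (at 0)"
    using E.line_derivative[OF U(1) V'(1) U(2) V'(2) x(2) assms(7) coord_Cinf[OF assms(3,1,5)]]
    by (metis DERIV_imp_deriv)
  then have "((\<lambda>r. ?c r *\<^sub>R l.tinv t x 1) has_vector_derivative deriv ?c 0 *\<^sub>R l.tinv t x 1) (at 0)"
    by (intro bounded_linear.has_vector_derivative[OF bounded_linear_scaleR_left])
      (simp add: has_real_derivative_iff_has_vector_derivative)
  ultimately show ?thesis by (simp add: vector_derivative_at)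
qed

text \<open>The operator \<open>I(s)\<close>, that is, the flat vertical connection along the
  vertical lift of \<open>s\<close>.\<close>

definition Ds :: "('p \<Rightarrow> 'e) \<Rightarrow> ('p \<times> 'e \<Rightarrow> 'l) \<Rightarrow> 'p \<times> 'e \<Rightarrow> 'l" where
  "Ds s \<eta> = restrict_to (points N) (\<lambda>(x, w). vector_derivative (\<lambda>r. \<eta> (x, w + r *\<^sub>R s x)) (at 0))"

lemma Ds_coord:
  assumes "(V, t) \<in> triv ell" "x \<in> V" "cutoff S V \<theta>" "\<theta> x = 1" "\<eta> \<in> sections N LN"
    "(x, w) \<in> points N" "s \<in> sections S E"
  shows "Ds s \<eta> (x, w) = E.vert s (coord \<theta> t \<eta>) (x, w) *\<^sub>R l.tinv t x 1"
proof -
  have "s x \<in> fib E x" using E.sections_fib[OF assms(7)] assms(6) by simp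
  from line_vector_derivative[OF assms(1-6) this] show ?thesis
    using coord_Cinf[OF assms(3,1,5)] assms(6)
    by (simp add: Ds_def restrict_to_def E.vert_def)
qed

lemma Ds_sections:
  assumes "s \<in> sections S E" "\<eta> \<in> sections N LN"
  shows "Ds s \<eta> \<in> sections N LN"
  unfolding LN.sections_iff
proof (intro conjI ballI allI impI)
  fix p assume pN: "p \<in> points N"
  then obtain x w where p: "p = (x, w)" "x \<in> points S" "w \<in> fib E x" by (cases p) auto
  obtain V t \<theta> W where V: "(V, t) \<in> triv ell" "x \<in> V" "cutoff S V \<theta>" "mopen S W" "x \<in> W" "W \<subseteq> V"
    "\<forall>y\<in>W. \<theta> y = 1" by (rule local_frame[OF p(2)])
  have pV: "p \<in> points N \<inter> fst -` V" using p V by simp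
  have "E.vert s (coord \<theta> t \<eta>) \<in> Cinf N"
    by (rule E.T.vector_field_Cinf[OF E.vert_vector_field[OF assms(1)]])
  then have "LN.section_near (\<lambda>q. E.vert s (coord \<theta> t \<eta>) q *\<^sub>R LN.tinv (\<lambda>p. t (fst p)) q 1) p"
    by (intro LN.section_near_scaleR LN.section_near_frame[OF triv_LN[OF V(1)] pV] E.T.Cinf_smooth_near pN)
  then show "LN.section_near (Ds s \<eta>) p"
  proof (rule LN.section_near_cong[OF _ E.mopen_over[OF V(4)]])
    show "p \<in> points N \<inter> fst -` W" using p V by simp
    fix q assume q: "q \<in> points N \<inter> fst -` W"
    obtain y u where y: "q = (y, u)" by (cases q)
    have "y \<in> V" "\<theta> y = 1" "(y, u) \<in> points N" using q y V(6,7) by auto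
    then show "E.vert s (coord \<theta> t \<eta>) q *\<^sub>R LN.tinv (\<lambda>p. t (fst p)) q 1 = Ds s \<eta> q"
      using Ds_coord[OF V(1) _ V(3) _ assms(2) _ assms(1), of y u] y by simp
  qed
qed (simp add: Ds_def restrict_to_def)

text \<open>The frame pulled back from the base is constant on fibres. Where the cutoff is 1,
  \<open>Ds s\<close> therefore acts on components by \<open>vert s\<close>, from which it inherits
  additivity and the Leibniz rule.\<close>

lemma Ds_derivation:
  assumes s: "s \<in> sections S E"
  shows "derivation_with_symbol N LN (Ds s) (E.vert s)"
proof -
  note X = E.vert_vector_field[OF s]
  have off: "Ds s \<eta> p = 0" if "p \<notin> points N" for \<eta> p using that by (simp add: Ds_def restrict_to_def)
  have add: "Ds s (\<lambda>q. \<eta> q + \<mu> q) p = Ds s \<eta> p + Ds s \<mu> p"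
    if \<eta>: "\<eta> \<in> sections N LN" and \<mu>: "\<mu> \<in> sections N LN" for \<eta> \<mu> p
  proof (cases "p \<in> points N")
    case True
    then obtain x w where p: "p = (x, w)" "(x, w) \<in> points N" "x \<in> points S" by (cases p) auto
    obtain V t \<theta> W where V: "(V, t) \<in> triv ell" "x \<in> V" "cutoff S V \<theta>" "mopen S W" "x \<in> W" "W \<subseteq> V"
      "\<forall>y\<in>W. \<theta> y = 1" by (rule local_frame[OF p(3)])
    have 1: "\<theta> x = 1" using V by blast
    show ?thesis
      unfolding p(1) Ds_coord[OF V(1-3) 1 LN.sections_add[OF \<eta> \<mu>] p(2) s]
        Ds_coord[OF V(1-3) 1 \<eta> p(2) s] Ds_coord[OF V(1-3) 1 \<mu> p(2) s] coord_add[OF V(3,1) \<eta> \<mu>]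
      using E.T.tangent_add[OF E.T.vector_field_tangent[OF X p(2)] coord_Cinf[OF V(3,1) \<eta>] coord_Cinf[OF V(3,1) \<mu>]]
      by (simp add: scaleR_left_distrib)
  qed (simp add: off)
  have leib: "Ds s (smul f \<eta>) p = E.vert s f p *\<^sub>R \<eta> p + f p *\<^sub>R Ds s \<eta> p"
    if f: "f \<in> Cinf N" and \<eta>: "\<eta> \<in> sections N LN" for f \<eta> p
  proof (cases "p \<in> points N")
    case True
    then obtain x w where p: "p = (x, w)" "(x, w) \<in> points N" "x \<in> points S" by (cases p) auto
    obtain V t \<theta> W where V: "(V, t) \<in> triv ell" "x \<in> V" "cutoff S V \<theta>" "mopen S W" "x \<in> W" "W \<subseteq> V"
      "\<forall>y\<in>W. \<theta> y = 1" by (rule local_frame[OF p(3)])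
    have 1: "\<theta> x = 1" using V by blast
    have "Ds s (smul f \<eta>) (x, w) = (f (x, w) * E.vert s (coord \<theta> t \<eta>) (x, w)
        + E.vert s f (x, w) * coord \<theta> t \<eta> (x, w)) *\<^sub>R l.tinv t x 1"
      unfolding Ds_coord[OF V(1-3) 1 LN.sections_smul[OF f \<eta>] p(2) s] coord_smul[OF V(3,1) \<eta>]
      using E.T.tangent_mult[OF E.T.vector_field_tangent[OF X p(2)] f coord_Cinf[OF V(3,1) \<eta>]] by simp
    also have "\<dots> = f (x, w) *\<^sub>R Ds s \<eta> (x, w) + E.vert s f (x, w) *\<^sub>R (coord \<theta> t \<eta> (x, w) *\<^sub>R l.tinv t x 1)"
      unfolding Ds_coord[OF V(1-3) 1 \<eta> p(2) s] by (simp add: scaleR_left_distrib)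
    also have "coord \<theta> t \<eta> (x, w) *\<^sub>R l.tinv t x 1 = \<eta> (x, w)"
      using coord_expand[OF V(1) \<eta> p(2) V(2)] 1 by simp
    finally show ?thesis using p(1) by simp
  next
    case False
    then show ?thesis using LN.sections_off[OF \<eta>] off by simp
  qed
  have scale: "Ds s (\<lambda>q. c *\<^sub>R \<eta> q) p = c *\<^sub>R Ds s \<eta> p" if \<eta>: "\<eta> \<in> sections N LN" for c \<eta> p
  proof (cases "p \<in> points N")
    case True
    \<comment> \<open>Scaling is multiplication by a constant function, so it is a case of the
      Leibniz rule in which the derivative of the coefficient vanishes.\<close>
    have eq: "(\<lambda>q. c *\<^sub>R \<eta> q) = smul (restrict_to (points N) (\<lambda>_. c)) \<eta>"
      using LN.sections_off[OF \<eta>] by (auto simp: smul_def restrict_to_def)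
    show ?thesis
      unfolding eq leib[OF E.T.Cinf_const \<eta>]
      using E.T.tangent_const[OF E.T.vector_field_tangent[OF X True]] True by (simp add: restrict_to_def)
  qed (simp add: off)
  show ?thesis
    unfolding derivation_with_symbol_def
    using X Ds_sections[OF s] add scale leib by (auto simp: plus_fun_def smul_def)
qed

lemma jacobi_derivation_Ds: "s \<in> sections S E \<Longrightarrow> jacobi_derivation N LN JN (Ds s) (E.vert s)"
  by unfold_locales (rule Ds_derivation)

section \<open>Twisted conormal vectors and the jets that represent them\<close>

lemma conormal_apply_fib: "\<alpha> \<in> conormal E L x \<Longrightarrow> w \<in> fib E x \<Longrightarrow> \<alpha> w \<in> fib L x"
  and conormal_add: "\<alpha> \<in> conormal E L x \<Longrightarrow> w \<in> fib E x \<Longrightarrow> w' \<in> fib E x \<Longrightarrow> \<alpha> (w + w') = \<alpha> w + \<alpha> w'"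
  and conormal_scale: "\<alpha> \<in> conormal E L x \<Longrightarrow> w \<in> fib E x \<Longrightarrow> \<alpha> (c *\<^sub>R w) = c *\<^sub>R \<alpha> w"
  by (auto simp: conormal_def linear_map_on_def)

lemma conormalI:
  assumes "\<And>w w'. w \<in> fib E x \<Longrightarrow> w' \<in> fib E x \<Longrightarrow> \<beta> (w + w') = \<beta> w + \<beta> w'"
    "\<And>c w. w \<in> fib E x \<Longrightarrow> \<beta> (c *\<^sub>R w) = c *\<^sub>R \<beta> w" "\<And>w. w \<in> fib E x \<Longrightarrow> \<beta> w \<in> fib L x"
    and x: "x \<in> points S"
  shows "restrict_to (fib E x) \<beta> \<in> conormal E L x"
  using assms(1-3) E.fib_add[OF x] E.fib_scale[OF x]
  by (auto simp: conormal_def linear_map_on_def restrict_to_def)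

lemma line_deriv_linear:
  assumes "f \<in> Cinf N" "(x, w) \<in> points N"
  shows "w' \<in> fib E x \<Longrightarrow> w'' \<in> fib E x \<Longrightarrow> deriv (\<lambda>r. f (x, w + r *\<^sub>R (w' + w''))) 0 =
      deriv (\<lambda>r. f (x, w + r *\<^sub>R w')) 0 + deriv (\<lambda>r. f (x, w + r *\<^sub>R w'')) 0"
    and "w' \<in> fib E x \<Longrightarrow> deriv (\<lambda>r. f (x, w + r *\<^sub>R (c *\<^sub>R w'))) 0 = c * deriv (\<lambda>r. f (x, w + r *\<^sub>R w')) 0"
proof -
  have x: "x \<in> points S" "w \<in> fib E x" using assms(2) by auto
  obtain U \<phi> where U: "(U, \<phi>) \<in> S" "x \<in> U" by (rule E.chart_at[OF x(1)])
  obtain V t where V: "(V, t) \<in> triv E" "x \<in> V" by (rule E.triv_at[OF x(1)])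
  let ?D = "chart_derivative (E.tdom U V) (E.tmap \<phi> t) f (x, w)"
  have d: "deriv (\<lambda>r. f (x, w + r *\<^sub>R u)) 0 = ?D (0, t x u)" if "u \<in> fib E x" for u
    using DERIV_imp_deriv[OF E.line_derivative[OF U(1) V(1) U(2) V(2) x(2) that assms(1)]] .
  have lin: "linear ?D"
    using has_derivative_linear E.T.Cinf_chart_has_derivative[OF assms(1) E.total_chart[OF U(1) V(1)], of "(x, w)"]
      U V x by auto
  show "deriv (\<lambda>r. f (x, w + r *\<^sub>R (w' + w''))) 0 =
      deriv (\<lambda>r. f (x, w + r *\<^sub>R w')) 0 + deriv (\<lambda>r. f (x, w + r *\<^sub>R w'')) 0"
    if w: "w' \<in> fib E x" "w'' \<in> fib E x"
    unfolding d[OF E.fib_add[OF x(1) w]] d[OF w(1)] d[OF w(2)] E.triv_add[OF V w]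
    using linear_add[OF lin, of "(0, t x w')" "(0, t x w'')"] by simp
  show "deriv (\<lambda>r. f (x, w + r *\<^sub>R (c *\<^sub>R w'))) 0 = c * deriv (\<lambda>r. f (x, w + r *\<^sub>R w')) 0"
    if w: "w' \<in> fib E x"
    unfolding d[OF E.fib_scale[OF x(1) w]] d[OF w] E.triv_scale[OF V w]
    using linear_scale[OF lin, of c "(0, t x w')"] by simp
qed

text \<open>Forms take the default value 0 on invalid arguments; this membership is what makes
  \<open>lift_form\<close> an actual contraction with the vertical derivatives.\<close>

lemma vertical_derivative_conormal:
  assumes "\<eta> \<in> sections N LN" "(x, w) \<in> points N"
  shows "vertical_derivative E \<eta> (x, w) \<in> conormal E L x"
proof -
  have x: "x \<in> points S" "w \<in> fib E x" using assms(2) by auto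
  obtain V t \<theta> W where V: "(V, t) \<in> triv ell" "x \<in> V" "cutoff S V \<theta>" "mopen S W" "x \<in> W" "W \<subseteq> V"
    "\<forall>y\<in>W. \<theta> y = 1" by (rule local_frame[OF x(1)])
  have 1: "\<theta> x = 1" using V by blast
  note d = line_vector_derivative[OF V(1-3) 1 assms]
  note lin = line_deriv_linear[OF coord_Cinf[OF V(3,1) assms(1)] assms(2)]
  have "restrict_to (fib E x) (\<lambda>w'. vector_derivative (\<lambda>r. \<eta> (x, w + r *\<^sub>R w')) (at 0)) \<in> conormal E L x"
  proof (rule conormalI[OF _ _ _ x(1)])
    fix w' w'' assume w: "w' \<in> fib E x" "w'' \<in> fib E x"
    show "vector_derivative (\<lambda>r. \<eta> (x, w + r *\<^sub>R (w' + w''))) (at 0) =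
        vector_derivative (\<lambda>r. \<eta> (x, w + r *\<^sub>R w')) (at 0) + vector_derivative (\<lambda>r. \<eta> (x, w + r *\<^sub>R w'')) (at 0)"
      unfolding d[OF E.fib_add[OF x(1) w]] d[OF w(1)] d[OF w(2)] lin(1)[OF w] by (simp add: scaleR_left_distrib)
  next
    fix c w' assume w: "w' \<in> fib E x"
    show "vector_derivative (\<lambda>r. \<eta> (x, w + r *\<^sub>R (c *\<^sub>R w'))) (at 0) =
        c *\<^sub>R vector_derivative (\<lambda>r. \<eta> (x, w + r *\<^sub>R w')) (at 0)"
      unfolding d[OF E.fib_scale[OF x(1) w]] d[OF w] lin(2)[OF w] by simp
    show "vector_derivative (\<lambda>r. \<eta> (x, w + r *\<^sub>R w')) (at 0) \<in> fib L x"
      unfolding d[OF w] using l.fib_scale[OF x(1)] frame_nonzero(1)[OF V(1,2)] by simp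
  qed
  then show ?thesis by (simp add: vertical_derivative_def)
qed

lemma lift_form_section:
  assumes "s \<in> sections S E" "\<eta> \<in> sections N LN"
  shows "lift_form S E (as_form S E L s) [\<eta>] = Ds s \<eta>"
proof
  fix p
  show "lift_form S E (as_form S E L s) [\<eta>] p = Ds s \<eta> p"
  proof (cases "p \<in> points N")
    case True
    then obtain x w where p: "p = (x, w)" "(x, w) \<in> points N" "x \<in> points S" by (cases p) auto
    have "s x \<in> fib E x" by (rule E.sections_fib[OF assms(1) p(3)])
    then show ?thesis
      using vertical_derivative_conormal[OF assms(2) p(2)] p True
      by (simp add: lift_form_def restrict_to_def as_form_def valid_args_def Ds_def vertical_derivative_def)
  qed (simp add: lift_form_def Ds_def restrict_to_def)
qed

text \<open>The normalization \<open>f (x, 0) = 0\<close> makes \<open>smul f \<eta>\<close> a representative of \<open>\<gamma>(\<alpha>)\<close>.\<close>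
definition gamma_rep :: "'p \<Rightarrow> ('e \<Rightarrow> 'l) \<Rightarrow> ('p \<times> 'e \<Rightarrow> real) \<Rightarrow> ('p \<times> 'e \<Rightarrow> 'l) \<Rightarrow> bool" where
  "gamma_rep x \<alpha> f \<eta> \<longleftrightarrow> f \<in> Cinf N \<and> \<eta> \<in> sections N LN \<and> f (x, 0) = 0 \<and>
     (\<forall>u\<in>tangent_space S x. u (\<lambda>y. f (y, 0)) = 0) \<and>
     (\<forall>w\<in>fib E x. \<alpha> w = deriv (\<lambda>r. f (x, r *\<^sub>R w)) 0 *\<^sub>R \<eta> (x, 0))"

text \<open>The constant \<open>f (x, 0)\<close> can be absorbed into \<open>f\<close>, which
  changes neither \<open>\<mu>\<close> nor the derivatives of \<open>f\<close>. It is cut to the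
  total space to stay inside \<open>Cinf\<close>.\<close>

lemma represents_gamma_normalize:
  assumes "x \<in> points S" "represents_gamma S E L x \<alpha> \<mu>"
  obtains f \<eta> where "gamma_rep x \<alpha> f \<eta>" "\<mu> = smul f \<eta>"
proof -
  obtain f \<eta> where f: "f \<in> Cinf N" and \<eta>: "\<eta> \<in> sections N LN"
    and u: "\<And>u. u \<in> tangent_space S x \<Longrightarrow> u (\<lambda>y. f (y, 0)) = 0"
    and \<alpha>: "\<And>w. w \<in> fib E x \<Longrightarrow> \<alpha> w = deriv (\<lambda>r. f (x, r *\<^sub>R w)) 0 *\<^sub>R \<eta> (x, 0)"
    and \<mu>: "\<mu> = (\<lambda>v. f v *\<^sub>R \<eta> v - f (x, 0) *\<^sub>R \<eta> v)"
    using assms(2) unfolding represents_gamma_def by blast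
  let ?c = "restrict_to (points N) (\<lambda>_. f (x, 0))"
  let ?f = "\<lambda>v. f v - ?c v"
  have x0: "(x, 0) \<in> points N" using assms(1) E.fib_zero by simp
  have "u (\<lambda>y. ?f (y, 0)) = 0" if u': "u \<in> tangent_space S x" for u
  proof -
    have "(\<lambda>y. ?f (y, 0)) = (\<lambda>y. f (y, 0) - restrict_to (points S) (\<lambda>_. f (x, 0)) y)"
      using E.fib_zero by (auto simp: restrict_to_def)
    then show ?thesis
      using E.tangent_diff[OF u' E.restrict_zero_Cinf[OF f] E.Cinf_const] E.tangent_const[OF u'] u[OF u'] by simp
  qed
  moreover have "deriv (\<lambda>r. ?f (x, r *\<^sub>R w)) 0 = deriv (\<lambda>r. f (x, r *\<^sub>R w)) 0" if w: "w \<in> fib E x" for w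
  proof -
    obtain U \<phi> where U: "(U, \<phi>) \<in> S" "x \<in> U" by (rule E.chart_at[OF assms(1)])
    obtain V t where V: "(V, t) \<in> triv E" "x \<in> V" by (rule E.triv_at[OF assms(1)])
    have "((\<lambda>r. f (x, r *\<^sub>R w)) has_real_derivative deriv (\<lambda>r. f (x, r *\<^sub>R w)) 0) (at 0)"
      using E.line_derivative[OF U(1) V(1) U(2) V(2) E.fib_zero[OF assms(1)] w f]
      by (simp add: DERIV_imp_deriv)
    from DERIV_diff[OF this DERIV_const[of "f (x, 0)"]]
    have "((\<lambda>r. f (x, r *\<^sub>R w) - f (x, 0)) has_real_derivative deriv (\<lambda>r. f (x, r *\<^sub>R w)) 0) (at 0)" by simp
    moreover have "?f (x, r *\<^sub>R w) = f (x, r *\<^sub>R w) - f (x, 0)" for r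
      using E.fib_scale[OF assms(1) w] assms(1) by (simp add: restrict_to_def)
    ultimately show ?thesis by (simp add: DERIV_imp_deriv)
  qed
  ultimately have "gamma_rep x \<alpha> ?f \<eta>"
    using E.T.Cinf_diff[OF f E.T.Cinf_const] \<eta> \<alpha> x0 by (auto simp: gamma_rep_def restrict_to_def)
  moreover have "\<mu> = smul ?f \<eta>"
    using LN.sections_off[OF \<eta>] by (auto simp: \<mu> smul_def restrict_to_def scaleR_left_diff_distrib)
  ultimately show ?thesis using that by blast
qed

lemma gamma_rep_represents: "gamma_rep x \<alpha> f \<eta> \<Longrightarrow> represents_gamma S E L x \<alpha> (smul f \<eta>)"
  unfolding gamma_rep_def represents_gamma_def
  by (intro bexI[of _ f] bexI[of _ \<eta>]) (auto simp: smul_def)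

lemma tangent_zero_function: "u \<in> tangent_space S x \<Longrightarrow> u (\<lambda>_. 0) = 0"
  using E.tangent_const[of u x 0] by (simp add: restrict_to_def)

lemma gamma_repI:
  assumes "f \<in> Cinf N" "\<And>y. y \<in> points S \<Longrightarrow> f (y, 0) = 0" "\<eta> \<in> sections N LN" "x \<in> points S"
    "\<And>w. w \<in> fib E x \<Longrightarrow> \<alpha> w = deriv (\<lambda>r. f (x, r *\<^sub>R w)) 0 *\<^sub>R \<eta> (x, 0)"
  shows "gamma_rep x \<alpha> f \<eta>"
proof -
  have "(\<lambda>y. f (y, 0)) = (\<lambda>_. 0)"
  proof
    fix y
    show "f (y, 0) = 0"
      using assms(2) E.restrict_zero_Cinf[OF assms(1)] by (cases "y \<in> points S") (auto simp: E.Cinf_iff)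
  qed
  then show ?thesis using assms tangent_zero_function by (simp add: gamma_rep_def)
qed

text \<open>Relative to a nonzero vector \<open>\<eta> (x, 0)\<close> of the line,
  \<open>\<alpha>\<close> is a real linear functional \<open>k\<close> on the fibre, and
  \<open>fibre_linearization\<close> realizes it. The function vanishes on the whole zero section,
  more than \<open>gamma_rep\<close> asks, so that coisotropy can be applied to it.\<close>

lemma gamma_rep_exists:
  assumes "x \<in> points S" "\<alpha> \<in> conormal E L x"
  obtains f \<eta> where "gamma_rep x \<alpha> f \<eta>" "\<And>y. y \<in> points S \<Longrightarrow> f (y, 0) = 0" "\<eta> (x, 0) \<noteq> 0"
proof -
  have x0: "(x, 0) \<in> points N" using assms(1) E.fib_zero by simp
  obtain \<eta> where \<eta>: "\<eta> \<in> sections N LN" "\<eta> (x, 0) \<noteq> 0" using J.nonvanishing[OF x0] by blast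
  obtain V t where V: "(V, t) \<in> triv ell" "x \<in> V" by (rule l.triv_at[OF assms(1)])
  have e: "\<eta> (x, 0) \<in> fib ell x" using LN.sections_fib[OF \<eta>(1) x0] by simp
  have ne: "t x (\<eta> (x, 0)) \<noteq> 0"
    using l.triv_inj[OF V e l.fib_zero[OF assms(1)]] l.triv_zero[OF V] \<eta>(2) by auto
  define k where "k w = t x (\<alpha> w) / t x (\<eta> (x, 0))" for w
  have k: "k (w + w') = k w + k w'" "k (c *\<^sub>R w) = c * k w"
    if "w \<in> fib E x" "w' \<in> fib E x" for w w' c
    unfolding k_def using that assms(2)
    by (simp_all add: conormal_add conormal_scale conormal_apply_fib l.triv_add[OF V] l.triv_scale[OF V] add_divide_distrib)
  obtain V' t' \<theta> \<kappa> where f: "cutoff S V' \<theta>" "(V', t') \<in> triv E" "bounded_linear \<kappa>"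
    "\<And>w. w \<in> fib E x \<Longrightarrow> deriv (\<lambda>r. E.flin \<theta> t' \<kappa> (x, r *\<^sub>R w)) 0 = k w"
    using E.fibre_linearization[OF Hausdorff_S assms(1), of k] k by metis
  have "\<alpha> w = k w *\<^sub>R \<eta> (x, 0)" if w: "w \<in> fib E x" for w
  proof (rule l.triv_inj[OF V])
    show "\<alpha> w \<in> fib ell x" "k w *\<^sub>R \<eta> (x, 0) \<in> fib ell x"
      using conormal_apply_fib[OF assms(2) w] l.fib_scale[OF assms(1) e] by auto
    show "t x (\<alpha> w) = t x (k w *\<^sub>R \<eta> (x, 0))"
      using ne by (simp add: l.triv_scale[OF V e] k_def)
  qed
  then have "gamma_rep x \<alpha> (E.flin \<theta> t' \<kappa>) \<eta>"
    using f by (intro gamma_repI E.flin_Cinf E.flin_zero \<eta> assms(1)) auto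
  then show ?thesis using that E.flin_zero[OF f(1-3)] \<eta>(2) by blast
qed

lemma gamma_rep_some:
  assumes "x \<in> points S" "\<alpha> \<in> conormal E L x"
  obtains f \<eta> where "gamma_rep x \<alpha> f \<eta>" "(SOME \<mu>. represents_gamma S E L x \<alpha> \<mu>) = smul f \<eta>"
proof -
  have "\<exists>\<mu>. represents_gamma S E L x \<alpha> \<mu>"
    using gamma_rep_exists[OF assms] gamma_rep_represents by metis
  then have "represents_gamma S E L x \<alpha> (SOME \<mu>. represents_gamma S E L x \<alpha> \<mu>)" by (rule someI_ex)
  then show ?thesis using represents_gamma_normalize[OF assms(1)] that by metis
qed

text \<open>Split \<open>D\<close> along the zero section: the part tangent to \<open>S\<close>
  annihilates both functions, and on the fibre part both products reproduce
  \<open>\<alpha>\<close>.\<close>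

lemma gamma_rep_jet:
  assumes "x \<in> points S" "gamma_rep x \<alpha> f \<eta>" "gamma_rep x \<alpha> f' \<eta>'"
    and e: "\<eta> (x, 0) = a *\<^sub>R e" "\<eta>' (x, 0) = a' *\<^sub>R e" "e \<noteq> 0" and D: "D \<in> tangent_space N (x, 0)"
  shows "a * D f = a' * D f'"
proof -
  obtain u w where u: "u \<in> tangent_space S x" and w: "w \<in> fib E x"
    and split: "\<And>f. f \<in> Cinf N \<Longrightarrow> D f = u (\<lambda>y. f (y, 0)) + deriv (\<lambda>r. f (x, r *\<^sub>R w)) 0"
    by (rule E.tangent_zero_split[OF D]) blast
  have "D f = deriv (\<lambda>r. f (x, r *\<^sub>R w)) 0" "D f' = deriv (\<lambda>r. f' (x, r *\<^sub>R w)) 0"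
    using assms(2,3) u split by (auto simp: gamma_rep_def)
  moreover have "deriv (\<lambda>r. f (x, r *\<^sub>R w)) 0 *\<^sub>R \<eta> (x, 0) = deriv (\<lambda>r. f' (x, r *\<^sub>R w)) 0 *\<^sub>R \<eta>' (x, 0)"
    using assms(2,3) w unfolding gamma_rep_def by metis
  ultimately show ?thesis using e by (simp add: mult.commute)
qed

section \<open>The differential in degrees 0 and 1\<close>

lemma fibre_basis:
  assumes "x \<in> points S"
  obtains e where "e \<noteq> 0" "\<And>\<eta>. \<eta> \<in> sections N LN \<Longrightarrow> \<exists>a. \<eta> (x, 0) = a *\<^sub>R e"
proof -
  have x0: "(x, 0) \<in> points N" using assms E.fib_zero by simp
  obtain \<eta>0 where \<eta>0: "\<eta>0 \<in> sections N LN" "\<eta>0 (x, 0) \<noteq> 0" using J.nonvanishing[OF x0] by blast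
  have "\<exists>a. \<eta> (x, 0) = a *\<^sub>R \<eta>0 (x, 0)" if "\<eta> \<in> sections N LN" for \<eta>
    using J.line_multiple[OF x0 LN.sections_fib[OF that x0] LN.sections_fib[OF \<eta>0(1) x0] \<eta>0(2)] by metis
  with that \<eta>0(2) show ?thesis by blast
qed

text \<open>By \<open>bd_jet\<close> the representatives that \<open>normal_part\<close> picks with
  \<open>SOME\<close> may be exchanged for any others; later arguments bring their own.\<close>

lemma m1_section_form:
  assumes "s \<in> sections S E" "x \<in> points S" "\<alpha> \<in> conormal E L x" "\<beta> \<in> conormal E L x"
    and f: "gamma_rep x \<alpha> f \<eta>" and g: "gamma_rep x \<beta> g \<mu>"
  shows "m1 S E L JN 1 (as_form S E L s) x [\<alpha>, \<beta>] =
    jacobi_derivation.bd JN (Ds s) (smul f \<eta>) (smul g \<mu>) (x, 0)"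
proof -
  interpret D: jacobi_derivation N LN JN "Ds s" "E.vert s" by (rule jacobi_derivation_Ds[OF assms(1)])
  have x0: "(x, 0) \<in> points N" using assms(2) E.fib_zero by simp
  obtain f' \<eta>' where f': "gamma_rep x \<alpha> f' \<eta>'" "(SOME \<mu>. represents_gamma S E L x \<alpha> \<mu>) = smul f' \<eta>'"
    by (rule gamma_rep_some[OF assms(2,3)])
  obtain g' \<mu>' where g': "gamma_rep x \<beta> g' \<mu>'" "(SOME \<mu>. represents_gamma S E L x \<beta> \<mu>) = smul g' \<mu>'"
    by (rule gamma_rep_some[OF assms(2,4)])
  have s: "smul f' \<eta>' \<in> sections N LN" "smul g' \<mu>' \<in> sections N LN"
    using f'(1) g'(1) LN.sections_smul by (auto simp: gamma_rep_def)
  have "m1 S E L JN 1 (as_form S E L s) x [\<alpha>, \<beta>] =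
      schouten_jacobi 2 1 (\<lambda>ls. JN (ls ! 0) (ls ! 1)) (lift_form S E (as_form S E L s)) [smul f' \<eta>', smul g' \<mu>'] (x, 0)"
    using assms(2-4) f'(2) g'(2) by (simp add: m1_def normal_part_def valid_args_def)
  also have "\<dots> = JN (Ds s (smul f' \<eta>')) (smul g' \<mu>') (x, 0) - JN (Ds s (smul g' \<mu>')) (smul f' \<eta>') (x, 0)
      - Ds s (JN (smul f' \<eta>') (smul g' \<mu>')) (x, 0)"
    unfolding schouten_jacobi_2_1 lift_form_section[OF assms(1) s(1)] lift_form_section[OF assms(1) s(2)]
      lift_form_section[OF assms(1) J.J_sections[OF s]] ..
  also have "\<dots> = D.bd (smul f' \<eta>') (smul g' \<mu>') (x, 0)"
    unfolding D.bd_def using J.J_antisym[OF D.\<Delta>_sections[OF s(2)] s(1)] by simp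
  also have "\<dots> = D.bd (smul f \<eta>) (smul g \<mu>) (x, 0)"
  proof -
    obtain e where e: "e \<noteq> 0" "\<And>\<eta>. \<eta> \<in> sections N LN \<Longrightarrow> \<exists>a. \<eta> (x, 0) = a *\<^sub>R e"
      by (rule fibre_basis[OF assms(2)]) blast
    have sec: "\<eta> \<in> sections N LN" "\<eta>' \<in> sections N LN" "\<mu> \<in> sections N LN" "\<mu>' \<in> sections N LN"
      "f \<in> Cinf N" "f' \<in> Cinf N" "g \<in> Cinf N" "g' \<in> Cinf N"
      "f (x, 0) = 0" "f' (x, 0) = 0" "g (x, 0) = 0" "g' (x, 0) = 0"
      using f f' g g' by (auto simp: gamma_rep_def)
    obtain a a' b b' where ab: "\<eta> (x, 0) = a *\<^sub>R e" "\<eta>' (x, 0) = a' *\<^sub>R e" "\<mu> (x, 0) = b *\<^sub>R e" "\<mu>' (x, 0) = b' *\<^sub>R e"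
      using e(2) sec(1-4) by metis
    show ?thesis
      by (rule D.bd_jet[OF x0 E.total_has_coordinates[OF Hausdorff_S x0] sec(6,10,5,9,2) ab(2) sec(1) ab(1)
            sec(8,12,7,11,4) ab(4) sec(3) ab(3)])
        (auto intro: gamma_rep_jet[OF assms(2) f'(1) f ab(2,1) e(1)] gamma_rep_jet[OF assms(2) g'(1) g ab(4,3) e(1)])
  qed
  finally show ?thesis .
qed

text \<open>The representative \<open>f'\<close> vanishes at \<open>(x, 0)\<close>, so the bracket
  with \<open>smul f' \<eta>'\<close> reduces there to the Hamiltonian derivative of
  \<open>f'\<close>, which depends on the jet alone. The sign is that of
  \<open>schouten_jacobi_2_0\<close>.\<close>

lemma m1_degree_0:
  assumes "x \<in> points S" "\<alpha> \<in> conormal E L x" "(\<lambda>x. \<xi> x []) \<in> sections S ell" "gamma_rep x \<alpha> f \<eta>"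
  shows "m1 S E L JN 0 \<xi> x [\<alpha>] = - (J.ham (pull (\<lambda>x. \<xi> x [])) f (x, 0) *\<^sub>R \<eta> (x, 0))"
proof -
  have x0: "(x, 0) \<in> points N" using assms(1) E.fib_zero by simp
  obtain f' \<eta>' where f': "gamma_rep x \<alpha> f' \<eta>'" "(SOME \<mu>. represents_gamma S E L x \<alpha> \<mu>) = smul f' \<eta>'"
    by (rule gamma_rep_some[OF assms(1,2)])
  let ?a = "pull (\<lambda>x. \<xi> x [])"
  have a: "?a \<in> sections N LN" by (rule pull_sections[OF assms(3)])
  have lift: "lift_form S E \<xi> [] = ?a" by (simp add: lift_form_def pull_def)
  have sec: "f \<in> Cinf N" "f' \<in> Cinf N" "\<eta> \<in> sections N LN" "\<eta>' \<in> sections N LN" "f (x, 0) = 0" "f' (x, 0) = 0"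
    using assms(4) f' by (auto simp: gamma_rep_def)
  have "m1 S E L JN 0 \<xi> x [\<alpha>] =
      schouten_jacobi 2 0 (\<lambda>ls. JN (ls ! 0) (ls ! 1)) (lift_form S E \<xi>) [smul f' \<eta>'] (x, 0)"
    using assms(1,2) f'(2) by (simp add: m1_def normal_part_def valid_args_def)
  also have "\<dots> = - (J.ham ?a f' (x, 0) *\<^sub>R \<eta>' (x, 0))"
    unfolding schouten_jacobi_2_0 lift using J.J_smul_right[OF a sec(2,4), of "(x, 0)"] sec(6) by simp
  also have "J.ham ?a f' (x, 0) *\<^sub>R \<eta>' (x, 0) = J.ham ?a f (x, 0) *\<^sub>R \<eta> (x, 0)"
  proof -
    obtain e where e: "e \<noteq> 0" "\<And>\<eta>. \<eta> \<in> sections N LN \<Longrightarrow> \<exists>a. \<eta> (x, 0) = a *\<^sub>R e"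
      by (rule fibre_basis[OF assms(1)]) blast
    obtain b b' where b: "\<eta> (x, 0) = b *\<^sub>R e" "\<eta>' (x, 0) = b' *\<^sub>R e" using e(2) sec(3,4) by metis
    show ?thesis
      using gamma_rep_jet[OF assms(1,4) f'(1) b e(1) J.ham_tangent[OF a x0]] b by (simp add: mult.commute)
  qed
  finally show ?thesis .
qed

end

section \<open>Deformations and cohomology\<close>

lemma linear_not_in_bigo_square:
  assumes "(\<lambda>\<epsilon>::real. \<epsilon> * c) \<in> O[at 0](\<lambda>\<epsilon>. \<epsilon>\<^sup>2)"
  shows "c = 0"
proof (rule ccontr)
  assume c: "c \<noteq> 0"
  obtain K where K: "K > 0" "eventually (\<lambda>\<epsilon>. norm (\<epsilon> * c) \<le> K * norm (\<epsilon>\<^sup>2)) (at (0::real))"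
    using assms by (elim landau_o.bigE)
  then obtain d where d: "d > 0" "\<And>\<epsilon>. \<epsilon> \<noteq> 0 \<Longrightarrow> \<bar>\<epsilon>\<bar> < d \<Longrightarrow> \<bar>\<epsilon> * c\<bar> \<le> K * \<epsilon>\<^sup>2"
    by (auto simp: eventually_at dist_real_def)
  \<comment> \<open>The first entry keeps \<open>\<epsilon>\<close> in the range of the estimate;
    the second turns the bound of \<open>|c|\<close> by \<open>K * \<epsilon>\<close> into a bound
    by \<open>|c| / 2\<close>.\<close>
  define \<epsilon> where "\<epsilon> = min (d / 2) (\<bar>c\<bar> / (2 * K))"
  have e: "0 < \<epsilon>" "\<epsilon> < d" "\<epsilon> \<le> \<bar>c\<bar> / (2 * K)" using d(1) K(1) c by (auto simp: \<epsilon>_def)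
  have "\<epsilon> * \<bar>c\<bar> \<le> \<epsilon> * (K * \<epsilon>)" using d(2)[of \<epsilon>] e by (simp add: abs_mult power2_eq_square mult.left_commute)
  then have "\<bar>c\<bar> \<le> K * \<epsilon>" using e(1) by simp
  also have "\<dots> \<le> K * (\<bar>c\<bar> / (2 * K))" using e(3) K(1) by (intro mult_left_mono) auto
  also have "\<dots> < \<bar>c\<bar>" using K(1) c by simp
  finally show False by simp
qed

text \<open>Coisotropy of the zero section, tested on functions that vanish on all of
  \<open>S\<close>. That such functions realize every conormal vector is the content of
  \<open>gamma_rep_exists\<close>; the assumption itself is supplied by
  \<open>coisotropic_N\<close>.\<close>

locale coisotropic_setup = normal_setup +
  assumes coiso: "\<lbrakk>x \<in> points S; f \<in> Cinf N; g \<in> Cinf N; \<eta> \<in> sections N LN;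
      \<forall>y\<in>points S. f (y, 0) = 0; \<forall>y\<in>points S. g (y, 0) = 0\<rbrakk> \<Longrightarrow> J.lam \<eta> f g (x, 0) = 0"
begin

lemma tangent_vanishing:
  assumes "f \<in> Cinf N" "\<forall>y\<in>points S. f (y, 0) = 0" "u \<in> tangent_space S x"
  shows "u (\<lambda>y. f (y, 0)) = 0"
proof -
  have "f (y, 0) = 0" for y
    using assms(2) E.restrict_zero_Cinf[OF assms(1)] by (cases "y \<in> points S") (auto simp: E.Cinf_iff)
  then have "(\<lambda>y. f (y, 0)) = (\<lambda>_. 0)" by blast
  then show ?thesis using tangent_zero_function[OF assms(3)] by simp
qed

text \<open>A function that vanishes on \<open>S\<close> has at \<open>(x, 0)\<close> a differential
  that sees the fibre part of a tangent vector only, and a fibre-linear function can be given the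
  same fibre derivative.\<close>

lemma fibre_linear_replacement:
  assumes "x \<in> points S" "f \<in> Cinf N" "\<forall>y\<in>points S. f (y, 0) = 0"
  obtains V t \<theta> \<kappa> where "cutoff S V \<theta>" "(V, t) \<in> triv E" "bounded_linear \<kappa>"
    "\<And>D. D \<in> tangent_space N (x, 0) \<Longrightarrow> D f = D (E.flin \<theta> t \<kappa>)"
proof -
  have x0: "(x, 0) \<in> points N" using assms(1) E.fib_zero by simp
  define k where "k w = deriv (\<lambda>r. f (x, r *\<^sub>R w)) 0" for w
  have lin: "k (w + w') = k w + k w'" "k (c *\<^sub>R w) = c * k w" if "w \<in> fib E x" "w' \<in> fib E x" for w w' c
    using line_deriv_linear[OF assms(2) x0] that by (simp_all add: k_def)
  obtain V t \<theta> \<kappa> where f0: "cutoff S V \<theta>" "(V, t) \<in> triv E" "bounded_linear \<kappa>"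
    "\<And>w. w \<in> fib E x \<Longrightarrow> deriv (\<lambda>r. E.flin \<theta> t \<kappa> (x, r *\<^sub>R w)) 0 = k w"
    using E.fibre_linearization[OF Hausdorff_S assms(1), of k] lin by metis
  have C: "E.flin \<theta> t \<kappa> \<in> Cinf N" by (rule E.flin_Cinf[OF f0(1-3)])
  have "D f = D (E.flin \<theta> t \<kappa>)" if D: "D \<in> tangent_space N (x, 0)" for D
  proof -
    obtain u w where u: "u \<in> tangent_space S x" and w: "w \<in> fib E x"
      and split: "\<And>f. f \<in> Cinf N \<Longrightarrow> D f = u (\<lambda>y. f (y, 0)) + deriv (\<lambda>r. f (x, r *\<^sub>R w)) 0"
      by (rule E.tangent_zero_split[OF D]) blast
    show ?thesis
      unfolding split[OF assms(2)] split[OF C] f0(4)[OF w] k_def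
      using tangent_vanishing[OF assms(2,3) u] tangent_vanishing[OF C _ u] E.flin_zero[OF f0(1-3)] by simp
  qed
  with that f0(1-3) show ?thesis by blast
qed

text \<open>The number \<open>c\<close> is, up to sign, both the derivative at \<open>\<epsilon> = 0\<close> of the quantity measuring the
  failure of \<open>\<epsilon> s\<close> to be coisotropic and the value of the bracket of \<open>J\<close> with the lift of \<open>s\<close>.\<close>
lemma coisotropy_defect:
  assumes s: "s \<in> sections S E" and x: "x \<in> points S" and \<eta>: "\<eta> \<in> sections N LN"
    and f: "f \<in> Cinf N" "\<forall>y\<in>points S. f (y, 0) = 0" and g: "g \<in> Cinf N" "\<forall>y\<in>points S. g (y, 0) = 0"
  obtains c where
    "(\<lambda>\<epsilon>. J.lam \<eta> (translate (\<lambda>y. \<epsilon> *\<^sub>R s y) f) (translate (\<lambda>y. \<epsilon> *\<^sub>R s y) g) (x, \<epsilon> *\<^sub>R s x))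
       \<in> O[at 0](\<lambda>\<epsilon>. \<epsilon>\<^sup>2) \<longleftrightarrow> c = 0"
    "\<And>\<mu>. \<mu> \<in> sections N LN \<Longrightarrow>
       jacobi_derivation.bd JN (Ds s) (smul f \<eta>) (smul g \<mu>) (x, 0) = - (c *\<^sub>R \<mu> (x, 0))"
proof -
  interpret D: jacobi_derivation N LN JN "Ds s" "E.vert s" by (rule jacobi_derivation_Ds[OF s])
  have x0: "(x, 0) \<in> points N" using x E.fib_zero by simp
  have sx: "s x \<in> fib E x" by (rule E.sections_fib[OF s x])
  obtain V t \<theta> \<kappa> where F: "cutoff S V \<theta>" "(V, t) \<in> triv E" "bounded_linear \<kappa>"
    and fD: "\<And>D. D \<in> tangent_space N (x, 0) \<Longrightarrow> D f = D (E.flin \<theta> t \<kappa>)"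
    by (rule fibre_linear_replacement[OF x f]) blast
  obtain V' t' \<theta>' \<kappa>' where G: "cutoff S V' \<theta>'" "(V', t') \<in> triv E" "bounded_linear \<kappa>'"
    and gD: "\<And>D. D \<in> tangent_space N (x, 0) \<Longrightarrow> D g = D (E.flin \<theta>' t' \<kappa>')"
    by (rule fibre_linear_replacement[OF x g]) blast
  let ?f = "E.flin \<theta> t \<kappa>" and ?g = "E.flin \<theta>' t' \<kappa>'" and ?X = "E.vert s"
  have Cf: "?f \<in> Cinf N" and Cg: "?g \<in> Cinf N" by (rule E.flin_Cinf[OF F], rule E.flin_Cinf[OF G])
  have CX: "?X ?f \<in> Cinf N" "?X ?g \<in> Cinf N" by (rule D.X_Cinf)+
  have f0: "\<forall>y\<in>points S. ?f (y, 0) = 0" and g0: "\<forall>y\<in>points S. ?g (y, 0) = 0"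
    using E.flin_zero[OF F] E.flin_zero[OF G] by auto
  define a where "a h \<epsilon> = h (x, \<epsilon> *\<^sub>R s x)" for h :: "'a \<times> 'c \<Rightarrow> real" and \<epsilon> :: real
  have sm: "smooth_on UNIV (a h)" if "h \<in> Cinf N" for h
    unfolding a_def using E.line_smooth[OF that x sx] .
  \<comment> \<open>The coefficients of the powers of \<open>\<epsilon>\<close> in the expanded
    bivector. They are functions on the total space, still to be evaluated at the moving
    point.\<close>
  let ?A = "J.lam \<eta> ?f ?g"
  let ?B = "\<lambda>p. J.lam \<eta> (?X ?f) ?g p + J.lam \<eta> ?f (?X ?g) p"
  let ?C = "J.lam \<eta> (?X ?f) (?X ?g)"
  have CA: "?A \<in> Cinf N" "?B \<in> Cinf N" "?C \<in> Cinf N"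
    by (intro J.lam_Cinf E.T.Cinf_add Cf CX \<eta>)+
  define H where "H \<epsilon> = a ?A \<epsilon> - \<epsilon> * a ?B \<epsilon> + \<epsilon> * (\<epsilon> * a ?C \<epsilon>)" for \<epsilon>
  have eqH: "J.lam \<eta> (translate (\<lambda>y. \<epsilon> *\<^sub>R s y) f) (translate (\<lambda>y. \<epsilon> *\<^sub>R s y) g) (x, \<epsilon> *\<^sub>R s x) = H \<epsilon>" for \<epsilon>
  proof -
    let ?p = "(x, \<epsilon> *\<^sub>R s x)" and ?\<sigma> = "\<lambda>y. \<epsilon> *\<^sub>R s y"
    have p: "?p \<in> points N" using x E.fib_scale[OF x sx] by simp
    have \<sigma>: "?\<sigma> \<in> sections S E" by (rule E.sections_scale[OF s])
    \<comment> \<open>Equality of differentials at \<open>(x, 0)\<close> passes to the translates at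
      \<open>?p\<close>: apply it to the push-forward of \<open>D\<close> under the
      translation.\<close>
    have tr: "D (translate ?\<sigma> h) = D (translate ?\<sigma> h')"
      if D: "D \<in> tangent_space N ?p" and h: "h \<in> Cinf N" "h' \<in> Cinf N"
        and eq: "\<And>D. D \<in> tangent_space N (x, 0) \<Longrightarrow> D h = D h'" for D h h'
      using eq[OF E.tangent_translate[OF \<sigma> D, simplified]] h by simp
    have "J.lam \<eta> (translate ?\<sigma> f) (translate ?\<sigma> g) ?p = J.lam \<eta> (translate ?\<sigma> ?f) (translate ?\<sigma> ?g) ?p"
      by (rule J.lam_cong[OF p])
        (auto intro: E.translate_Cinf[OF \<sigma>] f g Cf Cg \<eta> tr[OF _ f(1) Cf fD] tr[OF _ g(1) Cg gD])
    also have "\<dots> = J.lam \<eta> (\<lambda>q. ?f q - \<epsilon> * ?X ?f q) (\<lambda>q. ?g q - \<epsilon> * ?X ?g q) ?p"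
      unfolding E.flin_translate[OF F s] E.flin_translate[OF G s] ..
    also have "\<dots> = H \<epsilon>"
    proof -
      have g': "(\<lambda>q. ?g q - \<epsilon> * ?X ?g q) \<in> Cinf N"
        by (intro E.T.Cinf_diff E.T.Cinf_scale Cg CX)
      show ?thesis
        unfolding J.lam_comb_left[OF p Cf CX(1) \<eta> g'] J.lam_comb_right[OF p Cf \<eta> Cg CX(2)]
          J.lam_comb_right[OF p CX(1) \<eta> Cg CX(2)]
        by (simp add: H_def a_def algebra_simps)
    qed
    finally show ?thesis .
  qed
  have smH: "smooth_on UNIV H"
    unfolding H_def[abs_def]
    by (intro smooth_on_add smooth_on_diff smooth_on_mult open_UNIV sm CA smooth_on_linear[OF bounded_linear_ident])
  have H0: "H 0 = 0" using coiso[OF x Cf Cg \<eta> f0 g0] by (simp add: H_def a_def)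
  \<comment> \<open>The derivative of \<open>H\<close> at 0: the line derivative of
    \<open>?A\<close> is its \<open>vert s\<close> derivative, the linear term contributes minus
    \<open>?B\<close>, and the quadratic term nothing.\<close>
  define c where "c = ?X ?A (x, 0) - ?B (x, 0)"
  have d: "(a h has_real_derivative deriv (a h) 0) (at 0)" if "h \<in> Cinf N" for h
  proof -
    have "a h differentiable at 0" using smooth_on_imp_has_derivative[OF sm[OF that]] differentiable_def by blast
    then show ?thesis by (metis real_differentiable_def DERIV_imp_deriv)
  qed
  have dA: "deriv (a ?A) 0 = ?X ?A (x, 0)"
    using CA(1) x0 by (simp add: E.vert_def a_def[abs_def])
  have aB: "a ?B 0 = ?B (x, 0)" by (simp add: a_def)
  have "(H has_real_derivative c) (at 0)"
    using DERIV_add[OF DERIV_diff[OF d[OF CA(1)] DERIV_mult[OF DERIV_ident d[OF CA(2)]]]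
        DERIV_mult[OF DERIV_ident DERIV_mult[OF DERIV_ident d[OF CA(3)]]]]
    by (simp add: H_def[abs_def] c_def dA aB)
  then have dH: "deriv H 0 = c" by (rule DERIV_imp_deriv)
  have rem: "(\<lambda>\<epsilon>. H \<epsilon> - \<epsilon> * c) \<in> O[at 0](\<lambda>\<epsilon>. \<epsilon>\<^sup>2)"
    using smooth_first_order_expansion[OF smH] by (simp add: H0 dH)
  have big: "H \<in> O[at 0](\<lambda>\<epsilon>. \<epsilon>\<^sup>2) \<longleftrightarrow> c = 0"
  proof
    assume "H \<in> O[at 0](\<lambda>\<epsilon>. \<epsilon>\<^sup>2)"
    from sum_in_bigo(2)[OF this rem] show "c = 0"
      by (intro linear_not_in_bigo_square) simp
  next
    assume "c = 0"
    then show "H \<in> O[at 0](\<lambda>\<epsilon>. \<epsilon>\<^sup>2)" using rem by simp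
  qed
  have bd: "D.bd (smul f \<eta>) (smul g \<mu>) (x, 0) = - (c *\<^sub>R \<mu> (x, 0))" if \<mu>: "\<mu> \<in> sections N LN" for \<mu>
  proof -
    obtain e where e: "e \<noteq> 0" "\<And>\<eta>. \<eta> \<in> sections N LN \<Longrightarrow> \<exists>a. \<eta> (x, 0) = a *\<^sub>R e"
      by (rule fibre_basis[OF x]) blast
    obtain b b' where b: "\<eta> (x, 0) = b *\<^sub>R e" "\<mu> (x, 0) = b' *\<^sub>R e" using e(2) \<eta> \<mu> by metis
    have z: "f (x, 0) = 0" "g (x, 0) = 0" "?f (x, 0) = 0" "?g (x, 0) = 0" using f g f0 g0 x by auto
    have "D.bd (smul f \<eta>) (smul g \<mu>) (x, 0) = D.bd (smul ?f \<eta>) (smul ?g \<mu>) (x, 0)"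
      by (rule D.bd_jet[OF x0 E.total_has_coordinates[OF Hausdorff_S x0] f(1) z(1) Cf z(3) \<eta> b(1) \<eta> b(1)
            g(1) z(2) Cg z(4) \<mu> b(2) \<mu> b(2)])
        (use fD gD in auto)
    \<comment> \<open>\<open>bd_smul_smul\<close> produces the coefficient \<open>?B - ?X ?A\<close>
      at \<open>(x, 0)\<close>, which is \<open>- c\<close>, and a term with
      \<open>Ds s \<eta>\<close> that coisotropy removes.\<close>
    also have "\<dots> = - (c *\<^sub>R \<mu> (x, 0))"
      using D.bd_smul_smul[OF Cf z(3) Cg z(4) \<eta> \<mu>] coiso[OF x Cf Cg D.\<Delta>_sections[OF \<eta>] f0 g0]
      by (simp add: c_def algebra_simps)
    finally show ?thesis .
  qed
  show ?thesis by (rule that[of c]) (use big eqH bd in auto)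
qed

lemma valid_args_1: "valid_args S E L 1 x as \<longleftrightarrow> (\<exists>\<alpha>\<in>conormal E L x. x \<in> points S \<and> as = [\<alpha>])"
  unfolding valid_args_def by (cases as) auto

lemma valid_args_2: "valid_args S E L 2 x as \<longleftrightarrow>
    (\<exists>\<alpha>\<in>conormal E L x. \<exists>\<beta>\<in>conormal E L x. x \<in> points S \<and> as = [\<alpha>, \<beta>])"
  unfolding valid_args_def by (cases as rule: list.exhaust; cases "tl as") auto

text \<open>Test data \<open>f\<close>, \<open>g\<close>, \<open>\<eta>\<close> and pairs of
  conormal vectors correspond to each other through \<open>gamma_rep\<close>, and on corresponding
  data either condition says that the number \<open>c\<close> of \<open>coisotropy_defect\<close> is
  0.\<close>

lemma m1_zero_iff:
  assumes s: "s \<in> sections S E"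
  shows "m1 S E L JN 1 (as_form S E L s) = 0 \<longleftrightarrow> inf_coisotropic_deformation S E L JN s"
proof
  assume m: "m1 S E L JN 1 (as_form S E L s) = 0"
  have "(\<lambda>\<epsilon>. J.lam \<eta> (translate (\<lambda>y. \<epsilon> *\<^sub>R s y) f) (translate (\<lambda>y. \<epsilon> *\<^sub>R s y) g) (x, \<epsilon> *\<^sub>R s x))
      \<in> O[at 0](\<lambda>\<epsilon>. \<epsilon>\<^sup>2)"
    if f: "f \<in> Cinf N" and g: "g \<in> Cinf N" and \<eta>: "\<eta> \<in> sections N LN" and x: "x \<in> points S"
      and z: "\<forall>y\<in>points S. f (y, 0) = 0 \<and> g (y, 0) = 0" for f g \<eta> x
  proof -
    have x0: "(x, 0) \<in> points N" using x E.fib_zero by simp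
    have z': "\<forall>y\<in>points S. f (y, 0) = 0" "\<forall>y\<in>points S. g (y, 0) = 0" using z by auto
    obtain c where c: "(\<lambda>\<epsilon>. J.lam \<eta> (translate (\<lambda>y. \<epsilon> *\<^sub>R s y) f) (translate (\<lambda>y. \<epsilon> *\<^sub>R s y) g) (x, \<epsilon> *\<^sub>R s x))
        \<in> O[at 0](\<lambda>\<epsilon>. \<epsilon>\<^sup>2) \<longleftrightarrow> c = 0"
      "\<And>\<mu>. \<mu> \<in> sections N LN \<Longrightarrow>
        jacobi_derivation.bd JN (Ds s) (smul f \<eta>) (smul g \<mu>) (x, 0) = - (c *\<^sub>R \<mu> (x, 0))"
      by (rule coisotropy_defect[OF s x \<eta> f z'(1) g z'(2)]) (rule that)
    \<comment> \<open>\<open>m1\<close> only yields \<open>c\<close> times the value of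
      \<open>\<mu>\<close>; a section nonzero at the point is required to recover
      \<open>c\<close>.\<close>
    obtain \<mu> where \<mu>: "\<mu> \<in> sections N LN" "\<mu> (x, 0) \<noteq> 0" using J.nonvanishing[OF x0] by blast
    have rep: "\<exists>\<alpha>\<in>conormal E L x. gamma_rep x \<alpha> h \<nu>"
      if h: "h \<in> Cinf N" "\<forall>y\<in>points S. h (y, 0) = 0" and \<nu>: "\<nu> \<in> sections N LN" for h \<nu>
    proof
      let ?\<alpha> = "restrict_to (fib E x) (\<lambda>w. deriv (\<lambda>r. h (x, r *\<^sub>R w)) 0 *\<^sub>R \<nu> (x, 0))"
      note lin = line_deriv_linear[OF h(1) x0, simplified]
      show "?\<alpha> \<in> conormal E L x"
        using lin LN.sections_fib[OF \<nu> x0] l.fib_scale[OF x]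
        by (intro conormalI x) (auto simp: scaleR_left_distrib)
      show "gamma_rep x ?\<alpha> h \<nu>"
        by (rule gamma_repI[OF h(1) _ \<nu> x]) (use h(2) in \<open>auto simp: restrict_to_def\<close>)
    qed
    obtain \<alpha> where \<alpha>: "\<alpha> \<in> conormal E L x" "gamma_rep x \<alpha> f \<eta>" using rep[OF f z'(1) \<eta>] by blast
    obtain \<beta> where \<beta>: "\<beta> \<in> conormal E L x" "gamma_rep x \<beta> g \<mu>" using rep[OF g z'(2) \<mu>(1)] by blast
    have "- (c *\<^sub>R \<mu> (x, 0)) = 0"
      using m1_section_form[OF s x \<alpha>(1) \<beta>(1) \<alpha>(2) \<beta>(2)] m c(2)[OF \<mu>(1)] by simp
    then show ?thesis using c(1) \<mu>(2) by simp
  qed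
  then show "inf_coisotropic_deformation S E L JN s"
    unfolding inf_coisotropic_deformation_def Let_def J.Lambda_sharp_eq using s by blast
next
  assume i: "inf_coisotropic_deformation S E L JN s"
  have "m1 S E L JN 1 (as_form S E L s) x as = 0" for x as
  proof (cases "valid_args S E L 2 x as")
    case True
    then obtain \<alpha> \<beta> where ab: "\<alpha> \<in> conormal E L x" "\<beta> \<in> conormal E L x" "x \<in> points S" "as = [\<alpha>, \<beta>]"
      unfolding valid_args_2 by blast
    obtain f \<eta> where f: "gamma_rep x \<alpha> f \<eta>" "\<And>y. y \<in> points S \<Longrightarrow> f (y, 0) = 0"
      by (rule gamma_rep_exists[OF ab(3,1)]) blast
    obtain g \<mu> where g: "gamma_rep x \<beta> g \<mu>" "\<And>y. y \<in> points S \<Longrightarrow> g (y, 0) = 0"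
      by (rule gamma_rep_exists[OF ab(3,2)]) blast
    have sec: "f \<in> Cinf N" "g \<in> Cinf N" "\<eta> \<in> sections N LN" "\<mu> \<in> sections N LN"
      using f g by (auto simp: gamma_rep_def)
    have z: "\<forall>y\<in>points S. f (y, 0) = 0" "\<forall>y\<in>points S. g (y, 0) = 0" using f g by auto
    obtain c where c: "(\<lambda>\<epsilon>. J.lam \<eta> (translate (\<lambda>y. \<epsilon> *\<^sub>R s y) f) (translate (\<lambda>y. \<epsilon> *\<^sub>R s y) g) (x, \<epsilon> *\<^sub>R s x))
        \<in> O[at 0](\<lambda>\<epsilon>. \<epsilon>\<^sup>2) \<longleftrightarrow> c = 0"
      "\<And>\<mu>. \<mu> \<in> sections N LN \<Longrightarrow>
        jacobi_derivation.bd JN (Ds s) (smul f \<eta>) (smul g \<mu>) (x, 0) = - (c *\<^sub>R \<mu> (x, 0))"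
      by (rule coisotropy_defect[OF s ab(3) sec(3,1) z(1) sec(2) z(2)]) (rule that)
    have "(\<lambda>\<epsilon>. J.lam \<eta> (translate (\<lambda>y. \<epsilon> *\<^sub>R s y) f) (translate (\<lambda>y. \<epsilon> *\<^sub>R s y) g) (x, \<epsilon> *\<^sub>R s x))
        \<in> O[at 0](\<lambda>\<epsilon>. \<epsilon>\<^sup>2)"
      using i sec(1-3) ab(3) z unfolding inf_coisotropic_deformation_def Let_def J.Lambda_sharp_eq by blast
    then show ?thesis
      using m1_section_form[OF s ab(3,1,2) f(1) g(1)] c(1) c(2)[OF sec(4)] ab(4) by simp
  qed (simp add: m1_def normal_part_def numeral_2_eq_2)
  then show "m1 S E L JN 1 (as_form S E L s) = 0" by (intro ext) (simp add: zero_fun_def)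
qed

section \<open>Sections of the normal bundle as 1-forms\<close>

lemma conormal_plus:
  assumes "x \<in> points S" "\<alpha> \<in> conormal E L x" "\<beta> \<in> conormal E L x"
  shows "\<alpha> + \<beta> \<in> conormal E L x"
  using assms(2,3) l.fib_add[OF assms(1)] unfolding conormal_def linear_map_on_def
  by (auto simp: scaleR_add_right image_subset_iff)

lemma conormal_scaleR:
  assumes "x \<in> points S" "\<alpha> \<in> conormal E L x"
  shows "(\<lambda>w. c *\<^sub>R \<alpha> w) \<in> conormal E L x"
  using assms(2) l.fib_scale[OF assms(1)] unfolding conormal_def linear_map_on_def
  by (auto simp: scaleR_add_right image_subset_iff)

text \<open>The test covector is the inner product with \<open>?v\<close> in the model fibre, times
  a frame of the line; its values at \<open>w\<close> and \<open>w'\<close> differ by the squared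
  length of \<open>?v\<close>.\<close>

lemma conormal_separates:
  assumes x: "x \<in> points S" and w: "w \<in> fib E x" "w' \<in> fib E x"
    and eq: "\<And>\<alpha>. \<alpha> \<in> conormal E L x \<Longrightarrow> \<alpha> w = \<alpha> w'"
  shows "w = w'"
proof -
  obtain V t where V: "(V, t) \<in> triv E" "x \<in> V" by (rule E.triv_at[OF x])
  obtain V' t' where V': "(V', t') \<in> triv ell" "x \<in> V'" by (rule l.triv_at[OF x])
  let ?v = "t x w - t x w'" and ?e = "l.tinv t' x 1"
  let ?\<alpha> = "restrict_to (fib E x) (\<lambda>u. (t x u \<bullet> ?v) *\<^sub>R ?e)"
  have "?\<alpha> \<in> conormal E L x"
    using l.fib_scale[OF x] frame_nonzero(1)[OF V']
    by (intro conormalI x) (auto simp: E.triv_add[OF V] E.triv_scale[OF V] inner_add_left scaleR_left_distrib)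
  from eq[OF this] have "(t x w \<bullet> ?v) *\<^sub>R ?e = (t x w' \<bullet> ?v) *\<^sub>R ?e" using w by (simp add: restrict_to_def)
  then have "?v \<bullet> ?v = 0" using frame_nonzero(2)[OF V'] by (simp add: inner_diff_left)
  then show ?thesis using E.triv_inj[OF V w] by simp
qed

lemma as_form_apply:
  "x \<in> points S \<Longrightarrow> \<alpha> \<in> conormal E L x \<Longrightarrow> as_form S E L s x [\<alpha>] = \<alpha> (s x)"
  by (simp add: as_form_def valid_args_def)

lemma as_form_eqI:
  assumes "\<And>x as. \<not> valid_args S E L 1 x as \<Longrightarrow> \<xi> x as = 0"
    "\<And>x \<alpha>. x \<in> points S \<Longrightarrow> \<alpha> \<in> conormal E L x \<Longrightarrow> \<xi> x [\<alpha>] = \<alpha> (s x)"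
  shows "as_form S E L s = \<xi>"
proof (intro ext)
  fix x as
  show "as_form S E L s x as = \<xi> x as"
  proof (cases "valid_args S E L 1 x as")
    case True
    then show ?thesis using assms(2) as_form_apply unfolding valid_args_1 by metis
  next
    case False
    then show ?thesis using assms(1) by (simp add: as_form_def)
  qed
qed

lemma as_form_forms:
  assumes s: "s \<in> sections S E"
  shows "as_form S E L s \<in> forms S E L 1"
  unfolding forms_def
proof (intro CollectI conjI)
  show "\<forall>x as. \<not> valid_args S E L 1 x as \<longrightarrow> as_form S E L s x as = 0" by (simp add: as_form_def)
  have "as_form S E L s x [\<alpha>] \<in> fib L x" if "x \<in> points S" "\<alpha> \<in> conormal E L x" for x \<alpha>
    using conormal_apply_fib[OF that(2) E.sections_fib[OF s that(1)]] as_form_apply[OF that] by simp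
  then show "\<forall>x as. valid_args S E L 1 x as \<longrightarrow> as_form S E L s x as \<in> fib L x \<and>
      (\<forall>j<1. \<forall>\<alpha>\<in>conormal E L x. \<forall>\<beta>\<in>conormal E L x.
        as_form S E L s x (as[j := \<alpha> + \<beta>]) = as_form S E L s x (as[j := \<alpha>]) + as_form S E L s x (as[j := \<beta>])) \<and>
      (\<forall>j<1. \<forall>c. \<forall>\<alpha>\<in>conormal E L x.
        as_form S E L s x (as[j := \<lambda>w. c *\<^sub>R \<alpha> w]) = c *\<^sub>R as_form S E L s x (as[j := \<alpha>])) \<and>
      (\<forall>i<1. \<forall>j<1. i \<noteq> j \<and> as ! i = as ! j \<longrightarrow> as_form S E L s x as = 0)"
    unfolding valid_args_1 by (auto simp: as_form_apply conormal_plus conormal_scaleR)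
  show "\<forall>\<alpha>s. length \<alpha>s = 1 \<and> set \<alpha>s \<subseteq> conormal_sections S E L \<longrightarrow>
      (\<lambda>x. as_form S E L s x (map (\<lambda>\<alpha>. \<alpha> x) \<alpha>s)) \<in> sections S ell"
  proof (intro allI impI)
  fix \<alpha>s assume "length \<alpha>s = 1 \<and> set \<alpha>s \<subseteq> conormal_sections S E L"
  then obtain \<alpha> where \<alpha>: "\<alpha>s = [\<alpha>]" "\<alpha> \<in> conormal_sections S E L" by (cases \<alpha>s) auto
  have "(\<lambda>x. as_form S E L s x (map (\<lambda>\<alpha>. \<alpha> x) \<alpha>s)) = (\<lambda>x. \<alpha> x (s x))"
  proof
    fix x
    show "as_form S E L s x (map (\<lambda>\<alpha>. \<alpha> x) \<alpha>s) = \<alpha> x (s x)"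
      using \<alpha> by (cases "x \<in> points S") (auto simp: as_form_apply conormal_sections_def as_form_def valid_args_def)
  qed
  then show "(\<lambda>x. as_form S E L s x (map (\<lambda>\<alpha>. \<alpha> x) \<alpha>s)) \<in> sections S ell"
    using \<alpha>(2) s unfolding conormal_sections_def by simp
  qed
qed

lemma as_form_inj: "inj_on (as_form S E L) (sections S E)"
proof (rule inj_onI, rule ext)
  fix s s' x assume s: "s \<in> sections S E" "s' \<in> sections S E" and eq: "as_form S E L s = as_form S E L s'"
  show "s x = s' x"
  proof (cases "x \<in> points S")
    case True
    then show ?thesis
      using conormal_separates[OF True E.sections_fib[OF s(1) True] E.sections_fib[OF s(2) True]]
        as_form_apply[OF True] eq by metis
  next
    case False
    then show ?thesis using E.sections_off s by metis
  qed
qed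

lemma form_1_zero: "\<xi> \<in> forms S E L 1 \<Longrightarrow> \<not> valid_args S E L 1 x as \<Longrightarrow> \<xi> x as = 0"
  by (simp add: forms_def)

lemma form_1_linear:
  assumes "\<xi> \<in> forms S E L 1" "x \<in> points S" "\<alpha> \<in> conormal E L x" "\<beta> \<in> conormal E L x"
  shows "\<xi> x [\<alpha>] \<in> fib L x" "\<xi> x [\<alpha> + \<beta>] = \<xi> x [\<alpha>] + \<xi> x [\<beta>]" "\<xi> x [\<lambda>w. c *\<^sub>R \<alpha> w] = c *\<^sub>R \<xi> x [\<alpha>]"
proof -
  have v: "valid_args S E L 1 x [\<alpha>]" using assms by (simp add: valid_args_def)
  note F = assms(1)[unfolded forms_def mem_Collect_eq, THEN conjunct2, THEN conjunct1, rule_format, OF v]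
  then show "\<xi> x [\<alpha>] \<in> fib L x" "\<xi> x [\<alpha> + \<beta>] = \<xi> x [\<alpha>] + \<xi> x [\<beta>]" "\<xi> x [\<lambda>w. c *\<^sub>R \<alpha> w] = c *\<^sub>R \<xi> x [\<alpha>]"
    using assms(3,4) by simp_all
qed

text \<open>Fibrewise this is the double dual: linear maps from Hom(E, \<ell>) to the line \<ell>
  are evaluations at vectors of E. The vector is assembled from the values of \<open>\<xi>\<close>
  on coordinate covectors.\<close>

lemma form_1_pointwise:
  assumes \<xi>: "\<xi> \<in> forms S E L 1" and x: "x \<in> points S"
  shows "\<exists>w\<in>fib E x. \<forall>\<alpha>\<in>conormal E L x. \<xi> x [\<alpha>] = \<alpha> w"
proof -
  obtain V t where V: "(V, t) \<in> triv E" "x \<in> V" by (rule E.triv_at[OF x])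
  obtain V' t' where V': "(V', t') \<in> triv ell" "x \<in> V'" by (rule l.triv_at[OF x])
  obtain I :: "'d set" and c where I: "finite I" "\<And>b. bounded_linear (c b :: 'd \<Rightarrow> real)"
    "\<And>v. v = (\<Sum>b\<in>I. c b v *\<^sub>R b)" by (rule finite_dim_coordinates[OF E.model_fin_dim]) blast
  let ?e = "l.tinv t' x 1"
  have e: "?e \<in> fib ell x" using frame_nonzero(1)[OF V'] by simp
  have mult: "u = t' x u *\<^sub>R ?e" if "u \<in> fib L x" for u
    using l.tinv_scale[OF V', of "t' x u" 1] l.tinv_triv[OF V', of u] that by simp
  define \<beta> where "\<beta> b = restrict_to (fib E x) (\<lambda>u. c b (t x u) *\<^sub>R ?e)" for b
  have \<beta>: "\<beta> b \<in> conormal E L x" for b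
  proof -
    interpret cb: bounded_linear "c b" by (rule I(2))
    show ?thesis unfolding \<beta>_def
      using l.fib_scale[OF x e]
      by (intro conormalI x)
        (auto simp: E.triv_add[OF V] E.triv_scale[OF V] cb.add cb.scaleR scaleR_left_distrib)
  qed
  have sum: "(\<lambda>u. \<Sum>b\<in>K. a b *\<^sub>R \<beta> b u) \<in> conormal E L x \<and>
      \<xi> x [\<lambda>u. \<Sum>b\<in>K. a b *\<^sub>R \<beta> b u] = (\<Sum>b\<in>K. a b *\<^sub>R \<xi> x [\<beta> b])" if "finite K" for K a
    using that
  proof induction
    case empty
    have z: "(\<lambda>u. 0) \<in> conormal E L x" using conormal_scaleR[OF x \<beta>, of 0] by simp
    have "\<xi> x [\<lambda>u. 0] = 0" using form_1_linear(3)[OF \<xi> x \<beta>[of undefined] \<beta>[of undefined], of 0] by simp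
    with z show ?case by simp
  next
    case (insert b K)
    have eq: "(\<lambda>u. \<Sum>b\<in>insert b K. a b *\<^sub>R \<beta> b u) = (\<lambda>u. a b *\<^sub>R \<beta> b u) + (\<lambda>u. \<Sum>b\<in>K. a b *\<^sub>R \<beta> b u)"
      using insert by (auto simp: plus_fun_def)
    note ab = conormal_scaleR[OF x \<beta>[of b], of "a b"]
    have IH: "(\<lambda>u. \<Sum>b\<in>K. a b *\<^sub>R \<beta> b u) \<in> conormal E L x"
      "\<xi> x [\<lambda>u. \<Sum>b\<in>K. a b *\<^sub>R \<beta> b u] = (\<Sum>b\<in>K. a b *\<^sub>R \<xi> x [\<beta> b])"
      using insert.IH by blast+
    show ?case
      unfolding eq form_1_linear(2)[OF \<xi> x ab IH(1)] form_1_linear(3)[OF \<xi> x \<beta> \<beta>] IH(2)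
      using conormal_plus[OF x ab IH(1)] insert by simp
  qed
  \<comment> \<open>The components of the vector sought: coefficients of the values of
    \<open>\<xi>\<close> on \<open>\<beta> b\<close> with respect to the frame
    \<open>?e\<close>.\<close>
  define h where "h b = t' x (\<xi> x [\<beta> b])" for b
  define v where "v = (\<Sum>b\<in>I. h b *\<^sub>R b)"
  have \<xi>\<beta>: "\<xi> x [\<beta> b] = h b *\<^sub>R ?e" for b
    unfolding h_def by (rule mult[OF form_1_linear(1)[OF \<xi> x \<beta> \<beta>]])
  have "\<xi> x [\<alpha>] = \<alpha> (E.tinv t x v)" if \<alpha>: "\<alpha> \<in> conormal E L x" for \<alpha>
  proof -
    have tv: "\<alpha> (E.tinv t x (\<Sum>b\<in>K. d b *\<^sub>R b)) = (\<Sum>b\<in>K. d b *\<^sub>R \<alpha> (E.tinv t x b))" if "finite K" for K d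
      using that
    proof induction
      case empty
      show ?case
        using E.tinv_scale[OF V, of 0 0] conormal_scale[OF \<alpha> E.fib_zero[OF x], of 0] by simp
    next
      case (insert b K)
      then show ?case
        by (simp add: E.tinv_add[OF V] E.tinv_scale[OF V] conormal_add[OF \<alpha>] conormal_scale[OF \<alpha>]
            E.tinv_fib[OF V] E.fib_scale[OF x])
    qed
    define a where "a b = t' x (\<alpha> (E.tinv t x b))" for b
    have ab: "\<alpha> (E.tinv t x b) = a b *\<^sub>R ?e" for b
      unfolding a_def by (rule mult[OF conormal_apply_fib[OF \<alpha> E.tinv_fib[OF V]]])
    \<comment> \<open>A covector is the combination of the coordinate covectors
      \<open>\<beta> b\<close> whose coefficients are its values on the vectors
      \<open>E.tinv t x b\<close>.\<close>
    have "\<alpha> u = (\<Sum>b\<in>I. a b *\<^sub>R \<beta> b u)" for u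
    proof (cases "u \<in> fib E x")
      case True
      have "\<alpha> u = \<alpha> (E.tinv t x (\<Sum>b\<in>I. c b (t x u) *\<^sub>R b))"
        by (subst I(3)[symmetric]) (simp add: E.tinv_triv[OF V True])
      also have "\<dots> = (\<Sum>b\<in>I. c b (t x u) *\<^sub>R \<alpha> (E.tinv t x b))" by (rule tv[OF I(1)])
      also have "\<dots> = (\<Sum>b\<in>I. c b (t x u) *\<^sub>R (a b *\<^sub>R ?e))" by (simp only: ab)
      also have "\<dots> = (\<Sum>b\<in>I. a b *\<^sub>R \<beta> b u)"
        using True by (simp add: \<beta>_def restrict_to_def mult.commute)
      finally show ?thesis .
    next
      case False
      then show ?thesis using \<alpha> by (simp add: conormal_def \<beta>_def restrict_to_def)
    qed
    then have "\<alpha> = (\<lambda>u. \<Sum>b\<in>I. a b *\<^sub>R \<beta> b u)" by blast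
    then have "\<xi> x [\<alpha>] = (\<Sum>b\<in>I. a b *\<^sub>R \<xi> x [\<beta> b])" using sum[OF I(1), of a] by metis
    also have "\<dots> = (\<Sum>b\<in>I. h b *\<^sub>R \<alpha> (E.tinv t x b))"
      by (simp only: ab \<xi>\<beta> scaleR_scaleR mult.commute)
    also have "\<dots> = \<alpha> (E.tinv t x v)" unfolding v_def by (rule tv[OF I(1), symmetric])
    finally show ?thesis .
  qed
  then show ?thesis using E.tinv_fib[OF V] by blast
qed

text \<open>With the pointwise vectors at hand, smoothness is the point. Cut off coordinate
  covectors are smooth conormal sections, so \<open>forms\<close> guarantees smooth values of
  \<open>\<xi>\<close> on them, and these values are the coordinates of \<open>s\<close> near
  \<open>x\<close>.\<close>

lemma as_form_surj:
  assumes \<xi>: "\<xi> \<in> forms S E L 1"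
  obtains s where "s \<in> sections S E" "as_form S E L s = \<xi>"
proof -
  obtain w where w: "\<And>x. x \<in> points S \<Longrightarrow> w x \<in> fib E x"
    "\<And>x \<alpha>. x \<in> points S \<Longrightarrow> \<alpha> \<in> conormal E L x \<Longrightarrow> \<xi> x [\<alpha>] = \<alpha> (w x)"
    using form_1_pointwise[OF \<xi>] by metis
  define s where "s = restrict_to (points S) w"
  have sw: "s x = w x" if "x \<in> points S" for x using that by (simp add: s_def restrict_to_def)
  have "E.section_near s x" if x: "x \<in> points S" for x
  proof -
    obtain V t where V: "(V, t) \<in> triv E" "x \<in> V" by (rule E.triv_at[OF x])
    obtain V' t' where V': "(V', t') \<in> triv ell" "x \<in> V'" by (rule l.triv_at[OF x])
    have o: "mopen S (V \<inter> V')" "x \<in> V \<inter> V'"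
      using V V' E.triv_mopen[OF V(1)] l.triv_mopen[OF V'(1)] E.mopen_Int by auto
    obtain \<theta> W where \<theta>: "cutoff S (V \<inter> V') \<theta>" "mopen S W" "x \<in> W" "W \<subseteq> V \<inter> V'" "\<forall>q\<in>W. \<theta> q = 1"
      by (rule E.cutoff_exists[OF Hausdorff_S o])
    obtain I :: "'d set" and c where I: "finite I" "\<And>b. bounded_linear (c b :: 'd \<Rightarrow> real)"
      "\<And>v. v = (\<Sum>b\<in>I. c b v *\<^sub>R b)" by (rule finite_dim_coordinates[OF E.model_fin_dim]) blast
    let ?e = "\<lambda>y. l.tinv t' y 1"
    define \<beta> where "\<beta> b y = restrict_to (fib E y) (\<lambda>u. (\<theta> y * c b (t y u)) *\<^sub>R ?e y)" for b y
    have \<beta>: "\<beta> b y \<in> conormal E L y" if y: "y \<in> points S" for b y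
    proof (cases "y \<in> V \<inter> V'")
      case True
      interpret cb: bounded_linear "c b" by (rule I(2))
      have "?e y \<in> fib ell y" using frame_nonzero(1)[OF V'(1)] True by simp
      then show ?thesis unfolding \<beta>_def
        using l.fib_scale[OF y] True
        by (intro conormalI y)
          (auto simp: E.triv_add[OF V(1)] E.triv_scale[OF V(1)] cb.add cb.scaleR scaleR_left_distrib distrib_left)
    next
      case False
      then have "\<theta> y = 0" using E.cutoff_zero[OF \<theta>(1)] by blast
      then show ?thesis unfolding \<beta>_def
        using l.fib_zero[OF y] by (intro conormalI y) auto
    qed
    have \<beta>s: "\<beta> b \<in> conormal_sections S E L" for b
      unfolding conormal_sections_def
    proof (intro CollectI conjI ballI allI impI)
      show "\<beta> b y \<in> conormal E L y" if "y \<in> points S" for y by (rule \<beta>[OF that])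
      show "\<beta> b y = 0" if "y \<notin> points S" for y
      proof -
        have "\<theta> y = 0" using \<theta>(1) that by (auto simp: cutoff_def E.Cinf_iff)
        then show ?thesis by (auto simp: \<beta>_def restrict_to_def)
      qed
      fix s' assume s': "s' \<in> sections S E"
      have "(\<lambda>y. \<theta> y *\<^sub>R (c b (t y (s' y)) *\<^sub>R ?e y)) \<in> sections S ell"
      proof (rule l.sections_cutoff[OF \<theta>(1)])
        fix y assume y: "y \<in> V \<inter> V'"
        show "l.section_near (\<lambda>y. c b (t y (s' y)) *\<^sub>R ?e y) y"
          by (intro l.section_near_scaleR E.smooth_near_linear[OF I(2)] E.sections_smooth_near[OF s' V(1)]
              l.section_near_frame[OF V'(1)]) (use y in auto)
      qed
      moreover have "(\<lambda>y. \<theta> y *\<^sub>R (c b (t y (s' y)) *\<^sub>R ?e y)) = (\<lambda>y. \<beta> b y (s' y))"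
      proof
        fix y
        show "\<theta> y *\<^sub>R (c b (t y (s' y)) *\<^sub>R ?e y) = \<beta> b y (s' y)"
        proof (cases "y \<in> points S")
          case True
          then show ?thesis using E.sections_fib[OF s' True] by (simp add: \<beta>_def restrict_to_def)
        next
          case False
          then have "\<theta> y = 0" using \<theta>(1) by (auto simp: cutoff_def E.Cinf_iff)
          then show ?thesis by (simp add: \<beta>_def restrict_to_def)
        qed
      qed
      ultimately show "(\<lambda>y. \<beta> b y (s' y)) \<in> sections S ell" by simp
    qed
    have near\<xi>: "smooth_near S (\<lambda>y. t' y (\<xi> y [\<beta> b y])) x" for b
    proof -
      have "(\<lambda>x. \<xi> x (map (\<lambda>\<alpha>. \<alpha> x) [\<beta> b])) \<in> sections S ell"
        using \<xi> \<beta>s[of b] unfolding forms_def by (auto simp del: list.map)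
      from l.sections_smooth_near[OF this V'] show ?thesis by simp
    qed
    have "smooth_near S (\<lambda>y. \<Sum>b\<in>I. t' y (\<xi> y [\<beta> b y]) *\<^sub>R b) x"
      by (intro E.smooth_near_sum x E.smooth_near_scaleR near\<xi> E.smooth_near_const)
    then have near: "smooth_near S (\<lambda>y. t y (s y)) x"
    proof (rule E.smooth_near_cong[OF _ \<theta>(2,3)])
      fix y assume y: "y \<in> W"
      then have y': "y \<in> V" "y \<in> V'" "\<theta> y = 1" "y \<in> points S"
        using \<theta>(4,5) E.mopen_subset[OF \<theta>(2)] by auto
      have "t' y (\<xi> y [\<beta> b y]) = c b (t y (s y))" for b
      proof -
        have e: "?e y \<in> fib ell y" using frame_nonzero(1)[OF V'(1) y'(2)] by simp
        have "\<xi> y [\<beta> b y] = c b (t y (s y)) *\<^sub>R ?e y"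
          using w(2)[OF y'(4) \<beta>[OF y'(4)]] w(1)[OF y'(4)] sw[OF y'(4)] y'(3)
          by (simp add: \<beta>_def restrict_to_def)
        then show ?thesis
          using l.triv_scale[OF V'(1) y'(2) e] l.triv_tinv[OF V'(1) y'(2), of 1] by simp
      qed
      then show "(\<Sum>b\<in>I. t' y (\<xi> y [\<beta> b y]) *\<^sub>R b) = t y (s y)" by (simp flip: I(3))
    qed
    show ?thesis
      by (rule E.section_nearI[OF E.mopen_points x _ V near]) (use w(1) sw in auto)
  qed
  then have "s \<in> sections S E" by (simp add: E.sections_iff s_def restrict_to_def)
  moreover have "as_form S E L s = \<xi>"
    by (rule as_form_eqI) (use form_1_zero[OF \<xi>] w(2) sw in auto)
  ultimately show ?thesis using that by blast
qed

lemma form_0_section: "\<xi> \<in> forms S E L 0 \<Longrightarrow> (\<lambda>x. \<xi> x []) \<in> sections S ell"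
  unfolding forms_def by (auto dest: spec[of _ "[]"])

lemma section_form_0:
  assumes "a \<in> sections S ell"
  obtains \<xi> where "\<xi> \<in> forms S E L 0" "(\<lambda>x. \<xi> x []) = a"
proof -
  define \<xi> where "\<xi> x as = (if valid_args S E L 0 x as then a x else 0)" for x :: 'a and as :: "('c \<Rightarrow> 'e) list"
  have eq: "(\<lambda>x. \<xi> x []) = a"
    using l.sections_off[OF assms] by (auto simp: \<xi>_def valid_args_def)
  have "\<xi> \<in> forms S E L 0"
    unfolding forms_def
  proof (intro CollectI conjI allI impI)
    fix x as assume "valid_args S E L 0 x as"
    then show "\<xi> x as \<in> fib L x" using l.sections_fib[OF assms] by (simp add: \<xi>_def valid_args_def)
  next
    fix \<alpha>s assume "length \<alpha>s = 0 \<and> set \<alpha>s \<subseteq> conormal_sections S E L"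
    then show "(\<lambda>x. \<xi> x (map (\<lambda>\<alpha>. \<alpha> x) \<alpha>s)) \<in> sections S ell" using eq assms by simp
  qed (auto simp: \<xi>_def)
  with eq that show ?thesis by blast
qed

section \<open>Hamiltonian vector fields and exact forms\<close>

lemma J_minus_left:
  assumes "\<eta> \<in> sections N LN" "\<nu> \<in> sections N LN"
  shows "JN (\<lambda>q. - \<eta> q) \<nu> p = - JN \<eta> \<nu> p"
  using J.J_antisym[OF LN.sections_minus[OF assms(1)] assms(2), of p] J.J_antisym[OF assms, of p]
    J.J_scale_right[OF assms(2,1), of "-1" p] by simp

lemma ham_gamma_rep:
  assumes "\<eta> \<in> sections N LN" "gamma_rep x \<alpha> f \<mu>"
  shows "J.ham \<eta> f (x, 0) *\<^sub>R \<mu> (x, 0) = JN \<eta> (smul f \<mu>) (x, 0)"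
  using J.J_smul_right[OF assms(1), of f \<mu> "(x, 0)"] assms(2) by (simp add: gamma_rep_def)

lemma ham_gamma_rep_unique:
  assumes "x \<in> points S" "\<eta> \<in> sections N LN" "gamma_rep x \<alpha> f \<mu>" "gamma_rep x \<alpha> f' \<mu>'"
  shows "J.ham \<eta> f (x, 0) *\<^sub>R \<mu> (x, 0) = J.ham \<eta> f' (x, 0) *\<^sub>R \<mu>' (x, 0)"
proof -
  have x0: "(x, 0) \<in> points N" using assms(1) E.fib_zero by simp
  obtain e where e: "e \<noteq> 0" "\<And>\<eta>. \<eta> \<in> sections N LN \<Longrightarrow> \<exists>a. \<eta> (x, 0) = a *\<^sub>R e"
    by (rule fibre_basis[OF assms(1)]) blast
  have "\<mu> \<in> sections N LN" "\<mu>' \<in> sections N LN" using assms(3,4) by (auto simp: gamma_rep_def)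
  then obtain b b' where b: "\<mu> (x, 0) = b *\<^sub>R e" "\<mu>' (x, 0) = b' *\<^sub>R e" using e(2) by metis
  show ?thesis
    using gamma_rep_jet[OF assms(1,3,4) b e(1) J.ham_tangent[OF assms(2) x0]] b by (simp add: mult.commute)
qed

text \<open>By coisotropy, a section vanishing on the zero section has a Hamiltonian vector field tangent
  to the zero section.\<close>
lemma ham_vanishing:
  assumes x: "x \<in> points S" and \<delta>: "\<delta> \<in> sections N LN" "\<And>y. y \<in> points S \<Longrightarrow> \<delta> (y, 0) = 0"
    and rep: "\<alpha> \<in> conormal E L x" "gamma_rep x \<alpha> f \<mu>"
  shows "J.ham \<delta> f (x, 0) *\<^sub>R \<mu> (x, 0) = 0"
proof -
  have x0: "(x, 0) \<in> points N" using x E.fib_zero by simp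
  obtain f' \<mu>' where f': "gamma_rep x \<alpha> f' \<mu>'" "\<And>y. y \<in> points S \<Longrightarrow> f' (y, 0) = 0"
    by (rule gamma_rep_exists[OF x rep(1)]) blast
  have sec: "f' \<in> Cinf N" "\<mu>' \<in> sections N LN" using f' by (auto simp: gamma_rep_def)
  obtain V t \<theta> W where V: "(V, t) \<in> triv ell" "x \<in> V" "cutoff S V \<theta>" "mopen S W" "x \<in> W" "W \<subseteq> V"
    "\<forall>y\<in>W. \<theta> y = 1" by (rule local_frame[OF x])
  \<comment> \<open>Coisotropy speaks of functions vanishing on \<open>S\<close>, so
    \<open>\<delta>\<close> has to become such a function times a section. Component and frame each
    carry the cutoff, and their product is globally the squared cutoff \<open>?q\<close> times
    \<open>\<delta>\<close>.\<close>
  let ?fr = "pull (\<lambda>y. \<theta> y *\<^sub>R l.tinv t y 1)" and ?c = "coord \<theta> t \<delta>" and ?q = "\<lambda>p. E.over \<theta> p * E.over \<theta> p"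
  have fr: "?fr \<in> sections N LN"
    by (rule pull_sections[OF l.sections_cutoff[OF V(3) l.section_near_frame[OF V(1)]]])
  have c: "?c \<in> Cinf N" by (rule coord_Cinf[OF V(3,1) \<delta>(1)])
  have c0: "?c (y, 0) = 0" for y
    using over_outside[OF V(3), of "(y, 0)"] \<delta>(2)[of y] l.triv_zero[OF V(1), of y]
    by (cases "(y, 0) \<in> points N \<inter> fst -` V") (auto simp: coord_def)
  have q: "?q \<in> Cinf N"
    using V(3) E.over_Cinf E.T.Cinf_mult by (auto simp: cutoff_def)
  have "smul ?c ?fr p = smul ?q \<delta> p" for p
  proof (cases "p \<in> points N \<inter> fst -` V")
    case True
    then obtain y u where p: "p = (y, u)" "(y, u) \<in> points N" "y \<in> V" by (cases p) auto
    have "?c p *\<^sub>R ?fr p = \<theta> y *\<^sub>R (?c p *\<^sub>R l.tinv t y 1)"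
      using p by (simp add: pull_def restrict_to_def mult.commute)
    also have "\<dots> = \<theta> y *\<^sub>R \<theta> y *\<^sub>R \<delta> (y, u)" using coord_expand[OF V(1) \<delta>(1) p(2,3)] p(1) by simp
    also have "\<dots> = ?q p *\<^sub>R \<delta> p" using p by (simp add: E.over_apply)
    finally show ?thesis by (simp add: smul_def)
  next
    case False
    then show ?thesis using over_outside[OF V(3) False] by (simp add: smul_def coord_def)
  qed
  then have eq: "smul ?c ?fr = smul ?q \<delta>" by blast
  have s: "smul f' \<mu>' \<in> sections N LN" by (rule LN.sections_smul[OF sec])
  \<comment> \<open>At \<open>(x, 0)\<close> the factor \<open>?q\<close> is 1 and
    \<open>\<delta>\<close> is 0, so both corrections in the Leibniz rule disappear.\<close>
  have "JN (smul ?q \<delta>) (smul f' \<mu>') (x, 0) = JN \<delta> (smul f' \<mu>') (x, 0)"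
    using J.J_smul_left[OF q \<delta>(1) s, of "(x, 0)"] \<delta>(2)[OF x] V(5,7) x E.fib_zero[OF x] by (simp add: E.over_apply)
  moreover have "JN (smul ?c ?fr) (smul f' \<mu>') (x, 0) = 0"
    using J.J_smul_smul[OF c sec(1) fr sec(2), of "(x, 0)"] c0 f'(2)[OF x] coiso[OF x c sec(1) fr] f'(2)
    by simp
  ultimately have "JN \<delta> (smul f' \<mu>') (x, 0) = 0" using eq by simp
  then show ?thesis
    using ham_gamma_rep_unique[OF x \<delta>(1) rep(2) f'(1)] ham_gamma_rep[OF \<delta>(1) f'(1)] by simp
qed

text \<open>Functions representing conormal vectors ignore the part of a tangent vector along
  \<open>S\<close> and pair with its fibre part; by \<open>conormal_separates\<close> these pairings
  determine the fibre part.\<close>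

lemma vertical_component_iff:
  assumes s: "s \<in> sections S E" and \<eta>: "\<eta> \<in> sections N LN"
  shows "is_vertical_component S E (J.ham \<eta>) s \<longleftrightarrow>
    (\<forall>x\<in>points S. \<forall>\<alpha>\<in>conormal E L x. \<forall>f \<mu>. gamma_rep x \<alpha> f \<mu> \<longrightarrow>
       J.ham \<eta> f (x, 0) *\<^sub>R \<mu> (x, 0) = \<alpha> (s x))"
proof (intro iffI ballI allI impI)
  fix x \<alpha> f \<mu>
  assume v: "is_vertical_component S E (J.ham \<eta>) s" and x: "x \<in> points S"
    and \<alpha>: "\<alpha> \<in> conormal E L x" "gamma_rep x \<alpha> f \<mu>"
  have f: "f \<in> Cinf N" using \<alpha>(2) by (simp add: gamma_rep_def)
  obtain u where u: "u \<in> tangent_space S x"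
    "J.ham \<eta> f (x, 0) = u (\<lambda>y. f (y, 0)) + deriv (\<lambda>r. f (x, r *\<^sub>R s x)) 0"
    using v x f unfolding is_vertical_component_def by blast
  show "J.ham \<eta> f (x, 0) *\<^sub>R \<mu> (x, 0) = \<alpha> (s x)"
    using \<alpha>(2) u E.sections_fib[OF s x] by (simp add: gamma_rep_def)
next
  assume *: "\<forall>x\<in>points S. \<forall>\<alpha>\<in>conormal E L x. \<forall>f \<mu>. gamma_rep x \<alpha> f \<mu> \<longrightarrow>
       J.ham \<eta> f (x, 0) *\<^sub>R \<mu> (x, 0) = \<alpha> (s x)"
  show "is_vertical_component S E (J.ham \<eta>) s"
    unfolding is_vertical_component_def
  proof (intro ballI conjI)
    fix x assume x: "x \<in> points S"
    show sx: "s x \<in> fib E x" by (rule E.sections_fib[OF s x])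
    have x0: "(x, 0) \<in> points N" using x E.fib_zero by simp
    obtain u w where u: "u \<in> tangent_space S x" and w: "w \<in> fib E x"
      and split: "\<And>f. f \<in> Cinf N \<Longrightarrow> J.ham \<eta> f (x, 0) = u (\<lambda>y. f (y, 0)) + deriv (\<lambda>r. f (x, r *\<^sub>R w)) 0"
      by (rule E.tangent_zero_split[OF J.ham_tangent[OF \<eta> x0]]) blast
    have "s x = w"
    proof (rule conormal_separates[OF x sx w])
      fix \<alpha> assume \<alpha>: "\<alpha> \<in> conormal E L x"
      obtain f \<mu> where f: "gamma_rep x \<alpha> f \<mu>" by (rule gamma_rep_exists[OF x \<alpha>]) blast
      then have "\<alpha> (s x) = J.ham \<eta> f (x, 0) *\<^sub>R \<mu> (x, 0)" using * x \<alpha> by simp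
      also have "\<dots> = \<alpha> w" using f split u w by (simp add: gamma_rep_def)
      finally show "\<alpha> (s x) = \<alpha> w" .
    qed
    then show "\<exists>u\<in>tangent_space S x. \<forall>g\<in>Cinf N.
        J.ham \<eta> g (x, 0) = u (\<lambda>y. g (y, 0)) + deriv (\<lambda>r. g (x, r *\<^sub>R s x)) 0"
      using u split by blast
  qed
qed

lemma m1_0_invalid: "\<not> valid_args S E L 1 x as \<Longrightarrow> m1 S E L JN 0 \<xi> x as = 0"
  by (simp add: m1_def normal_part_def)

text \<open>\<open>\<eta>\<close> may be replaced by the pullback of its restriction to
  \<open>S\<close>: the difference vanishes on \<open>S\<close>, and \<open>ham_vanishing\<close>
  applies to it. Pullbacks are precisely what \<open>m1\<close> differentiates in degree 0.\<close>

lemma hamiltonian_iff_exact: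
  assumes s: "s \<in> sections S E"
  shows "(\<exists>\<eta>\<in>sections N LN. is_vertical_component S E (J.ham \<eta>) s) \<longleftrightarrow>
    as_form S E L s \<in> m1 S E L JN 0 ` forms S E L 0"
proof
  assume "\<exists>\<eta>\<in>sections N LN. is_vertical_component S E (J.ham \<eta>) s"
  then obtain \<eta> where \<eta>: "\<eta> \<in> sections N LN" and v: "is_vertical_component S E (J.ham \<eta>) s" by blast
  \<comment> \<open>The sign compensates the one in \<open>m1_degree_0\<close>.\<close>
  let ?a = "\<lambda>x. - \<eta> (x, 0)"
  have a: "?a \<in> sections S ell" using l.sections_minus[OF restrict_zero_sections[OF \<eta>]] .
  obtain \<xi> where \<xi>: "\<xi> \<in> forms S E L 0" "(\<lambda>x. \<xi> x []) = ?a" by (rule section_form_0[OF a])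
  have "as_form S E L s = m1 S E L JN 0 \<xi>"
  proof (rule as_form_eqI[OF m1_0_invalid])
    fix x \<alpha> assume x: "x \<in> points S" and \<alpha>: "\<alpha> \<in> conormal E L x"
    obtain f \<mu> where f: "gamma_rep x \<alpha> f \<mu>" by (rule gamma_rep_exists[OF x \<alpha>]) blast
    have sf: "smul f \<mu> \<in> sections N LN" using f LN.sections_smul by (simp add: gamma_rep_def)
    have p: "pull ?a \<in> sections N LN" by (rule pull_sections[OF a])
    \<comment> \<open>\<open>\<eta>\<close> minus the pullback of its own restriction, hence zero
      along the zero section.\<close>
    let ?d = "\<lambda>q. \<eta> q + pull ?a q"
    have d: "?d \<in> sections N LN" by (rule LN.sections_add[OF \<eta> p])
    have "JN ?d (smul f \<mu>) (x, 0) = 0"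
      unfolding ham_gamma_rep[OF d f, symmetric]
      by (rule ham_vanishing[OF x d _ \<alpha> f]) (use E.fib_zero in \<open>simp add: pull_def restrict_to_def\<close>)
    then have "JN \<eta> (smul f \<mu>) (x, 0) = - JN (pull ?a) (smul f \<mu>) (x, 0)"
      using J.J_add_left[OF \<eta> p sf] by (simp add: eq_neg_iff_add_eq_0)
    moreover have "\<alpha> (s x) = JN \<eta> (smul f \<mu>) (x, 0)"
      using v x \<alpha> f ham_gamma_rep[OF \<eta> f] unfolding vertical_component_iff[OF s \<eta>] by metis
    moreover have "m1 S E L JN 0 \<xi> x [\<alpha>] = - JN (pull ?a) (smul f \<mu>) (x, 0)"
      using m1_degree_0[where \<xi> = \<xi>, OF x \<alpha> form_0_section[OF \<xi>(1)] f] ham_gamma_rep[OF p f] \<xi>(2) by simp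
    ultimately show "m1 S E L JN 0 \<xi> x [\<alpha>] = \<alpha> (s x)" by simp
  qed
  then show "as_form S E L s \<in> m1 S E L JN 0 ` forms S E L 0" using \<xi>(1) by blast
next
  assume "as_form S E L s \<in> m1 S E L JN 0 ` forms S E L 0"
  then obtain \<xi> where \<xi>: "\<xi> \<in> forms S E L 0" "as_form S E L s = m1 S E L JN 0 \<xi>" by blast
  let ?a = "pull (\<lambda>x. \<xi> x [])"
  have a: "?a \<in> sections N LN" by (rule pull_sections[OF form_0_section[OF \<xi>(1)]])
  have \<eta>: "(\<lambda>q. - ?a q) \<in> sections N LN" by (rule LN.sections_minus[OF a])
  have "is_vertical_component S E (J.ham (\<lambda>q. - ?a q)) s"
    unfolding vertical_component_iff[OF s \<eta>]
  proof (intro ballI allI impI)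
    fix x \<alpha> f \<mu> assume x: "x \<in> points S" and \<alpha>: "\<alpha> \<in> conormal E L x" and f: "gamma_rep x \<alpha> f \<mu>"
    have sf: "smul f \<mu> \<in> sections N LN" using f LN.sections_smul by (simp add: gamma_rep_def)
    have "\<alpha> (s x) = m1 S E L JN 0 \<xi> x [\<alpha>]" using as_form_apply[OF x \<alpha>, of s] \<xi>(2) by simp
    also have "\<dots> = - JN ?a (smul f \<mu>) (x, 0)"
      using m1_degree_0[where \<xi> = \<xi>, OF x \<alpha> form_0_section[OF \<xi>(1)] f] ham_gamma_rep[OF a f] by simp
    also have "\<dots> = J.ham (\<lambda>q. - ?a q) f (x, 0) *\<^sub>R \<mu> (x, 0)"
      using J_minus_left[OF a sf] ham_gamma_rep[OF \<eta> f] by simp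
    finally show "J.ham (\<lambda>q. - ?a q) f (x, 0) *\<^sub>R \<mu> (x, 0) = \<alpha> (s x)" by simp
  qed
  then show "\<exists>\<eta>\<in>sections N LN. is_vertical_component S E (J.ham \<eta>) s" using \<eta> by blast
qed

lemma as_form_diff:
  assumes "s \<in> sections S E" "s' \<in> sections S E"
  shows "as_form S E L (s' - s) = as_form S E L s' - as_form S E L s"
proof (rule as_form_eqI)
  fix x as assume "\<not> valid_args S E L 1 x as"
  then show "(as_form S E L s' - as_form S E L s) x as = 0" by (simp add: as_form_def)
next
  fix x \<alpha> assume x: "x \<in> points S" and \<alpha>: "\<alpha> \<in> conormal E L x"
  have f: "s x \<in> fib E x" "s' x \<in> fib E x" using E.sections_fib assms x by blast+
  have "\<alpha> (s' x - s x) = \<alpha> (s' x) - \<alpha> (s x)"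
    using conormal_add[OF \<alpha> f(2) E.fib_scale[OF x f(1), of "-1"]] conormal_scale[OF \<alpha> f(1), of "-1"] by simp
  then show "(as_form S E L s' - as_form S E L s) x [\<alpha>] = \<alpha> ((s' - s) x)"
    using as_form_apply[OF x \<alpha>] by simp
qed

text \<open>Membership of the two sections is \<open>m1_zero_iff\<close>, and their difference is
  treated by \<open>hamiltonian_iff_exact\<close>, since \<open>as_form\<close> respects
  differences.\<close>

lemma hamiltonian_equivalent_iff:
  assumes s: "s \<in> sections S E" "s' \<in> sections S E"
  shows "(s, s') \<in> inf_hamiltonian_equivalent S E L JN \<longleftrightarrow>
    (as_form S E L s, as_form S E L s') \<in> cohomologous (cochains S E L) (m1 S E L JN) 1"
proof -
  have d: "s' - s \<in> sections S E" using E.sections_diff[OF s(2,1)] by (simp add: fun_diff_def)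
  have "as_form S E L a \<in> cocycles (cochains S E L) (m1 S E L JN) 1 \<longleftrightarrow> inf_coisotropic_deformation S E L JN a"
    if "a \<in> sections S E" for a
    using m1_zero_iff[OF that] as_form_forms[OF that] by (simp add: cocycles_def cochains_def)
  then show ?thesis
    using hamiltonian_iff_exact[OF d] as_form_diff[OF s] s
    by (simp add: inf_hamiltonian_equivalent_def cohomologous_def cochains_def)
qed

end

text \<open>A bijection that preserves and reflects the relations carries the class of
  \<open>a\<close> onto the class of \<open>f a\<close>. The two inclusions keep all classes inside
  \<open>X\<close> and \<open>Y\<close>, where \<open>f\<close> is injective and onto.\<close>

lemma quotient_bij:
  assumes f: "bij_betw f X Y" and R: "R \<subseteq> X \<times> X" and Q: "Q \<subseteq> Y \<times> Y"
    and eq: "\<And>a b. a \<in> X \<Longrightarrow> b \<in> X \<Longrightarrow> (a, b) \<in> R \<longleftrightarrow> (f a, f b) \<in> Q"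
  shows "bij_betw (\<lambda>c. f ` c) (X // R) (Y // Q)"
proof -
  have img: "f ` (R `` {a}) = Q `` {f a}" if a: "a \<in> X" for a
  proof (intro set_eqI iffI)
    fix y assume "y \<in> f ` (R `` {a})"
    then show "y \<in> Q `` {f a}" using R eq a by auto
  next
    fix y assume y: "y \<in> Q `` {f a}"
    then have "y \<in> f ` X" using Q f by (auto simp: bij_betw_def)
    then obtain b where "b \<in> X" "y = f b" by blast
    then show "y \<in> f ` (R `` {a})" using y eq a by auto
  qed
  have "inj_on (\<lambda>c. f ` c) (X // R)"
  proof (rule inj_onI)
    fix c d assume "c \<in> X // R" "d \<in> X // R" and fcd: "f ` c = f ` d"
    then have "c \<subseteq> X" "d \<subseteq> X" using R by (auto elim!: quotientE)
    then show "c = d" using fcd f inj_on_image_eq_iff by (metis bij_betw_def)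
  qed
  moreover have "(\<lambda>c. f ` c) ` (X // R) = Y // Q"
  proof -
    have "(\<lambda>c. f ` c) ` (X // R) = (\<lambda>a. Q `` {f a}) ` X"
      using img by (auto simp: quotient_def image_iff)
    also have "\<dots> = Y // Q" using f by (auto simp: quotient_def bij_betw_def)
    finally show ?thesis .
  qed
  ultimately show ?thesis by (simp add: bij_betw_def)
qed

context coisotropic_setup
begin

text \<open>By \<open>m1_zero_iff\<close> and \<open>as_form_surj\<close> the forms of infinitesimal
  deformations are all the cocycles of degree 1; the relations match by
  \<open>hamiltonian_equivalent_iff\<close>.\<close>

lemma moduli_space_bij:
  "bij_betw (\<lambda>c. as_form S E L ` c) (inf_moduli_space S E L JN) (cohomology (cochains S E L) (m1 S E L JN) 1)"
proof -
  let ?X = "{s. inf_coisotropic_deformation S E L JN s}"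
  have X: "?X \<subseteq> sections S E" by (auto simp: inf_coisotropic_deformation_def Let_def)
  have "as_form S E L ` ?X = cocycles (cochains S E L) (m1 S E L JN) 1"
  proof (intro set_eqI iffI)
    fix \<xi> assume "\<xi> \<in> as_form S E L ` ?X"
    then show "\<xi> \<in> cocycles (cochains S E L) (m1 S E L JN) 1"
      using m1_zero_iff as_form_forms X by (auto simp: cocycles_def cochains_def)
  next
    fix \<xi> assume \<xi>: "\<xi> \<in> cocycles (cochains S E L) (m1 S E L JN) 1"
    then have "\<xi> \<in> forms S E L 1" by (simp add: cocycles_def cochains_def)
    then obtain s where s: "s \<in> sections S E" "as_form S E L s = \<xi>" by (rule as_form_surj)
    then show "\<xi> \<in> as_form S E L ` ?X" using m1_zero_iff[OF s(1)] \<xi> by (auto simp: cocycles_def)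
  qed
  then have bij: "bij_betw (as_form S E L) ?X (cocycles (cochains S E L) (m1 S E L JN) 1)"
    using inj_on_subset[OF as_form_inj X] by (simp add: bij_betw_def)
  show ?thesis
    unfolding inf_moduli_space_def cohomology_def
  proof (rule quotient_bij[OF bij])
    show "inf_hamiltonian_equivalent S E L JN \<subseteq> ?X \<times> ?X" by (auto simp: inf_hamiltonian_equivalent_def)
    show "cohomologous (cochains S E L) (m1 S E L JN) 1 \<subseteq>
        cocycles (cochains S E L) (m1 S E L JN) 1 \<times> cocycles (cochains S E L) (m1 S E L JN) 1"
      by (auto simp: cohomologous_def)
    show "(a, b) \<in> inf_hamiltonian_equivalent S E L JN \<longleftrightarrow>
        (as_form S E L a, as_form S E L b) \<in> cohomologous (cochains S E L) (m1 S E L JN) 1"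
      if "a \<in> ?X" "b \<in> ?X" for a b
      using hamiltonian_equivalent_iff X that by blast
  qed
qed

end

section \<open>Transfer of coisotropy to the tubular neighbourhood\<close>

lemma smooth_manifold_atlas: "smooth_manifold A \<Longrightarrow> smooth_atlas A"
  by (simp add: smooth_manifold_def smooth_atlas_def)

text \<open>The inverse of the tubular embedding is smooth for the atlas of its open image, whose
  charts have shrunken domains, while smoothness on the ambient manifold is tested in the full
  charts. The two chart inverses agree over \<open>W\<close>.\<close>

lemma smooth_near_open_submanifold_map:
  assumes "smooth_atlas A" "smooth_atlas B" "mopen A W" "smooth_map (open_submanifold A W) B F"
    "p \<in> W" "smooth_near B g (F p)"
  shows "smooth_near A (\<lambda>q. g (F q)) p"
proof -
  interpret A: atlas A by standard fact
  interpret B: atlas B by standard fact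
  obtain U \<phi> where U: "(U, \<phi>) \<in> A" "p \<in> U" by (rule A.chart_at_mopen[OF assms(3,5)])
  obtain V \<psi> where V: "(V, \<psi>) \<in> B" "F p \<in> V" using assms(6) B.smooth_near_imp_points B.chart_at by blast
  obtain Q where Q: "open Q" "Q \<subseteq> \<psi> ` V" "\<psi> (F p) \<in> Q" "smooth_on Q (g \<circ> inv_into V \<psi>)"
    by (rule B.smooth_near_chart[OF assms(6) V])
  let ?W = "\<phi> ` (U \<inter> W \<inter> F -` V)" and ?T = "\<psi> \<circ> F \<circ> inv_into (U \<inter> W) \<phi>"
  have "(U \<inter> W, \<phi>) \<in> open_submanifold A W" using U by (force simp: open_submanifold_def)
  then have W: "open ?W" "smooth_on ?W ?T" using assms(4) V unfolding smooth_map_def by blast+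
  have inv: "inv_into (U \<inter> W) \<phi> (\<phi> q) = q" if "q \<in> U" "q \<in> W" for q
    using that inj_on_subset[OF A.chart_inj[OF U(1)], of "U \<inter> W"] by (simp add: inv_into_f_f)
  define R where "R = ?W \<inter> ?T -` Q"
  have oR: "open R" unfolding R_def
    using continuous_open_preimage[OF smooth_on_imp_continuous_on[OF W(2)] W(1) Q(1)] .
  have sm: "smooth_on R (\<lambda>z. (g \<circ> inv_into V \<psi>) (?T z))"
    by (rule smooth_on_compose[OF B.fin_dim oR Q(1) _ smooth_on_subset[OF W(2)] Q(4)]) (auto simp: R_def)
  have eq: "(g \<circ> inv_into V \<psi>) (?T z) = ((\<lambda>q. g (F q)) \<circ> inv_into U \<phi>) z" if "z \<in> R" for z
    using that U V by (auto simp: R_def inv)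
  have "smooth_on R ((\<lambda>q. g (F q)) \<circ> inv_into U \<phi>)" using iffD1[OF smooth_on_cong[OF oR eq] sm] .
  then show ?thesis
    by (rule A.smooth_nearI[OF U oR, rotated]) (use U V Q assms(5) in \<open>auto simp: R_def inv\<close>)
qed

lemma jacobi_manifold_jacobi:
  assumes "jacobi_manifold A L J"
  shows "jacobi A L J"
proof -
  have A: "smooth_atlas A" "Hausdorff_space (manifold_topology A)" "vector_bundle A L" "jacobi_bracket A L J"
    using assms smooth_manifold_atlas by (auto simp: jacobi_manifold_def smooth_manifold_def)
  interpret vec_bundle A L by unfold_locales fact+
  show ?thesis
  proof unfold_locales
    fix p assume p: "p \<in> points A"
    obtain V t where V: "(V, t) \<in> triv L" "p \<in> V" by (rule triv_at[OF p])
    have "tinv t p 1 \<noteq> 0" using triv_tinv[OF V, of 1] triv_zero[OF V] by auto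
    then show "\<exists>\<eta>\<in>sections A L. \<eta> p \<noteq> 0"
      using section_through[OF A(2) p tinv_fib[OF V, of 1]] by metis
  qed fact
qed

locale tubular =
  M: jacobi A L J + normal_setup S E L JN
  for A :: "('p, 'a::real_inner) atlas"
    and L :: "('p, 'l::real_normed_vector) line_bundle"
    and J :: "('p \<Rightarrow> 'l) \<Rightarrow> ('p \<Rightarrow> 'l) \<Rightarrow> 'p \<Rightarrow> 'l"
    and S :: "('p, 'c::real_inner) atlas"
    and E :: "('p, 'e::real_vector, 'v::real_inner) vbundle"
    and JN :: "('p \<times> 'e \<Rightarrow> 'l) \<Rightarrow> ('p \<times> 'e \<Rightarrow> 'l) \<Rightarrow> 'p \<times> 'e \<Rightarrow> 'l" +
  fixes q :: "'p \<Rightarrow> (('p \<Rightarrow> real) \<Rightarrow> real) \<Rightarrow> 'e"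
    and \<tau>0 :: "'p \<times> 'e \<Rightarrow> 'p" and \<tau>1 :: "'p \<times> 'e \<Rightarrow> 'l \<Rightarrow> 'l"
  assumes Hausdorff_A: "Hausdorff_space (manifold_topology A)"
    and coisotropic_S: "coisotropic A L J S"
    and tub: "fat_tubular_neighborhood A L S E q \<tau>0 \<tau>1"
    and induced: "induced_jacobi_bracket A L J S E \<tau>0 \<tau>1 JN"
begin

lemma \<tau>0_inj: "inj_on \<tau>0 (points N)"
  and \<tau>0_open: "mopen A (\<tau>0 ` points N)"
  and \<tau>0_smooth: "smooth_map N A \<tau>0"
  and \<tau>0_inverse_smooth: "smooth_map (open_submanifold A (\<tau>0 ` points N)) N (inv_into (points N) \<tau>0)"
  and \<tau>0_zero: "x \<in> points S \<Longrightarrow> \<tau>0 (x, 0) = x"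
  and \<tau>1_linear: "v \<in> points N \<Longrightarrow> linear_map_on (fib LN v) (\<tau>1 v)"
  and \<tau>1_bij: "v \<in> points N \<Longrightarrow> bij_betw (\<tau>1 v) (fib LN v) (fib L (\<tau>0 v))"
  and \<tau>1_smooth: "(U, t) \<in> triv LN \<Longrightarrow> (V, t') \<in> triv L \<Longrightarrow>
    smooth_fun_on N (U \<inter> \<tau>0 -` V) (\<lambda>v. t' (\<tau>0 v) (\<tau>1 v (inv_into (fib LN v) (t v) c)))"
  and \<tau>1_zero: "x \<in> points S \<Longrightarrow> l \<in> fib L x \<Longrightarrow> \<tau>1 (x, 0) l = l"
  unfolding M.openin_manifold_topology[symmetric]
  using tub unfolding fat_tubular_neighborhood_def Let_def by blast+

abbreviation "pb \<equiv> pullback_section L S E \<tau>0 \<tau>1"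

lemma \<tau>0_points: "v \<in> points N \<Longrightarrow> \<tau>0 v \<in> points A"
  using \<tau>0_smooth by (auto simp: smooth_map_def)

lemma pb_fib:
  assumes "v \<in> points N" "\<kappa> \<in> sections A L"
  shows "pb \<kappa> v \<in> fib LN v" "\<tau>1 v (pb \<kappa> v) = \<kappa> (\<tau>0 v)"
proof -
  have k: "\<kappa> (\<tau>0 v) \<in> \<tau>1 v ` fib LN v"
    using M.sections_fib[OF assms(2) \<tau>0_points[OF assms(1)]] \<tau>1_bij[OF assms(1)] by (simp add: bij_betw_def)
  have "pb \<kappa> v = inv_into (fib LN v) (\<tau>1 v) (\<kappa> (\<tau>0 v))"
    using assms(1) by (simp add: pullback_section_def restrict_to_def)
  then show "pb \<kappa> v \<in> fib LN v" "\<tau>1 v (pb \<kappa> v) = \<kappa> (\<tau>0 v)"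
    using inv_into_into[OF k] f_inv_into_f[OF k] by simp_all
qed

lemma pb_eqI:
  assumes "v \<in> points N" "\<kappa> \<in> sections A L" "u \<in> fib LN v" "\<tau>1 v u = \<kappa> (\<tau>0 v)"
  shows "pb \<kappa> v = u"
  using inj_onD[OF bij_betw_imp_inj_on[OF \<tau>1_bij[OF assms(1)]], of "pb \<kappa> v" u]
    pb_fib[OF assms(1,2)] assms(3,4) by simp

lemma \<tau>1_scale: "v \<in> points N \<Longrightarrow> u \<in> fib LN v \<Longrightarrow> \<tau>1 v (c *\<^sub>R u) = c *\<^sub>R \<tau>1 v u"
  using \<tau>1_linear unfolding linear_map_on_def by blast

text \<open>In trivializations \<open>\<tau>1\<close> is multiplication by the smooth function
  \<open>?a\<close>, without zeros because \<open>\<tau>1\<close> is injective on fibres; the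
  component of \<open>pb \<kappa>\<close> is thus the quotient of \<open>?b\<close> by
  \<open>?a\<close>.\<close>

lemma pb_sections:
  assumes \<kappa>: "\<kappa> \<in> sections A L"
  shows "pb \<kappa> \<in> sections N LN"
  unfolding LN.sections_iff
proof (intro conjI ballI allI impI)
  fix p assume p: "p \<in> points N"
  obtain U t where U: "(U, t) \<in> triv LN" "p \<in> U" by (rule LN.triv_at[OF p])
  obtain V t' where V: "(V, t') \<in> triv L" "\<tau>0 p \<in> V" by (rule M.triv_at[OF \<tau>0_points[OF p]])
  let ?e = "\<lambda>v. LN.tinv t v 1"
  let ?a = "\<lambda>v. t' (\<tau>0 v) (\<tau>1 v (?e v))" and ?b = "\<lambda>v. t' (\<tau>0 v) (\<kappa> (\<tau>0 v))"
  let ?W = "U \<inter> \<tau>0 -` V"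
  have UN: "U \<subseteq> points N" using E.T.mopen_subset[OF LN.triv_mopen[OF U(1)]] .
  have "mopen N (U \<inter> (points N \<inter> \<tau>0 -` V))"
    using E.T.mopen_Int[OF LN.triv_mopen[OF U(1)]
        mopen_smooth_map_preimage[OF E.T.smooth_atlas M.smooth_atlas \<tau>0_smooth M.triv_mopen[OF V(1)]]] .
  moreover have "U \<inter> (points N \<inter> \<tau>0 -` V) = ?W" using UN by blast
  ultimately have W: "mopen N ?W" by simp
  have pW: "p \<in> ?W" using U V by simp
  have sa: "smooth_near N ?a p"
    using \<tau>1_smooth[OF U(1) V(1), of 1] E.T.smooth_fun_on_iff[OF W] pW by blast
  have sb: "smooth_near N ?b p"
    using smooth_near_map[OF E.T.smooth_atlas M.smooth_atlas \<tau>0_smooth p M.sections_smooth_near[OF \<kappa> V]] .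
  have key: "t v (pb \<kappa> v) * ?a v = ?b v" "?a v \<noteq> 0" if v: "v \<in> ?W" for v
  proof -
    have v': "v \<in> points N" "v \<in> U" "\<tau>0 v \<in> V" using v UN by auto
    have e: "?e v \<in> fib LN v" by (rule LN.tinv_fib[OF U(1) v'(2)])
    have te: "\<tau>1 v (?e v) \<in> fib L (\<tau>0 v)" using \<tau>1_bij[OF v'(1)] e by (auto simp: bij_betw_def)
    have "pb \<kappa> v = t v (pb \<kappa> v) *\<^sub>R ?e v"
      using LN.tinv_scale[OF U(1) v'(2), of "t v (pb \<kappa> v)" 1] LN.tinv_triv[OF U(1) v'(2) pb_fib(1)[OF v'(1) \<kappa>]] by simp
    then have "\<kappa> (\<tau>0 v) = t v (pb \<kappa> v) *\<^sub>R \<tau>1 v (?e v)"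
      using pb_fib(2)[OF v'(1) \<kappa>] \<tau>1_scale[OF v'(1) e] by metis
    then show "t v (pb \<kappa> v) * ?a v = ?b v" using M.triv_scale[OF V(1) v'(3) te] by simp
    show "?a v \<noteq> 0"
    proof
      assume "?a v = 0"
      then have "\<tau>1 v (?e v) = 0"
        using M.triv_inj[OF V(1) v'(3) te M.fib_zero[OF \<tau>0_points[OF v'(1)]]] M.triv_zero[OF V(1) v'(3)] by simp
      moreover have "\<tau>1 v 0 = 0" using \<tau>1_scale[OF v'(1) e, of 0] by simp
      ultimately have "?e v = 0"
        using inj_onD[OF bij_betw_imp_inj_on[OF \<tau>1_bij[OF v'(1)]], of "?e v" 0] e LN.fib_zero[OF v'(1)] by simp
      then show False using LN.triv_tinv[OF U(1) v'(2), of 1] LN.triv_zero[OF U(1) v'(2)] by simp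
    qed
  qed
  have "smooth_near N (\<lambda>v. ?b v / ?a v) p"
    by (rule E.T.smooth_near_divide[OF sb sa key(2)[OF pW]])
  then have near: "smooth_near N (\<lambda>v. t v (pb \<kappa> v)) p"
    by (rule E.T.smooth_near_cong[OF _ W pW]) (use key in \<open>simp add: divide_eq_eq\<close>)
  show "LN.section_near (pb \<kappa>) p"
    by (rule LN.section_nearI[OF E.T.mopen_points p _ U near]) (rule pb_fib(1)[OF _ \<kappa>])
qed (simp add: pullback_section_def restrict_to_def)

lemma pb_smul:
  assumes "\<kappa> \<in> sections A L" "F \<in> Cinf A" "\<And>v. v \<in> points N \<Longrightarrow> f v = F (\<tau>0 v)"
  shows "pb (smul F \<kappa>) = smul f (pb \<kappa>)"
proof
  fix v
  show "pb (smul F \<kappa>) v = smul f (pb \<kappa>) v"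
  proof (cases "v \<in> points N")
    case True
    show ?thesis
    proof (rule pb_eqI[OF True M.sections_smul[OF assms(2,1)]])
      show "smul f (pb \<kappa>) v \<in> fib LN v"
        using LN.fib_scale[OF True pb_fib(1)[OF True assms(1)]] by (simp add: smul_def)
      show "\<tau>1 v (smul f (pb \<kappa>) v) = smul F \<kappa> (\<tau>0 v)"
        using \<tau>1_scale[OF True pb_fib(1)[OF True assms(1)]] pb_fib(2)[OF True assms(1)] assms(3)[OF True]
        by (simp add: smul_def)
    qed
  qed (simp add: smul_def pullback_section_def restrict_to_def)
qed

lemma pb_zero_section:
  assumes "x \<in> points S" "\<kappa> \<in> sections A L"
  shows "pb \<kappa> (x, 0) = \<kappa> x"
proof -
  have x0: "(x, 0) \<in> points N" using assms(1) E.fib_zero by simp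
  have "\<kappa> x \<in> fib L x"
    using M.sections_fib[OF assms(2) \<tau>0_points[OF x0]] \<tau>0_zero[OF assms(1)] by simp
  then show ?thesis
    using \<tau>0_zero[OF assms(1)] \<tau>1_zero[OF assms(1)] by (intro pb_eqI[OF x0 assms(2)]) auto
qed

text \<open>\<open>F\<close> vanishes on \<open>S\<close>, so its sharp is tangent to
  \<open>S\<close> by coisotropy; a vector tangent to \<open>S\<close> annihilates \<open>G\<close>,
  which vanishes on \<open>S\<close> too.\<close>

lemma coisotropic_A:
  assumes x: "x \<in> points S" and F: "F \<in> Cinf A" and G: "G \<in> Cinf A" and \<kappa>: "\<kappa> \<in> sections A L"
    and z: "\<forall>y\<in>points S. F y = 0" "\<forall>y\<in>points S. G y = 0"
  shows "M.lam \<kappa> F G x = 0"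
proof -
  have r: "restrict_to (points S) F = (\<lambda>_. 0)" "restrict_to (points S) G = (\<lambda>_. 0)"
    using z by (auto simp: restrict_to_def)
  have "\<forall>u\<in>tangent_space S x. pushforward_incl A S u F = 0"
    using tangent_zero_function by (simp add: pushforward_incl_def r)
  then have "Lambda_sharp A L J F \<kappa> x \<in> pushforward_incl A S ` tangent_space S x"
    using coisotropic_S x F \<kappa> unfolding coisotropic_def by blast
  then obtain u where u: "u \<in> tangent_space S x" "Lambda_sharp A L J F \<kappa> x = pushforward_incl A S u" by blast
  have "Lambda_sharp A L J F \<kappa> x G = 0"
    unfolding u(2) using tangent_zero_function[OF u(1)] by (simp add: pushforward_incl_def r)
  then show ?thesis by (simp add: M.Lambda_sharp_eq)
qed

text \<open>Multiplying by a cutoff function \<open>\<theta>\<close> with \<open>\<theta> x = 1\<close> does not change the differential at \<open>x\<close> of a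
  function vanishing there, and makes the function extend to the ambient manifold.\<close>
lemma coisotropic_N:
  assumes x: "x \<in> points S" and f: "f \<in> Cinf N" and g: "g \<in> Cinf N" and \<eta>: "\<eta> \<in> sections N LN"
    and z: "\<forall>y\<in>points S. f (y, 0) = 0" "\<forall>y\<in>points S. g (y, 0) = 0"
  shows "J.lam \<eta> f g (x, 0) = 0"
proof -
  let ?W = "\<tau>0 ` points N" and ?i = "inv_into (points N) \<tau>0"
  have x0: "(x, 0) \<in> points N" using x E.fib_zero by simp
  have xW: "x \<in> ?W" using imageI[OF x0, of \<tau>0] \<tau>0_zero[OF x] by simp
  then have xA: "x \<in> points A" using M.mopen_subset[OF \<tau>0_open] by blast
  obtain \<theta> W' where \<theta>: "cutoff A ?W \<theta>" "mopen A W'" "x \<in> W'" "W' \<subseteq> ?W" "\<forall>q\<in>W'. \<theta> q = 1"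
    by (rule M.cutoff_exists[OF Hausdorff_A \<tau>0_open xW])
  obtain \<kappa> where \<kappa>: "\<kappa> \<in> sections A L" "\<kappa> x \<noteq> 0" using M.nonvanishing[OF xA] by blast
  let ?\<theta> = "restrict_to (points N) (\<lambda>v. \<theta> (\<tau>0 v))"
  have \<theta>A: "\<theta> \<in> Cinf A" using \<theta>(1) by (simp add: cutoff_def)
  have \<theta>N: "?\<theta> \<in> Cinf N" unfolding E.T.Cinf_iff
  proof (intro conjI ballI allI impI)
    fix v assume v: "v \<in> points N"
    show "smooth_near N ?\<theta> v"
      by (rule E.T.smooth_near_cong[OF smooth_near_map[OF E.T.smooth_atlas M.smooth_atlas \<tau>0_smooth v
              M.Cinf_smooth_near[OF \<theta>A \<tau>0_points[OF v]]] E.T.mopen_points v])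
        (simp add: restrict_to_def)
  qed (simp add: restrict_to_def)
  have \<theta>1: "?\<theta> (x, 0) = 1" using \<theta>(3,5) x0 \<tau>0_zero[OF x] by (simp add: restrict_to_def)
  \<comment> \<open>Off the image of the embedding \<open>?i\<close> returns an arbitrary value, but
    \<open>\<theta>\<close> is zero there.\<close>
  define ext where "ext h = (\<lambda>q. \<theta> q * h (?i q))" for h
  have i: "?i (\<tau>0 v) = v" if "v \<in> points N" for v using \<tau>0_inj that by simp
  have ext_Cinf: "ext h \<in> Cinf A" if h: "h \<in> Cinf N" for h
    unfolding ext_def
  proof (rule M.cutoff_Cinf[OF \<theta>(1)])
    fix p assume p: "p \<in> ?W"
    then have "?i p \<in> points N" by (rule inv_into_into)
    then show "smooth_near A (\<lambda>q. h (?i q)) p"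
      by (intro smooth_near_open_submanifold_map[OF M.smooth_atlas E.T.smooth_atlas \<tau>0_open \<tau>0_inverse_smooth p]
          E.T.Cinf_smooth_near[OF h])
  qed
  have ext_zero: "\<forall>y\<in>points S. ext h y = 0" if h: "\<forall>y\<in>points S. h (y, 0) = 0" for h :: "'p \<times> 'e \<Rightarrow> real"
  proof
    fix y assume y: "y \<in> points S"
    have "?i y = (y, 0)" using i[of "(y, 0)"] \<tau>0_zero[OF y] y E.fib_zero by simp
    then show "ext h y = 0" using h y by (simp add: ext_def)
  qed
  have pull_ext: "pb (smul (ext h) \<kappa>) = smul (\<lambda>v. ?\<theta> v * h v) (pb \<kappa>)" if h: "h \<in> Cinf N" for h
    by (rule pb_smul[OF \<kappa>(1) ext_Cinf[OF h]]) (simp add: ext_def restrict_to_def i)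
  have pk: "pb \<kappa> \<in> sections N LN" by (rule pb_sections[OF \<kappa>(1)])
  have pk0: "pb \<kappa> (x, 0) \<noteq> 0" using pb_zero_section[OF x \<kappa>(1)] \<kappa>(2) by simp
  \<comment> \<open>The induced bracket is known on pullbacks of sections from the ambient manifold,
    and \<open>pull_ext\<close> exhibits the cut off products as such pullbacks. \<open>f\<close>
    and \<open>g\<close> are in reversed order because \<open>lam_zero_transfer\<close> exchanges
    them at the end.\<close>
  have lam0: "J.lam (pb \<kappa>) (\<lambda>v. ?\<theta> v * g v) (\<lambda>v. ?\<theta> v * f v) (x, 0) = 0"
  proof -
    have s: "smul (ext g) \<kappa> \<in> sections A L" "smul (ext f) \<kappa> \<in> sections A L"
      using M.sections_smul[OF ext_Cinf \<kappa>(1)] f g by blast+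
    have JA: "J (smul (ext g) \<kappa>) (smul (ext f) \<kappa>) x = 0"
      using M.J_smul_smul[OF ext_Cinf[OF g] ext_Cinf[OF f] \<kappa>(1) \<kappa>(1), of x]
        coisotropic_A[OF x ext_Cinf[OF g] ext_Cinf[OF f] \<kappa>(1) ext_zero[OF z(2)] ext_zero[OF z(1)]]
        ext_zero[OF z(2)] ext_zero[OF z(1)] x by simp
    have C: "(\<lambda>v. ?\<theta> v * g v) \<in> Cinf N" "(\<lambda>v. ?\<theta> v * f v) \<in> Cinf N"
      using E.T.Cinf_mult[OF \<theta>N] f g by blast+
    have "JN (pb (smul (ext g) \<kappa>)) (pb (smul (ext f) \<kappa>)) = pb (J (smul (ext g) \<kappa>) (smul (ext f) \<kappa>))"
      using induced s unfolding induced_jacobi_bracket_def by blast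
    then have "JN (smul (\<lambda>v. ?\<theta> v * g v) (pb \<kappa>)) (smul (\<lambda>v. ?\<theta> v * f v) (pb \<kappa>)) (x, 0) = 0"
      unfolding pull_ext[OF g] pull_ext[OF f]
      using pb_zero_section[OF x M.J_sections[OF s]] JA by simp
    then show ?thesis
      unfolding J.J_smul_smul[OF C pk pk] using z x pk0 by simp
  qed
  have D: "D (\<lambda>v. ?\<theta> v * h v) = D h" if h: "h \<in> Cinf N" "h (x, 0) = 0" and D: "D \<in> tangent_space N (x, 0)" for D h
    using E.T.tangent_mult[OF D \<theta>N h(1)] h(2) \<theta>1 by simp
  have "J.lam (pb \<kappa>) g f (x, 0) = J.lam (pb \<kappa>) (\<lambda>v. ?\<theta> v * g v) (\<lambda>v. ?\<theta> v * f v) (x, 0)"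
    by (rule J.lam_cong[OF x0 g _ f _ pk])
      (use z x f g in \<open>auto intro!: E.T.Cinf_mult[OF \<theta>N] D[symmetric]\<close>)
  then have "J.lam (pb \<kappa>) g f (x, 0) = 0" using lam0 by simp
  then show ?thesis by (rule J.lam_zero_transfer[OF x0 f g \<eta> pk pk0])
qed

end

theorem corollary4p21:
  fixes A :: "('p, 'a::real_inner) atlas"
    and L :: "('p, 'l::real_normed_vector) line_bundle"
    and J :: "('p \<Rightarrow> 'l) \<Rightarrow> ('p \<Rightarrow> 'l) \<Rightarrow> 'p \<Rightarrow> 'l"
    and AS :: "('p, 'c::real_inner) atlas"
    and E :: "('p, 'e::real_vector, 'v::real_inner) vbundle"
    and q :: "'p \<Rightarrow> (('p \<Rightarrow> real) \<Rightarrow> real) \<Rightarrow> 'e"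
    and \<tau>0 :: "'p \<times> 'e \<Rightarrow> 'p" and \<tau>1 :: "'p \<times> 'e \<Rightarrow> 'l \<Rightarrow> 'l"
    and JN :: "('p \<times> 'e \<Rightarrow> 'l) \<Rightarrow> ('p \<times> 'e \<Rightarrow> 'l) \<Rightarrow> 'p \<times> 'e \<Rightarrow> 'l"
  assumes "jacobi_manifold A L J"
    and "closed_submanifold A AS"
    and "coisotropic A L J AS"
    and "normal_bundle A AS E q"
    and "fat_tubular_neighborhood A L AS E q \<tau>0 \<tau>1"
    and "induced_jacobi_bracket A L J AS E \<tau>0 \<tau>1 JN"
  shows "(\<forall>s\<in>sections AS E.
            m1 AS E L JN 1 (as_form AS E L s) = 0 \<longleftrightarrow> inf_coisotropic_deformation AS E L JN s) \<and>
         (\<forall>s0\<in>sections AS E. \<forall>s1\<in>sections AS E.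
            m1 AS E L JN 1 (as_form AS E L s0) = 0 \<and> m1 AS E L JN 1 (as_form AS E L s1) = 0 \<longrightarrow>
            ((s0, s1) \<in> inf_hamiltonian_equivalent AS E L JN \<longleftrightarrow>
             (as_form AS E L s0, as_form AS E L s1)
               \<in> cohomologous (shift1 (cochains AS E L)) (shift1 (m1 AS E L JN)) 0)) \<and>
         bij_betw (\<lambda>c. as_form AS E L ` c) (inf_moduli_space AS E L JN)
           (cohomology (shift1 (cochains AS E L)) (shift1 (m1 AS E L JN)) 0) \<and>
         cohomology (shift1 (cochains AS E L)) (shift1 (m1 AS E L JN)) 0 =
         cohomology (cochains AS E L) (m1 AS E L JN) 1"
proof -
  have AS: "smooth_atlas AS" "Hausdorff_space (manifold_topology AS)" "smooth_map AS A (\<lambda>x. x)"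
    using assms(2) smooth_manifold_atlas unfolding closed_submanifold_def smooth_manifold_def by blast+
  have A: "smooth_atlas A" "Hausdorff_space (manifold_topology A)" "vector_bundle A L"
    using assms(1) smooth_manifold_atlas unfolding jacobi_manifold_def smooth_manifold_def by blast+
  interpret M: jacobi A L J by (rule jacobi_manifold_jacobi[OF assms(1)])
  have B: "vector_bundle AS E" "vector_bundle AS (restricted_line AS L)"
    "jacobi_bracket (total_atlas AS E) (normal_line AS E L) JN"
  proof -
    show "vector_bundle AS E" using assms(4) unfolding normal_bundle_def by (rule conjunct1)
    show "vector_bundle AS (restricted_line AS L)" by (rule vector_bundle_pullback[OF A(1) AS(1) A(3) AS(3)])
    show "jacobi_bracket (total_atlas AS E) (normal_line AS E L) JN"
      using assms(6) unfolding induced_jacobi_bracket_def by (rule conjunct1)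
  qed
  interpret normal_setup AS E L JN
    by unfold_locales (fact AS B)+
  interpret T: tubular A L J AS E JN q \<tau>0 \<tau>1
    by unfold_locales (fact A(2) assms(3,5,6))+
  interpret C: coisotropic_setup AS E L JN
    by unfold_locales (rule T.coisotropic_N)
  \<comment> \<open>Degree 0 of the shifted complex, and degree -1 from which its coboundaries come,
    are degrees 1 and 0 of the original one.\<close>
  have co: "cocycles (shift1 C) (shift1 d) 0 = cocycles C d 1"
    "cohomologous (shift1 C) (shift1 d) 0 = cohomologous C d 1" for C and d :: "int \<Rightarrow> 'b::ab_group_add \<Rightarrow> 'b"
    by (simp_all add: cocycles_def cohomologous_def shift1_def)
  show ?thesis
    using C.m1_zero_iff C.hamiltonian_equivalent_iff C.moduli_space_bij
    by (simp add: cohomology_def co)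
qed

end
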